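(* Let $R=\mathbb C$ and let $\delta\in\mathbb C$ satisfy $\delta^2=2+q+q^{-1}$ for some nonzero $q\in\mathbb C$ that is not a root of unity. Then every finitely presented $\mathcal C_{\mathrm{TL}}$-module is representation stable.
   Context: Notation: $\mathbb N=\{0,1,2,\dots\}$, $[n]=\{1,\dots,n\}$, $[-n]=\{-n,\dots,-1\}$. Temperley--Lieb algebra. A diagram on $n$ is a partition of $[-n]\cup[n]$ into two-element blocks such that there are no two blocks $\{a,b\},\{c,d\}$ with $a<c<b<d$. It is pictured with dots $-1,\dots,-n$ on the left and $1,\dots,n$ on the right (from top to bottom). $A_n=\mathrm{TL}_n=\mathrm{TL}_n(\mathbb C,\delta)$ is the $\mathbb C$-vector space with basis these diagrams. The product $pr$ is obtained by placing $p$ to the left of $r$, identifying dot $k$ of $p$ with dot $-k$ of $r$ and connecting; if $s$ is the resulting diagram on the outer dots and $c$ components lie entirely in the middle, then $pr=\delta^c s$. Stacking a diagram on $a$ on top of a diagram on $b$ gives $A_a\otimes A_b\hookrightarrow A_{a+b}$; the left embedding is $A_a\hookrightarrow A_{a+b}$, $d\mapsto d\otimes 1$, and the right embedding is $A_b\hookrightarrow A_{a+b}$, $d\mapsto 1\otimes d$. The trivial $A_k$-module $\mathbb C$ is the one on which the identity diagram acts as the identity and all other diagrams act as $0$. The category $\mathcal C_{\mathrm{TL}}$, enriched in $\mathbb C$-vector spaces, has objects $\mathbb N$, $\mathrm{Hom}(m,n)=A_n\otimes_{A_{n-m}}\mathbb C$ for $m\le n$ (with $A_{n-m}\subset A_n$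 by the right embedding and $\mathbb C$ the trivial module) and $\mathrm{Hom}(m,n)=0$ for $m>n$. Composition is $(x\otimes1)\circ(y\otimes 1)=xy\otimes1$ for $x\in A_n$, $y\in A_m$, with $A_m\subset A_n$ by the left embedding. A $\mathcal C_{\mathrm{TL}}$-module is a $\mathbb C$-linear functor $V$ from $\mathcal C_{\mathrm{TL}}$ to $\mathbb C$-vector spaces. Write $V_n=V(n)$, an $A_n$-module since $\mathrm{End}(n)\cong A_n$, and $\phi_n=V(1_{A_{n+1}}\otimes 1)\colon V_n\to V_{n+1}$. Let $M(m)=\mathrm{Hom}(m,-)$. $V$ is finitely presented if there is an exact sequence $Q\to P\to V\to0$ with $P,Q$ finite direct sums of modules of the form $M(m)$. Simple modules. For these $\delta$, each $\mathrm{TL}_n$ is split semisimple, with simple modules $\mathrm{TL}_n(\lambda)$ indexed by the partitions $\lambda$ of $n$ with at most two parts. Explicitly, $\mathrm{TL}_n((n-k,k))$ has basis the noncrossing perfect matchings of $[-n]\cup[n-2k]$ in which every element of $[n-2k]$ is matched with an element of $[-n]$, with $\mathrm{TL}_n$ acting by concatenation from the left (closed loops giving $\delta$) and concatenations not of this form set to $0$; $\mathrm{TL}_n((n))$ is the trivial module. For a partition $\lambda$ and $n\ge|\lambda|+\lambda_1$ let $\lambda[n]=(n-|\lambda|,\lambda_1,\lambda_2,\dots)$. Representation stability. Write $V_n\cong\bigoplus_\lambda \mathrm{TL}_n(\lambda[n])^{\oplus c_{\lambda,n}}$, the sum over partitions $\lambda$ with at most one part. $V$ is representation stable if: (injectivity)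 $\phi_n$ is injective for all large enough $n$; (surjectivity) the induced map $A_{n+1}\otimes_{A_n}V_n\to V_{n+1}$ is surjective for all large enough $n$; (multiplicity stability) each $c_{\lambda,n}$ is independent of $n$ for all large enough $n$. *)

theory Defs
  imports
    "HOL-Algebra.AbelCoset"
    "HOL-Library.Poly_Mapping"
    "HOL-Library.Disjoint_Sets"
    "Jordan_Normal_Form.VS_Connect"
begin

section \<open>Vector spaces\<close>

text \<open>
  Vector spaces over the complex numbers are records of type \<open>(complex, 'v) module\<close> satisfying
  \<^term>\<open>vectorspace class_ring\<close>. The fields \<open>mult\<close> and \<open>one\<close> of such a record play no
  role, except for the algebras \<open>TL\<close> below.
\<close>

definition free_space :: "'x set \<Rightarrow> (complex, 'x \<Rightarrow>\<^sub>0 complex) module" where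
  "free_space X = \<lparr>carrier = {f. Poly_Mapping.keys f \<subseteq> X}, mult = (\<lambda>_ _. 0), one = 0,
     zero = 0, add = (+), smult = (\<lambda>c. Poly_Mapping.map ((*) c))\<rparr>"

definition scalar_space :: "(complex, complex) module" where
  "scalar_space = \<lparr>carrier = UNIV, mult = (*), one = 1, zero = 0, add = (+), smult = (*)\<rparr>"

definition zero_space :: "(complex, 'v) module" where
  "zero_space = \<lparr>carrier = {undefined}, mult = (\<lambda>_ _. undefined), one = undefined,
     zero = undefined, add = (\<lambda>_ _. undefined), smult = (\<lambda>_ _. undefined)\<rparr>"

text \<open>The union in \<open>smult\<close> makes \<open>0\<close> act correctly: \<open>c (U + x) = U + c x\<close> also for \<open>c = 0\<close>.\<close>

definition quotient_space :: "(complex, 'v) module \<Rightarrow> 'v set \<Rightarrow> (complex, 'v set) module" where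
  "quotient_space V U = \<lparr>carrier = a_rcosets\<^bsub>V\<^esub> U, mult = (\<lambda>_ _. U), one = U,
     zero = U, add = set_add V, smult = (\<lambda>c C. \<Union>x\<in>C. U +>\<^bsub>V\<^esub> (c \<odot>\<^bsub>V\<^esub> x))\<rparr>"

text \<open>The direct sum of the spaces \<open>V i\<close>, for a finite index set \<open>I\<close>.\<close>

definition dsum :: "'i set \<Rightarrow> ('i \<Rightarrow> (complex, 'v) module) \<Rightarrow> (complex, 'i \<Rightarrow> 'v) module" where
  "dsum I V = \<lparr>carrier = (\<Pi>\<^sub>E i\<in>I. carrier (V i)),
     mult = (\<lambda>_ _. (\<lambda>i\<in>I. \<zero>\<^bsub>V i\<^esub>)), one = (\<lambda>i\<in>I. \<zero>\<^bsub>V i\<^esub>),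
     zero = (\<lambda>i\<in>I. \<zero>\<^bsub>V i\<^esub>),
     add = (\<lambda>f g. \<lambda>i\<in>I. f i \<oplus>\<^bsub>V i\<^esub> g i),
     smult = (\<lambda>c f. \<lambda>i\<in>I. c \<odot>\<^bsub>V i\<^esub> f i)\<rparr>"

subsection \<open>Tensor product over an algebra\<close>

text \<open>
  For a space \<open>X\<close> with a right action \<open>ra\<close>, and a space \<open>Y\<close> with a left action \<open>la\<close>, of an
  algebra with underlying set \<open>S\<close>.
\<close>

definition tensor_relations ::
  "'s set \<Rightarrow> (complex, 'a) module \<Rightarrow> ('a \<Rightarrow> 's \<Rightarrow> 'a) \<Rightarrow> (complex, 'b) module \<Rightarrow> ('s \<Rightarrow> 'b \<Rightarrow> 'b)
    \<Rightarrow> ('a \<times> 'b \<Rightarrow>\<^sub>0 complex) set" where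
  "tensor_relations S X ra Y la =
     {Poly_Mapping.single (x \<oplus>\<^bsub>X\<^esub> x', y) 1 - Poly_Mapping.single (x, y) 1
        - Poly_Mapping.single (x', y) 1 | x x' y.
        x \<in> carrier X \<and> x' \<in> carrier X \<and> y \<in> carrier Y} \<union>
     {Poly_Mapping.single (x, y \<oplus>\<^bsub>Y\<^esub> y') 1 - Poly_Mapping.single (x, y) 1
        - Poly_Mapping.single (x, y') 1 | x y y'.
        x \<in> carrier X \<and> y \<in> carrier Y \<and> y' \<in> carrier Y} \<union>
     {Poly_Mapping.single (c \<odot>\<^bsub>X\<^esub> x, y) 1 - Poly_Mapping.single (x, y) c | c x y.
        x \<in> carrier X \<and> y \<in> carrier Y} \<union>
     {Poly_Mapping.single (x, c \<odot>\<^bsub>Y\<^esub> y) 1 - Poly_Mapping.single (x, y) c | c x y.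
        x \<in> carrier X \<and> y \<in> carrier Y} \<union>
     {Poly_Mapping.single (ra x s, y) 1 - Poly_Mapping.single (x, la s y) 1 | x s y.
        x \<in> carrier X \<and> s \<in> S \<and> y \<in> carrier Y}"

definition tensor_kernel ::
  "'s set \<Rightarrow> (complex, 'a) module \<Rightarrow> ('a \<Rightarrow> 's \<Rightarrow> 'a) \<Rightarrow> (complex, 'b) module \<Rightarrow> ('s \<Rightarrow> 'b \<Rightarrow> 'b)
    \<Rightarrow> ('a \<times> 'b \<Rightarrow>\<^sub>0 complex) set" where
  "tensor_kernel S X ra Y la = LinearCombinations.module.span class_ring
     (free_space (carrier X \<times> carrier Y)) (tensor_relations S X ra Y la)"

definition tensor_space ::
  "'s set \<Rightarrow> (complex, 'a) module \<Rightarrow> ('a \<Rightarrow> 's \<Rightarrow> 'a) \<Rightarrow> (complex, 'b) module \<Rightarrow> ('s \<Rightarrow> 'b \<Rightarrow> 'b)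
    \<Rightarrow> (complex, ('a \<times> 'b \<Rightarrow>\<^sub>0 complex) set) module" where
  "tensor_space S X ra Y la =
     quotient_space (free_space (carrier X \<times> carrier Y)) (tensor_kernel S X ra Y la)"

definition pure_tensor ::
  "'s set \<Rightarrow> (complex, 'a) module \<Rightarrow> ('a \<Rightarrow> 's \<Rightarrow> 'a) \<Rightarrow> (complex, 'b) module \<Rightarrow> ('s \<Rightarrow> 'b \<Rightarrow> 'b)
    \<Rightarrow> 'a \<Rightarrow> 'b \<Rightarrow> ('a \<times> 'b \<Rightarrow>\<^sub>0 complex) set" where
  "pure_tensor S X ra Y la x y =
     tensor_kernel S X ra Y la +>\<^bsub>free_space (carrier X \<times> carrier Y)\<^esub> Poly_Mapping.single (x, y) 1"

text \<open>
  The linear map from a tensor product into \<open>W\<close> with \<open>x \<otimes> y \<mapsto> b x y\<close>; it is meaningful only if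
  \<open>b\<close> is bilinear and balanced, so that the linear extension is constant on cosets.
\<close>

definition tensor_lift ::
  "(complex, 'w) module \<Rightarrow> ('a \<Rightarrow> 'b \<Rightarrow> 'w) \<Rightarrow> ('a \<times> 'b \<Rightarrow>\<^sub>0 complex) set \<Rightarrow> 'w" where
  "tensor_lift W b C = the_elem
     ((\<lambda>f. \<Oplus>\<^bsub>W\<^esub>u\<in>Poly_Mapping.keys f. Poly_Mapping.lookup f u \<odot>\<^bsub>W\<^esub> b (fst u) (snd u)) ` C)"


section \<open>Diagrams\<close>

text \<open>
  Noncrossing perfect matchings of \<open>[-a] \<union> [b]\<close>: \<open>a\<close> dots on the left, \<open>b\<close> dots on the right.
\<close>

type_synonym diagram = "int set set"

definition matchings :: "nat \<Rightarrow> nat \<Rightarrow> diagram set" where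
  "matchings a b = {p. partition_on ({- int a..-1} \<union> {1..int b}) p \<and> (\<forall>B\<in>p. card B = 2) \<and>
     \<not> (\<exists>i j k l. {i, j} \<in> p \<and> {k, l} \<in> p \<and> i < k \<and> k < j \<and> j < l)}"

abbreviation diagrams :: "nat \<Rightarrow> diagram set" where
  "diagrams n \<equiv> matchings n n"

definition id_diagram :: "nat \<Rightarrow> diagram" where
  "id_diagram n = (\<lambda>i. {- i, i}) ` {1..int n}"

text \<open>
  Concatenation of \<open>p \<in> matchings a b\<close> (placed left) and \<open>r \<in> matchings b c\<close> (placed right): the
  dot \<open>i\<close> of \<open>p\<close> and the dot \<open>-i\<close> of \<open>r\<close> both become \<open>Mid i\<close>.
\<close>

datatype dot = Lft int | Mid int | Rgt int

definition left_dot :: "int \<Rightarrow> dot" where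
  "left_dot i = (if i < 0 then Lft (- i) else Mid i)"

definition right_dot :: "int \<Rightarrow> dot" where
  "right_dot i = (if i < 0 then Mid (- i) else Rgt i)"

definition outer_dot :: "int \<Rightarrow> dot" where
  "outer_dot i = (if i < 0 then Lft (- i) else Rgt i)"

definition glued :: "diagram \<Rightarrow> diagram \<Rightarrow> dot set set" where
  "glued p r = (image left_dot) ` p \<union> (image right_dot) ` r"

definition components :: "diagram \<Rightarrow> diagram \<Rightarrow> dot set set" where
  "components p r = \<Union> (glued p r) // {(x, y). \<exists>B\<in>glued p r. x \<in> B \<and> y \<in> B}\<^sup>*"

definition diagram_concat :: "diagram \<Rightarrow> diagram \<Rightarrow> diagram" where
  "diagram_concat p r = (\<lambda>C. outer_dot -` C) ` components p r - {{}}"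

definition loops :: "diagram \<Rightarrow> diagram \<Rightarrow> nat" where
  "loops p r = card {C \<in> components p r. C \<subseteq> range Mid}"

text \<open>Stacking a diagram \<open>p\<close> on \<open>a\<close> on top of a diagram \<open>r\<close>; dots are numbered from top to bottom.\<close>

definition stack :: "nat \<Rightarrow> diagram \<Rightarrow> diagram \<Rightarrow> diagram" where
  "stack a p r = p \<union> (image (\<lambda>i. if i < 0 then i - int a else i + int a)) ` r"


section \<open>Temperley--Lieb algebras\<close>

type_synonym tl = "diagram \<Rightarrow>\<^sub>0 complex"

definition tl_mult :: "complex \<Rightarrow> tl \<Rightarrow> tl \<Rightarrow> tl" where
  "tl_mult \<delta> f g = (\<Sum>p\<in>Poly_Mapping.keys f. \<Sum>r\<in>Poly_Mapping.keys g.
     Poly_Mapping.single (diagram_concat p r)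
       (Poly_Mapping.lookup f p * Poly_Mapping.lookup g r * \<delta> ^ loops p r))"

definition TL :: "complex \<Rightarrow> nat \<Rightarrow> (complex, tl) module" where
  "TL \<delta> n = (free_space (diagrams n))
     \<lparr>mult := tl_mult \<delta>, one := Poly_Mapping.single (id_diagram n) 1\<rparr>"

definition tl_stack :: "nat \<Rightarrow> tl \<Rightarrow> tl \<Rightarrow> tl" where
  "tl_stack a f g = (\<Sum>p\<in>Poly_Mapping.keys f. \<Sum>r\<in>Poly_Mapping.keys g.
     Poly_Mapping.single (stack a p r) (Poly_Mapping.lookup f p * Poly_Mapping.lookup g r))"

definition left_embedding :: "complex \<Rightarrow> nat \<Rightarrow> nat \<Rightarrow> tl \<Rightarrow> tl" where
  "left_embedding \<delta> a b f = tl_stack a f \<one>\<^bsub>TL \<delta> b\<^esub>"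

definition right_embedding :: "complex \<Rightarrow> nat \<Rightarrow> nat \<Rightarrow> tl \<Rightarrow> tl" where
  "right_embedding \<delta> a b g = tl_stack a \<one>\<^bsub>TL \<delta> a\<^esub> g"

definition trivial_action :: "nat \<Rightarrow> tl \<Rightarrow> complex \<Rightarrow> complex" where
  "trivial_action n f z = Poly_Mapping.lookup f (id_diagram n) * z"

text \<open>The simple module indexed by the partition \<open>(n - k, k)\<close>, where \<open>2 * k \<le> n\<close>.\<close>

definition simple_basis :: "nat \<Rightarrow> nat \<Rightarrow> diagram set" where
  "simple_basis n k = {w \<in> matchings n (n - 2 * k).
     \<forall>i\<in>{1..int (n - 2 * k)}. \<exists>j\<in>{- int n..-1}. {j, i} \<in> w}"

definition simple_space :: "nat \<Rightarrow> nat \<Rightarrow> (complex, tl) module" where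
  "simple_space n k = free_space (simple_basis n k)"

definition simple_action :: "complex \<Rightarrow> nat \<Rightarrow> nat \<Rightarrow> tl \<Rightarrow> tl \<Rightarrow> tl" where
  "simple_action \<delta> n k f g = (\<Sum>p\<in>Poly_Mapping.keys f. \<Sum>w\<in>Poly_Mapping.keys g.
     if diagram_concat p w \<in> simple_basis n k
     then Poly_Mapping.single (diagram_concat p w)
       (Poly_Mapping.lookup f p * Poly_Mapping.lookup g w * \<delta> ^ loops p w)
     else 0)"


section \<open>The Temperley--Lieb category and its modules\<close>

type_synonym tl_hom = "(tl \<times> complex \<Rightarrow>\<^sub>0 complex) set"

definition hom_right_action :: "complex \<Rightarrow> nat \<Rightarrow> nat \<Rightarrow> tl \<Rightarrow> tl \<Rightarrow> tl" where
  "hom_right_action \<delta> m n x s = x \<otimes>\<^bsub>TL \<delta> n\<^esub> right_embedding \<delta> m (n - m) s"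

definition hom_space :: "complex \<Rightarrow> nat \<Rightarrow> nat \<Rightarrow> (complex, tl_hom) module" where
  "hom_space \<delta> m n =
     (if m \<le> n
      then tensor_space (carrier (TL \<delta> (n - m))) (TL \<delta> n) (hom_right_action \<delta> m n)
             scalar_space (trivial_action (n - m))
      else zero_space)"

text \<open>The morphism \<open>x \<otimes> 1\<close> from \<open>m\<close> to \<open>n\<close>, for \<open>m \<le> n\<close> and \<open>x\<close> in \<open>TL \<delta> n\<close>.\<close>

definition hom_of :: "complex \<Rightarrow> nat \<Rightarrow> nat \<Rightarrow> tl \<Rightarrow> tl_hom" where
  "hom_of \<delta> m n x = pure_tensor (carrier (TL \<delta> (n - m))) (TL \<delta> n) (hom_right_action \<delta> m n)
     scalar_space (trivial_action (n - m)) x 1"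

definition hom_comp :: "complex \<Rightarrow> nat \<Rightarrow> nat \<Rightarrow> nat \<Rightarrow> tl_hom \<Rightarrow> tl_hom \<Rightarrow> tl_hom" where
  "hom_comp \<delta> l m n F G =
     (if l \<le> m \<and> m \<le> n
      then THE H. \<exists>x\<in>carrier (TL \<delta> n). \<exists>y\<in>carrier (TL \<delta> m).
             F = hom_of \<delta> m n x \<and> G = hom_of \<delta> l m y \<and>
             H = hom_of \<delta> l n (x \<otimes>\<^bsub>TL \<delta> n\<^esub> left_embedding \<delta> m (n - m) y)
      else \<zero>\<^bsub>hom_space \<delta> l n\<^esub>)"

record 'v tlc_functor =
  ob :: "nat \<Rightarrow> (complex, 'v) module"
  mor :: "nat \<Rightarrow> nat \<Rightarrow> tl_hom \<Rightarrow> 'v \<Rightarrow> 'v"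

definition tlc_module :: "complex \<Rightarrow> 'v tlc_functor \<Rightarrow> bool" where
  "tlc_module \<delta> V \<longleftrightarrow>
     (\<forall>n. vectorspace class_ring (ob V n)) \<and>
     (\<forall>m n. \<forall>F\<in>carrier (hom_space \<delta> m n).
        linear_map class_ring (ob V m) (ob V n) (mor V m n F)) \<and>
     (\<forall>m n. \<forall>v\<in>carrier (ob V m).
        linear_map class_ring (hom_space \<delta> m n) (ob V n) (\<lambda>F. mor V m n F v)) \<and>
     (\<forall>n. \<forall>v\<in>carrier (ob V n). mor V n n (hom_of \<delta> n n \<one>\<^bsub>TL \<delta> n\<^esub>) v = v) \<and>
     (\<forall>l m n. \<forall>F\<in>carrier (hom_space \<delta> m n). \<forall>G\<in>carrier (hom_space \<delta> l m).
        \<forall>v\<in>carrier (ob V l).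
          mor V l n (hom_comp \<delta> l m n F G) v = mor V m n F (mor V l m G v))"

definition tlc_hom ::
  "complex \<Rightarrow> 'v tlc_functor \<Rightarrow> 'w tlc_functor \<Rightarrow> (nat \<Rightarrow> 'v \<Rightarrow> 'w) \<Rightarrow> bool" where
  "tlc_hom \<delta> V W \<eta> \<longleftrightarrow>
     (\<forall>n. linear_map class_ring (ob V n) (ob W n) (\<eta> n)) \<and>
     (\<forall>m n. \<forall>F\<in>carrier (hom_space \<delta> m n). \<forall>v\<in>carrier (ob V m).
        \<eta> n (mor V m n F v) = mor W m n F (\<eta> m v))"

definition principal :: "complex \<Rightarrow> nat \<Rightarrow> tl_hom tlc_functor" where
  "principal \<delta> m = \<lparr>ob = hom_space \<delta> m, mor = hom_comp \<delta> m\<rparr>"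

definition tlc_dsum :: "'i set \<Rightarrow> ('i \<Rightarrow> 'v tlc_functor) \<Rightarrow> ('i \<Rightarrow> 'v) tlc_functor" where
  "tlc_dsum I V = \<lparr>ob = (\<lambda>n. dsum I (\<lambda>i. ob (V i) n)),
     mor = (\<lambda>m n F f. \<lambda>i\<in>I. mor (V i) m n F (f i))\<rparr>"

definition principal_sum :: "complex \<Rightarrow> nat list \<Rightarrow> (nat \<Rightarrow> tl_hom) tlc_functor" where
  "principal_sum \<delta> ms = tlc_dsum {..<length ms} (\<lambda>i. principal \<delta> (ms ! i))"

definition finitely_presented :: "complex \<Rightarrow> 'v tlc_functor \<Rightarrow> bool" where
  "finitely_presented \<delta> V \<longleftrightarrow>
     (\<exists>qs ps \<alpha> \<beta>.
        tlc_hom \<delta> (principal_sum \<delta> qs) (principal_sum \<delta> ps) \<alpha> \<and>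
        tlc_hom \<delta> (principal_sum \<delta> ps) V \<beta> \<and>
        (\<forall>n. \<alpha> n ` carrier (ob (principal_sum \<delta> qs) n) =
               {x \<in> carrier (ob (principal_sum \<delta> ps) n). \<beta> n x = \<zero>\<^bsub>ob V n\<^esub>}) \<and>
        (\<forall>n. \<beta> n ` carrier (ob (principal_sum \<delta> ps) n) = carrier (ob V n)))"


section \<open>Representation stability\<close>

definition tl_action :: "complex \<Rightarrow> 'v tlc_functor \<Rightarrow> nat \<Rightarrow> tl \<Rightarrow> 'v \<Rightarrow> 'v" where
  "tl_action \<delta> V n a = mor V n n (hom_of \<delta> n n a)"

definition stab_map :: "complex \<Rightarrow> 'v tlc_functor \<Rightarrow> nat \<Rightarrow> 'v \<Rightarrow> 'v" where
  "stab_map \<delta> V n = mor V n (n + 1) (hom_of \<delta> n (n + 1) \<one>\<^bsub>TL \<delta> (n + 1)\<^esub>)"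

definition induced_space ::
  "complex \<Rightarrow> 'v tlc_functor \<Rightarrow> nat \<Rightarrow> (complex, (tl \<times> 'v \<Rightarrow>\<^sub>0 complex) set) module" where
  "induced_space \<delta> V n = tensor_space (carrier (TL \<delta> n))
     (TL \<delta> (n + 1)) (\<lambda>x s. x \<otimes>\<^bsub>TL \<delta> (n + 1)\<^esub> left_embedding \<delta> n 1 s)
     (ob V n) (tl_action \<delta> V n)"

definition induced_map ::
  "complex \<Rightarrow> 'v tlc_functor \<Rightarrow> nat \<Rightarrow> (tl \<times> 'v \<Rightarrow>\<^sub>0 complex) set \<Rightarrow> 'v" where
  "induced_map \<delta> V n =
     tensor_lift (ob V (n + 1)) (\<lambda>x v. tl_action \<delta> V (n + 1) x (stab_map \<delta> V n v))"

text \<open>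
  \<open>V\<^sub>n\<close> is isomorphic, as a module over \<open>TL \<delta> n\<close>, to the direct sum over all \<open>k\<close> with
  \<open>2 * k \<le> n\<close> of \<open>c k\<close> copies of the simple module indexed by \<open>(n - k, k)\<close>. These are the
  \<open>\<lambda>[n]\<close> for the partitions \<open>\<lambda> = (k)\<close> with at most one part, where \<open>k = 0\<close> stands for the empty
  partition.
\<close>

definition has_multiplicities :: "complex \<Rightarrow> 'v tlc_functor \<Rightarrow> nat \<Rightarrow> (nat \<Rightarrow> nat) \<Rightarrow> bool" where
  "has_multiplicities \<delta> V n c \<longleftrightarrow>
     (let I = {(k, j). 2 * k \<le> n \<and> j < c k};
          S = dsum I (\<lambda>(k, j). simple_space n k)
      in \<exists>\<psi>. linear_map class_ring (ob V n) S \<psi> \<and>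
             bij_betw \<psi> (carrier (ob V n)) (carrier S) \<and>
             (\<forall>a\<in>carrier (TL \<delta> n). \<forall>v\<in>carrier (ob V n).
                \<psi> (tl_action \<delta> V n a v) = (\<lambda>(k, j)\<in>I. simple_action \<delta> n k a (\<psi> v (k, j)))))"

definition representation_stable :: "complex \<Rightarrow> 'v tlc_functor \<Rightarrow> bool" where
  "representation_stable \<delta> V \<longleftrightarrow>
     (\<exists>N. \<forall>n\<ge>N. inj_on (stab_map \<delta> V n) (carrier (ob V n))) \<and>
     (\<exists>N. \<forall>n\<ge>N. induced_map \<delta> V n ` carrier (induced_space \<delta> V n) = carrier (ob V (n + 1))) \<and>
     (\<exists>c. (\<forall>n. has_multiplicities \<delta> V n (c n)) \<and> (\<forall>k. \<exists>N. \<forall>n\<ge>N. c n k = c N k))"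

end

theory Submission
  imports Defs
begin

text \<open>
  Write \<open>\<delta> = t + 1 / t\<close> with \<open>t\<^sup>2 = q\<close>. All quantum integers are nonzero, so the Jones--Wenzl projectors
  exist. Sandwiching the projector on \<open>m\<close> strands between \<open>k\<close> small cups and \<open>k\<close> small caps gives an
  idempotent \<open>e\<^sub>m\<close> of \<open>TL\<^sub>n\<close>, where \<open>n = m + 2 k\<close>, whose image in a module is the multiplicity space of the
  simple module indexed by \<open>(n - k, k)\<close>.

  Let \<open>V\<close> be generated in finitely many degrees \<open>\<le> L\<close>. A diagram with a block in \<open>{p + 1..n}\<close> kills the image of a
  generator of degree \<open>p\<close>, and \<open>e\<^sub>m\<close> kills diagrams in which the \<open>m\<close> strands are joined to one another. So
  every \<open>e\<^sub>m\<cdot>d\<cdot>g\<close> with \<open>d\<close> a diagram and \<open>g\<close> the image of a generator is zero unless \<open>k \<le> L\<close>; and once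
  \<open>m \<ge> L\<close> the diagrams on \<open>n + 1\<close> strands that matter have a through strand at the bottom, so they come
  from \<open>n\<close> strands. Hence \<open>v \<mapsto> e\<^bsub>m+1\<^esub> \<phi>(v)\<close> maps the multiplicity space at \<open>n\<close> onto the one at
  \<open>n + 1\<close>. The dimensions are thus eventually decreasing, hence eventually constant; and then these
  surjections are bijective, which also makes \<open>\<phi>\<close> injective.
\<close>

text \<open>Semisimplicity is not taken as given. Once the projectors exist, the unit of TL_n is a
  combination of products \<open>\<alpha> \<star> JW m \<star> \<beta>\<close>; the decomposition of
  a module, the nondegeneracy of the form on the simple modules and the injectivity of the
  stabilisation maps are all read off from this. Two obstacles shape the rest. Diagrams are bare set
  partitions, so planarity of a product has to be earned without pictures: associativity is shown
  for arbitrary families of blocks, and a planar diagram is then taken apart into small cups and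
  caps, whose products can be computed. The values of a functor are vector spaces given as records,
  while the argument compares dimensions of images of idempotents; each V_n is therefore copied into
  a space of finitely supported functions, where subspaces, bases and dimensions are at hand.
  Invertibility of \<open>\<delta>\<close> normalises the idempotents, and it identifies Hom(m, n)
  with TL_n modulo the diagrams with a right block below the first m dots; this is where the
  vanishing rule for generators comes from.\<close>

section \<open>Connected components of a family of blocks\<close>

definition adj :: "'x set set \<Rightarrow> 'x rel" where
  "adj G = {(x, y). \<exists>B\<in>G. x \<in> B \<and> y \<in> B}"

text \<open>The construction behind \<open>components\<close>, at an arbitrary type of dots, so that
  three diagrams can be glued at once on numbered levels.\<close>

definition comps :: "'x set set \<Rightarrow> 'x set set" where
  "comps G = \<Union> G // (adj G)\<^sup>*"

definition cls :: "'x set set \<Rightarrow> 'x \<Rightarrow> 'x set" where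
  "cls G x = (adj G)\<^sup>* `` {x}"

lemma components_eq: "components p q = comps (glued p q)"
  by (simp add: components_def comps_def adj_def)

lemma conn_sym: "(x, y) \<in> (adj G)\<^sup>* \<Longrightarrow> (y, x) \<in> (adj G)\<^sup>*"
  by (rule symD[OF sym_rtrancl]) (auto simp: adj_def sym_def)

lemma comps_eq: "comps G = cls G ` \<Union> G"
  by (auto simp: comps_def cls_def quotient_def)

lemma cls_cong: "(x, y) \<in> (adj G)\<^sup>* \<Longrightarrow> cls G x = cls G y"
  by (auto simp: cls_def dest: conn_sym intro: rtrancl_trans)

lemma self_in_cls [simp]: "x \<in> cls G x"
  by (simp add: cls_def)

lemma conn_Union: "(x, y) \<in> (adj G)\<^sup>* \<Longrightarrow> x \<in> \<Union> G \<Longrightarrow> y \<in> \<Union> G"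
  by (induction rule: rtrancl_induct) (auto simp: adj_def)

lemma cls_subset: "x \<in> \<Union> G \<Longrightarrow> cls G x \<subseteq> \<Union> G"
  by (auto simp: cls_def dest: conn_Union)

lemma comps_member: "C \<in> comps G \<Longrightarrow> x \<in> C \<Longrightarrow> x \<in> \<Union> G \<and> C = cls G x"
proof -
  assume "C \<in> comps G" "x \<in> C"
  then obtain y where y: "y \<in> \<Union> G" "C = cls G y" by (auto simp: comps_eq)
  with \<open>x \<in> C\<close> have "(y, x) \<in> (adj G)\<^sup>*" by (simp add: cls_def)
  then show ?thesis using y cls_cong conn_Union by metis
qed

lemma Union_comps: "\<Union> (comps G) = \<Union> G"
proof
  show "\<Union> (comps G) \<subseteq> \<Union> G" using comps_member by fast
  show "\<Union> G \<subseteq> \<Union> (comps G)" unfolding comps_eq using self_in_cls by fast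
qed

lemma conn_image:
  assumes "(x, y) \<in> (adj G)\<^sup>*" shows "(h x, h y) \<in> (adj ((image h) ` G))\<^sup>*"
  using assms
proof (induction rule: rtrancl_induct)
  case (step y z)
  then have "(h y, h z) \<in> adj ((image h) ` G)" by (auto simp: adj_def)
  with step show ?case by simp
qed simp

lemma cls_image:
  assumes "inj h" shows "cls ((image h) ` G) (h x) = h ` cls G x"
proof
  show "h ` cls G x \<subseteq> cls ((image h) ` G) (h x)"
    by (auto simp: cls_def intro: conn_image)
  have "\<exists>z. y = h z \<and> (x, z) \<in> (adj G)\<^sup>*" if "(h x, y) \<in> (adj ((image h) ` G))\<^sup>*" for y
    using that
  proof (induction rule: rtrancl_induct)
    case (step y y')
    then obtain z where z: "y = h z" "(x, z) \<in> (adj G)\<^sup>*" by blast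
    from step(2) obtain B where B: "B \<in> G" "y \<in> h ` B" "y' \<in> h ` B" by (auto simp: adj_def)
    from B(2) z(1) have "z \<in> B" using assms by (auto dest: injD)
    moreover obtain z' where "z' \<in> B" "y' = h z'" using B(3) by blast
    ultimately have "(z, z') \<in> adj G" using B(1) by (auto simp: adj_def)
    with z(2) have "(x, z') \<in> (adj G)\<^sup>*" by simp
    with \<open>y' = h z'\<close> show ?case by blast
  qed blast
  then show "cls ((image h) ` G) (h x) \<subseteq> h ` cls G x" by (auto simp: cls_def)
qed

lemma comps_image: "inj h \<Longrightarrow> comps ((image h) ` G) = (image h) ` comps G"
proof -
  assume "inj h"
  have "\<Union> ((image h) ` G) = h ` \<Union> G" by blast
  then show ?thesis using cls_image[OF \<open>inj h\<close>]
    unfolding comps_eq by (simp add: image_image)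
qed

section \<open>Gluing in two stages\<close>

text \<open>What \<open>diagram_concat\<close> does with the outer dots: components are cut down to
  the visible dots \<open>S\<close>, and those that become empty, the loops, are dropped.\<close>

definition traces :: "'x set \<Rightarrow> 'x set set \<Rightarrow> 'x set set" where
  "traces S G = (\<lambda>C. C \<inter> S) ` comps G - {{}}"

lemma Union_traces: "\<Union> (traces S G) = \<Union> G \<inter> S"
proof -
  have "\<Union> (traces S G) = \<Union> (comps G) \<inter> S" unfolding traces_def by blast
  then show ?thesis by (simp add: Union_comps)
qed

context
  fixes G H :: "'x set set" and S :: "'x set"
  assumes GHS: "\<Union> G \<inter> \<Union> H \<subseteq> S"
begin

private abbreviation "G' \<equiv> traces S G"
private abbreviation "K \<equiv> (\<Union> G \<inter> S) \<union> \<Union> H"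

private lemma conn_GH: "(x, y) \<in> (adj (G' \<union> H))\<^sup>* \<Longrightarrow> (x, y) \<in> (adj (G \<union> H))\<^sup>*"
proof (induction rule: rtrancl_induct)
  case (step y z)
  from step(2) consider C where "C \<in> comps G" "y \<in> C" "z \<in> C" | "(y, z) \<in> adj H"
    by (auto simp: adj_def traces_def)
  then have "(y, z) \<in> (adj (G \<union> H))\<^sup>*"
  proof cases
    case 1
    then have "(y, z) \<in> (adj G)\<^sup>*" using comps_member[OF 1(1,2)] by (auto simp: cls_def)
    moreover have "adj G \<subseteq> adj (G \<union> H)" by (auto simp: adj_def)
    ultimately show ?thesis using rtrancl_mono by blast
  qed (auto simp: adj_def)
  with step show ?case by simp
qed simp

private lemma trace_step:
  "(x, y) \<in> (adj G)\<^sup>* \<Longrightarrow> x \<in> \<Union> G \<Longrightarrow> x \<in> S \<Longrightarrow> y \<in> S \<Longrightarrow> (x, y) \<in> adj (G' \<union> H)"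
proof -
  assume *: "(x, y) \<in> (adj G)\<^sup>*" "x \<in> \<Union> G" "x \<in> S" "y \<in> S"
  then have "cls G x \<inter> S \<in> G'" "x \<in> cls G x \<inter> S" "y \<in> cls G x \<inter> S"
    by (auto simp: traces_def comps_eq cls_def)
  then show ?thesis
    unfolding adj_def by (intro CollectI case_prodI bexI[of _ "cls G x \<inter> S"] conjI UnI1)
qed

private lemma trace_conn:
  assumes "(x, y) \<in> (adj G)\<^sup>*" "x \<in> K" "y \<in> K" shows "(x, y) \<in> (adj (G' \<union> H))\<^sup>*"
proof (cases "x = y")
  case False
  then have x: "x \<in> \<Union> G"
    using assms(1) by (auto simp: adj_def elim: converse_rtranclE)
  then have "y \<in> \<Union> G" using assms(1) conn_Union by metis
  with x assms GHS have "x \<in> S" "y \<in> S" by auto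
  then show ?thesis using trace_step[OF assms(1) x] by blast
qed simp

text \<open>A path in \<open>G \<union> H\<close> enters and leaves \<open>H\<close> only through
  dots of \<open>S\<close>, because \<open>G\<close> and \<open>H\<close> meet only there. Each
  stretch inside \<open>G\<close> between two such dots can be replaced by one block of the
  trace.\<close>

private lemma conn_trace:
  assumes "(x, z) \<in> (adj (G \<union> H))\<^sup>*" "x \<in> K" "z \<in> K" shows "(x, z) \<in> (adj (G' \<union> H))\<^sup>*"
proof -
  \<comment> \<open>Invariant along the path: \<open>k\<close> is a visible dot already reached
    through traces, and a stretch inside \<open>G\<close> from \<open>k\<close> to the current dot
    is still pending. A step in \<open>H\<close> ends the stretch at a dot of
    \<open>K\<close>.\<close>
  have "\<exists>k\<in>K. (x, k) \<in> (adj (G' \<union> H))\<^sup>* \<and> (k, z) \<in> (adj G)\<^sup>*"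
    using assms(1)
  proof (induction rule: rtrancl_induct)
    case base
    then show ?case using assms(2) by blast
  next
    case (step z z')
    then obtain k where k: "k \<in> K" "(x, k) \<in> (adj (G' \<union> H))\<^sup>*" "(k, z) \<in> (adj G)\<^sup>*" by blast
    from step(2) consider "(z, z') \<in> adj G" | "(z, z') \<in> adj H" by (auto simp: adj_def)
    then show ?case
    proof cases
      case 1
      then show ?thesis using k by (meson rtrancl.rtrancl_into_rtrancl)
    next
      case 2
      then have z: "z \<in> K" "z' \<in> K" "(z, z') \<in> adj (G' \<union> H)" by (auto simp: adj_def)
      have "(k, z) \<in> (adj (G' \<union> H))\<^sup>*" by (rule trace_conn[OF k(3,1) z(1)])
      with z k show ?thesis by (meson rtrancl.rtrancl_into_rtrancl rtrancl_trans rtrancl.rtrancl_refl)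
    qed
  qed
  then show ?thesis using trace_conn assms(3) by (meson rtrancl_trans)
qed

lemma comps_traces: "comps (traces S G \<union> H) = traces ((\<Union> G \<inter> S) \<union> \<Union> H) (G \<union> H)"
proof -
  have U: "\<Union> (G' \<union> H) = K" using Union_traces[of S G] by auto
  have cls: "cls (G' \<union> H) x = cls (G \<union> H) x \<inter> K" if "x \<in> K" for x
  proof
    show "cls (G' \<union> H) x \<subseteq> cls (G \<union> H) x \<inter> K"
      using conn_GH cls_subset[of x "G' \<union> H"] that unfolding U by (auto simp: cls_def)
    show "cls (G \<union> H) x \<inter> K \<subseteq> cls (G' \<union> H) x"
      using conn_trace that by (auto simp: cls_def)
  qed
  have "comps (G' \<union> H) = (\<lambda>x. cls (G \<union> H) x \<inter> K) ` K"
    unfolding comps_eq U using cls by (rule image_cong[OF refl])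
  also have "\<dots> = traces K (G \<union> H)"
  proof
    show "(\<lambda>x. cls (G \<union> H) x \<inter> K) ` K \<subseteq> traces K (G \<union> H)"
    proof
      fix D assume "D \<in> (\<lambda>x. cls (G \<union> H) x \<inter> K) ` K"
      then obtain x where x: "x \<in> K" "D = cls (G \<union> H) x \<inter> K" by blast
      then have "x \<in> D" "cls (G \<union> H) x \<in> comps (G \<union> H)" by (auto simp: comps_eq)
      then have "D \<in> (\<lambda>C. C \<inter> K) ` comps (G \<union> H)" "D \<noteq> {}" unfolding x(2) by blast+
      then show "D \<in> traces K (G \<union> H)" unfolding traces_def by simp
    qed
    show "traces K (G \<union> H) \<subseteq> (\<lambda>x. cls (G \<union> H) x \<inter> K) ` K"
    proof
      fix D assume "D \<in> traces K (G \<union> H)"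
      then obtain C x where C: "C \<in> comps (G \<union> H)" "D = C \<inter> K" "x \<in> C" "x \<in> K"
        by (auto simp: traces_def)
      then have "C = cls (G \<union> H) x" using comps_member by metis
      with C show "D \<in> (\<lambda>x. cls (G \<union> H) x \<inter> K) ` K" by blast
    qed
  qed
  finally show ?thesis .
qed

text \<open>Identifies the loops closed at the first stage inside the full gluing: a component of
  \<open>G\<close> that avoids \<open>S\<close> cannot meet \<open>H\<close>, so it is never
  enlarged by the second stage.\<close>

lemma comps_hidden:
  "{D \<in> comps (G \<union> H). D \<inter> ((\<Union> G \<inter> S) \<union> \<Union> H) = {}} = {C \<in> comps G. C \<inter> S = {}}"
proof -
  have 1: "cls (G \<union> H) x = cls G x" if "cls G x \<inter> \<Union> H = {}" for x
  proof
    have "adj G \<subseteq> adj (G \<union> H)" by (auto simp: adj_def)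
    then show "cls G x \<subseteq> cls (G \<union> H) x" unfolding cls_def using rtrancl_mono by blast
    have "(x, y) \<in> (adj (G \<union> H))\<^sup>* \<Longrightarrow> (x, y) \<in> (adj G)\<^sup>*" for y
    proof (induction rule: rtrancl_induct)
      case (step y z)
      then have "y \<notin> \<Union> H" using that by (auto simp: cls_def)
      with step(2) have "(y, z) \<in> adj G" by (auto simp: adj_def)
      with step show ?case by simp
    qed simp
    then show "cls (G \<union> H) x \<subseteq> cls G x" by (auto simp: cls_def)
  qed
  have 2: "cls G x \<subseteq> cls (G \<union> H) x" for x
  proof -
    have "adj G \<subseteq> adj (G \<union> H)" by (auto simp: adj_def)
    then show ?thesis unfolding cls_def using rtrancl_mono by blast
  qed
  show ?thesis
  proof (rule Set.set_eqI, rule iffI)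
    fix D assume "D \<in> {D \<in> comps (G \<union> H). D \<inter> K = {}}"
    then obtain x where x: "x \<in> \<Union> (G \<union> H)" "D = cls (G \<union> H) x" "D \<inter> K = {}"
      by (auto simp: comps_eq)
    from x(2,3) have "x \<notin> K" using self_in_cls[of x "G \<union> H"] by blast
    with x(1) have xG: "x \<in> \<Union> G" by blast
    have sub: "cls G x \<subseteq> D" using 2[of x] by (simp add: x(2))
    then have "cls G x \<inter> \<Union> H = {}" using x(3) by blast
    then have D: "D = cls G x" using 1 x(2) by simp
    have "D \<inter> S = {}" using cls_subset[OF xG] x(3) unfolding D by blast
    with D xG show "D \<in> {C \<in> comps G. C \<inter> S = {}}" by (simp add: comps_eq)
  next
    fix C assume "C \<in> {C \<in> comps G. C \<inter> S = {}}"
    then obtain x where x: "x \<in> \<Union> G" "C = cls G x" "C \<inter> S = {}" by (auto simp: comps_eq)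
    have *: "cls G x \<inter> \<Union> H = {}" using cls_subset[OF x(1)] x(2,3) GHS by blast
    then have C: "C = cls (G \<union> H) x" using 1 x(2) by simp
    have "C \<inter> K = {}" using * x(2,3) by blast
    moreover have "C \<in> comps (G \<union> H)" unfolding C comps_eq using x(1) by blast
    ultimately show "C \<in> {D \<in> comps (G \<union> H). D \<inter> K = {}}" by blast
  qed
qed

end

section \<open>Concatenation is associative\<close>

text \<open>Left dots go to level \<open>u\<close> and right dots to level \<open>v\<close>. With
  consecutive diagrams on levels 0 to 3, identifying dots is automatic and gluing is plain
  union.\<close>

definition lv :: "nat \<Rightarrow> nat \<Rightarrow> int \<Rightarrow> nat \<times> int" where
  "lv u v i = (if i < 0 then (u, - i) else (v, i))"

definition lvs :: "nat \<Rightarrow> nat \<Rightarrow> diagram \<Rightarrow> (nat \<times> int) set set" where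
  "lvs u v p = (image (lv u v)) ` p"

fun lv_dot :: "nat \<Rightarrow> nat \<Rightarrow> nat \<Rightarrow> dot \<Rightarrow> nat \<times> int" where
  "lv_dot u v w (Lft i) = (u, i)"
| "lv_dot u v w (Mid i) = (v, i)"
| "lv_dot u v w (Rgt i) = (w, i)"

definition lev :: "nat set \<Rightarrow> (nat \<times> int) set" where
  "lev U = {x. fst x \<in> U}"

lemma inj_lv_dot: "u \<noteq> v \<Longrightarrow> v \<noteq> w \<Longrightarrow> u \<noteq> w \<Longrightarrow> inj (lv_dot u v w)"
  apply (rule injI) subgoal for x y by (cases x; cases y) auto done

lemma inj_lv: "u \<noteq> w \<Longrightarrow> inj (lv u w)"
  by (rule injI) (auto simp: lv_def split: if_splits)

lemma inj_lvs: "u \<noteq> w \<Longrightarrow> inj (lvs u w)"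
proof (rule injI)
  fix p q assume uw: "u \<noteq> w" and "lvs u w p = lvs u w q"
  moreover have "inj (image (lv u w))" using inj_lv[OF uw] by (simp add: inj_def inj_image_eq_iff)
  ultimately show "p = q" by (simp add: lvs_def inj_image_eq_iff)
qed

lemma lv_dot_glued: "(image (lv_dot u v w)) ` glued p q = lvs u v p \<union> lvs v w q"
proof -
  have "lv_dot u v w (left_dot i) = lv u v i" "lv_dot u v w (right_dot i) = lv v w i" for i
    by (auto simp: left_dot_def right_dot_def lv_def)
  then show ?thesis by (simp add: glued_def lvs_def image_Un image_image)
qed

context
  fixes u v w :: nat
  assumes uvw: "u \<noteq> v" "v \<noteq> w" "u \<noteq> w"
begin

lemma comps_lvs: "comps (lvs u v p \<union> lvs v w q) = (image (lv_dot u v w)) ` components p q"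
  unfolding components_eq lv_dot_glued[symmetric]
  by (rule comps_image) (rule inj_lv_dot[OF uvw])

lemma lvs_concat: "lvs u w (diagram_concat p q) = traces (lev {u, w}) (lvs u v p \<union> lvs v w q)"
proof -
  have *: "lv u w ` (outer_dot -` C) = lv_dot u v w ` C \<inter> lev {u, w}"
    if "C \<in> components p q" for C
  proof -
    have C: "C \<subseteq> \<Union> (glued p q)"
      using that comps_member unfolding components_eq by fast
    show ?thesis
    proof (rule Set.set_eqI, rule iffI)
      fix x assume "x \<in> lv u w ` (outer_dot -` C)"
      then obtain i where i: "x = lv u w i" "outer_dot i \<in> C" by blast
      have "lv u w i = lv_dot u v w (outer_dot i)" "lv u w i \<in> lev {u, w}"
        by (simp_all add: outer_dot_def lv_def lev_def)
      with i show "x \<in> lv_dot u v w ` C \<inter> lev {u, w}" by blast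
    next
      fix x assume "x \<in> lv_dot u v w ` C \<inter> lev {u, w}"
      then obtain y where y: "y \<in> C" "x = lv_dot u v w y" "fst x = u \<or> fst x = w"
        by (auto simp: lev_def)
      \<comment> \<open>\<open>outer_dot\<close> does not reach every \<open>Lft j\<close> and
        \<open>Rgt j\<close>, only those with \<open>j > 0\<close> and \<open>j \<ge> 0\<close>
        respectively; glued families contain no others.\<close>
      have "\<exists>i. y = outer_dot i"
      proof (cases y)
        case (Lft j)
        with y C have "j > 0" by (auto simp: glued_def left_dot_def right_dot_def split: if_splits)
        with Lft have "y = outer_dot (- j)" by (simp add: outer_dot_def)
        then show ?thesis ..
      next
        case (Mid j)
        with y uvw show ?thesis by auto
      next
        case (Rgt j)
        with y C have "j \<ge> 0" by (auto simp: glued_def left_dot_def right_dot_def split: if_splits)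
        with Rgt have "y = outer_dot j" by (simp add: outer_dot_def)
        then show ?thesis ..
      qed
      then obtain i where i: "y = outer_dot i" ..
      have "lv u w i = lv_dot u v w (outer_dot i)" by (auto simp: outer_dot_def lv_def)
      then have "x = lv u w i" "i \<in> outer_dot -` C" using y(1,2) i by simp_all
      then show "x \<in> lv u w ` (outer_dot -` C)" by blast
    qed
  qed
  have "lvs u w (diagram_concat p q) = (\<lambda>C. lv u w ` (outer_dot -` C)) ` components p q - {{}}"
  proof -
    have "(image h) ` (X - {{}}) = (image h) ` X - {{}}" for h :: "int \<Rightarrow> nat \<times> int" and X
      by auto
    then show ?thesis by (simp add: lvs_def diagram_concat_def image_image)
  qed
  also have "\<dots> = (\<lambda>C. lv_dot u v w ` C \<inter> lev {u, w}) ` components p q - {{}}"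
    using * by (simp cong: image_cong)
  finally show ?thesis by (simp add: traces_def comps_lvs image_image)
qed

lemma loops_lvs: "loops p q = card {C \<in> comps (lvs u v p \<union> lvs v w q). C \<inter> lev {u, w} = {}}"
proof -
  have "C \<subseteq> range Mid \<longleftrightarrow> lv_dot u v w ` C \<inter> lev {u, w} = {}" for C
  proof -
    have "x \<in> range Mid \<longleftrightarrow> lv_dot u v w x \<notin> lev {u, w}" for x
      using uvw by (cases x) (auto simp: lev_def)
    then show ?thesis by blast
  qed
  then have "{C \<in> comps (lvs u v p \<union> lvs v w q). C \<inter> lev {u, w} = {}}
      = (image (lv_dot u v w)) ` {C \<in> components p q. C \<subseteq> range Mid}"
    unfolding comps_lvs by auto
  moreover have "inj_on (image (lv_dot u v w)) A" for A
    using inj_lv_dot[OF uvw] by (simp add: inj_on_def inj_image_eq_iff)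
  ultimately show ?thesis by (simp add: card_image loops_def)
qed

end

context
  fixes p q r :: diagram
begin

private abbreviation "T \<equiv> lvs 0 1 p \<union> lvs 1 2 q \<union> lvs 2 3 r"

private lemma lvs_fst: "X \<in> lvs u v d \<Longrightarrow> (i, j) \<in> X \<Longrightarrow> i = u \<or> i = v"
  by (auto simp: lvs_def lv_def split: if_splits)

lemma traces_mono:
  "(\<And>x. x \<in> \<Union> G \<Longrightarrow> x \<in> S \<Longrightarrow> x \<in> K) \<Longrightarrow> (\<lambda>C. C \<inter> S) ` traces K G - {{}} = traces S G"
proof -
  assume *: "\<And>x. x \<in> \<Union> G \<Longrightarrow> x \<in> S \<Longrightarrow> x \<in> K"
  have KS: "C \<inter> K \<inter> S = C \<inter> S" if "C \<in> comps G" for C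
    using * comps_member[OF that] by blast
  have "(\<lambda>C. C \<inter> S) ` traces K G - {{}} = (\<lambda>C. C \<inter> K \<inter> S) ` comps G - {{}}"
    unfolding traces_def by auto
  also have "\<dots> = traces S G" unfolding traces_def using KS by (simp cong: image_cong)
  finally show ?thesis .
qed

text \<open>The components that miss \<open>S\<close> are counted in two portions: those still seen
  on \<open>K\<close>, which their traces on \<open>K\<close> tell apart, and those that miss
  \<open>K\<close> as well.\<close>

lemma card_traces:
  assumes fin: "finite (comps G)" and SK: "\<And>x. x \<in> \<Union> G \<Longrightarrow> x \<in> S \<Longrightarrow> x \<in> K"
  shows "card {D \<in> traces K G. D \<inter> S = {}} + card {D \<in> comps G. D \<inter> K = {}}
     = card {D \<in> comps G. D \<inter> S = {}}"
proof -
  have KS: "C \<inter> K \<inter> S = C \<inter> S" if "C \<in> comps G" for C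
    using SK comps_member[OF that] by blast
  have inj: "inj_on (\<lambda>C. C \<inter> K) {D \<in> comps G. D \<inter> S = {} \<and> D \<inter> K \<noteq> {}}"
  proof (rule inj_onI)
    fix C D assume "C \<in> {D \<in> comps G. D \<inter> S = {} \<and> D \<inter> K \<noteq> {}}"
      "D \<in> {D \<in> comps G. D \<inter> S = {} \<and> D \<inter> K \<noteq> {}}" "C \<inter> K = D \<inter> K"
    then obtain x where "x \<in> C" "x \<in> D" "C \<in> comps G" "D \<in> comps G" by blast
    then show "C = D" using comps_member by metis
  qed
  have img: "{D \<in> traces K G. D \<inter> S = {}} = (\<lambda>C. C \<inter> K) ` {D \<in> comps G. D \<inter> S = {} \<and> D \<inter> K \<noteq> {}}"
  proof (rule Set.set_eqI, rule iffI)
    fix D assume "D \<in> {D \<in> traces K G. D \<inter> S = {}}"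
    then obtain C where C: "C \<in> comps G" "D = C \<inter> K" "D \<noteq> {}" "D \<inter> S = {}"
      by (auto simp: traces_def)
    then have "C \<inter> S = {}" using KS[OF C(1)] by simp
    with C show "D \<in> (\<lambda>C. C \<inter> K) ` {D \<in> comps G. D \<inter> S = {} \<and> D \<inter> K \<noteq> {}}" by blast
  next
    fix D assume "D \<in> (\<lambda>C. C \<inter> K) ` {D \<in> comps G. D \<inter> S = {} \<and> D \<inter> K \<noteq> {}}"
    then obtain C where C: "C \<in> comps G" "D = C \<inter> K" "D \<noteq> {}" "C \<inter> S = {}" by blast
    then have "D \<inter> S = {}" by blast
    with C show "D \<in> {D \<in> traces K G. D \<inter> S = {}}" by (simp add: traces_def)
  qed
  have "card {D \<in> traces K G. D \<inter> S = {}} = card {D \<in> comps G. D \<inter> S = {} \<and> D \<inter> K \<noteq> {}}"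
    unfolding img using inj by (rule card_image)
  moreover have "D \<inter> S = {}" if "D \<in> comps G" "D \<inter> K = {}" for D
    using KS[OF that(1)] that(2) by simp
  then have "{D \<in> comps G. D \<inter> S = {}} =
      {D \<in> comps G. D \<inter> S = {} \<and> D \<inter> K \<noteq> {}} \<union> {D \<in> comps G. D \<inter> K = {}}"
    by auto
  moreover have "card ({D \<in> comps G. D \<inter> S = {} \<and> D \<inter> K \<noteq> {}} \<union> {D \<in> comps G. D \<inter> K = {}}) =
      card {D \<in> comps G. D \<inter> S = {} \<and> D \<inter> K \<noteq> {}} + card {D \<in> comps G. D \<inter> K = {}}"
    using fin by (intro card_Un_disjoint) auto
  ultimately show ?thesis by simp
qed

private lemma left_comps:
  "comps (lvs 0 2 (diagram_concat p q) \<union> lvs 2 3 r) =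
     traces ((\<Union> (lvs 0 1 p \<union> lvs 1 2 q) \<inter> lev {0, 2}) \<union> \<Union> (lvs 2 3 r)) T"
proof -
  have "\<Union> (lvs 0 1 p \<union> lvs 1 2 q) \<inter> \<Union> (lvs 2 3 r) \<subseteq> lev {0, 2}"
    by (fastforce simp: lev_def dest: lvs_fst)
  from comps_traces[OF this] show ?thesis by (subst lvs_concat[of 0 1 2]) auto
qed

private lemma right_comps:
  "comps (lvs 0 1 p \<union> lvs 1 3 (diagram_concat q r)) =
     traces ((\<Union> (lvs 1 2 q \<union> lvs 2 3 r) \<inter> lev {1, 3}) \<union> \<Union> (lvs 0 1 p)) T"
proof -
  have "\<Union> (lvs 1 2 q \<union> lvs 2 3 r) \<inter> \<Union> (lvs 0 1 p) \<subseteq> lev {1, 3}"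
    by (fastforce simp: lev_def dest: lvs_fst)
  from comps_traces[OF this] show ?thesis
    by (subst lvs_concat[of 1 2 3]) (auto simp: Un_commute Un_left_commute)
qed

private lemma outer_left:
  assumes "x \<in> \<Union> T" "x \<in> lev {0, 3}"
  shows "x \<in> (\<Union> (lvs 0 1 p \<union> lvs 1 2 q) \<inter> lev {0, 2}) \<union> \<Union> (lvs 2 3 r)"
proof -
  obtain i j where x: "x = (i, j)" by force
  consider "x \<in> \<Union> (lvs 0 1 p)" | "x \<in> \<Union> (lvs 1 2 q)" | "x \<in> \<Union> (lvs 2 3 r)"
    using assms(1) by blast
  then show ?thesis
  proof cases
    case 1
    then have "i = 0 \<or> i = 1" using lvs_fst x by blast
    with assms(2) x have "x \<in> lev {0, 2}" by (auto simp: lev_def)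
    with 1 show ?thesis by blast
  next
    case 2
    then have "i = 1 \<or> i = 2" using lvs_fst x by blast
    with assms(2) x show ?thesis by (auto simp: lev_def)
  qed blast
qed

private lemma outer_right:
  assumes "x \<in> \<Union> T" "x \<in> lev {0, 3}"
  shows "x \<in> (\<Union> (lvs 1 2 q \<union> lvs 2 3 r) \<inter> lev {1, 3}) \<union> \<Union> (lvs 0 1 p)"
proof -
  obtain i j where x: "x = (i, j)" by force
  consider "x \<in> \<Union> (lvs 0 1 p)" | "x \<in> \<Union> (lvs 1 2 q)" | "x \<in> \<Union> (lvs 2 3 r)"
    using assms(1) by blast
  then show ?thesis
  proof cases
    case 2
    then have "i = 1 \<or> i = 2" using lvs_fst x by blast
    with assms(2) x show ?thesis by (auto simp: lev_def)
  next
    case 3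
    then have "i = 2 \<or> i = 3" using lvs_fst x by blast
    with assms(2) x have "x \<in> lev {1, 3}" by (auto simp: lev_def)
    with 3 show ?thesis by blast
  qed blast
qed

text \<open>Both bracketings are the trace of the threefold gluing \<open>T\<close> on the outermost
  levels 0 and 3. The families are arbitrary, so the law is available for proving that products are
  planar.\<close>

theorem concat_assoc:
  "diagram_concat (diagram_concat p q) r = diagram_concat p (diagram_concat q r)"
proof -
  have "lvs 0 3 (diagram_concat (diagram_concat p q) r) = traces (lev {0, 3}) T"
  proof -
    have "lvs 0 3 (diagram_concat (diagram_concat p q) r) =
        (\<lambda>C. C \<inter> lev {0, 3}) `
          traces ((\<Union> (lvs 0 1 p \<union> lvs 1 2 q) \<inter> lev {0, 2}) \<union> \<Union> (lvs 2 3 r)) T - {{}}"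
      unfolding left_comps[symmetric] traces_def[symmetric] by (rule lvs_concat) simp_all
    also have "\<dots> = traces (lev {0, 3}) T"
      by (rule traces_mono[OF outer_left])
    finally show ?thesis .
  qed
  moreover have "lvs 0 3 (diagram_concat p (diagram_concat q r)) = traces (lev {0, 3}) T"
  proof -
    have "lvs 0 3 (diagram_concat p (diagram_concat q r)) =
        (\<lambda>C. C \<inter> lev {0, 3}) `
          traces ((\<Union> (lvs 1 2 q \<union> lvs 2 3 r) \<inter> lev {1, 3}) \<union> \<Union> (lvs 0 1 p)) T - {{}}"
      unfolding right_comps[symmetric] traces_def[symmetric] by (rule lvs_concat) simp_all
    also have "\<dots> = traces (lev {0, 3}) T"
      by (rule traces_mono[OF outer_right])
    finally show ?thesis .
  qed
  ultimately have "lvs 0 3 (diagram_concat (diagram_concat p q) r) =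
      lvs 0 3 (diagram_concat p (diagram_concat q r))" by (simp only:)
  then show ?thesis by (rule injD[OF inj_lvs, rotated]) simp
qed

text \<open>Both sides count the components of \<open>T\<close> that miss the levels 0 and 3; the
  two summands separate them by the stage of the gluing at which they close.\<close>

theorem loops_assoc:
  assumes "finite (\<Union> p)" "finite (\<Union> q)" "finite (\<Union> r)"
  shows "loops p q + loops (diagram_concat p q) r = loops q r + loops p (diagram_concat q r)"
proof -
  let ?K = "(\<Union> (lvs 0 1 p \<union> lvs 1 2 q) \<inter> lev {0, 2}) \<union> \<Union> (lvs 2 3 r)"
  let ?K' = "(\<Union> (lvs 1 2 q \<union> lvs 2 3 r) \<inter> lev {1, 3}) \<union> \<Union> (lvs 0 1 p)"
  let ?c = "card {D \<in> comps T. D \<inter> lev {0, 3} = {}}"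
  have "\<Union> (lvs u v d) = lv u v ` \<Union> d" for u v d by (auto simp: lvs_def)
  then have "finite (\<Union> T)" using assms by simp
  then have fin: "finite (comps T)" by (simp add: comps_eq)
  have eqs: "lvs 1 2 q \<union> lvs 2 3 r \<union> lvs 0 1 p = T" by auto
  have sub: "\<Union> (lvs 0 1 p \<union> lvs 1 2 q) \<inter> \<Union> (lvs 2 3 r) \<subseteq> lev {0, 2}"
    "\<Union> (lvs 1 2 q \<union> lvs 2 3 r) \<inter> \<Union> (lvs 0 1 p) \<subseteq> lev {1, 3}"
    by (fastforce simp: lev_def dest: lvs_fst)+
  have "loops p q = card {D \<in> comps T. D \<inter> ?K = {}}"
    unfolding comps_hidden[OF sub(1)] by (rule loops_lvs) simp_all
  moreover have "loops (diagram_concat p q) r = card {D \<in> traces ?K T. D \<inter> lev {0, 3} = {}}"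
    unfolding left_comps[symmetric] by (rule loops_lvs) simp_all
  moreover have "card {D \<in> traces ?K T. D \<inter> lev {0, 3} = {}} + card {D \<in> comps T. D \<inter> ?K = {}} = ?c"
    by (rule card_traces[OF fin outer_left])
  moreover have "loops q r = card {D \<in> comps T. D \<inter> ?K' = {}}"
  proof -
    have "loops q r = card {D \<in> comps (lvs 1 2 q \<union> lvs 2 3 r \<union> lvs 0 1 p). D \<inter> ?K' = {}}"
      unfolding comps_hidden[OF sub(2)] by (rule loops_lvs) simp_all
    then show ?thesis by (simp only: eqs)
  qed
  moreover have "loops p (diagram_concat q r) = card {D \<in> traces ?K' T. D \<inter> lev {0, 3} = {}}"
    unfolding right_comps[symmetric] by (rule loops_lvs) simp_all
  moreover have "card {D \<in> traces ?K' T. D \<inter> lev {0, 3} = {}} + card {D \<in> comps T. D \<inter> ?K' = {}} = ?c"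
    by (rule card_traces[OF fin outer_right])
  ultimately show ?thesis by simp
qed

end

section \<open>Noncrossing perfect matchings\<close>

text \<open>\<open>matchings\<close> with an arbitrary set of integers in place of the standard
  dots, so that blocks can be inserted and removed before the dots are renumbered.\<close>

definition ncm :: "int set \<Rightarrow> diagram \<Rightarrow> bool" where
  "ncm S p \<longleftrightarrow> partition_on S p \<and> (\<forall>B\<in>p. card B = 2) \<and>
     \<not> (\<exists>i j k l. {i, j} \<in> p \<and> {k, l} \<in> p \<and> i < k \<and> k < j \<and> j < l)"

definition dots :: "nat \<Rightarrow> nat \<Rightarrow> int set" where
  "dots a b = {- int a..-1} \<union> {1..int b}"

lemma matchings_iff: "p \<in> matchings a b \<longleftrightarrow> ncm (dots a b) p"
  by (simp add: matchings_def ncm_def dots_def)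

lemma dots_iff: "x \<in> dots a b \<longleftrightarrow> (- int a \<le> x \<and> x \<le> -1) \<or> (1 \<le> x \<and> x \<le> int b)"
  by (auto simp: dots_def)

lemma finite_dots [simp]: "finite (dots a b)"
  by (simp add: dots_def)

lemma ncm_Union: "ncm S p \<Longrightarrow> \<Union> p = S"
  by (simp add: ncm_def partition_on_def)

lemma ncm_mem: "ncm S p \<Longrightarrow> {x, y} \<in> p \<Longrightarrow> x \<in> S \<and> y \<in> S \<and> x \<noteq> y"
  unfolding ncm_def partition_on_def by fastforce

lemma ncm_block:
  assumes "ncm S p" "B \<in> p" obtains x y where "B = {x, y}" "x < y" "x \<in> S" "y \<in> S"
proof -
  have "card B = 2" using assms by (simp add: ncm_def)
  then obtain x y where "B = {x, y}" "x \<noteq> y" by (auto simp: card_2_iff)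
  then consider "B = {x, y}" "x < y" | "B = {y, x}" "y < x" by (metis insert_commute linorder_neqE)
  then show ?thesis using that ncm_mem[OF assms(1)] assms(2) by cases metis+
qed

lemma ncm_partner:
  assumes "ncm S p" "x \<in> S" obtains y where "{x, y} \<in> p" "y \<noteq> x" "y \<in> S"
proof -
  obtain B where B: "B \<in> p" "x \<in> B" using assms ncm_Union by blast
  obtain u v where uv: "B = {u, v}" "u < v" "u \<in> S" "v \<in> S" using ncm_block[OF assms(1) B(1)] .
  then consider "x = u" | "x = v" using B by auto
  then show ?thesis
    using that B uv by cases (metis insert_commute less_irrefl)+
qed

lemma partition_on_unique:
  "partition_on S p \<Longrightarrow> B \<in> p \<Longrightarrow> C \<in> p \<Longrightarrow> x \<in> B \<Longrightarrow> x \<in> C \<Longrightarrow> B = C"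
  by (metis IntI disjointD empty_iff partition_onD2)

lemma ncm_unique:
  assumes "ncm S p" "{x, y} \<in> p" "{x, z} \<in> p" shows "y = z"
proof -
  have "partition_on S p" using assms(1) by (simp add: ncm_def)
  from partition_on_unique[OF this assms(2,3), of x] have "{x, y} = {x, z}" by simp
  then show ?thesis by (auto simp: doubleton_eq_iff)
qed

text \<open>The definition forbids one order of the four ends only. Writing the unordered pairs in
  both ways, and excluding common ends by uniqueness, turns it into nesting.\<close>

lemma ncm_nest:
  assumes p: "ncm S p" and ab: "{a, b} \<in> p" and cd: "{c, d} \<in> p" and "a < c" "c < b"
  shows "a < d \<and> d < b"
proof -
  have "d \<noteq> a" using ncm_unique[OF p, of a b c] ab cd assms(4,5) by (auto simp: insert_commute)
  moreover have "d \<noteq> b" using ncm_unique[OF p, of b a c] ab cd assms(4,5) by (auto simp: insert_commute)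
  moreover have cross: "\<not> (i < k \<and> k < j \<and> j < l)" if H: "{i, j} \<in> p" "{k, l} \<in> p" for i j k l
    using p H unfolding ncm_def by blast
  moreover have "\<not> d < a"
    using cross[of d c a b] ab cd assms(4,5) by (auto simp: insert_commute)
  moreover have "\<not> b < d" using cross[OF ab cd] assms(4,5) by blast
  ultimately show ?thesis by linarith
qed

lemma ncmI:
  assumes "\<Union> p = S" and pair: "\<And>B. B \<in> p \<Longrightarrow> \<exists>x y. x < y \<and> B = {x, y}"
    and unique: "\<And>x y z. {x, y} \<in> p \<Longrightarrow> {x, z} \<in> p \<Longrightarrow> y = z"
    and nest: "\<And>a b c d. {a, b} \<in> p \<Longrightarrow> {c, d} \<in> p \<Longrightarrow> a < c \<Longrightarrow> c < b \<Longrightarrow> a < d \<and> d < b"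
  shows "ncm S p"
  unfolding ncm_def
proof (intro conjI)
  show "partition_on S p"
  proof (rule partition_onI)
    fix B C assume BC: "B \<in> p" "C \<in> p" "B \<noteq> C"
    show "disjnt B C"
    proof (rule ccontr)
      assume "\<not> disjnt B C"
      then obtain z where z: "z \<in> B" "z \<in> C" by (auto simp: disjnt_def)
      have "\<exists>y. B = {z, y}" if H: "B \<in> p" "z \<in> B" for B
        using pair[OF H(1)] H(2) by (auto simp: insert_commute)
      with z BC obtain y y' where "B = {z, y}" "C = {z, y'}" by metis
      with BC unique show False by metis
    qed
  next
    show "\<Union> p = S" by fact
    show "{} \<notin> p" using pair by fastforce
  qed
  show "\<forall>B\<in>p. card B = 2" using pair by fastforce
  show "\<not> (\<exists>i j k l. {i, j} \<in> p \<and> {k, l} \<in> p \<and> i < k \<and> k < j \<and> j < l)"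
    using nest by fastforce
qed

lemma image_block:
  assumes p: "ncm S p" and xy: "{x, y} \<in> (image f) ` p"
  obtains u v where "{u, v} \<in> p" "x = f u" "y = f v"
proof -
  obtain B where B: "B \<in> p" "{x, y} = f ` B" using xy by auto
  obtain u v where uv: "B = {u, v}" using ncm_block[OF p B(1)] by metis
  then have "(x = f u \<and> y = f v) \<or> (x = f v \<and> y = f u)" using B(2) by (auto simp: doubleton_eq_iff)
  then show ?thesis using that B(1) uv by (metis insert_commute)
qed

lemma ncm_image:
  assumes p: "ncm S p" and f: "strict_mono_on S f" shows "ncm (f ` S) ((image f) ` p)"
proof (rule ncmI)
  have less: "f x < f y \<longleftrightarrow> x < y" if H: "x \<in> S" "y \<in> S" for x y
  proof -
    have "x < y \<Longrightarrow> f x < f y" "y < x \<Longrightarrow> f y < f x" using strict_mono_onD[OF f] H by auto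
    then show ?thesis by (cases x y rule: linorder_cases) auto
  qed
  show "\<Union> ((image f) ` p) = f ` S" unfolding ncm_Union[OF p, symmetric] by auto
  show "\<exists>x y. x < y \<and> B = {x, y}" if H: "B \<in> (image f) ` p" for B
  proof -
    obtain C where C: "C \<in> p" "B = f ` C" using H by blast
    obtain x y where "C = {x, y}" "x < y" "x \<in> S" "y \<in> S" using ncm_block[OF p C(1)] .
    then have "f x < f y" "B = {f x, f y}" using less C(2) by auto
    then show ?thesis by blast
  qed
  show "y = z" if H: "{x, y} \<in> (image f) ` p" "{x, z} \<in> (image f) ` p" for x y z
  proof -
    obtain u v where uv: "{u, v} \<in> p" "x = f u" "y = f v" using image_block[OF p H(1)] .
    obtain u' v' where uv': "{u', v'} \<in> p" "x = f u'" "z = f v'" using image_block[OF p H(2)] .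
    have "u = u'" using uv uv' ncm_mem[OF p uv(1)] ncm_mem[OF p uv'(1)] less
      by (metis linorder_neqE less_irrefl)
    then show ?thesis using ncm_unique[OF p uv(1)] uv uv' by metis
  qed
  show "a < d \<and> d < b" if H: "{a, b} \<in> (image f) ` p" "{c, d} \<in> (image f) ` p" "a < c" "c < b" for a b c d
  proof -
    obtain u v where uv: "{u, v} \<in> p" "a = f u" "b = f v" using image_block[OF p H(1)] .
    obtain u' v' where uv': "{u', v'} \<in> p" "c = f u'" "d = f v'" using image_block[OF p H(2)] .
    show ?thesis using ncm_nest[OF p uv(1) uv'(1)] H(3,4) uv uv'
      ncm_mem[OF p uv(1)] ncm_mem[OF p uv'(1)] less by auto
  qed
qed

lemma ncm_insert:
  assumes p: "ncm S p" and xy: "x < y" "x \<notin> S" "y \<notin> S"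
    and inside: "\<And>u v. {u, v} \<in> p \<Longrightarrow> x < u \<Longrightarrow> u < y \<Longrightarrow> x < v \<and> v < y"
  shows "ncm (insert x (insert y S)) (insert {x, y} p)"
proof (rule ncmI)
  show "\<Union> (insert {x, y} p) = insert x (insert y S)" using ncm_Union[OF p] by auto
  show "\<exists>x y. x < y \<and> B = {x, y}" if H: "B \<in> insert {x, y} p" for B
    using H ncm_block[OF p] xy(1) by (metis insertE)
  have notin: "{u, v} \<in> p \<Longrightarrow> u \<noteq> x \<and> u \<noteq> y \<and> v \<noteq> x \<and> v \<noteq> y" for u v
    using ncm_mem[OF p] xy(2,3) by metis
  show "b = c" if H: "{a, b} \<in> insert {x, y} p" "{a, c} \<in> insert {x, y} p" for a b c
    using H ncm_unique[OF p, of a b c] notin[of a b] notin[of a c]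
    by (auto simp: doubleton_eq_iff)
  show "a < d \<and> d < b" if *: "{a, b} \<in> insert {x, y} p" "{c, d} \<in> insert {x, y} p" "a < c" "c < b"
    for a b c d
  proof -
    consider "{a, b} \<in> p" "{c, d} \<in> p" | "{a, b} \<in> p" "{c, d} = {x, y}"
      | "{a, b} = {x, y}" "{c, d} \<in> p" | "{a, b} = {x, y}" "{c, d} = {x, y}"
      using * by auto
    then show ?thesis
    proof cases
      case 1
      then show ?thesis using ncm_nest[OF p] *(3,4) by metis
    next
      case 2
      have "{b, a} \<in> p" using 2 by (simp add: insert_commute)
      then have "x < a \<and> a < y \<longleftrightarrow> x < b \<and> b < y" using inside 2(1) by blast
      moreover have "(c = x \<and> d = y) \<or> (c = y \<and> d = x)" using 2(2) by (simp add: doubleton_eq_iff)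
      ultimately show ?thesis using *(3,4) notin[OF 2(1)] xy(1) by presburger
    next
      case 3
      then show ?thesis using inside[of c d] *(3,4) xy(1) by (auto simp: doubleton_eq_iff)
    next
      case 4
      then show ?thesis using *(3,4) by (auto simp: doubleton_eq_iff)
    qed
  qed
qed

lemma ncm_remove:
  assumes p: "ncm S p" and B: "B \<in> p" shows "ncm (S - B) (p - {B})"
proof (rule ncmI)
  have "partition_on S p" using p by (simp add: ncm_def)
  then have "x \<notin> B" if H: "C \<in> p - {B}" "x \<in> C" for C x using H B partition_on_unique by fast
  then show "\<Union> (p - {B}) = S - B" using ncm_Union[OF p] B by auto
  show "\<exists>x y. x < y \<and> C = {x, y}" if H: "C \<in> p - {B}" for C using H ncm_block[OF p] by (metis DiffD1)
  show "y = z" if H: "{x, y} \<in> p - {B}" "{x, z} \<in> p - {B}" for x y z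
    using ncm_unique[OF p, of x y z] H by simp
  show "a < d \<and> d < b" if H: "{a, b} \<in> p - {B}" "{c, d} \<in> p - {B}" "a < c" "c < b" for a b c d
    using ncm_nest[OF p, of a b c d] H by simp
qed

lemma ncm_uminus:
  assumes p: "ncm S p" shows "ncm (uminus ` S) ((image uminus) ` p)"
proof (rule ncmI)
  show "\<Union> ((image uminus) ` p) = uminus ` S" unfolding ncm_Union[OF p, symmetric] by auto
  show "\<exists>x y. x < y \<and> B = {x, y}" if H: "B \<in> (image uminus) ` p" for B
  proof -
    obtain C where C: "C \<in> p" "B = uminus ` C" using H by blast
    obtain x y where "C = {x, y}" "x < y" using ncm_block[OF p C(1)] by metis
    then have "- y < - x" "B = {- y, - x}" using C(2) by auto
    then show ?thesis by blast
  qed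
  show "y = z" if H: "{x, y} \<in> (image uminus) ` p" "{x, z} \<in> (image uminus) ` p" for x y z
  proof -
    obtain u v where uv: "{u, v} \<in> p" "x = - u" "y = - v" using image_block[OF p H(1)] .
    obtain u' v' where uv': "{u', v'} \<in> p" "x = - u'" "z = - v'" using image_block[OF p H(2)] .
    then have "u = u'" using uv by simp
    then show ?thesis using ncm_unique[OF p uv(1)] uv uv' by metis
  qed
  show "a < d \<and> d < b" if H: "{a, b} \<in> (image uminus) ` p" "{c, d} \<in> (image uminus) ` p" "a < c" "c < b"
    for a b c d
  proof -
    obtain u v where uv: "{u, v} \<in> p" "a = - u" "b = - v" using image_block[OF p H(1)] .
    obtain u' v' where uv': "{u', v'} \<in> p" "c = - u'" "d = - v'" using image_block[OF p H(2)] .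
    have "{v, u} \<in> p" using uv(1) by (simp add: insert_commute)
    then show ?thesis using ncm_nest[OF p _ uv'(1), of v u] H(3,4) uv uv' by auto
  qed
qed

text \<open>The effect of attaching a cap to two neighbouring dots. Another block encloses
  \<open>u\<close> if and only if it encloses \<open>x\<close> by nesting, hence \<open>y\<close>
  because no dot lies in between, hence \<open>v\<close>. So nothing crosses the new block.\<close>

lemma ncm_cap:
  assumes p: "ncm S p" and x: "{x, u} \<in> p" and y: "{y, v} \<in> p" and "x < y" "u \<noteq> y"
    and adjacent: "\<And>z. z \<in> S \<Longrightarrow> z \<le> x \<or> y \<le> z"
  shows "ncm (S - {x, y}) (insert {u, v} (p - {{x, u}, {y, v}}))"
proof -
  let ?q = "p - {{x, u}, {y, v}}"
  let ?r = "insert {u, v} ?q"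
  have mem: "x \<in> S" "y \<in> S" "u \<in> S" "v \<in> S" "u \<noteq> x" "v \<noteq> y"
    using ncm_mem[OF p x] ncm_mem[OF p y] by auto
  have "v \<noteq> x" using ncm_unique[OF p, of x u y] x y assms(5) by (auto simp: insert_commute)
  have "u \<noteq> v"
    using ncm_unique[OF p, of u x y] x y assms(4) by (auto simp: insert_commute)
  have "{x, u} \<noteq> {y, v}" using assms(4,5) by (auto simp: doubleton_eq_iff)
  have q: "ncm (S - {x, u} - {y, v}) (p - {{x, u}} - {{y, v}})"
    using ncm_remove[OF ncm_remove[OF p x], of "{y, v}"] y \<open>{x, u} \<noteq> {y, v}\<close> by simp
  have q': "p - {{x, u}} - {{y, v}} = ?q" by auto
  have q: "ncm (S - {x, u} - {y, v}) ?q" using q unfolding q' .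
  have nin: "{a, b} \<in> ?q \<Longrightarrow> a \<notin> {x, u, y, v} \<and> b \<notin> {x, u, y, v}" for a b
    using ncm_mem[OF q] by fast
  have into: "a < v \<and> v < b" if ab: "{a, b} \<in> ?q" and "a < u" "u < b" for a b
  proof -
    have "{a, b} \<in> p" using ab by simp
    then have S: "a \<in> S" "b \<in> S" using ncm_mem[OF p] by auto
    have ab': "a \<notin> {x, u, y, v}" "b \<notin> {x, u, y, v}" using nin[OF ab] by auto
    have "a < x \<and> x < b" using ncm_nest[OF p \<open>{a, b} \<in> p\<close>, of u x] x that(2,3) by (simp add: insert_commute)
    then have "a < y \<and> y < b" using adjacent[OF S(2)] assms(4) ab' by auto
    then show ?thesis using ncm_nest[OF p \<open>{a, b} \<in> p\<close> y] by simp
  qed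
  have into': "a < u \<and> u < b" if ab: "{a, b} \<in> ?q" and "a < v" "v < b" for a b
  proof -
    have "{a, b} \<in> p" using ab by simp
    then have S: "a \<in> S" "b \<in> S" using ncm_mem[OF p] by auto
    have ab': "a \<notin> {x, u, y, v}" "b \<notin> {x, u, y, v}" using nin[OF ab] by auto
    have "a < y \<and> y < b" using ncm_nest[OF p \<open>{a, b} \<in> p\<close>, of v y] y that(2,3) by (simp add: insert_commute)
    then have "a < x \<and> x < b" using adjacent[OF S(1)] assms(4) ab' by auto
    then show ?thesis using ncm_nest[OF p \<open>{a, b} \<in> p\<close> x] by simp
  qed
  define lo hi where "lo = min u v" and "hi = max u v"
  have lohi: "lo < hi" "{u, v} = {lo, hi}" "lo \<in> {u, v}" "hi \<in> {u, v}"
    using \<open>u \<noteq> v\<close> by (auto simp: lo_def hi_def min_def max_def)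
  have lohi': "(lo = u \<and> hi = v) \<or> (lo = v \<and> hi = u)"
    by (auto simp: lo_def hi_def min_def max_def)
  have "ncm (insert lo (insert hi (S - {x, u} - {y, v}))) (insert {lo, hi} ?q)"
  proof (rule ncm_insert[OF q lohi(1)])
    show "lo \<notin> S - {x, u} - {y, v}" "hi \<notin> S - {x, u} - {y, v}" using lohi' by auto
    fix c d assume cd: "{c, d} \<in> ?q" "lo < c" "c < hi"
    have d: "d \<noteq> lo" "d \<noteq> hi" using nin[OF cd(1)] lohi' by auto
    have dc: "{d, c} \<in> ?q" using cd(1) by (simp add: insert_commute)
    show "lo < d \<and> d < hi"
    proof (rule ccontr)
      assume "\<not> ?thesis"
      then consider "d < lo" | "hi < d" using d by linarith
      then show False
      proof cases
        case 1
        then have "d < u \<and> u < c \<or> d < v \<and> v < c" using cd(2,3) lohi' by metis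
        then have "d < u \<and> u < c \<and> d < v \<and> v < c" using into[OF dc] into'[OF dc] by blast
        then show False using cd(2,3) lohi' by auto
      next
        case 2
        then have "c < u \<and> u < d \<or> c < v \<and> v < d" using cd(2,3) lohi' by metis
        then have "c < u \<and> u < d \<and> c < v \<and> v < d" using into[OF cd(1)] into'[OF cd(1)] by blast
        then show False using cd(2,3) lohi' by auto
      qed
    qed
  qed
  moreover have "insert lo (insert hi (S - {x, u} - {y, v})) = S - {x, y}"
    using mem lohi' \<open>v \<noteq> x\<close> assms(5) by auto
  ultimately show ?thesis by (simp add: lohi(2))
qed

text \<open>Finds an innermost block. A dot strictly between \<open>x\<close> and \<open>y\<close>
  has its partner there too, which gives a shorter block to continue with.\<close>

lemma ncm_adjacent:
  assumes p: "ncm S p" and "{x, y} \<in> p" "x < y"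
  shows "\<exists>u v. {u, v} \<in> p \<and> x \<le> u \<and> u < v \<and> v \<le> y \<and> (\<forall>z\<in>S. \<not> (u < z \<and> z < v))"
  using assms(2,3)
proof (induction "nat (y - x)" arbitrary: x y rule: less_induct)
  case less
  show ?case
  proof (cases "\<exists>z\<in>S. x < z \<and> z < y")
    case True
    then obtain z where z: "z \<in> S" "x < z" "z < y" by blast
    obtain w where w: "{z, w} \<in> p" "w \<noteq> z" using ncm_partner[OF p z(1)] by metis
    have xw: "x < w \<and> w < y" using ncm_nest[OF p less(2) w(1)] z by simp
    define lo hi where "lo = min z w" and "hi = max z w"
    have lohi: "lo < hi" "{lo, hi} \<in> p" "x < lo" "hi < y"
      using w xw z by (auto simp: lo_def hi_def min_def max_def insert_commute)
    then obtain u v where "{u, v} \<in> p \<and> lo \<le> u \<and> u < v \<and> v \<le> hi \<and> (\<forall>z\<in>S. \<not> (u < z \<and> z < v))"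
      using less(1)[of hi lo] by auto
    then show ?thesis using lohi by (intro exI[of _ u] exI[of _ v]) auto
  next
    case False
    then show ?thesis using less(2,3) by (intro exI[of _ x] exI[of _ y]) auto
  qed
qed

lemma partition_on_eqI:
  assumes "partition_on S p" "partition_on S q" "\<And>B. B \<in> r \<Longrightarrow> B \<in> p \<and> B \<in> q" "S \<subseteq> \<Union> r"
  shows "p = q"
proof -
  have "p \<subseteq> r" if H: "partition_on S p" "\<And>B. B \<in> r \<Longrightarrow> B \<in> p" for p
  proof
    fix B assume B: "B \<in> p"
    then obtain x where x: "x \<in> B" "x \<in> S"
      using partition_onD3[OF H(1)] partition_onD1[OF H(1)] by (metis UnionI all_not_in_conv)
    then obtain C where C: "C \<in> r" "x \<in> C" using assms(4) by blast
    then have "B = C" using partition_on_unique[OF H(1) B] H(2) x(1) by blast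
    with C show "B \<in> r" by simp
  qed
  then have "p \<subseteq> r" "q \<subseteq> r" using assms by blast+
  then show ?thesis using assms(3) by blast
qed

section \<open>Cups, caps and mirror images\<close>

text \<open>On one side of 0 the dots are consecutive integers, so an innermost block there joins
  two neighbours.\<close>

lemma left_cup:
  assumes p: "p \<in> matchings a b" and "{x, y} \<in> p" "x < y" "y < 0"
  obtains i where "1 \<le> i" "i < int a" "{- i - 1, - i} \<in> p" "x \<le> - i - 1" "- i \<le> y"
proof -
  note q = p[unfolded matchings_iff]
  obtain u v where uv: "{u, v} \<in> p" "x \<le> u" "u < v" "v \<le> y" "\<forall>z\<in>dots a b. \<not> (u < z \<and> z < v)"
    using ncm_adjacent[OF q assms(2,3)] by blast
  have S: "u \<in> dots a b" "v \<in> dots a b" using ncm_mem[OF q uv(1)] by auto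
  then have "u + 1 \<in> dots a b" using uv assms(4) by (auto simp: dots_iff)
  then have "v = u + 1" using uv by force
  then show ?thesis using that[of "- v"] uv S assms(4) by (simp add: dots_iff add.commute)
qed

lemma right_cup:
  assumes p: "p \<in> matchings a b" and "{x, y} \<in> p" "x < y" "0 < x"
  obtains i where "1 \<le> i" "i < int b" "{i, i + 1} \<in> p" "x \<le> i" "i + 1 \<le> y"
proof -
  note q = p[unfolded matchings_iff]
  obtain u v where uv: "{u, v} \<in> p" "x \<le> u" "u < v" "v \<le> y" "\<forall>z\<in>dots a b. \<not> (u < z \<and> z < v)"
    using ncm_adjacent[OF q assms(2,3)] by blast
  have S: "u \<in> dots a b" "v \<in> dots a b" using ncm_mem[OF q uv(1)] by auto
  then have "u + 1 \<in> dots a b" using uv assms(4) by (auto simp: dots_iff)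
  then have "v = u + 1" using uv by force
  then show ?thesis using that[of u] uv S assms(4) by (auto simp: dots_iff)
qed

lemma matchings_mem: "p \<in> matchings a b \<Longrightarrow> {x, y} \<in> p \<Longrightarrow> x \<in> dots a b \<and> y \<in> dots a b \<and> x \<noteq> y"
  using ncm_mem unfolding matchings_iff by metis

lemma matchings_unique: "p \<in> matchings a b \<Longrightarrow> {x, y} \<in> p \<Longrightarrow> {x, z} \<in> p \<Longrightarrow> y = z"
  using ncm_unique unfolding matchings_iff by metis

lemma matchings_partition: "p \<in> matchings a b \<Longrightarrow> partition_on (dots a b) p"
  by (simp add: matchings_iff ncm_def)

lemma finite_matching: "p \<in> matchings a b \<Longrightarrow> finite (\<Union> p)"
  using ncm_Union[of "dots a b" p] by (simp add: matchings_iff)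

lemma finite_matchings: "finite (matchings a b)"
proof (rule finite_subset)
  show "matchings a b \<subseteq> Pow (Pow (dots a b))"
  proof
    fix p assume "p \<in> matchings a b"
    then have "\<Union> p = dots a b" using ncm_Union by (simp add: matchings_iff)
    then show "p \<in> Pow (Pow (dots a b))" by auto
  qed
qed simp

lemma id_matching: "id_diagram n \<in> matchings n n"
  unfolding matchings_iff
proof (rule ncmI)
  show "\<Union> (id_diagram n) = dots n n"
  proof
    show "\<Union> (id_diagram n) \<subseteq> dots n n" by (auto simp: id_diagram_def dots_iff)
    show "dots n n \<subseteq> \<Union> (id_diagram n)"
    proof
      fix x assume "x \<in> dots n n"
      then have "\<bar>x\<bar> \<in> {1..int n}" "x \<in> {- \<bar>x\<bar>, \<bar>x\<bar>}" by (auto simp: dots_iff)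
      then show "x \<in> \<Union> (id_diagram n)" unfolding id_diagram_def by blast
    qed
  qed
  have id: "{x, y} \<in> id_diagram n \<Longrightarrow> x = - y" for x y
    by (auto simp: id_diagram_def doubleton_eq_iff)
  show "\<exists>x y. x < y \<and> B = {x, y}" if H: "B \<in> id_diagram n" for B
  proof -
    obtain i where "1 \<le> i" "B = {- i, i}" using H by (auto simp: id_diagram_def)
    then have "- i < i" "B = {- i, i}" by auto
    then show ?thesis by blast
  qed
  show "y = z" if H: "{x, y} \<in> id_diagram n" "{x, z} \<in> id_diagram n" for x y z using id[OF H(1)] id[OF H(2)] by simp
  show "a < d \<and> d < b" if H: "{a, b} \<in> id_diagram n" "{c, d} \<in> id_diagram n" "a < c" "c < b" for a b c d
    using id[OF H(1)] id[OF H(2)] H(3,4) by simp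
qed

text \<open>Without a block on the left, every left dot \<open>- i\<close> has a partner
  \<open>f i\<close> on the right, and planarity makes \<open>f\<close> strictly increasing. Hence
  \<open>i \<le> f i\<close> and \<open>a \<le> b\<close>; for \<open>a = b\<close> also
  \<open>f i \<le> i\<close>, and the diagram is the identity.\<close>

lemma left_block_exists:
  assumes p: "p \<in> matchings a b" and ab: "b < a \<or> (a = b \<and> p \<noteq> id_diagram a)"
  obtains x y where "{x, y} \<in> p" "x < y" "y < 0"
proof (rule ccontr)
  note q = p[unfolded matchings_iff]
  assume "\<not> thesis"
  with that have no: "\<And>x y. {x, y} \<in> p \<Longrightarrow> x < y \<Longrightarrow> \<not> y < 0" by blast
  have "\<exists>y. {- i, y} \<in> p \<and> 1 \<le> y \<and> y \<le> int b" if H: "1 \<le> i" "i \<le> int a" for i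
  proof -
    have "- i \<in> dots a b" using H by (simp add: dots_iff)
    then obtain y where y: "{- i, y} \<in> p" "y \<noteq> - i" "y \<in> dots a b" using ncm_partner[OF q] by metis
    have "\<not> y < 0"
    proof
      assume "y < 0"
      moreover have "y < - i \<or> - i < y" using y(2) by linarith
      moreover have "{y, - i} \<in> p" using y(1) by (simp add: insert_commute)
      ultimately show False using no y(1) H(1) by fastforce
    qed
    with y show ?thesis by (auto simp: dots_iff)
  qed
  then obtain f where f: "\<And>i. 1 \<le> i \<Longrightarrow> i \<le> int a \<Longrightarrow> {- i, f i} \<in> p \<and> 1 \<le> f i \<and> f i \<le> int b"
    by metis
  have step: "f i < f (i + 1)" if H: "1 \<le> i" "i + 1 \<le> int a" for i
  proof (rule ccontr)
    assume "\<not> f i < f (i + 1)"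
    moreover have "f i \<noteq> f (i + 1)"
    proof
      assume "f i = f (i + 1)"
      then have "{f i, - i} \<in> p" "{f i, - (i + 1)} \<in> p" using f[of i] f[of "i + 1"] H by (auto simp: insert_commute)
      then show False using ncm_unique[OF q, of "f i" "- i" "- (i + 1)"] by simp
    qed
    ultimately have *: "f (i + 1) < f i" by simp
    have b: "{- i, f i} \<in> p" "{- (i + 1), f (i + 1)} \<in> p" "1 \<le> f (i + 1)" using f[of i] f[of "i + 1"] H by auto
    have "- (i + 1) < f i \<and> f i < f (i + 1)"
      using ncm_nest[OF q b(2) b(1)] b(3) H by simp
    with * show False by simp
  qed
  have mono: "f i + (j - i) \<le> f j" if H: "1 \<le> i" "i \<le> j" "j \<le> int a" for i j
    using H(2,3)
  proof (induction j rule: int_ge_induct)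
    case (step j)
    then show ?case using \<open>\<And>i. 1 \<le> i \<Longrightarrow> i + 1 \<le> int a \<Longrightarrow> f i < f (i + 1)\<close>[of j] H(1) by auto
  qed simp
  have ge: "i \<le> f i" if H: "1 \<le> i" "i \<le> int a" for i
    using mono[of 1 i] f[of 1] H by auto
  have "a \<le> b" using ge[of "int a"] f[of "int a"] by (cases a) auto
  with ab have eq: "a = b" "p \<noteq> id_diagram a" by auto
  have le: "f i \<le> i" if H: "1 \<le> i" "i \<le> int a" for i
    using mono[of i "int a"] f[of "int a"] H eq(1) by auto
  have "p = id_diagram a"
  proof (rule partition_on_eqI[of "dots a a" _ _ "id_diagram a"])
    show "partition_on (dots a a) p" "partition_on (dots a a) (id_diagram a)"
      using matchings_partition[OF p] matchings_partition[OF id_matching] eq(1) by auto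
    show "B \<in> p \<and> B \<in> id_diagram a" if H: "B \<in> id_diagram a" for B
    proof -
      obtain i where i: "1 \<le> i" "i \<le> int a" "B = {- i, i}" using H by (auto simp: id_diagram_def)
      then have "f i = i" using ge le by (meson order_antisym)
      with f[OF i(1,2)] i(3) H show ?thesis by simp
    qed
    show "dots a a \<subseteq> \<Union> (id_diagram a)"
      using ncm_Union[of "dots a a" "id_diagram a"] id_matching[of a] by (simp add: matchings_iff)
  qed
  with eq show False by simp
qed

section \<open>Inserting and removing a small cup\<close>

text \<open>Makes room for a small cup at the dots \<open>- i\<close> and \<open>- i - 1\<close>;
  \<open>unsh i\<close> closes the gap again and is inverse to it off these two dots. For
  \<open>i \<ge> 1\<close> right dots stay fixed.\<close>

definition sh :: "int \<Rightarrow> int \<Rightarrow> int" where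
  "sh i x = (if x \<le> - i then x - 2 else x)"

definition unsh :: "int \<Rightarrow> int \<Rightarrow> int" where
  "unsh i x = (if x < - i then x + 2 else x)"

lemma unsh_sh [simp]: "unsh i (sh i x) = x"
  by (auto simp: sh_def unsh_def)

lemma sh_unsh: "x \<noteq> - i \<Longrightarrow> x \<noteq> - i - 1 \<Longrightarrow> sh i (unsh i x) = x"
  by (auto simp: sh_def unsh_def)

lemma sh_pos [simp]: "1 \<le> i \<Longrightarrow> 0 < x \<Longrightarrow> sh i x = x"
  by (auto simp: sh_def)

lemma unsh_pos [simp]: "1 \<le> i \<Longrightarrow> 0 < x \<Longrightarrow> unsh i x = x"
  by (auto simp: unsh_def)

definition ins :: "int \<Rightarrow> diagram \<Rightarrow> diagram" where
  "ins i p = insert {- i - 1, - i} ((image (sh i)) ` p)"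

definition unins :: "int \<Rightarrow> diagram \<Rightarrow> diagram" where
  "unins i p = (image (unsh i)) ` (p - {{- i - 1, - i}})"

lemma ins_self [simp]: "{- i - 1, - i} \<in> ins i p"
  by (simp add: ins_def)

lemma ins_sh: "{x, y} \<in> p \<Longrightarrow> {sh i x, sh i y} \<in> ins i p"
  using imageI[of "{x, y}" p "image (sh i)"] by (simp add: ins_def)

lemma dots_ins:
  assumes "1 \<le> i" "i \<le> int a + 1"
  shows "dots (a + 2) b = insert (- i - 1) (insert (- i) (sh i ` dots a b))"
proof
  show "dots (a + 2) b \<subseteq> insert (- i - 1) (insert (- i) (sh i ` dots a b))"
  proof
    fix x assume x: "x \<in> dots (a + 2) b"
    show "x \<in> insert (- i - 1) (insert (- i) (sh i ` dots a b))"
    proof (cases "x = - i \<or> x = - i - 1")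
      case False
      then have "unsh i x \<in> dots a b" using x assms by (auto simp: unsh_def dots_iff)
      moreover have "x = sh i (unsh i x)" using False sh_unsh by metis
      ultimately show ?thesis by blast
    qed auto
  qed
  show "insert (- i - 1) (insert (- i) (sh i ` dots a b)) \<subseteq> dots (a + 2) b"
    using assms by (auto simp: sh_def dots_iff)
qed

lemma sh_mono: "strict_mono_on S (sh i)"
  by (rule strict_mono_onI) (auto simp: sh_def)

lemma ins_matching:
  assumes p: "p \<in> matchings a b" and i: "1 \<le> i" "i \<le> int a + 1"
  shows "ins i p \<in> matchings (a + 2) b"
  unfolding matchings_iff dots_ins[OF i] ins_def
proof (rule ncm_insert)
  show "ncm (sh i ` dots a b) ((image (sh i)) ` p)"
    using p sh_mono by (simp add: matchings_iff ncm_image)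
  show "- i - 1 \<notin> sh i ` dots a b" "- i \<notin> sh i ` dots a b" by (auto simp: sh_def)
qed auto

lemma unins_matching:
  assumes p: "p \<in> matchings (a + 2) b" and i: "1 \<le> i" "i \<le> int a + 1" and cup: "{- i - 1, - i} \<in> p"
  shows "unins i p \<in> matchings a b" "ins i (unins i p) = p"
proof -
  let ?q = "p - {{- i - 1, - i}}"
  have q: "ncm (dots (a + 2) b - {- i - 1, - i}) ?q"
    using ncm_remove p cup by (simp add: matchings_iff)
  have S: "dots (a + 2) b - {- i - 1, - i} = sh i ` dots a b"
    unfolding dots_ins[OF i] by (auto simp: sh_def)
  have "strict_mono_on (sh i ` dots a b) (unsh i)"
    by (rule strict_mono_onI) (auto simp: sh_def unsh_def split: if_splits)
  from ncm_image[OF q[unfolded S] this] show "unins i p \<in> matchings a b"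
    by (simp add: matchings_iff unins_def image_image)
  have "sh i ` unsh i ` B = B" if H: "B \<in> ?q" for B
  proof -
    have "B \<subseteq> sh i ` dots a b" using ncm_Union[OF q] H unfolding S by blast
    then have "\<forall>x\<in>B. sh i (unsh i x) = x" by auto
    then show ?thesis by (simp add: image_image)
  qed
  then have "(\<lambda>B. sh i ` unsh i ` B) ` ?q = (\<lambda>B. B) ` ?q" by (intro image_cong) auto
  then have "(image (sh i)) ` (image (unsh i)) ` ?q = ?q" by (simp only: image_image image_ident)
  then have "ins i (unins i p) = insert {- i - 1, - i} ?q" by (simp only: ins_def unins_def)
  then show "ins i (unins i p) = p" by (simp only: insert_Diff[OF cup])
qed

section \<open>Reflection, which turns statements about cups into statements about caps\<close>

definition mirror :: "diagram \<Rightarrow> diagram" where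
  "mirror p = (image uminus) ` p"

lemma mirror_mirror [simp]: "mirror (mirror p) = p"
  by (simp add: mirror_def image_image)

lemma mirror_block [simp]: "{x, y} \<in> mirror p \<longleftrightarrow> {- x, - y} \<in> p"
proof -
  have "{- x, - y} \<in> mirror p" if "{x, y} \<in> p" for x y and p :: diagram
    using image_eqI[OF _ that, of "{- x, - y}" "image uminus"] by (simp add: mirror_def)
  from this[of "- x" "- y" p] this[of x y "mirror p"] show ?thesis by auto
qed

lemma mirror_matching: "p \<in> matchings a b \<Longrightarrow> mirror p \<in> matchings b a"
proof -
  have "uminus ` dots a b = dots b a"
  proof
    show "uminus ` dots a b \<subseteq> dots b a" by (auto simp: dots_iff)
    show "dots b a \<subseteq> uminus ` dots a b"
    proof
      fix x assume "x \<in> dots b a"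
      then have "- x \<in> dots a b" "x = - (- x)" by (auto simp: dots_iff)
      then show "x \<in> uminus ` dots a b" by blast
    qed
  qed
  then show "p \<in> matchings a b \<Longrightarrow> mirror p \<in> matchings b a"
    using ncm_uminus[of "dots a b" p] by (simp add: matchings_iff mirror_def)
qed

lemma mirror_id [simp]: "mirror (id_diagram n) = id_diagram n"
proof -
  have "uminus ` {- i, i} = {- i, i}" for i :: int by auto
  then show ?thesis by (simp add: mirror_def id_diagram_def image_image)
qed

fun flip :: "dot \<Rightarrow> dot" where
  "flip (Lft i) = Rgt i"
| "flip (Mid i) = Mid i"
| "flip (Rgt i) = Lft i"

lemma flip_flip [simp]: "flip (flip x) = x"
  by (cases x) auto

lemma inj_flip: "inj flip"
  by (metis flip_flip injI)

text \<open>The dot 0 has to be excluded because the encoding is not symmetric there: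
  \<open>left_dot 0\<close> is a middle dot, while \<open>right_dot 0\<close> is an outer
  one.\<close>

lemma mirror_components:
  assumes "0 \<notin> \<Union> p" "0 \<notin> \<Union> q"
  shows "components (mirror q) (mirror p) = (image flip) ` components p q"
proof -
  have "left_dot ` uminus ` B = flip ` right_dot ` B" if "B \<in> q" for B
  proof -
    have "left_dot (- i) = flip (right_dot i)" if "i \<noteq> 0" for i
      using that by (auto simp: left_dot_def right_dot_def)
    moreover have "0 \<notin> B" using assms that by blast
    ultimately show ?thesis unfolding image_image by (intro image_cong refl) metis
  qed
  moreover have "right_dot ` uminus ` B = flip ` left_dot ` B" if "B \<in> p" for B
  proof -
    have "right_dot (- i) = flip (left_dot i)" if "i \<noteq> 0" for i
      using that by (auto simp: left_dot_def right_dot_def)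
    moreover have "0 \<notin> B" using assms that by blast
    ultimately show ?thesis unfolding image_image by (intro image_cong refl) metis
  qed
  ultimately have "glued (mirror q) (mirror p) = (image flip) ` glued p q"
    by (simp add: glued_def mirror_def image_image image_Un Un_commute cong: image_cong)
  then show ?thesis using comps_image[OF inj_flip] by (simp add: components_eq)
qed

lemma mirror_concat:
  assumes "0 \<notin> \<Union> p" "0 \<notin> \<Union> q"
  shows "diagram_concat (mirror q) (mirror p) = mirror (diagram_concat p q)"
proof -
  have nz: "Rgt 0 \<notin> C \<and> Lft 0 \<notin> C" if "C \<in> components p q" for C
  proof -
    have "C \<subseteq> \<Union> (glued p q)" using that comps_member unfolding components_eq by fast
    moreover have "Rgt 0 \<notin> \<Union> (glued p q)" "Lft 0 \<notin> \<Union> (glued p q)"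
      using assms by (auto simp: glued_def left_dot_def right_dot_def split: if_splits)
    ultimately show ?thesis by blast
  qed
  have "outer_dot -` flip ` C = uminus ` (outer_dot -` C)" if C: "C \<in> components p q" for C
  proof -
    have iff: "outer_dot z \<in> flip ` C \<longleftrightarrow> outer_dot (- z) \<in> C" for z
    proof -
      have "outer_dot z \<in> flip ` C \<longleftrightarrow> flip (outer_dot z) \<in> C"
        by (metis flip_flip image_eqI image_iff)
      also have "\<dots> \<longleftrightarrow> outer_dot (- z) \<in> C"
        using nz[OF C] by (cases "z = 0") (auto simp: outer_dot_def)
      finally show ?thesis .
    qed
    show ?thesis
    proof (rule Set.set_eqI)
      fix z
      have "z \<in> uminus ` (outer_dot -` C) \<longleftrightarrow> - z \<in> outer_dot -` C"
        by (metis image_eqI image_iff minus_minus)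
      then show "z \<in> outer_dot -` flip ` C \<longleftrightarrow> z \<in> uminus ` (outer_dot -` C)" using iff by simp
    qed
  qed
  then have "(\<lambda>C. outer_dot -` C) ` components (mirror q) (mirror p)
      = (image uminus) ` (\<lambda>C. outer_dot -` C) ` components p q"
    unfolding mirror_components[OF assms] image_image by (rule image_cong[OF refl])
  moreover have "(image uminus) ` X - {{}} = (image uminus) ` (X - {{}})" for X :: "int set set" by auto
  ultimately show ?thesis by (simp add: diagram_concat_def mirror_def)
qed

lemma mirror_loops:
  assumes "0 \<notin> \<Union> p" "0 \<notin> \<Union> q"
  shows "loops (mirror q) (mirror p) = loops p q"
proof -
  have "flip x \<in> range Mid \<longleftrightarrow> x \<in> range Mid" for x by (cases x) auto
  then have "flip ` C \<subseteq> range Mid \<longleftrightarrow> C \<subseteq> range Mid" for C by blast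
  then have "{C \<in> components (mirror q) (mirror p). C \<subseteq> range Mid}
      = (image flip) ` {C \<in> components p q. C \<subseteq> range Mid}"
    unfolding mirror_components[OF assms] by auto
  moreover have "inj_on (image flip) X" for X
    using inj_flip by (simp add: inj_on_def inj_image_eq_iff)
  ultimately show ?thesis by (simp add: loops_def card_image)
qed

lemma matchings_nz: "p \<in> matchings a b \<Longrightarrow> 0 \<notin> \<Union> p"
  using ncm_Union[of "dots a b" p] by (simp add: matchings_iff dots_iff)

section \<open>Computing concatenations\<close>

definition cn :: "diagram \<Rightarrow> diagram \<Rightarrow> dot \<Rightarrow> dot \<Rightarrow> bool" where
  "cn p q x y \<longleftrightarrow> (x, y) \<in> (adj (glued p q))\<^sup>*"

lemma cn_refl [simp]: "cn p q x x" by (simp add: cn_def)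

lemma cn_sym: "cn p q x y \<Longrightarrow> cn p q y x" by (simp add: cn_def conn_sym)

lemma cn_trans [trans]: "cn p q x y \<Longrightarrow> cn p q y z \<Longrightarrow> cn p q x z"
  unfolding cn_def by (rule rtrancl_trans)

lemma cn_left: "{i, j} \<in> p \<Longrightarrow> cn p q (left_dot i) (left_dot j)"
proof -
  assume "{i, j} \<in> p"
  then have *: "left_dot ` {i, j} \<in> glued p q"
    unfolding glued_def by (intro UnI1 imageI)
  have "(left_dot i, left_dot j) \<in> adj (glued p q)"
    unfolding adj_def by (intro CollectI case_prodI bexI[OF _ *]) simp
  then show ?thesis by (simp add: cn_def)
qed

lemma cn_right: "{i, j} \<in> q \<Longrightarrow> cn p q (right_dot i) (right_dot j)"
proof -
  assume "{i, j} \<in> q"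
  then have *: "right_dot ` {i, j} \<in> glued p q"
    unfolding glued_def by (intro UnI2 imageI)
  have "(right_dot i, right_dot j) \<in> adj (glued p q)"
    unfolding adj_def by (intro CollectI case_prodI bexI[OF _ *]) simp
  then show ?thesis by (simp add: cn_def)
qed

text \<open>Colouring argument for showing that dots are not connected. In the applications
  \<open>\<chi>\<close> colours a dot by the block of the expected product in which it should end
  up.\<close>

lemma cn_invariant:
  assumes "cn p q x y"
    and "\<And>i j. {i, j} \<in> p \<Longrightarrow> \<chi> (left_dot i) = \<chi> (left_dot j)"
    and "\<And>i j. {i, j} \<in> q \<Longrightarrow> \<chi> (right_dot i) = \<chi> (right_dot j)"
    and p: "p \<in> matchings a b" and q: "q \<in> matchings b' c"
  shows "\<chi> x = \<chi> y"
proof -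
  have "\<chi> x = \<chi> y" if H: "(x, y) \<in> adj (glued p q)" for x y
  proof -
    obtain B where "B \<in> glued p q" "x \<in> B" "y \<in> B" using H by (auto simp: adj_def)
    then consider C where "C \<in> p" "x \<in> left_dot ` C" "y \<in> left_dot ` C"
      | C where "C \<in> q" "x \<in> right_dot ` C" "y \<in> right_dot ` C"
      by (auto simp: glued_def)
    then show ?thesis
    proof cases
      case 1
      obtain i j where "C = {i, j}" using ncm_block[OF p[unfolded matchings_iff] 1(1)] by metis
      then show ?thesis using assms(2)[of i j] 1 by auto
    next
      case 2
      obtain i j where "C = {i, j}" using ncm_block[OF q[unfolded matchings_iff] 2(1)] by metis
      then show ?thesis using assms(3)[of i j] 2 by auto
    qed
  qed
  with assms(1) show ?thesis unfolding cn_def by (induction rule: rtrancl_induct) auto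
qed

lemma Union_glued:
  assumes p: "p \<in> matchings a b" and q: "q \<in> matchings b c"
  shows "\<Union> (glued p q) = Lft ` {1..int a} \<union> Mid ` {1..int b} \<union> Rgt ` {1..int c}"
proof -
  have 1: "\<Union> (glued p q) = left_dot ` dots a b \<union> right_dot ` dots b c"
  proof -
    have "\<Union> p = dots a b" "\<Union> q = dots b c" using ncm_Union p q by (auto simp: matchings_iff)
    moreover have "\<Union> (glued p q) = left_dot ` \<Union> p \<union> right_dot ` \<Union> q" unfolding glued_def by blast
    ultimately show ?thesis by simp
  qed
  have "left_dot ` dots a b = Lft ` {1..int a} \<union> Mid ` {1..int b}"
  proof
    show "left_dot ` dots a b \<subseteq> Lft ` {1..int a} \<union> Mid ` {1..int b}"
      by (auto simp: left_dot_def dots_iff)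
    have "Lft i = left_dot (- i)" "- i \<in> dots a b" if "i \<in> {1..int a}" for i
      using that by (auto simp: left_dot_def dots_iff)
    moreover have "Mid i = left_dot i" "i \<in> dots a b" if "i \<in> {1..int b}" for i
      using that by (auto simp: left_dot_def dots_iff)
    ultimately show "Lft ` {1..int a} \<union> Mid ` {1..int b} \<subseteq> left_dot ` dots a b" by blast
  qed
  moreover have "right_dot ` dots b c = Mid ` {1..int b} \<union> Rgt ` {1..int c}"
  proof
    show "right_dot ` dots b c \<subseteq> Mid ` {1..int b} \<union> Rgt ` {1..int c}"
      by (auto simp: right_dot_def dots_iff)
    have "Mid i = right_dot (- i)" "- i \<in> dots b c" if "i \<in> {1..int b}" for i
      using that by (auto simp: right_dot_def dots_iff)
    moreover have "Rgt i = right_dot i" "i \<in> dots b c" if "i \<in> {1..int c}" for i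
      using that by (auto simp: right_dot_def dots_iff)
    ultimately show "Mid ` {1..int b} \<union> Rgt ` {1..int c} \<subseteq> right_dot ` dots b c" by blast
  qed
  ultimately show ?thesis using 1 by auto
qed

lemma outer_dot_glued:
  assumes "p \<in> matchings a b" "q \<in> matchings b c"
  shows "outer_dot z \<in> \<Union> (glued p q) \<longleftrightarrow> z \<in> dots a c"
  unfolding Union_glued[OF assms] by (auto simp: outer_dot_def dots_iff)

lemma concat_eq:
  assumes p: "p \<in> matchings a b" and q: "q \<in> matchings b c"
  shows "diagram_concat p q = (\<lambda>z. {w. cn p q (outer_dot z) (outer_dot w)}) ` dots a c"
proof
  have cls: "outer_dot -` cls (glued p q) (outer_dot z) = {w. cn p q (outer_dot z) (outer_dot w)}" for z
    by (auto simp: cls_def cn_def)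
  show "diagram_concat p q \<subseteq> (\<lambda>z. {w. cn p q (outer_dot z) (outer_dot w)}) ` dots a c"
  proof
    fix B assume "B \<in> diagram_concat p q"
    then obtain C z where C: "C \<in> components p q" "B = outer_dot -` C" "outer_dot z \<in> C"
      by (auto simp: diagram_concat_def)
    then have "outer_dot z \<in> \<Union> (glued p q)" "C = cls (glued p q) (outer_dot z)"
      using comps_member unfolding components_eq by metis+
    then show "B \<in> (\<lambda>z. {w. cn p q (outer_dot z) (outer_dot w)}) ` dots a c"
      unfolding outer_dot_glued[OF p q] using C(2) cls by blast
  qed
  show "(\<lambda>z. {w. cn p q (outer_dot z) (outer_dot w)}) ` dots a c \<subseteq> diagram_concat p q"
  proof
    fix B assume "B \<in> (\<lambda>z. {w. cn p q (outer_dot z) (outer_dot w)}) ` dots a c"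
    then obtain z where z: "z \<in> dots a c" "B = {w. cn p q (outer_dot z) (outer_dot w)}" by blast
    then have "cls (glued p q) (outer_dot z) \<in> components p q"
      using outer_dot_glued[OF p q] by (simp add: components_eq comps_eq)
    moreover have "z \<in> B" using z by simp
    ultimately show "B \<in> diagram_concat p q"
      unfolding diagram_concat_def z(2) cls[symmetric] by blast
  qed
qed

text \<open>Common pattern for computing a product: \<open>conn\<close> is shown by exhibiting
  paths, \<open>inv\<close> by a colouring as in \<open>cn_invariant\<close> with colours
  \<open>blk r\<close>.\<close>

lemma concat_eqI:
  assumes p: "p \<in> matchings a b" and q: "q \<in> matchings b c" and r: "r \<in> matchings a c"
    and inv: "\<And>z w. cn p q (outer_dot z) (outer_dot w) \<Longrightarrow> z \<in> dots a c \<Longrightarrow> w \<in> dots a c \<Longrightarrow>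
      \<exists>B\<in>r. z \<in> B \<and> w \<in> B"
    and conn: "\<And>z w. {z, w} \<in> r \<Longrightarrow> cn p q (outer_dot z) (outer_dot w)"
  shows "diagram_concat p q = r"
proof -
  have part: "partition_on (dots a c) r" by (rule matchings_partition[OF r])
  have eq: "{w. cn p q (outer_dot z) (outer_dot w)} = B" if H: "B \<in> r" "z \<in> B" for B z
  proof
    have z: "z \<in> dots a c" using H partition_onD1[OF part] by auto
    show "{w. cn p q (outer_dot z) (outer_dot w)} \<subseteq> B"
    proof
      fix w assume w: "w \<in> {w. cn p q (outer_dot z) (outer_dot w)}"
      have "outer_dot z \<in> \<Union> (glued p q)" using z outer_dot_glued[OF p q] by simp
      then have "outer_dot w \<in> \<Union> (glued p q)"
        using conn_Union[of "outer_dot z" "outer_dot w" "glued p q"] w by (simp add: cn_def)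
      then have "w \<in> dots a c" using outer_dot_glued[OF p q] by simp
      with inv[of z w] w z obtain C where C: "C \<in> r" "z \<in> C" "w \<in> C" by auto
      show "w \<in> B" using partition_on_unique[OF part C(1) H(1) C(2) H(2)] C(3) by simp
    qed
    obtain x y where B: "B = {x, y}" using ncm_block[OF r[unfolded matchings_iff] H(1)] by metis
    then show "B \<subseteq> {w. cn p q (outer_dot z) (outer_dot w)}"
      using H conn[of x y] by (auto intro: cn_sym)
  qed
  show ?thesis
  proof
    show "diagram_concat p q \<subseteq> r"
    proof
      fix D assume "D \<in> diagram_concat p q"
      then obtain z where z: "z \<in> dots a c" "D = {w. cn p q (outer_dot z) (outer_dot w)}"
        using concat_eq[OF p q] by auto
      then obtain B where "B \<in> r" "z \<in> B" using partition_onD1[OF part] by auto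
      then show "D \<in> r" using eq z(2) by simp
    qed
    show "r \<subseteq> diagram_concat p q"
    proof
      fix B assume B: "B \<in> r"
      then obtain z where z: "z \<in> B" using partition_onD3[OF part] by (metis all_not_in_conv)
      then have "B = {w. cn p q (outer_dot z) (outer_dot w)}" "z \<in> dots a c"
        using eq[OF B z] B partition_onD1[OF part] by auto
      then show "B \<in> diagram_concat p q" unfolding concat_eq[OF p q] by blast
    qed
  qed
qed

lemma loops_eq_0I:
  assumes p: "p \<in> matchings a b" and q: "q \<in> matchings b c"
    and "\<And>k. 1 \<le> k \<Longrightarrow> k \<le> int b \<Longrightarrow> \<exists>z. cn p q (Mid k) (outer_dot z)"
  shows "loops p q = 0"
proof -
  have "\<not> C \<subseteq> range Mid" if H: "C \<in> components p q" for C
  proof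
    assume C: "C \<subseteq> range Mid"
    obtain x where x: "x \<in> \<Union> (glued p q)" "C = cls (glued p q) x"
      using H by (auto simp: components_eq comps_eq)
    then have "x \<in> C" by simp
    then obtain k where k: "x = Mid k" using C by blast
    then have "1 \<le> k" "k \<le> int b" using x(1) unfolding Union_glued[OF p q] by auto
    then obtain z where "cn p q (Mid k) (outer_dot z)" using assms(3) by blast
    then have "outer_dot z \<in> C" using x k by (simp add: cls_def cn_def)
    with C show False by (auto simp: outer_dot_def split: if_splits)
  qed
  then have no: "{C \<in> components p q. C \<subseteq> range Mid} = {}" by blast
  show ?thesis unfolding loops_def no by simp
qed

definition blk :: "diagram \<Rightarrow> int \<Rightarrow> int set" where
  "blk r z = (THE B. B \<in> r \<and> z \<in> B)"

lemma blk_eq: "r \<in> matchings a c \<Longrightarrow> {z, w} \<in> r \<Longrightarrow> blk r z = {z, w}"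
proof -
  assume r: "r \<in> matchings a c" and zw: "{z, w} \<in> r"
  show ?thesis unfolding blk_def
  proof (rule the_equality)
    show "{z, w} \<in> r \<and> z \<in> {z, w}" using zw by simp
    show "B = {z, w}" if "B \<in> r \<and> z \<in> B" for B
      using partition_on_unique[OF matchings_partition[OF r] _ zw, of B z] that by simp
  qed
qed

lemma blk_cong: "r \<in> matchings a c \<Longrightarrow> {z, w} \<in> r \<Longrightarrow> blk r z = blk r w"
  using blk_eq[of r a c z w] blk_eq[of r a c w z] by (simp add: insert_commute)

lemma blk_same:
  assumes r: "r \<in> matchings a c" and "z \<in> dots a c" "w \<in> dots a c" "blk r z = blk r w"
  shows "\<exists>B\<in>r. z \<in> B \<and> w \<in> B"
proof -
  note ncm = r[unfolded matchings_iff]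
  obtain z' where "{z, z'} \<in> r" using ncm_partner[OF ncm assms(2)] by metis
  moreover obtain w' where "{w, w'} \<in> r" using ncm_partner[OF ncm assms(3)] by metis
  ultimately show ?thesis using blk_eq[OF r] assms(4) by (metis insertI1)
qed

lemma matchings_obtain:
  assumes "p \<in> matchings a b" "x \<in> dots a b" obtains y where "{x, y} \<in> p" "y \<noteq> x" "y \<in> dots a b"
  using ncm_partner assms unfolding matchings_iff by metis

section \<open>Products with a single small cup or cap\<close>

definition cup :: "nat \<Rightarrow> int \<Rightarrow> diagram" where
  "cup a i = ins i (id_diagram a)"

definition cap :: "nat \<Rightarrow> int \<Rightarrow> diagram" where
  "cap a i = mirror (cup a i)"

lemma cup_matching: "1 \<le> i \<Longrightarrow> i \<le> int a + 1 \<Longrightarrow> cup a i \<in> matchings (a + 2) a"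
  unfolding cup_def by (rule ins_matching[OF id_matching])

lemma cap_matching: "1 \<le> i \<Longrightarrow> i \<le> int a + 1 \<Longrightarrow> cap a i \<in> matchings a (a + 2)"
  unfolding cap_def by (rule mirror_matching[OF cup_matching])

lemma id_block: "{x, y} \<in> id_diagram n \<longleftrightarrow> (1 \<le> \<bar>x\<bar> \<and> \<bar>x\<bar> \<le> int n \<and> y = - x)"
proof
  assume "{x, y} \<in> id_diagram n"
  then show "1 \<le> \<bar>x\<bar> \<and> \<bar>x\<bar> \<le> int n \<and> y = - x"
    by (auto simp: id_diagram_def doubleton_eq_iff)
next
  assume *: "1 \<le> \<bar>x\<bar> \<and> \<bar>x\<bar> \<le> int n \<and> y = - x"
  then have "{x, y} = {- \<bar>x\<bar>, \<bar>x\<bar>}" by (auto simp: abs_if)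
  then show "{x, y} \<in> id_diagram n" using * unfolding id_diagram_def by auto
qed

lemma cup_block_cases:
  assumes "{x, y} \<in> cup a i"
  shows "{x, y} = {- i - 1, - i} \<or> (\<exists>k. 1 \<le> k \<and> k \<le> int a \<and> (x = sh i (- k) \<and> y = sh i k \<or> x = sh i k \<and> y = sh i (- k)))"
proof -
  consider "{x, y} = {- i - 1, - i}" | "{x, y} \<in> (image (sh i)) ` id_diagram a"
    using assms by (auto simp: cup_def ins_def)
  then show ?thesis
  proof cases
    case 2
    then obtain u v where "{u, v} \<in> id_diagram a" "x = sh i u" "y = sh i v"
      using image_block[OF id_matching[of a, unfolded matchings_iff]] by metis
    then show ?thesis unfolding id_block by (intro disjI2 exI[of _ "\<bar>u\<bar>"]) (auto simp: abs_if)
  qed simp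
qed

lemma cup_through: "1 \<le> i \<Longrightarrow> 1 \<le> k \<Longrightarrow> k \<le> int a \<Longrightarrow> {sh i (- k), k} \<in> cup a i"
  unfolding cup_def using ins_sh[of "- k" k "id_diagram a" i] by (simp add: id_block)

text \<open>Here every middle dot ends a through strand of \<open>p\<close>. So \<open>p\<close>
  merely renames the left dots of \<open>q\<close> by \<open>f\<close> and contributes its own left
  blocks; nothing new is joined and no loop closes. This covers left factors that are identities or
  cups.\<close>

lemma concat_through:
  assumes p: "p \<in> matchings a b" and q: "q \<in> matchings b c" and r: "r \<in> matchings a c"
    and thr: "\<And>k. 1 \<le> k \<Longrightarrow> k \<le> int b \<Longrightarrow> {f (- k), k} \<in> p \<and> f (- k) < 0"
    and pos: "\<And>x. 0 < x \<Longrightarrow> f x = x"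
    and sub: "\<And>x y. {x, y} \<in> q \<Longrightarrow> {f x, f y} \<in> r"
    and lft: "\<And>x y. {x, y} \<in> p \<Longrightarrow> x < 0 \<Longrightarrow> y < 0 \<Longrightarrow> {x, y} \<in> r"
    and cases: "\<And>z w. {z, w} \<in> r \<Longrightarrow>
      (\<exists>x y. {x, y} \<in> q \<and> z = f x \<and> w = f y) \<or> ({z, w} \<in> p \<and> z < 0 \<and> w < 0)"
  shows "diagram_concat p q = r" "loops p q = 0"
proof -
  define \<chi> where "\<chi> d = (case d of Lft k \<Rightarrow> blk r (- k) | Mid k \<Rightarrow> blk r (f (- k)) | Rgt k \<Rightarrow> blk r k)" for d
  have outer: "\<chi> (outer_dot z) = blk r z" for z by (auto simp: \<chi>_def outer_dot_def)
  have thr': "y = f (- x)" if H: "{x, y} \<in> p" "0 < x" for x y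
  proof -
    have "x \<in> dots a b" using matchings_mem[OF p H(1)] by simp
    then have "{f (- x), x} \<in> p" using H(2) thr by (simp add: dots_iff)
    then show ?thesis using matchings_unique[OF p H(1), of "f (- x)"] by (simp add: insert_commute)
  qed
  have L: "\<chi> (left_dot i) = \<chi> (left_dot j)" if H: "{i, j} \<in> p" for i j
  proof -
    have H': "{j, i} \<in> p" using H by (simp add: insert_commute)
    have "i \<in> dots a b" "j \<in> dots a b" using matchings_mem[OF p H] by auto
    then consider "0 < i" | "0 < j" | "i < 0" "j < 0" by (auto simp: dots_iff)
    then show ?thesis
    proof cases
      case 1
      then have "j = f (- i)" "j < 0"
        using thr'[OF H] thr[of i] \<open>i \<in> dots a b\<close> by (auto simp: dots_iff)
      then show ?thesis using 1 by (simp add: \<chi>_def left_dot_def)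
    next
      case 2
      then have "i = f (- j)" "i < 0"
        using thr'[OF H'] thr[of j] \<open>j \<in> dots a b\<close> by (auto simp: dots_iff)
      then show ?thesis using 2 by (simp add: \<chi>_def left_dot_def)
    next
      case 3
      then show ?thesis using blk_cong[OF r lft[OF H 3]] by (simp add: \<chi>_def left_dot_def)
    qed
  qed
  have R: "\<chi> (right_dot i) = \<chi> (right_dot j)" if H: "{i, j} \<in> q" for i j
  proof -
    have "\<chi> (right_dot x) = blk r (f x)" if "x \<in> dots b c" for x
      using that pos by (auto simp: \<chi>_def right_dot_def dots_iff)
    then show ?thesis using blk_cong[OF r sub[OF H]] matchings_mem[OF q H] by simp
  qed
  have rd: "cn p q (outer_dot (f x)) (right_dot x)" if H: "x \<in> dots b c" for x
  proof (cases "0 < x")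
    case True
    then show ?thesis using pos by (simp add: outer_dot_def right_dot_def)
  next
    case False
    then have "{f x, - x} \<in> p" "f x < 0" "x < 0" using thr[of "- x"] H by (auto simp: dots_iff)
    then show ?thesis using cn_left[of "f x" "- x" p q] by (simp add: outer_dot_def right_dot_def left_dot_def)
  qed
  show "diagram_concat p q = r"
  proof (rule concat_eqI[OF p q r])
    show "\<exists>B\<in>r. z \<in> B \<and> w \<in> B"
      if H: "cn p q (outer_dot z) (outer_dot w)" "z \<in> dots a c" "w \<in> dots a c" for z w
      using cn_invariant[of p q _ _ \<chi>, OF H(1) L R p q] blk_same[OF r H(2,3)] unfolding outer by blast
    show "cn p q (outer_dot z) (outer_dot w)" if H: "{z, w} \<in> r" for z w
      using cases[OF H]
    proof (elim disjE exE conjE)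
      fix x y assume xy: "{x, y} \<in> q" "z = f x" "w = f y"
      then show ?thesis using rd matchings_mem[OF q xy(1)] cn_right[OF xy(1)] cn_trans cn_sym by metis
    next
      assume "{z, w} \<in> p" "z < 0" "w < 0"
      then show ?thesis using cn_left[of z w p q] by (simp add: outer_dot_def left_dot_def)
    qed
  qed
  show "loops p q = 0"
  proof (rule loops_eq_0I[OF p q])
    fix k assume "1 \<le> k" "k \<le> int b"
    then have "{f (- k), k} \<in> p" "f (- k) < 0" using thr by auto
    then have "cn p q (left_dot k) (outer_dot (f (- k)))"
      using cn_sym[OF cn_left[of "f (- k)" k p q]] by (simp add: outer_dot_def left_dot_def)
    then show "\<exists>z. cn p q (Mid k) (outer_dot z)" using \<open>1 \<le> k\<close> by (auto simp: left_dot_def)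
  qed
qed

lemma concat_id_left:
  assumes q: "q \<in> matchings b c"
  shows "diagram_concat (id_diagram b) q = q" "loops (id_diagram b) q = 0"
proof -
  note * = concat_through[OF id_matching q q, of "\<lambda>x. x"]
  show "diagram_concat (id_diagram b) q = q"
    by (rule *(1)) (auto simp: id_block)
  show "loops (id_diagram b) q = 0"
    by (rule *(2)) (auto simp: id_block)
qed

lemma concat_cup:
  assumes q: "q \<in> matchings a c" and i: "1 \<le> i" "i \<le> int a + 1"
  shows "diagram_concat (cup a i) q = ins i q" "loops (cup a i) q = 0"
proof -
  have thr: "{sh i (- k), k} \<in> cup a i \<and> sh i (- k) < 0" if "1 \<le> k" "k \<le> int a" for k
    using cup_through that i by (auto simp: sh_def)
  have lft: "{x, y} \<in> ins i q" if H: "{x, y} \<in> cup a i" "x < 0" "y < 0" for x y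
    using cup_block_cases[OF H(1)] H(2,3) i(1) by auto
  have cases: "(\<exists>x y. {x, y} \<in> q \<and> z = sh i x \<and> w = sh i y) \<or> ({z, w} \<in> cup a i \<and> z < 0 \<and> w < 0)"
    if H: "{z, w} \<in> ins i q" for z w
  proof -
    consider "{z, w} = {- i - 1, - i}" | "{z, w} \<in> (image (sh i)) ` q" using H by (auto simp: ins_def)
    then show ?thesis
    proof cases
      case 1
      then have "z < 0" "w < 0" using i(1) by (auto simp: doubleton_eq_iff)
      then show ?thesis unfolding 1 by (simp add: cup_def)
    next
      case 2
      then show ?thesis using image_block[OF q[unfolded matchings_iff] 2] by metis
    qed
  qed
  note * = concat_through[OF cup_matching[OF i] q ins_matching[OF q i], of "sh i", OF thr _ ins_sh lft cases]
  show "diagram_concat (cup a i) q = ins i q" by (rule *(1)) (use i in auto)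
  show "loops (cup a i) q = 0" by (rule *(2)) (use i in auto)
qed

lemma cap_block_cases:
  assumes "{x, y} \<in> cap a i" and i: "1 \<le> i" "i \<le> int a + 1"
  shows "{x, y} = {i, i + 1} \<or>
    (\<exists>z<0. z \<noteq> - i \<and> z \<noteq> - i - 1 \<and> (x = unsh i z \<and> y = - z \<or> x = - z \<and> y = unsh i z))"
proof -
  have "{- x, - y} \<in> cup a i" using assms by (simp add: cap_def)
  from cup_block_cases[OF this] show ?thesis
  proof (elim disjE exE conjE)
    assume "{- x, - y} = {- i - 1, - i}"
    then show ?thesis by (auto simp: doubleton_eq_iff)
  next
    fix k assume k: "1 \<le> k" "k \<le> int a" "- x = sh i (- k)" "- y = sh i k"
    then have "- k = unsh i (- x)" "y = - k" using i by simp_all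
    then show ?thesis using k i by (intro disjI2 exI[of _ "- x"]) (auto simp: sh_def split: if_splits)
  next
    fix k assume k: "1 \<le> k" "k \<le> int a" "- x = sh i k" "- y = sh i (- k)"
    then have "- k = unsh i (- y)" "x = - k" using i by simp_all
    then show ?thesis using k i by (intro disjI2 exI[of _ "- y"]) (auto simp: sh_def split: if_splits)
  qed
qed

lemma cap_through:
  assumes "1 \<le> i" "i \<le> int a + 1" "z < 0" "- int (a + 2) \<le> z" "z \<noteq> - i" "z \<noteq> - i - 1"
  shows "{unsh i z, - z} \<in> cap a i" "unsh i z < 0"
proof -
  show neg: "unsh i z < 0" using assms by (auto simp: unsh_def)
  have "- unsh i z \<le> int a" using assms by (auto simp: unsh_def)
  then have "{sh i (- (- unsh i z)), - unsh i z} \<in> cup a i"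
    using assms(1) neg by (intro cup_through) auto
  then show "{unsh i z, - z} \<in> cap a i" using sh_unsh[OF assms(5,6)] by (simp add: cap_def insert_commute)
qed

lemma cap_cup_block: "{i, i + 1} \<in> cap a i"
  using ins_self[of i "id_diagram a"] by (simp add: cap_def cup_def insert_commute)

lemma dots_cap:
  assumes "1 \<le> i" "i \<le> int a + 1"
  shows "dots (a + 2) c - {- i - 1, - i} = sh i ` dots a c"
  unfolding dots_ins[OF assms] by (auto simp: sh_def)

lemma unsh_mono: "strict_mono_on (sh i ` S) (unsh i)"
  by (rule strict_mono_onI) (auto simp: sh_def unsh_def split: if_splits)

text \<open>A cap on two dots that are not joined to each other connects their partners
  \<open>u\<close> and \<open>v\<close>, and \<open>unsh\<close> closes the gap. Planarity of the
  outcome is \<open>ncm_cap\<close>, and every middle dot can be followed to an outer one, so no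
  loop closes.\<close>

lemma concat_cap_join:
  assumes q: "q \<in> matchings (a + 2) c" and i: "1 \<le> i" "i \<le> int a + 1"
    and u: "{- i, u} \<in> q" and v: "{- i - 1, v} \<in> q" and "u \<noteq> - i - 1"
  shows "diagram_concat (cap a i) q \<in> matchings a c" "loops (cap a i) q = 0"
proof -
  let ?p = "cap a i"
  let ?s = "insert {v, u} (q - {{- i - 1, v}, {- i, u}})"
  let ?r = "(image (unsh i)) ` ?s"
  have p: "?p \<in> matchings a (a + 2)" by (rule cap_matching[OF i])
  have "v \<noteq> - i" using matchings_unique[OF q, of "- i" u "- i - 1"] u v assms(6) by (auto simp: insert_commute)
  then have s: "ncm (sh i ` dots a c) ?s"
    unfolding dots_cap[OF i, symmetric]
    by (intro ncm_cap[OF q[unfolded matchings_iff] v u]) auto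
  have r: "?r \<in> matchings a c"
    using ncm_image[OF s unsh_mono] by (simp add: matchings_iff image_image)
  have uv: "u \<in> dots (a + 2) c" "v \<in> dots (a + 2) c" "u \<noteq> - i" "v \<noteq> - i - 1"
    using matchings_mem[OF q u] matchings_mem[OF q v] by auto
  have special: "{unsh i v, unsh i u} \<in> ?r" using imageI[of "{v, u}" ?s "image (unsh i)"] by simp
  have ordinary: "{unsh i x, unsh i y} \<in> ?r" if H: "{x, y} \<in> q" "x \<notin> {- i, - i - 1}" "y \<notin> {- i, - i - 1}" for x y
  proof -
    have "{x, y} \<in> ?s" using H by (auto simp: doubleton_eq_iff)
    from imageI[OF this, of "image (unsh i)"] show ?thesis by simp
  qed
  \<comment> \<open>The middle dots \<open>i\<close> and \<open>i + 1\<close> under the cap do not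
    survive in the product; they take the colours of the partners \<open>u\<close> and
    \<open>v\<close> of \<open>- i\<close> and \<open>- i - 1\<close>, which are equal.\<close>
  define \<chi> where "\<chi> d = (case d of Lft k \<Rightarrow> blk ?r (- k)
     | Mid k \<Rightarrow> (if k = i then blk ?r (unsh i u) else if k = i + 1 then blk ?r (unsh i v) else blk ?r (unsh i (- k)))
     | Rgt k \<Rightarrow> blk ?r k)" for d
  have outer: "\<chi> (outer_dot z) = blk ?r z" for z by (auto simp: \<chi>_def outer_dot_def)
  have vu: "blk ?r (unsh i v) = blk ?r (unsh i u)" by (rule blk_cong[OF r special])
  have \<chi>r: "\<chi> (right_dot x) = blk ?r (unsh i x)" if H: "x \<in> dots (a + 2) c" "x \<notin> {- i, - i - 1}" for x
    using H i by (auto simp: \<chi>_def right_dot_def dots_iff)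
  have \<chi>i: "\<chi> (right_dot (- i)) = blk ?r (unsh i u)" "\<chi> (right_dot (- i - 1)) = blk ?r (unsh i v)"
    using i by (auto simp: \<chi>_def right_dot_def)
  have L: "\<chi> (left_dot x) = \<chi> (left_dot y)" if H: "{x, y} \<in> ?p" for x y
    using cap_block_cases[OF H i]
  proof (elim disjE exE conjE)
    assume "{x, y} = {i, i + 1}"
    then show ?thesis using i vu by (auto simp: doubleton_eq_iff \<chi>_def left_dot_def)
  next
    fix z assume z: "z < 0" "z \<noteq> - i" "z \<noteq> - i - 1" "x = unsh i z" "y = - z"
    then have "unsh i z < 0" using i by (auto simp: unsh_def)
    with z show ?thesis by (auto simp: \<chi>_def left_dot_def)
  next
    fix z assume z: "z < 0" "z \<noteq> - i" "z \<noteq> - i - 1" "x = - z" "y = unsh i z"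
    then have "unsh i z < 0" using i by (auto simp: unsh_def)
    with z show ?thesis by (auto simp: \<chi>_def left_dot_def)
  qed
  have R: "\<chi> (right_dot x) = \<chi> (right_dot y)" if H: "{x, y} \<in> q" for x y
  proof -
    have H': "{y, x} \<in> q" using H by (simp add: insert_commute)
    have xy: "x \<in> dots (a + 2) c" "y \<in> dots (a + 2) c" using matchings_mem[OF q H] by auto
    consider "x = - i" | "x = - i - 1" | "y = - i" | "y = - i - 1" | "x \<notin> {- i, - i - 1}" "y \<notin> {- i, - i - 1}"
      by blast
    then show ?thesis
    proof cases
      case 1
      then have "y = u" using matchings_unique[OF q u] H by simp
      then show ?thesis using 1 \<chi>i \<chi>r[OF uv(1)] uv(3) assms(6) by simp
    next
      case 2
      then have "y = v" using matchings_unique[OF q v] H by simp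
      then show ?thesis using 2 \<chi>i \<chi>r[OF uv(2)] uv(4) \<open>v \<noteq> - i\<close> by simp
    next
      case 3
      then have "x = u" using matchings_unique[OF q u] H' by simp
      then show ?thesis using 3 \<chi>i \<chi>r[OF uv(1)] uv(3) assms(6) by simp
    next
      case 4
      then have "x = v" using matchings_unique[OF q v] H' by simp
      then show ?thesis using 4 \<chi>i \<chi>r[OF uv(2)] uv(4) \<open>v \<noteq> - i\<close> by simp
    next
      case 5
      then show ?thesis using \<chi>r xy blk_cong[OF r ordinary[OF H 5]] by simp
    qed
  qed
  have rd: "cn ?p q (outer_dot (unsh i x)) (right_dot x)" if H: "x \<in> dots (a + 2) c" "x \<notin> {- i, - i - 1}" for x
  proof (cases "0 < x")
    case True
    then show ?thesis using i by (simp add: outer_dot_def right_dot_def)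
  next
    case False
    then have x: "x < 0" "- int (a + 2) \<le> x" "x \<noteq> - i" "x \<noteq> - i - 1" using H by (auto simp: dots_iff)
    show ?thesis using cn_left[OF cap_through(1)[OF i x], of q] cap_through(2)[OF i x] x(1)
      by (simp add: outer_dot_def right_dot_def left_dot_def)
  qed
  have ui: "cn ?p q (right_dot (- i)) (outer_dot (unsh i u))"
    using cn_trans[OF cn_right[OF u, of ?p] cn_sym[OF rd[OF uv(1)]]] uv(3) assms(6) by simp
  have vi: "cn ?p q (right_dot (- i - 1)) (outer_dot (unsh i v))"
    using cn_trans[OF cn_right[OF v, of ?p] cn_sym[OF rd[OF uv(2)]]] uv(4) \<open>v \<noteq> - i\<close> by simp
  have ii: "cn ?p q (right_dot (- i)) (right_dot (- i - 1))"
    using cn_left[OF cap_cup_block[of i a], of q] i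
    by (simp add: left_dot_def right_dot_def add.commute)
  have "diagram_concat ?p q = ?r"
  proof (rule concat_eqI[OF p q r])
    show "\<exists>B\<in>?r. z \<in> B \<and> w \<in> B"
      if H: "cn ?p q (outer_dot z) (outer_dot w)" "z \<in> dots a c" "w \<in> dots a c" for z w
      using cn_invariant[of ?p q _ _ \<chi>, OF H(1) L R p q] blk_same[OF r H(2,3)] unfolding outer by blast
    show "cn ?p q (outer_dot z) (outer_dot w)" if H: "{z, w} \<in> ?r" for z w
    proof -
      obtain x y where xy: "{x, y} \<in> ?s" "z = unsh i x" "w = unsh i y" using image_block[OF s H] by metis
      consider "{x, y} = {v, u}" | "{x, y} \<in> q - {{- i - 1, v}, {- i, u}}" using xy(1) by auto
      then show ?thesis
      proof cases
        case 1
        have "cn ?p q (outer_dot (unsh i v)) (outer_dot (unsh i u))"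
          using cn_trans[OF cn_trans[OF cn_sym[OF vi] cn_sym[OF ii]] ui] .
        then show ?thesis using 1 xy(2,3) cn_sym by (auto simp: doubleton_eq_iff)
      next
        case 2
        then have xyq: "{x, y} \<in> q" by simp
        have "x \<in> sh i ` dots a c" "y \<in> sh i ` dots a c" using ncm_mem[OF s xy(1)] by auto
        then have "x \<in> dots (a + 2) c" "x \<notin> {- i, - i - 1}" "y \<in> dots (a + 2) c" "y \<notin> {- i, - i - 1}"
          unfolding dots_cap[OF i, symmetric] by auto
        then show ?thesis unfolding xy(2,3)
          using cn_trans[OF cn_trans[OF rd cn_right[OF xyq]] cn_sym[OF rd]] by blast
      qed
    qed
  qed
  with r show "diagram_concat ?p q \<in> matchings a c" by simp
  show "loops ?p q = 0"
  proof (rule loops_eq_0I[OF p q])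
    fix k assume k: "1 \<le> k" "k \<le> int (a + 2)"
    have Mid: "Mid k = right_dot (- k)" using k by (simp add: right_dot_def)
    have "- k \<in> dots (a + 2) c" using k by (simp add: dots_iff)
    then consider "k = i" | "k = i + 1" | "- k \<in> dots (a + 2) c" "- k \<notin> {- i, - i - 1}" by force
    then show "\<exists>z. cn ?p q (Mid k) (outer_dot z)"
    proof cases
      case 1
      then show ?thesis using ui Mid by auto
    next
      case 2
      then have "Mid k = right_dot (- i - 1)" using Mid by simp
      then show ?thesis using vi by auto
    next
      case 3
      then show ?thesis using cn_sym[OF rd[OF 3]] Mid by auto
    qed
  qed
qed

text \<open>The cap closes the inserted cup to the single loop, and its other strands undo the
  renumbering by \<open>sh\<close>.\<close>

lemma concat_cap_ins:
  assumes r: "r \<in> matchings a c" and i: "1 \<le> i" "i \<le> int a + 1"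
  shows "diagram_concat (cap a i) (ins i r) = r" "loops (cap a i) (ins i r) = 1"
proof -
  let ?p = "cap a i" and ?q = "ins i r"
  have p: "?p \<in> matchings a (a + 2)" by (rule cap_matching[OF i])
  have q: "?q \<in> matchings (a + 2) c" by (rule ins_matching[OF r i])
  \<comment> \<open>The extra colour \<open>None\<close> is carried by \<open>Mid i\<close> and
    \<open>Mid (i + 1)\<close> alone. So their component contains no outer dot, and it is the
    loop.\<close>
  define \<chi> where "\<chi> d = (case d of Lft k \<Rightarrow> Some (blk r (- k))
     | Mid k \<Rightarrow> (if k = i \<or> k = i + 1 then None else Some (blk r (unsh i (- k))))
     | Rgt k \<Rightarrow> Some (blk r k))" for d
  have outer: "\<chi> (outer_dot z) = Some (blk r z)" for z by (auto simp: \<chi>_def outer_dot_def)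
  have \<chi>r: "\<chi> (right_dot (sh i x)) = Some (blk r x)" if H: "x \<in> dots a c" for x
    using H i unsh_sh[of i x] by (auto simp: \<chi>_def right_dot_def dots_iff sh_def split: if_splits)
  have \<chi>i: "\<chi> (right_dot (- i)) = None" "\<chi> (right_dot (- i - 1)) = None"
    using i by (auto simp: \<chi>_def right_dot_def)
  have L: "\<chi> (left_dot x) = \<chi> (left_dot y)" if H: "{x, y} \<in> ?p" for x y
    using cap_block_cases[OF H i]
  proof (elim disjE exE conjE)
    assume "{x, y} = {i, i + 1}"
    then show ?thesis using i by (auto simp: doubleton_eq_iff \<chi>_def left_dot_def)
  next
    fix z assume z: "z < 0" "z \<noteq> - i" "z \<noteq> - i - 1" "x = unsh i z" "y = - z"
    then have "unsh i z < 0" using i by (auto simp: unsh_def)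
    with z show ?thesis by (auto simp: \<chi>_def left_dot_def)
  next
    fix z assume z: "z < 0" "z \<noteq> - i" "z \<noteq> - i - 1" "x = - z" "y = unsh i z"
    then have "unsh i z < 0" using i by (auto simp: unsh_def)
    with z show ?thesis by (auto simp: \<chi>_def left_dot_def)
  qed
  have R: "\<chi> (right_dot x) = \<chi> (right_dot y)" if H: "{x, y} \<in> ?q" for x y
  proof -
    consider "{x, y} = {- i - 1, - i}" | "{x, y} \<in> (image (sh i)) ` r" using H by (auto simp: ins_def)
    then show ?thesis
    proof cases
      case 1
      then show ?thesis using \<chi>i by (auto simp: doubleton_eq_iff)
    next
      case 2
      then obtain x' y' where *: "{x', y'} \<in> r" "x = sh i x'" "y = sh i y'"
        using image_block[OF r[unfolded matchings_iff] 2] by metis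
      then show ?thesis using \<chi>r matchings_mem[OF r *(1)] blk_cong[OF r *(1)] by simp
    qed
  qed
  have rd: "cn ?p ?q (outer_dot x) (right_dot (sh i x))" if H: "x \<in> dots a c" for x
  proof (cases "0 < x")
    case True
    then show ?thesis using i by (simp add: outer_dot_def right_dot_def)
  next
    case False
    then have x: "sh i x < 0" "- int (a + 2) \<le> sh i x" "sh i x \<noteq> - i" "sh i x \<noteq> - i - 1" "x < 0"
      using H i by (auto simp: dots_iff sh_def)
    show ?thesis using cn_left[OF cap_through(1)[OF i x(1-4)], of ?q] x(1,5)
      by (simp add: outer_dot_def right_dot_def left_dot_def)
  qed
  show "diagram_concat ?p ?q = r"
  proof (rule concat_eqI[OF p q r])
    show "\<exists>B\<in>r. z \<in> B \<and> w \<in> B"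
      if H: "cn ?p ?q (outer_dot z) (outer_dot w)" "z \<in> dots a c" "w \<in> dots a c" for z w
      using cn_invariant[of ?p ?q _ _ \<chi>, OF H(1) L R p q] blk_same[OF r H(2,3)] unfolding outer by blast
    show "cn ?p ?q (outer_dot z) (outer_dot w)" if H: "{z, w} \<in> r" for z w
      using cn_trans[OF cn_trans[OF rd cn_right[OF ins_sh[OF H]]] cn_sym[OF rd]] matchings_mem[OF r H] by blast
  qed
  have inv: "\<chi> x = \<chi> y" if H: "y \<in> cls (glued ?p ?q) x" for x y
    using cn_invariant[of ?p ?q x y \<chi>, OF _ L R p q] H by (simp add: cls_def cn_def)
  have ii: "cn ?p ?q (Mid i) (Mid (i + 1))"
    using cn_left[OF cap_cup_block[of i a], of ?q] i by (simp add: left_dot_def)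
  have "{C \<in> components ?p ?q. C \<subseteq> range Mid} = {cls (glued ?p ?q) (Mid i)}"
  proof (rule Set.set_eqI, rule iffI)
    fix C assume C: "C \<in> {C \<in> components ?p ?q. C \<subseteq> range Mid}"
    then obtain x where x: "x \<in> \<Union> (glued ?p ?q)" "C = cls (glued ?p ?q) x" "C \<subseteq> range Mid"
      by (auto simp: components_eq comps_eq)
    have "x \<in> C" using x(2) by simp
    with x(3) obtain k where k: "x = Mid k" by blast
    then have k1: "1 \<le> k" "k \<le> int (a + 2)" using x(1) unfolding Union_glued[OF p q] by auto
    show "C \<in> {cls (glued ?p ?q) (Mid i)}"
    proof (cases "k = i \<or> k = i + 1")
      case True
      then have "cn ?p ?q (Mid i) (Mid k)" using ii by auto
      then have "cls (glued ?p ?q) (Mid i) = C" using cls_cong unfolding cn_def x(2) k by metis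
      then show ?thesis by simp
    next
      case False
      then have "- k \<in> sh i ` dots a c"
        unfolding dots_cap[OF i, symmetric] using k1 by (auto simp: dots_iff)
      then obtain z where z: "z \<in> dots a c" "- k = sh i z" by blast
      then have "cn ?p ?q (Mid k) (outer_dot z)" using cn_sym[OF rd[OF z(1)]] k1
        by (simp add: right_dot_def flip: z(2))
      then have "outer_dot z \<in> C" using x k by (simp add: cls_def cn_def)
      with x(3) show ?thesis by (auto simp: outer_dot_def split: if_splits)
    qed
  next
    fix C assume "C \<in> {cls (glued ?p ?q) (Mid i)}"
    then have C: "C = cls (glued ?p ?q) (Mid i)" by simp
    have "Mid i \<in> \<Union> (glued ?p ?q)" unfolding Union_glued[OF p q] using i by auto
    moreover have "C \<subseteq> range Mid"
    proof
      fix y assume "y \<in> C"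
      then have "\<chi> (Mid i) = \<chi> y" unfolding C by (rule inv)
      moreover have "\<chi> (Mid i) = None" by (simp add: \<chi>_def)
      ultimately have "\<chi> y = None" by simp
      then show "y \<in> range Mid" by (cases y) (auto simp: \<chi>_def)
    qed
    ultimately show "C \<in> {C \<in> components ?p ?q. C \<subseteq> range Mid}"
      using C by (simp add: components_eq comps_eq)
  qed
  then show "loops ?p ?q = 1" by (simp add: loops_def)
qed

section \<open>Planarity and the Temperley--Lieb relations\<close>

lemma mirror_concat_matching:
  assumes "p \<in> matchings a b" "q \<in> matchings b c"
  shows "diagram_concat (mirror q) (mirror p) = mirror (diagram_concat p q)"
    and "loops (mirror q) (mirror p) = loops p q"
  by (rule mirror_concat[OF matchings_nz[OF assms(1)] matchings_nz[OF assms(2)]],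
      rule mirror_loops[OF matchings_nz[OF assms(1)] matchings_nz[OF assms(2)]])

lemma loops_assoc_matching:
  assumes "p \<in> matchings a b" "q \<in> matchings c d" "r \<in> matchings e f"
  shows "loops p q + loops (diagram_concat p q) r = loops q r + loops p (diagram_concat q r)"
  by (rule loops_assoc[OF finite_matching[OF assms(1)] finite_matching[OF assms(2)] finite_matching[OF assms(3)]])

lemma strip_left_cup:
  assumes p: "p \<in> matchings a b" and "{- i - 1, - i} \<in> p" "1 \<le> i"
  obtains a' p' where "a = a' + 2" "i \<le> int a' + 1" "p' \<in> matchings a' b" "p = ins i p'"
proof -
  have "- i - 1 \<in> dots a b" using matchings_mem[OF p assms(2)] by simp
  then have a: "i + 1 \<le> int a" using assms(3) by (auto simp: dots_iff)
  define a' where "a' = a - 2"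
  have a': "a = a' + 2" using a assms(3) unfolding a'_def by linarith
  with a have i: "i \<le> int a' + 1" by simp
  show ?thesis
    using that[OF a' i] unins_matching[OF p[unfolded a'] assms(3) i assms(2)] by metis
qed

text \<open>Takes a planar diagram apart: if it is not an identity, counting strands yields a block
  on one side, hence a small cup that can be split off on the left or, after reflection, a small cap
  on the right.\<close>

lemma mirror_cases:
  assumes p: "p \<in> matchings a b"
  obtains (id) "a = b" "p = id_diagram a"
    | (left) a' i p' where "a = a' + 2" "1 \<le> i" "i \<le> int a' + 1" "p' \<in> matchings a' b" "p = ins i p'"
    | (right) b' i p' where "b = b' + 2" "1 \<le> i" "i \<le> int b' + 1" "p' \<in> matchings a b'"
        "p = diagram_concat p' (cap b' i)" "loops p' (cap b' i) = 0"
proof -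
  have strip: "\<exists>a' i p'. a = a' + 2 \<and> 1 \<le> i \<and> i \<le> int a' + 1 \<and> p' \<in> matchings a' b \<and> p = ins i p'"
    if p: "p \<in> matchings a b" and H: "{x, y} \<in> p" "x < y" "y < 0" for p a b x y
  proof -
    obtain i where i: "1 \<le> i" "{- i - 1, - i} \<in> p" using left_cup[OF p H] by metis
    show ?thesis using strip_left_cup[OF p i(2,1)] i(1) by metis
  qed
  consider "a = b" "p = id_diagram a" | "b < a \<or> a = b \<and> p \<noteq> id_diagram a" | "a < b" by linarith
  then show ?thesis
  proof cases
    case 1
    then show ?thesis using id by blast
  next
    case 2
    obtain x y where "{x, y} \<in> p" "x < y" "y < 0" using left_block_exists[OF p 2] .
    then show ?thesis using strip[OF p] left by blast
  next
    case 3
    have m: "mirror p \<in> matchings b a" by (rule mirror_matching[OF p])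
    obtain x y where "{x, y} \<in> mirror p" "x < y" "y < 0" using left_block_exists[OF m] 3 by blast
    then obtain b' i q where q: "b = b' + 2" "1 \<le> i" "i \<le> int b' + 1" "q \<in> matchings b' a" "mirror p = ins i q"
      using strip[OF m] by blast
    note cq = concat_cup[OF q(4,2,3)]
    have "p = mirror (diagram_concat (cup b' i) q)" using q(5) cq(1) by (metis mirror_mirror)
    then have "p = diagram_concat (mirror q) (cap b' i)"
      using mirror_concat_matching(1)[OF cup_matching[OF q(2,3)] q(4)] by (simp add: cap_def)
    moreover have "loops (mirror q) (cap b' i) = 0"
      using mirror_concat_matching(2)[OF cup_matching[OF q(2,3)] q(4)] cq(2) by (simp add: cap_def)
    ultimately show ?thesis using right q mirror_matching[OF q(4)] by blast
  qed
qed

lemma concat_cap_matching: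
  assumes q: "q \<in> matchings (a + 2) c" and i: "1 \<le> i" "i \<le> int a + 1"
  shows "diagram_concat (cap a i) q \<in> matchings a c"
proof (cases "{- i - 1, - i} \<in> q")
  case True
  then obtain a' q' where "a + 2 = a' + 2" "q' \<in> matchings a' c" "q = ins i q'"
    using strip_left_cup[OF q _ i(1)] by metis
  then show ?thesis using concat_cap_ins(1)[of q' a c i] i by simp
next
  case False
  have "- i \<in> dots (a + 2) c" "- i - 1 \<in> dots (a + 2) c" using i by (auto simp: dots_iff)
  then obtain u v where uv: "{- i, u} \<in> q" "{- i - 1, v} \<in> q" using matchings_obtain[OF q] by metis
  have "u \<noteq> - i - 1" using uv(1) False by (auto simp: insert_commute)
  then show ?thesis using concat_cap_join(1)[OF q i uv] by simp
qed

text \<open>Planarity by taking \<open>p\<close> apart with \<open>mirror_cases\<close>: a left cup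
  is put back after multiplication by the rest, a right cap is first absorbed into \<open>q\<close>.
  Both rearrangements are instances of \<open>concat_assoc\<close>.\<close>

theorem concat_matching:
  "p \<in> matchings a b \<Longrightarrow> q \<in> matchings b c \<Longrightarrow> diagram_concat p q \<in> matchings a c"
proof (induction "a + b" arbitrary: a b p q c rule: less_induct)
  case less
  from less(2) show ?case
  proof (cases rule: mirror_cases)
    case id
    then show ?thesis using less(3) concat_id_left(1) by metis
  next
    case (left a' i p')
    have *: "diagram_concat p' q \<in> matchings a' c" using less(1)[OF _ left(4) less(3)] left(1) by simp
    have "diagram_concat p q = diagram_concat (cup a' i) (diagram_concat p' q)"
      unfolding left(5) concat_cup(1)[OF left(4,2,3), symmetric] by (rule concat_assoc)
    also have "\<dots> = ins i (diagram_concat p' q)" by (rule concat_cup(1)[OF * left(2,3)])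
    finally show ?thesis using ins_matching[OF * left(2,3)] left(1) by simp
  next
    case (right b' i p')
    have *: "diagram_concat (cap b' i) q \<in> matchings b' c"
      using concat_cap_matching[OF less(3)[unfolded right(1)] right(2,3)] .
    have "diagram_concat p q = diagram_concat p' (diagram_concat (cap b' i) q)"
      unfolding right(5) by (rule concat_assoc)
    then show ?thesis using less(1)[OF _ right(4) *] right(1) by simp
  qed
qed

lemma concat_id_right:
  assumes p: "p \<in> matchings a b"
  shows "diagram_concat p (id_diagram b) = p" "loops p (id_diagram b) = 0"
  using mirror_concat_matching[OF id_matching mirror_matching[OF p]] concat_id_left[OF mirror_matching[OF p]]
  by simp_all

lemma concat_memI:
  assumes p: "p \<in> matchings a b" and q: "q \<in> matchings b c"
    and "cn p q (outer_dot x) (outer_dot y)" "x \<in> dots a c" "x \<noteq> y"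
  shows "{x, y} \<in> diagram_concat p q"
proof -
  let ?B = "{w. cn p q (outer_dot x) (outer_dot w)}"
  have B: "?B \<in> diagram_concat p q" unfolding concat_eq[OF p q] using assms(4) by blast
  obtain u v where uv: "?B = {u, v}" using ncm_block[OF concat_matching[OF p q, unfolded matchings_iff] B] by metis
  have "x \<in> ?B" "y \<in> ?B" using assms(3) by auto
  then have "?B = {x, y}" using assms(5) unfolding uv by auto
  with B show ?thesis by simp
qed

context
  fixes p q a b c
  assumes p: "p \<in> matchings a b" and q: "q \<in> matchings b c"
begin

lemma concat_left_block:
  assumes H: "{x, y} \<in> p" "x < 0" "y < 0" shows "{x, y} \<in> diagram_concat p q"
proof (rule concat_memI[OF p q])
  show "cn p q (outer_dot x) (outer_dot y)"
    using cn_left[OF H(1), of q] H(2,3) by (simp add: left_dot_def outer_dot_def)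
  show "x \<in> dots a c" "x \<noteq> y" using matchings_mem[OF p H(1)] H(2) by (auto simp: dots_iff)
qed

lemma concat_right_block:
  assumes H: "{x, y} \<in> q" "0 < x" "0 < y" shows "{x, y} \<in> diagram_concat p q"
proof (rule concat_memI[OF p q])
  show "cn p q (outer_dot x) (outer_dot y)"
    using cn_right[OF H(1), of p] H(2,3) by (simp add: right_dot_def outer_dot_def)
  show "x \<in> dots a c" "x \<noteq> y" using matchings_mem[OF q H(1)] H(2) by (auto simp: dots_iff)
qed

lemma concat_through_block:
  assumes H: "{x, z} \<in> p" "x < 0" "0 < z" "{- z, y} \<in> q" "0 < y" shows "{x, y} \<in> diagram_concat p q"
proof (rule concat_memI[OF p q])
  have "cn p q (left_dot x) (left_dot z)" by (rule cn_left[OF H(1)])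
  moreover have "cn p q (right_dot (- z)) (right_dot y)" by (rule cn_right[OF H(4)])
  ultimately show "cn p q (outer_dot x) (outer_dot y)"
    using H(2,3,5) cn_trans by (simp add: left_dot_def right_dot_def outer_dot_def)
  show "x \<in> dots a c" "x \<noteq> y" using matchings_mem[OF p H(1)] H(2,5) by (auto simp: dots_iff)
qed

lemma concat_left_through:
  assumes H: "{x, z} \<in> p" "x < 0" "0 < z" "{y, w} \<in> p" "y < 0" "0 < w" "{- z, - w} \<in> q"
  shows "{x, y} \<in> diagram_concat p q"
proof (rule concat_memI[OF p q])
  have "cn p q (left_dot x) (left_dot z)" by (rule cn_left[OF H(1)])
  moreover have "cn p q (right_dot (- z)) (right_dot (- w))" by (rule cn_right[OF H(7)])
  moreover have "cn p q (left_dot w) (left_dot y)" by (rule cn_sym[OF cn_left[OF H(4)]])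
  moreover have "right_dot (- z) = left_dot z" "right_dot (- w) = left_dot w"
    "outer_dot x = left_dot x" "outer_dot y = left_dot y"
    using H(2,3,5,6) by (simp_all add: left_dot_def right_dot_def outer_dot_def)
  ultimately show "cn p q (outer_dot x) (outer_dot y)" by (metis cn_trans)
  show "x \<in> dots a c" using matchings_mem[OF p H(1)] H(2) by (auto simp: dots_iff)
  have "z \<noteq> w" using matchings_mem[OF q H(7)] by simp
  then show "x \<noteq> y" using matchings_unique[OF p H(1)] H(4) by metis
qed

lemma concat_right_through:
  assumes H: "{x, y} \<in> p" "0 < x" "0 < y" "{- x, z} \<in> q" "0 < z" "{- y, w} \<in> q" "0 < w"
  shows "{z, w} \<in> diagram_concat p q"
proof (rule concat_memI[OF p q])
  have "cn p q (left_dot x) (left_dot y)" by (rule cn_left[OF H(1)])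
  moreover have "cn p q (right_dot z) (right_dot (- x))" by (rule cn_sym[OF cn_right[OF H(4)]])
  moreover have "cn p q (right_dot (- y)) (right_dot w)" by (rule cn_right[OF H(6)])
  moreover have "right_dot (- x) = left_dot x" "right_dot (- y) = left_dot y"
    "outer_dot z = right_dot z" "outer_dot w = right_dot w"
    using H(2,3,5,7) by (simp_all add: left_dot_def right_dot_def outer_dot_def)
  ultimately show "cn p q (outer_dot z) (outer_dot w)" by (metis cn_trans)
  show "z \<in> dots a c" using matchings_mem[OF q H(4)] H(5) by (auto simp: dots_iff)
  have "- x \<noteq> - y" using matchings_mem[OF p H(1)] by simp
  moreover have "{z, - x} \<in> q" "{w, - y} \<in> q" using H(4,6) by (simp_all add: insert_commute)
  ultimately show "z \<noteq> w" using matchings_unique[OF q] by metis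
qed

end

lemma zigzag:
  assumes i: "1 \<le> i" "i \<le> int a"
  shows "diagram_concat (cap a i) (cup a (i + 1)) = id_diagram a" "loops (cap a i) (cup a (i + 1)) = 0"
    "diagram_concat (cap a (i + 1)) (cup a i) = id_diagram a" "loops (cap a (i + 1)) (cup a i) = 0"
proof -
  let ?p = "cap a i" and ?q = "cup a (i + 1)"
  have p: "?p \<in> matchings a (a + 2)" and q: "?q \<in> matchings (a + 2) a"
    using i cap_matching cup_matching by auto
  have "{- i, i} \<in> ?q" using cup_through[of "i + 1" i a] i by (simp add: sh_def)
  moreover have "{- i - 1, - i - 2} \<in> ?q"
  proof -
    have "- (i + 1) - 1 = - i - 2" "- (i + 1) = - i - 1" by simp_all
    then have "{- i - 2, - i - 1} \<in> ?q" using ins_self[of "i + 1" "id_diagram a"] by (simp only: cup_def)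
    then show ?thesis by (simp only: insert_commute)
  qed
  ultimately show l: "loops ?p ?q = 0" using concat_cap_join(2)[OF q] i by auto
  have blk: "{- k, k} \<in> diagram_concat ?p ?q" if k: "1 \<le> k" "k \<le> int a" for k
  proof (cases "k = i")
    case False
    have "{sh i (- k), k} \<in> cup a i" using cup_through k i by simp
    then have "{- k, - sh i (- k)} \<in> ?p" by (simp add: cap_def insert_commute)
    moreover have "{sh (i + 1) (- k), k} \<in> ?q" using cup_through k i by simp
    moreover have "sh (i + 1) (- k) = sh i (- k)" using False by (auto simp: sh_def)
    moreover have "sh i (- k) < 0" using k by (auto simp: sh_def)
    ultimately show ?thesis using concat_through_block[OF p q, of "- k" "- sh i (- k)" k] k by simp
  next
    \<comment> \<open>The only strand that bends: it runs through \<open>Lft i\<close>,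
      \<open>Mid (i + 2)\<close>, \<open>Mid (i + 1)\<close>, \<open>Mid i\<close> and
      \<open>Rgt i\<close>. All other strands are straight up to the two shifts, which
      cancel.\<close>
    case True
    have "{sh i (- i), i} \<in> cup a i" using cup_through i by simp
    then have "{- i, i + 2} \<in> ?p" by (simp add: cap_def insert_commute sh_def)
    from cn_left[OF this, of ?q] have 1: "cn ?p ?q (Lft i) (Mid (i + 2))" using i by (simp add: left_dot_def)
    from cn_right[OF \<open>{- i - 1, - i - 2} \<in> ?q\<close>, of ?p]
    have 2: "cn ?p ?q (Mid (i + 1)) (Mid (i + 2))" using i by (simp add: right_dot_def add.commute)
    from cn_left[OF cap_cup_block[of i a], of ?q]
    have 3: "cn ?p ?q (Mid i) (Mid (i + 1))" using i by (simp add: left_dot_def)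
    from cn_right[OF \<open>{- i, i} \<in> ?q\<close>, of ?p]
    have 4: "cn ?p ?q (Mid i) (Rgt i)" using i by (simp add: right_dot_def)
    have "cn ?p ?q (Lft i) (Rgt i)"
      using cn_trans[OF cn_trans[OF 1 cn_sym[OF 2]] cn_trans[OF cn_sym[OF 3] 4]] .
    then show ?thesis unfolding True using i
      by (intro concat_memI[OF p q]) (auto simp: outer_dot_def dots_iff)
  qed
  have "diagram_concat ?p ?q = id_diagram a"
  proof (rule partition_on_eqI[of "dots a a" _ _ "id_diagram a"])
    show "partition_on (dots a a) (diagram_concat ?p ?q)" "partition_on (dots a a) (id_diagram a)"
      by (rule matchings_partition[OF concat_matching[OF p q]], rule matchings_partition[OF id_matching])
    show "dots a a \<subseteq> \<Union> (id_diagram a)"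
      using partition_onD1[OF matchings_partition[OF id_matching[of a]]] by simp
    show "B \<in> diagram_concat ?p ?q \<and> B \<in> id_diagram a" if B: "B \<in> id_diagram a" for B
    proof -
      obtain k where "1 \<le> k" "k \<le> int a" "B = {- k, k}" using B by (auto simp: id_diagram_def)
      with blk B show ?thesis by simp
    qed
  qed
  then show *: "diagram_concat ?p ?q = id_diagram a" .
  show "diagram_concat (cap a (i + 1)) (cup a i) = id_diagram a" "loops (cap a (i + 1)) (cup a i) = 0"
    using mirror_concat_matching[OF p q] * l by (simp_all add: cap_def)
qed

section \<open>The Temperley--Lieb generators and their relations\<close>

text \<open>The standard generator with a cup and a cap at the positions \<open>i\<close> and
  \<open>i + 1\<close>; it factors through \<open>n - 2\<close> strands, see
  \<open>U_eq\<close>.\<close>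

definition U :: "nat \<Rightarrow> int \<Rightarrow> diagram" where
  "U n i = ins i (cap (n - 2) i)"

lemma U_eq:
  assumes "1 \<le> i" "i < int n"
  shows "U n i = diagram_concat (cup (n - 2) i) (cap (n - 2) i)" "loops (cup (n - 2) i) (cap (n - 2) i) = 0"
    "U n i \<in> matchings n n" "cup (n - 2) i \<in> matchings n (n - 2)" "cap (n - 2) i \<in> matchings (n - 2) n"
proof -
  have n: "n - 2 + 2 = n" and i: "i \<le> int (n - 2) + 1" using assms by auto
  have c: "cap (n - 2) i \<in> matchings (n - 2) n" using cap_matching[OF assms(1) i] n by simp
  then show "cap (n - 2) i \<in> matchings (n - 2) n" .
  show "cup (n - 2) i \<in> matchings n (n - 2)" using cup_matching[OF assms(1) i] n by simp
  show "U n i = diagram_concat (cup (n - 2) i) (cap (n - 2) i)" "loops (cup (n - 2) i) (cap (n - 2) i) = 0"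
    using concat_cup[OF c assms(1) i] by (simp_all add: U_def)
  show "U n i \<in> matchings n n" using ins_matching[OF c assms(1) i] n by (simp add: U_def)
qed

lemma U_left: "{- i - 1, - i} \<in> U n i"
  by (simp add: U_def)

lemma U_right: "1 \<le> i \<Longrightarrow> {i, i + 1} \<in> U n i"
  using ins_sh[OF cap_cup_block[of i "n - 2"], of i] by (simp add: U_def)

lemma U_through:
  assumes "1 \<le> i" "i < int n" "1 \<le> k" "k \<le> int n" "k \<noteq> i" "k \<noteq> i + 1"
  shows "{- k, k} \<in> U n i"
proof -
  have "- k \<noteq> - i" "- k \<noteq> - i - 1" using assms by auto
  moreover have "{unsh i (- k), - (- k)} \<in> cap (n - 2) i"
    using assms by (intro cap_through) auto
  then have "{sh i (unsh i (- k)), sh i k} \<in> U n i" using ins_sh by (simp add: U_def)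
  ultimately show ?thesis using assms(1,3) sh_unsh by simp
qed

lemma U_far:
  assumes i: "1 \<le> i" "i < int n" and j: "1 \<le> j" "j < int n" and ij: "i + 2 \<le> j \<or> j + 2 \<le> i"
  shows "diagram_concat (U n i) (U n j) = diagram_concat (U n j) (U n i)" "loops (U n i) (U n j) = 0"
proof -
  \<comment> \<open>The list of blocks of either product. It covers all dots and is symmetric in
    \<open>i\<close> and \<open>j\<close>, so it identifies both products with each other.\<close>
  define r where "r i j = {{- i - 1, - i}, {i, i + 1}, {- j - 1, - j}, {j, j + 1}} \<union>
    (\<lambda>k. {- k, k}) ` ({1..int n} - {i, i + 1, j, j + 1})" for i j :: int
  have mem: "B \<in> diagram_concat (U n i) (U n j)"
    if i: "1 \<le> i" "i < int n" and j: "1 \<le> j" "j < int n" and ij: "i + 2 \<le> j \<or> j + 2 \<le> i" and B: "B \<in> r i j"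
    for i j B
  proof -
    note p = U_eq(3)[OF i] and q = U_eq(3)[OF j]
    consider "B = {- i - 1, - i}" | "B = {i, i + 1}" | "B = {- j - 1, - j}" | "B = {j, j + 1}"
      | "B \<in> (\<lambda>k. {- k, k}) ` ({1..int n} - {i, i + 1, j, j + 1})"
      using B unfolding r_def by blast
    then show ?thesis
    proof cases
      case 1
      then show ?thesis using concat_left_block[OF p q U_left] i by simp
    next
      case 2
      have "{- i, i} \<in> U n j" "{- (i + 1), i + 1} \<in> U n j" by (rule U_through; use i j ij in auto)+
      then show ?thesis using concat_right_through[OF p q U_right[OF i(1)]] i 2 by simp
    next
      case 3
      have 1: "{- j, j} \<in> U n i" "{- (j + 1), j + 1} \<in> U n i" by (rule U_through; use i j ij in auto)+
      have e: "- (j + 1) = - j - 1" by simp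
      have "{- (j + 1), - j} \<in> U n j" using U_left[of j n] by (simp only: e)
      then have "{- (j + 1), - j} \<in> diagram_concat (U n i) (U n j)"
        using concat_left_through[OF p q 1(2) _ _ 1(1)] j by simp
      then show ?thesis unfolding 3 by (simp only: e)
    next
      case 4
      then show ?thesis using concat_right_block[OF p q U_right] j by simp
    next
      case 5
      then obtain k where k': "k \<in> {1..int n} - {i, i + 1, j, j + 1}" "B = {- k, k}" by blast
      then have k: "B = {- k, k}" "1 \<le> k" "k \<le> int n" "k \<notin> {i, i + 1, j, j + 1}" by auto
      have "{- k, k} \<in> U n i" "{- k, k} \<in> U n j"
        using i j k(2-4) by (auto intro!: U_through)
      then have "{- k, k} \<in> diagram_concat (U n i) (U n j)"
        using concat_through_block[OF p q, of "- k" k k] k(2) by simp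
      then show ?thesis by (simp only: k(1))
    qed
  qed
  have "{- i - 1, - i} \<in> r j i" "{i, i + 1} \<in> r j i" "{- j - 1, - j} \<in> r j i" "{j, j + 1} \<in> r j i"
    unfolding r_def by (simp_all only: insert_iff Un_iff simp_thms)
  moreover have "{1..int n} - {i, i + 1, j, j + 1} = {1..int n} - {j, j + 1, i, i + 1}" by auto
  then have "(\<lambda>k. {- k, k}) ` ({1..int n} - {i, i + 1, j, j + 1}) \<subseteq> r j i"
    unfolding r_def by (simp only: Un_upper2)
  ultimately have sym: "r i j \<subseteq> r j i"
    unfolding r_def[of i j] by (simp only: Un_subset_iff insert_subset empty_subsetI simp_thms)
  show "diagram_concat (U n i) (U n j) = diagram_concat (U n j) (U n i)"
  proof (rule partition_on_eqI[of "dots n n" _ _ "r i j"])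
    show "partition_on (dots n n) (diagram_concat (U n i) (U n j))"
      "partition_on (dots n n) (diagram_concat (U n j) (U n i))"
      by (rule matchings_partition[OF concat_matching[OF U_eq(3)[OF i] U_eq(3)[OF j]]],
          rule matchings_partition[OF concat_matching[OF U_eq(3)[OF j] U_eq(3)[OF i]]])
    show "B \<in> diagram_concat (U n i) (U n j) \<and> B \<in> diagram_concat (U n j) (U n i)" if B: "B \<in> r i j" for B
    proof
      show "B \<in> diagram_concat (U n i) (U n j)" by (rule mem[OF i j ij B])
      show "B \<in> diagram_concat (U n j) (U n i)" by (rule mem[OF j i _ subsetD[OF sym B]]) (use ij in linarith)
    qed
    show "dots n n \<subseteq> \<Union> (r i j)"
    proof
      fix x assume x: "x \<in> dots n n"
      show "x \<in> \<Union> (r i j)"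
      proof (cases "\<bar>x\<bar> \<in> {i, i + 1, j, j + 1}")
        case True
        then have "x \<in> {- i - 1, - i} \<or> x \<in> {i, i + 1} \<or> x \<in> {- j - 1, - j} \<or> x \<in> {j, j + 1}" by auto
        then show ?thesis unfolding r_def by blast
      next
        case False
        then have "\<bar>x\<bar> \<in> {1..int n} - {i, i + 1, j, j + 1}" using x by (auto simp: dots_iff)
        moreover have "x \<in> {- \<bar>x\<bar>, \<bar>x\<bar>}" by auto
        ultimately show ?thesis unfolding r_def by blast
      qed
    qed
  qed
  note p = U_eq(3)[OF i] and q = U_eq(3)[OF j]
  show "loops (U n i) (U n j) = 0"
  proof (rule loops_eq_0I[OF p q])
    fix k assume k: "1 \<le> k" "k \<le> int n"
    show "\<exists>z. cn (U n i) (U n j) (Mid k) (outer_dot z)"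
    proof (cases "k = i \<or> k = i + 1")
      case True
      have "{- k, k} \<in> U n j" by (rule U_through) (use True i j ij k in auto)
      then show ?thesis using cn_right[of "- k" k "U n j" "U n i"] k
        by (intro exI[of _ k]) (simp add: right_dot_def outer_dot_def)
    next
      case False
      have "{- k, k} \<in> U n i" by (rule U_through) (use False i j ij k in auto)
      then show ?thesis using cn_sym[OF cn_left[of "- k" k "U n i" "U n j"]] k
        by (intro exI[of _ "- k"]) (simp add: left_dot_def outer_dot_def)
    qed
  qed
qed

section \<open>Linear extension\<close>

text \<open>The scalar multiplication of \<open>free_space\<close> as a constant of its own, so that
  finitely supported functions become an instance of \<open>vector_space\<close> with its theory of
  spans and dimensions.\<close>

definition sc :: "complex \<Rightarrow> ('a \<Rightarrow>\<^sub>0 complex) \<Rightarrow> ('a \<Rightarrow>\<^sub>0 complex)" where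
  "sc c = Poly_Mapping.map ((*) c)"

lemma lookup_sc [simp]: "Poly_Mapping.lookup (sc c f) k = c * Poly_Mapping.lookup f k"
  by (auto simp: sc_def map.rep_eq when_def)

interpretation pm: vector_space sc
  by standard (auto intro!: poly_mapping_eqI simp: lookup_add algebra_simps)

lemma sc_single [simp]: "sc c (Poly_Mapping.single k a) = Poly_Mapping.single k (c * a)"
  by (rule poly_mapping_eqI) (auto simp: lookup_single when_def)

lemma keys_sc: "Poly_Mapping.keys (sc c f) \<subseteq> Poly_Mapping.keys f"
  by (auto simp: in_keys_iff)

definition lin :: "('a \<Rightarrow> ('b \<Rightarrow>\<^sub>0 complex)) \<Rightarrow> ('a \<Rightarrow>\<^sub>0 complex) \<Rightarrow> ('b \<Rightarrow>\<^sub>0 complex)" where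
  "lin F f = (\<Sum>p\<in>Poly_Mapping.keys f. sc (Poly_Mapping.lookup f p) (F p))"

lemma lin_superset:
  "finite A \<Longrightarrow> Poly_Mapping.keys f \<subseteq> A \<Longrightarrow> lin F f = (\<Sum>p\<in>A. sc (Poly_Mapping.lookup f p) (F p))"
  unfolding lin_def by (rule sum.mono_neutral_left) (auto simp: in_keys_iff)

lemma lin_add: "lin F (f + g) = lin F f + lin F g"
proof -
  let ?A = "Poly_Mapping.keys f \<union> Poly_Mapping.keys g"
  have A: "finite ?A" "Poly_Mapping.keys (f + g) \<subseteq> ?A" by (auto simp: keys_add)
  show ?thesis
    unfolding lin_superset[OF A] lin_superset[OF A(1), of f] lin_superset[OF A(1), of g]
    by (simp add: lin_superset[OF A(1)] lookup_add pm.scale_left_distrib sum.distrib)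
qed

lemma lin_sc: "lin F (sc c f) = sc c (lin F f)"
  unfolding lin_superset[OF finite_keys keys_sc]
  by (simp add: lin_def pm.scale_sum_right)

lemma linear_lin: "Vector_Spaces.linear sc sc (lin F)"
  by unfold_locales (auto simp: lin_add lin_sc)

lemma lin_single [simp]: "lin F (Poly_Mapping.single p c) = sc c (F p)"
  by (simp add: lin_superset[of "{p}"])

lemma lin_0 [simp]: "lin F 0 = 0"
  by (simp add: lin_def)

lemma lin_cong: "(\<And>p. p \<in> Poly_Mapping.keys f \<Longrightarrow> F p = G p) \<Longrightarrow> lin F f = lin G f"
  by (simp add: lin_def)

lemma lin_sum: "lin F (\<Sum>i\<in>I. g i) = (\<Sum>i\<in>I. lin F (g i))"
  by (induction I rule: infinite_finite_induct) (auto simp: lin_add)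

lemma lin_plus_fun: "lin (\<lambda>p. F p + G p) f = lin F f + lin G f"
  by (simp add: lin_def pm.scale_right_distrib sum.distrib)

lemma lin_sc_fun: "lin (\<lambda>p. sc c (F p)) f = sc c (lin F f)"
  by (simp add: lin_def pm.scale_sum_right mult.commute)

lemma lin_swap: "lin (\<lambda>p. lin (\<lambda>q. F p q) g) f = lin (\<lambda>q. lin (\<lambda>p. F p q) f) g"
  unfolding lin_def pm.scale_sum_right by (subst sum.swap) (simp add: mult.commute)

definition dg :: "'a \<Rightarrow> ('a \<Rightarrow>\<^sub>0 complex)" where
  "dg p = Poly_Mapping.single p 1"

lemma lin_dg [simp]: "lin F (dg p) = F p"
  by (simp add: dg_def)

lemma lin_id: "lin dg f = f"
proof (rule poly_mapping_eqI)
  fix k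
  have "Poly_Mapping.lookup (lin dg f) k =
      (\<Sum>p\<in>Poly_Mapping.keys f. if k = p then Poly_Mapping.lookup f p else 0)"
    unfolding lin_def lookup_sum by (intro sum.cong) (auto simp: dg_def lookup_single when_def)
  also have "\<dots> = Poly_Mapping.lookup f k"
    by (simp add: in_keys_iff)
  finally show "Poly_Mapping.lookup (lin dg f) k = Poly_Mapping.lookup f k" .
qed

definition supp_on :: "'a set \<Rightarrow> ('a \<Rightarrow>\<^sub>0 complex) set" where
  "supp_on X = {f. Poly_Mapping.keys f \<subseteq> X}"

lemma supp_on_iff: "f \<in> supp_on X \<longleftrightarrow> (\<forall>p. p \<notin> X \<longrightarrow> Poly_Mapping.lookup f p = 0)"
  by (auto simp: supp_on_def in_keys_iff)

lemma subspace_supp_on: "pm.subspace (supp_on X)"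
  by (auto simp: pm.subspace_def supp_on_iff lookup_add)

lemma dg_supp_on [simp]: "dg p \<in> supp_on X \<longleftrightarrow> p \<in> X"
  by (auto simp: supp_on_def dg_def)

lemma lin_in_subspace:
  assumes "pm.subspace S" "f \<in> supp_on X" "\<And>p. p \<in> X \<Longrightarrow> F p \<in> S"
  shows "lin F f \<in> S"
  unfolding lin_def using assms
  by (intro pm.subspace_sum[OF assms(1)] pm.subspace_scale[OF assms(1)]) (auto simp: supp_on_def)

lemma supp_on_span: "supp_on X = pm.span (dg ` X)"
proof
  show "supp_on X \<subseteq> pm.span (dg ` X)"
  proof
    fix f assume "f \<in> supp_on X"
    then have "lin dg f \<in> pm.span (dg ` X)"
      by (rule lin_in_subspace[OF pm.subspace_span]) (auto intro: pm.span_base)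
    then show "f \<in> pm.span (dg ` X)" by (simp add: lin_id)
  qed
  show "pm.span (dg ` X) \<subseteq> supp_on X"
    by (rule pm.span_minimal[OF _ subspace_supp_on]) auto
qed

lemma linear_eq_lin: "Vector_Spaces.linear sc sc L \<Longrightarrow> L f = lin (\<lambda>p. L (dg p)) f"
proof -
  assume "Vector_Spaces.linear sc sc L"
  then interpret L: Vector_Spaces.linear sc sc L .
  have "L (lin dg f) = lin (\<lambda>p. L (dg p)) f"
    unfolding lin_def by (simp add: L.sum L.scale)
  then show ?thesis by (simp add: lin_id)
qed

text \<open>Reduces a claim about an element to single diagrams; with \<open>S\<close> the zero
  space it becomes a vanishing criterion.\<close>

lemma linear_in_subspace:
  assumes "Vector_Spaces.linear sc sc L" "pm.subspace S" "f \<in> supp_on X" "\<And>p. p \<in> X \<Longrightarrow> L (dg p) \<in> S"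
  shows "L f \<in> S"
  unfolding linear_eq_lin[OF assms(1), of f] by (rule lin_in_subspace[OF assms(2-4)])

lemma linear_eq_on_supp:
  assumes "Vector_Spaces.linear sc sc L" "Vector_Spaces.linear sc sc M" "f \<in> supp_on X"
    "\<And>p. p \<in> X \<Longrightarrow> L (dg p) = M (dg p)"
  shows "L f = M f"
  unfolding linear_eq_lin[OF assms(1), of f] linear_eq_lin[OF assms(2), of f]
  using assms(3,4) by (intro lin_cong) (auto simp: supp_on_def)

section \<open>The Temperley--Lieb category as a linear category\<close>

text \<open>Diagrams with different numbers of dots on the two sides are included, since
  factorisations through fewer strands and the bases of the simple modules consist of such
  diagrams.\<close>

definition H :: "nat \<Rightarrow> nat \<Rightarrow> tl set" where
  "H a b = supp_on (matchings a b)"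

locale tl_alg = fixes \<delta> :: complex
begin

abbreviation mult (infixl "\<star>" 70) where "f \<star> g \<equiv> tl_mult \<delta> f g"

abbreviation one where "one n \<equiv> dg (id_diagram n)"

lemma mult_lin: "f \<star> g = lin (\<lambda>p. lin (\<lambda>r. sc (\<delta> ^ loops p r) (dg (diagram_concat p r))) g) f"
  unfolding tl_mult_def lin_def by (simp add: dg_def pm.scale_sum_right mult.assoc)

lemma mult_dg: "dg p \<star> dg r = sc (\<delta> ^ loops p r) (dg (diagram_concat p r))"
  by (simp add: mult_lin)

lemma linear_mult_left: "Vector_Spaces.linear sc sc (\<lambda>f. f \<star> g)"
  unfolding mult_lin by (rule linear_lin)

lemma linear_mult_right: "Vector_Spaces.linear sc sc (\<lambda>g. f \<star> g)"
  unfolding mult_lin by (subst lin_swap) (rule linear_lin)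

sublocale left: Vector_Spaces.linear sc sc "\<lambda>f. f \<star> g" for g by (rule linear_mult_left)
sublocale right: Vector_Spaces.linear sc sc "\<lambda>g. f \<star> g" for f by (rule linear_mult_right)

lemma mult_closed: "f \<in> H a b \<Longrightarrow> g \<in> H b c \<Longrightarrow> f \<star> g \<in> H a c"
proof -
  assume f: "f \<in> H a b" and g: "g \<in> H b c"
  have "lin (\<lambda>r. sc (\<delta> ^ loops p r) (dg (diagram_concat p r))) g \<in> H a c" if "p \<in> matchings a b" for p
    unfolding H_def
    by (rule lin_in_subspace[OF subspace_supp_on g[unfolded H_def]])
       (auto intro!: pm.subspace_scale[OF subspace_supp_on] concat_matching[OF that])
  then show ?thesis unfolding mult_lin H_def
    by (intro lin_in_subspace[OF subspace_supp_on f[unfolded H_def]])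
qed

lemma mult_assoc:
  assumes f: "f \<in> H a b" and g: "g \<in> H b c" and h: "h \<in> H c d"
  shows "f \<star> g \<star> h = f \<star> (g \<star> h)"
proof -
  have 1: "dg p \<star> dg q \<star> dg r = dg p \<star> (dg q \<star> dg r)"
    if "p \<in> matchings a b" "q \<in> matchings b c" "r \<in> matchings c d" for p q r
  proof -
    have "\<delta> ^ loops p q * \<delta> ^ loops (diagram_concat p q) r
        = \<delta> ^ loops q r * \<delta> ^ loops p (diagram_concat q r)"
      using loops_assoc_matching[OF that] by (simp flip: power_add)
    then show ?thesis by (simp add: mult_dg left.scale right.scale concat_assoc)
  qed
  have lin3: "Vector_Spaces.linear sc sc (\<lambda>f. f \<star> g \<star> h)" for g h
    by unfold_locales (auto simp: left.add left.scale)
  have lin3': "Vector_Spaces.linear sc sc (\<lambda>g. f \<star> g \<star> h)" "Vector_Spaces.linear sc sc (\<lambda>g. f \<star> (g \<star> h))" for f h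
    by (unfold_locales; auto simp: left.add left.scale right.add right.scale)+
  have lin3'': "Vector_Spaces.linear sc sc (\<lambda>h. f \<star> (g \<star> h))" for f g
    by unfold_locales (auto simp: right.add right.scale)
  have 2: "dg p \<star> dg q \<star> h = dg p \<star> (dg q \<star> h)" if "p \<in> matchings a b" "q \<in> matchings b c" for p q
    by (rule linear_eq_on_supp[OF linear_mult_right lin3'' h[unfolded H_def]]) (rule 1[OF that])
  have 3: "dg p \<star> g \<star> h = dg p \<star> (g \<star> h)" if "p \<in> matchings a b" for p
    by (rule linear_eq_on_supp[OF lin3' g[unfolded H_def]]) (rule 2[OF that])
  show ?thesis
    by (rule linear_eq_on_supp[OF lin3 linear_mult_left f[unfolded H_def]]) (rule 3)
qed

lemma dg_H [simp]: "dg p \<in> H a b \<longleftrightarrow> p \<in> matchings a b"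
  by (simp add: H_def)

lemma one_H [simp]: "one n \<in> H n n"
  by (simp add: id_matching)

lemma one_mult: "f \<in> H a b \<Longrightarrow> one a \<star> f = f"
proof -
  assume f: "f \<in> H a b"
  have idl: "Vector_Spaces.linear sc sc (\<lambda>f. f)" by unfold_locales auto
  show ?thesis
    by (rule linear_eq_on_supp[OF linear_mult_right idl f[unfolded H_def]])
       (simp add: mult_dg concat_id_left)
qed

lemma mult_one: "f \<in> H a b \<Longrightarrow> f \<star> one b = f"
proof -
  assume f: "f \<in> H a b"
  have idl: "Vector_Spaces.linear sc sc (\<lambda>f. f)" by unfold_locales auto
  show ?thesis
    by (rule linear_eq_on_supp[OF linear_mult_left idl f[unfolded H_def]])
       (simp add: mult_dg concat_id_right)
qed

lemma H_add: "f \<in> H a b \<Longrightarrow> g \<in> H a b \<Longrightarrow> f + g \<in> H a b"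
  and H_diff: "f \<in> H a b \<Longrightarrow> g \<in> H a b \<Longrightarrow> f - g \<in> H a b"
  and H_sc: "f \<in> H a b \<Longrightarrow> sc c f \<in> H a b"
  and H_0: "0 \<in> H a b"
  unfolding H_def
  using pm.subspace_add[OF subspace_supp_on] pm.subspace_diff[OF subspace_supp_on]
    pm.subspace_scale[OF subspace_supp_on] pm.subspace_0[OF subspace_supp_on] by auto

text \<open>The trivial module in disguise: diagrams other than the identity span an ideal, because
  a left block of the first factor survives in the product.\<close>

lemma lookup_mult_id:
  assumes f: "f \<in> H n n" and g: "g \<in> H n n"
  shows "Poly_Mapping.lookup (f \<star> g) (id_diagram n) =
    Poly_Mapping.lookup f (id_diagram n) * Poly_Mapping.lookup g (id_diagram n)"
proof -
  have 1: "dg p \<star> dg r \<in> supp_on (UNIV - {id_diagram n})"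
    if p: "p \<in> matchings n n" and r: "r \<in> matchings n n" and "p \<noteq> id_diagram n \<or> r \<noteq> id_diagram n" for p r
  proof -
    have "diagram_concat p r \<noteq> id_diagram n"
    proof (cases "p = id_diagram n")
      case True
      then show ?thesis using that(3) concat_id_left(1)[OF r] by simp
    next
      case False
      then obtain x y where "{x, y} \<in> p" "x < y" "y < 0" using left_block_exists[OF p] by blast
      then have "{x, y} \<in> diagram_concat p r" using concat_left_block[OF p r] by simp
      then show ?thesis using \<open>x < y\<close> \<open>y < 0\<close> by (auto simp: id_block)
    qed
    then show ?thesis
      unfolding mult_dg by (intro pm.subspace_scale[OF subspace_supp_on]) simp
  qed
  define N :: "tl set" where "N = supp_on (UNIV - {id_diagram n})"
  have N: "pm.subspace N" unfolding N_def by (rule subspace_supp_on)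
  have dec: "\<exists>h. h \<in> supp_on (matchings n n - {id_diagram n}) \<and>
     f = sc (Poly_Mapping.lookup f (id_diagram n)) (one n) + h" if "f \<in> H n n" for f
    using that
    by (intro exI[of _ "f - sc (Poly_Mapping.lookup f (id_diagram n)) (one n)"])
       (auto simp: H_def supp_on_iff lookup_minus dg_def lookup_single when_def)
  obtain f' where f': "f' \<in> supp_on (matchings n n - {id_diagram n})"
    "f = sc (Poly_Mapping.lookup f (id_diagram n)) (one n) + f'" using dec[OF f] by blast
  obtain g' where g': "g' \<in> supp_on (matchings n n - {id_diagram n})"
    "g = sc (Poly_Mapping.lookup g (id_diagram n)) (one n) + g'" using dec[OF g] by blast
  have "dg p \<star> g \<in> N" if "p \<in> matchings n n - {id_diagram n}" for p
    by (rule linear_in_subspace[OF linear_mult_right N g[unfolded H_def]]) (use 1 that N_def in auto)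
  then have fg: "f' \<star> g \<in> N" by (rule linear_in_subspace[OF linear_mult_left N f'(1)])
  have "g' \<in> N" using g'(1) by (auto simp: N_def supp_on_def)
  then have zero: "Poly_Mapping.lookup g' (id_diagram n) = 0" "Poly_Mapping.lookup (f' \<star> g) (id_diagram n) = 0"
    using fg by (auto simp: N_def supp_on_iff)
  have "f \<star> g = sc (Poly_Mapping.lookup f (id_diagram n)) g + f' \<star> g"
    by (subst f'(2)) (simp add: left.add left.scale one_mult[OF g])
  then show ?thesis using zero by (simp add: lookup_add)
qed

end

section \<open>Jones--Wenzl projectors\<close>

text \<open>\<open>jw_den \<delta> m\<close> is the quotient \<open>[m + 2] / [m + 1]\<close> of quantum integers.\<close>

fun jw_den :: "complex \<Rightarrow> nat \<Rightarrow> complex" where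
  "jw_den \<delta> 0 = \<delta>"
| "jw_den \<delta> (Suc m) = \<delta> - 1 / jw_den \<delta> m"

context tl_alg
begin

declare id_matching [simp]

abbreviation u where "u n i \<equiv> dg (U n i)"

lemma u_H: "1 \<le> i \<Longrightarrow> i < int n \<Longrightarrow> u n i \<in> H n n"
  using U_eq(3) by simp

lemma u_eq:
  assumes "1 \<le> i" "i < int n"
  shows "u n i = dg (cup (n - 2) i) \<star> dg (cap (n - 2) i)"
  using U_eq[OF assms] by (simp add: mult_dg)

text \<open>The cap of the generator closes the cup of \<open>d\<close> to a loop, which gives the
  factor \<open>\<delta>\<close>, and the cup of the generator restores what was removed.\<close>

lemma u_left_cup:
  assumes d: "d \<in> matchings n b" and cup: "{- i - 1, - i} \<in> d" and i: "1 \<le> i"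
  shows "u n i \<star> dg d = sc \<delta> (dg d)" "i < int n"
proof -
  obtain a d' where ad: "n = a + 2" "i \<le> int a + 1" "d' \<in> matchings a b" "d = ins i d'"
    using strip_left_cup[OF d cup i] .
  then show "i < int n" by simp
  then have c: "dg (cup a i) \<in> H n a" "dg (cap a i) \<in> H a n" "u n i = dg (cup a i) \<star> dg (cap a i)"
    using U_eq(4,5)[OF i, of n] u_eq[OF i, of n] ad(1) by auto
  have d': "dg d' \<in> H a b" using ad(3) by simp
  have d_eq: "dg d = dg (cup a i) \<star> dg d'"
    using concat_cup[OF ad(3) i ad(2)] ad(4) by (simp add: mult_dg)
  have "dg (cap a i) \<star> dg d = sc \<delta> (dg d')"
    unfolding ad(4) using concat_cap_ins[OF ad(3) i ad(2)] by (simp add: mult_dg)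
  then have "u n i \<star> dg d = dg (cup a i) \<star> sc \<delta> (dg d')"
    using mult_assoc[OF c(1,2), of "dg d" b] d c(3) by simp
  then show "u n i \<star> dg d = sc \<delta> (dg d)" by (simp add: right.scale d_eq)
qed

lemma mirror_U:
  assumes "1 \<le> i" "i < int n" shows "mirror (U n i) = U n i"
  using U_eq(1)[OF assms] mirror_concat_matching(1)[OF U_eq(4,5)[OF assms]]
  by (simp add: cap_def)

lemma u_right_cup:
  assumes d: "d \<in> matchings b n" and cup: "{i, i + 1} \<in> d" and i: "1 \<le> i"
  shows "dg d \<star> u n i = sc \<delta> (dg d)" "i < int n"
proof -
  have m: "mirror d \<in> matchings n b" by (rule mirror_matching[OF d])
  have "{i + 1, i} \<in> d" using cup by (simp only: insert_commute)
  then have "{- (i + 1), - i} \<in> mirror d" by (simp only: mirror_block minus_minus)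
  moreover have "- (i + 1) = - i - 1" by simp
  ultimately have cup': "{- i - 1, - i} \<in> mirror d" by (simp only:)
  show i': "i < int n" by (rule u_left_cup(2)[OF m cup' i])
  have "U n i \<in> matchings n n" by (rule U_eq(3)[OF i i'])
  note mc = mirror_concat_matching[OF this m]
  have "diagram_concat d (U n i) = mirror (diagram_concat (U n i) (mirror d))"
    "loops d (U n i) = loops (U n i) (mirror d)"
    using mc by (simp_all add: mirror_U[OF i i'])
  moreover have "diagram_concat (U n i) (mirror d) = mirror d \<and> loops (U n i) (mirror d) = 1"
  proof -
    obtain a d' where ad: "n = a + 2" "i \<le> int a + 1" "d' \<in> matchings a b" "mirror d = ins i d'"
      using strip_left_cup[OF m cup' i] .
    have n: "n - 2 = a" using ad(1) by simp
    note U = U_eq[OF i i', unfolded n]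
    note cp = concat_cap_ins[OF ad(3) i ad(2), folded ad(4)] and cu = concat_cup[OF ad(3) i ad(2), folded ad(4)]
    have "diagram_concat (U n i) (mirror d) = mirror d"
      unfolding U(1) concat_assoc cp(1) cu(1) ..
    moreover have "loops (U n i) (mirror d) = 1"
      using loops_assoc_matching[OF U(4,5) m] unfolding U(1)[symmetric] U(2) cp cu(2) by simp
    ultimately show ?thesis ..
  qed
  ultimately show "dg d \<star> u n i = sc \<delta> (dg d)" by (simp add: mult_dg)
qed

lemma u_square:
  assumes "1 \<le> i" "i < int n" shows "u n i \<star> u n i = sc \<delta> (u n i)"
  by (rule u_left_cup(1)[OF U_eq(3)[OF assms] U_left assms(1)])

lemma u_far:
  assumes "1 \<le> i" "i < int n" "1 \<le> j" "j < int n" "i + 2 \<le> j \<or> j + 2 \<le> i"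
  shows "u n i \<star> u n j = u n j \<star> u n i"
proof -
  have "j + 2 \<le> i \<or> i + 2 \<le> j" using assms(5) by blast
  then show ?thesis
    using U_far[OF assms] U_far(2)[OF assms(3,4,1,2)] by (simp add: mult_dg)
qed

text \<open>Writing each generator as a cup times a cap, the two inner cap-cup pairs straighten to
  identities by \<open>zigzag\<close>.\<close>

lemma u_braid:
  assumes i: "1 \<le> i" "i + 1 < int n"
  shows "u n (i + 1) \<star> u n i \<star> u n (i + 1) = u n (i + 1)"
proof -
  define a where "a = n - 2"
  have n: "n = a + 2" and ia: "i \<le> int a" "i \<le> int a + 1" "i + 1 \<le> int a + 1" "1 \<le> i + 1"
    using i by (auto simp: a_def)
  have H: "dg (cup a i) \<in> H n a" "dg (cup a (i + 1)) \<in> H n a" "dg (cap a i) \<in> H a n" "dg (cap a (i + 1)) \<in> H a n"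
    using cup_matching[OF i(1) ia(2)] cup_matching[OF ia(4,3)] cap_matching[OF i(1) ia(2)] cap_matching[OF ia(4,3)]
    unfolding n by (simp_all only: dg_H)
  have zz: "dg (cap a i) \<star> dg (cup a (i + 1)) = one a" "dg (cap a (i + 1)) \<star> dg (cup a i) = one a"
    unfolding mult_dg zigzag[OF i(1) ia(1)] by (simp_all only: power_0 pm.scale_one)
  have us: "u n i = dg (cup a i) \<star> dg (cap a i)" "u n (i + 1) = dg (cup a (i + 1)) \<star> dg (cap a (i + 1))"
    unfolding a_def using i by (intro u_eq; linarith)+
  let ?x = "dg (cup a i)" and ?y = "dg (cup a (i + 1))" and ?x' = "dg (cap a i)" and ?y' = "dg (cap a (i + 1))"
  have 1: "?y \<star> ?y' \<star> (?x \<star> ?x') = ?y \<star> ?x'"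
  proof -
    have "?y \<star> ?y' \<star> (?x \<star> ?x') = ?y \<star> ?y' \<star> ?x \<star> ?x'"
      by (rule mult_assoc[symmetric, OF mult_closed[OF H(2,4)] H(1,3)])
    also have "?y \<star> ?y' \<star> ?x = ?y \<star> (?y' \<star> ?x)" by (rule mult_assoc[OF H(2,4,1)])
    also have "\<dots> = ?y" unfolding zz by (rule mult_one[OF H(2)])
    finally show ?thesis .
  qed
  have "?y \<star> ?x' \<star> (?y \<star> ?y') = ?y \<star> ?y'"
  proof -
    have "?y \<star> ?x' \<star> (?y \<star> ?y') = ?y \<star> ?x' \<star> ?y \<star> ?y'"
      by (rule mult_assoc[symmetric, OF mult_closed[OF H(2,3)] H(2,4)])
    also have "?y \<star> ?x' \<star> ?y = ?y \<star> (?x' \<star> ?y)" by (rule mult_assoc[OF H(2,3,2)])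
    also have "\<dots> = ?y" unfolding zz by (rule mult_one[OF H(2)])
    finally show ?thesis .
  qed
  with 1 show ?thesis by (simp add: us)
qed

text \<open>Wenzl's recursion inside a fixed TL_n: \<open>jw n m\<close> is the projector on the
  first \<open>m\<close> strands, and \<open>1 / jw_den \<delta> (m - 1)\<close> is the coefficient
  [m]/[m + 1]. The projectors on 0 and on 1 strands are both the unit, hence the separate
  case.\<close>

fun jw :: "nat \<Rightarrow> nat \<Rightarrow> tl" where
  "jw n 0 = one n"
| "jw n (Suc m) = (if m = 0 then one n
     else jw n m - sc (1 / jw_den \<delta> (m - 1)) (jw n m \<star> u n (int m) \<star> jw n m))"

end

text \<open>The form in which genericity of \<open>q\<close> enters: no denominator of the recursion
  vanishes. The case \<open>m = 0\<close> says that \<open>\<delta>\<close> is invertible.\<close>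

locale tl_generic = tl_alg +
  assumes den: "jw_den \<delta> m \<noteq> 0"
begin

lemma delta_nz: "\<delta> \<noteq> 0"
  using den[of 0] by simp

context
  fixes n :: nat
begin

private lemma A_assoc: "f \<in> H n n \<Longrightarrow> g \<in> H n n \<Longrightarrow> h \<in> H n n \<Longrightarrow> f \<star> g \<star> h = f \<star> (g \<star> h)"
  by (rule mult_assoc)

private lemma uM: "1 \<le> i \<Longrightarrow> i < n \<Longrightarrow> U n (int i) \<in> matchings n n"
  by (rule U_eq(3)) auto

private lemma uH: "1 \<le> i \<Longrightarrow> i < n \<Longrightarrow> u n (int i) \<in> H n n"
  by (simp add: uM)

lemma jw_H: "m \<le> n \<Longrightarrow> jw n m \<in> H n n"
proof (induction m)
  case (Suc m)
  then show ?case by (auto intro!: H_diff H_sc mult_closed uM)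
qed simp

lemma jw_coeff: "m \<le> n \<Longrightarrow> Poly_Mapping.lookup (jw n m) (id_diagram n) = 1"
proof (induction m)
  case 0
  then show ?case by (simp add: dg_def)
next
  case (Suc m)
  show ?case
  proof (cases "m = 0")
    case False
    have P: "jw n m \<in> H n n" and v: "u n (int m) \<in> H n n" using jw_H uM Suc False by auto
    have "U n (int m) \<noteq> id_diagram n"
      using U_left[of "int m" n] id_block[of "- int m - 1" "- int m" n] False by auto
    then have "Poly_Mapping.lookup (u n (int m)) (id_diagram n) = 0"
      by (simp add: dg_def lookup_single when_def)
    then have "Poly_Mapping.lookup (jw n m \<star> u n (int m) \<star> jw n m) (id_diagram n) = 0"
      using lookup_mult_id[OF mult_closed[OF P v] P] lookup_mult_id[OF P v] by simp
    then show ?thesis using Suc False by (simp add: lookup_minus)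
  qed (simp add: dg_def)
qed

text \<open>The relations have to be carried through one induction, since each needs the others one
  step earlier. The decisive one is \<open>u \<star> (jw n m \<star> u) = sc (jw_den \<delta> (m -
  1)) (jw n (m - 1) \<star> u)\<close> for the generator \<open>u\<close> at position
  \<open>m\<close>, the algebraic form of a partial trace of the projector.\<close>

lemma jw_rel:
  assumes "1 \<le> m" "m \<le> n"
  shows "jw n m \<star> jw n m = jw n m \<and>
    (\<forall>i. 1 \<le> i \<longrightarrow> i < m \<longrightarrow> u n (int i) \<star> jw n m = 0 \<and> jw n m \<star> u n (int i) = 0) \<and>
    (\<forall>j. m < j \<longrightarrow> j < n \<longrightarrow> u n (int j) \<star> jw n m = jw n m \<star> u n (int j)) \<and>
    (m < n \<longrightarrow> u n (int m) \<star> jw n (m - 1) = jw n (m - 1) \<star> u n (int m)) \<and>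
    (m < n \<longrightarrow> u n (int m) \<star> (jw n m \<star> u n (int m)) = sc (jw_den \<delta> (m - 1)) (jw n (m - 1) \<star> u n (int m))) \<and>
    jw n m \<star> jw n (m - 1) = jw n m \<and> jw n (m - 1) \<star> jw n m = jw n m"
  using assms
proof (induction m rule: nat_induct_at_least)
  case base
  have o: "one n \<star> f = f" "f \<star> one n = f" if "f \<in> H n n" for f using one_mult mult_one that by auto
  show ?case using uH[of 1] u_square[of 1 n] uH by (auto simp: o)
next
  case (Suc m)
  define P where "P = jw n m"
  define R where "R = jw n (m - 1)"
  define v where "v = u n (int m)"
  define d where "d = jw_den \<delta> (m - 1)"
  define Q where "Q = jw n (Suc m)"
  have m: "m < n" "1 \<le> m" using Suc by auto
  have d: "d \<noteq> 0" using den by (simp add: d_def)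
  have [simp]: "P \<in> H n n" "R \<in> H n n" "v \<in> H n n" using jw_H uM m by (auto simp: P_def R_def v_def)
  have cl [simp]: "f \<star> g \<in> H n n" if "f \<in> H n n" "g \<in> H n n" for f g using that by (rule mult_closed)
  note IH = Suc.IH[unfolded P_def[symmetric] R_def[symmetric] v_def[symmetric] d_def[symmetric]]
  have PP: "P \<star> P = P" and PR: "P \<star> R = P" and RP: "R \<star> P = P"
    and vR: "v \<star> R = R \<star> v" and vPv: "v \<star> (P \<star> v) = sc d (R \<star> v)"
    using IH m by auto
  have Q: "Q = P - sc (1 / d) (P \<star> (v \<star> P))"
  proof -
    have "Q = P - sc (1 / d) (P \<star> v \<star> P)" using m by (simp add: Q_def P_def v_def d_def)
    then show ?thesis by (simp add: A_assoc)
  qed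
  have [simp]: "Q \<in> H n n" unfolding Q by (intro H_diff H_sc cl) auto
  \<comment> \<open>The coefficient \<open>1 / d\<close> of the recursion is chosen for this
    cancellation: multiplied by \<open>v\<close>, the correction term becomes
    \<open>v \<star> P\<close> by \<open>vPv\<close>.\<close>
  have vQ: "v \<star> Q = 0"
  proof -
    have "v \<star> (P \<star> (v \<star> P)) = v \<star> (P \<star> v) \<star> P" by (simp add: A_assoc)
    also have "\<dots> = sc d (R \<star> (v \<star> P))" unfolding vPv by (simp add: left.scale A_assoc)
    also have "R \<star> (v \<star> P) = v \<star> (R \<star> P)" using vR by (simp flip: A_assoc)
    also have "\<dots> = v \<star> P" by (simp add: RP)
    finally show ?thesis using d by (simp add: Q right.diff right.scale)
  qed
  have Qv: "Q \<star> v = 0"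
  proof -
    have "P \<star> (v \<star> P) \<star> v = P \<star> (v \<star> (P \<star> v))" by (simp add: A_assoc)
    also have "\<dots> = sc d (P \<star> (R \<star> v))" unfolding vPv by (simp add: right.scale)
    also have "P \<star> (R \<star> v) = P \<star> v" using PR by (simp flip: A_assoc)
    finally show ?thesis using d by (simp add: Q left.diff left.scale)
  qed
  have QP: "Q \<star> P = Q" by (simp add: Q left.diff left.scale A_assoc PP)
  have PQ: "P \<star> Q = Q"
  proof -
    have "P \<star> (P \<star> (v \<star> P)) = P \<star> (v \<star> P)" using PP by (simp flip: A_assoc)
    then show ?thesis by (simp add: Q right.diff right.scale PP)
  qed
  have QQ: "Q \<star> Q = Q"
  proof -
    have "Q \<star> Q = Q \<star> P - sc (1 / d) (Q \<star> (P \<star> (v \<star> P)))"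
      by (subst (2) Q) (simp add: right.diff right.scale)
    also have "Q \<star> (P \<star> (v \<star> P)) = Q \<star> v \<star> P" using QP by (simp flip: A_assoc)
    finally show ?thesis by (simp add: Qv QP left.zero)
  qed
  have kill: "u n (int i) \<star> Q = 0 \<and> Q \<star> u n (int i) = 0" if i: "1 \<le> i" "i < Suc m" for i
  proof (cases "i = m")
    case True
    then show ?thesis using vQ Qv by (simp add: v_def)
  next
    case False
    define w where "w = u n (int i)"
    have [simp]: "w \<in> H n n" using uM i m by (auto simp: w_def)
    have k: "w \<star> P = 0" "P \<star> w = 0" using IH i m False by (auto simp: w_def)
    have "w \<star> (P \<star> (v \<star> P)) = 0" using k by (simp add: left.zero flip: A_assoc)
    moreover have "P \<star> (v \<star> P) \<star> w = 0" using k by (simp add: right.zero A_assoc)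
    ultimately show ?thesis using k by (simp add: Q left.diff left.scale right.diff right.scale flip: w_def)
  qed
  have comm: "u n (int j) \<star> Q = Q \<star> u n (int j)" if j: "Suc m < j" "j < n" for j
  proof -
    define w where "w = u n (int j)"
    have [simp]: "w \<in> H n n" using uM j by (auto simp: w_def)
    have wP: "w \<star> P = P \<star> w" using IH j m by (auto simp: w_def)
    have wv: "w \<star> v = v \<star> w" unfolding w_def v_def by (rule u_far) (use j m in auto)
    have "w \<star> (P \<star> (v \<star> P)) = P \<star> (w \<star> (v \<star> P))" using wP by (simp flip: A_assoc)
    also have "w \<star> (v \<star> P) = v \<star> (w \<star> P)" using wv by (simp flip: A_assoc)
    also have "P \<star> (v \<star> (w \<star> P)) = P \<star> (v \<star> P) \<star> w" unfolding wP by (simp add: A_assoc)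
    finally show ?thesis by (simp add: Q left.diff left.scale right.diff right.scale wP flip: w_def)
  qed
  have comm': "Suc m < n \<Longrightarrow> u n (int (Suc m)) \<star> P = P \<star> u n (int (Suc m))"
    using IH m by auto
  have sandwich: "u n (int (Suc m)) \<star> (Q \<star> u n (int (Suc m))) = sc (jw_den \<delta> m) (P \<star> u n (int (Suc m)))"
    if mn: "Suc m < n"
  proof -
    define w where "w = u n (int (Suc m))"
    have [simp]: "w \<in> H n n" using uM mn by (auto simp: w_def simp del: of_nat_Suc)
    have wP: "w \<star> P = P \<star> w" using comm' mn by (simp add: w_def)
    have ww: "w \<star> w = sc \<delta> w" unfolding w_def by (rule u_square) (use mn in auto)
    have wvw: "w \<star> (v \<star> w) = w"
    proof -
      have "w \<star> v \<star> w = w"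
        using u_braid[of "int m" n] m mn by (simp add: w_def v_def add.commute)
      then show ?thesis by (simp add: A_assoc)
    qed
    have 1: "w \<star> (P \<star> w) = sc \<delta> (P \<star> w)"
    proof -
      have "w \<star> (P \<star> w) = P \<star> (w \<star> w)" using wP by (simp flip: A_assoc)
      then show ?thesis by (simp add: ww right.scale)
    qed
    have 2: "w \<star> (P \<star> (v \<star> P) \<star> w) = P \<star> w"
    proof -
      have "w \<star> (P \<star> (v \<star> P) \<star> w) = w \<star> P \<star> (v \<star> (P \<star> w))" by (simp add: A_assoc)
      also have "\<dots> = P \<star> w \<star> (v \<star> (w \<star> P))" by (simp only: wP)
      also have "\<dots> = P \<star> (w \<star> (v \<star> w) \<star> P)" by (simp add: A_assoc)
      also have "\<dots> = P \<star> (P \<star> w)" by (simp only: wvw wP)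
      also have "\<dots> = P \<star> w" using PP by (simp flip: A_assoc)
      finally show ?thesis .
    qed
    \<comment> \<open>Origin of the recursion for \<open>jw_den\<close>: the term \<open>P\<close>
      of \<open>Q\<close> contributes \<open>\<delta>\<close>, and the correction term contributes
      \<open>1 / d\<close>.\<close>
    have "jw_den \<delta> m = \<delta> - 1 / d" using m by (cases m) (auto simp: d_def)
    then have "w \<star> (Q \<star> w) = sc (jw_den \<delta> m) (P \<star> w)"
      by (simp add: Q left.diff left.scale right.diff right.scale 1 2 pm.scale_left_diff_distrib)
    then show ?thesis by (simp only: w_def)
  qed
  show ?case
    unfolding diff_Suc_1 P_def[symmetric] Q_def[symmetric]
    using QQ kill comm comm' sandwich QP PQ by blast
qed

end

definition JW :: "nat \<Rightarrow> tl" where "JW n = jw n n"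

lemma JW_H [simp]: "JW n \<in> H n n"
  unfolding JW_def by (rule jw_H) simp

lemma JW_coeff: "Poly_Mapping.lookup (JW n) (id_diagram n) = 1"
  unfolding JW_def by (rule jw_coeff) simp

lemma JW_idem: "JW n \<star> JW n = JW n"
proof (cases n)
  case 0
  then show ?thesis using one_mult[OF one_H, of 0] by (simp add: JW_def)
next
  case (Suc m)
  then show ?thesis using jw_rel[of n n] by (simp add: JW_def del: jw.simps)
qed

lemma JW_u:
  assumes "1 \<le> i" "i < int n" shows "u n i \<star> JW n = 0" "JW n \<star> u n i = 0"
  using jw_rel[of n n] assms
  by (auto simp: JW_def simp del: jw.simps dest!: spec[where x = "nat i"])

text \<open>Up to the nonzero factor \<open>\<delta>\<close>, \<open>dg d\<close> equals its own
  product with a generator, and the projector kills generators.\<close>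

lemma JW_left_cup:
  assumes d: "d \<in> matchings n b" and "{- i - 1, - i} \<in> d" "1 \<le> i"
  shows "JW n \<star> dg d = 0"
proof -
  have i: "i < int n" by (rule u_left_cup(2)[OF assms])
  have "JW n \<star> (u n i \<star> dg d) = 0"
    using mult_assoc[OF JW_H u_H[OF assms(3) i], of "dg d" b] JW_u(2)[OF assms(3) i] d
    by (simp add: left.zero)
  then show ?thesis unfolding u_left_cup(1)[OF assms] using delta_nz by (simp add: right.scale)
qed

lemma JW_right_cup:
  assumes d: "d \<in> matchings b n" and "{i, i + 1} \<in> d" "1 \<le> i"
  shows "dg d \<star> JW n = 0"
proof -
  have i: "i < int n" by (rule u_right_cup(2)[OF assms])
  have "dg d \<star> u n i \<star> JW n = 0"
    using mult_assoc[OF _ u_H[OF assms(3) i] JW_H, of "dg d" b] JW_u(1)[OF assms(3) i] d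
    by (simp add: right.zero)
  then show ?thesis unfolding u_right_cup(1)[OF assms] using delta_nz by (simp add: left.scale)
qed

lemma JW_left_block:
  assumes d: "d \<in> matchings n b" and "{x, y} \<in> d" "x < y" "y < 0"
  shows "JW n \<star> dg d = 0"
proof -
  obtain i where "1 \<le> i" "{- i - 1, - i} \<in> d" using left_cup[OF assms] by metis
  then show ?thesis using JW_left_cup[OF d] by blast
qed

lemma JW_right_block:
  assumes d: "d \<in> matchings b n" and "{x, y} \<in> d" "x < y" "0 < x"
  shows "dg d \<star> JW n = 0"
proof -
  obtain i where "1 \<le> i" "{i, i + 1} \<in> d" using right_cup[OF assms] by metis
  then show ?thesis using JW_right_cup[OF d] by blast
qed

end

section \<open>Half diagrams and small cups\<close>

text \<open>All right dots are ends of through strands. In this negative form it is plain how a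
  product leaves the simple module: by \<open>concat_right_block\<close> a right block never
  disappears under multiplication from the left.\<close>

definition right_free :: "diagram \<Rightarrow> bool" where
  "right_free w \<longleftrightarrow> \<not> (\<exists>x y. {x, y} \<in> w \<and> 0 < x \<and> x < y)"

lemma simple_basis_iff:
  "w \<in> simple_basis n k \<longleftrightarrow> w \<in> matchings n (n - 2 * k) \<and> right_free w"
proof
  assume w: "w \<in> simple_basis n k"
  then have m: "w \<in> matchings n (n - 2 * k)" by (simp add: simple_basis_def)
  have "\<not> ({x, y} \<in> w \<and> 0 < x \<and> x < y)" for x y
  proof
    assume H: "{x, y} \<in> w \<and> 0 < x \<and> x < y"
    then have "x \<in> dots n (n - 2 * k)" using matchings_mem[OF m] by blast
    then have "x \<in> {1..int (n - 2 * k)}" using H by (auto simp: dots_iff)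
    then obtain j where j: "j \<in> {- int n..-1}" "{j, x} \<in> w" using w unfolding simple_basis_def by blast
    have "{x, j} \<in> w" using j(2) by (simp add: insert_commute)
    then have "j = y" using matchings_unique[OF m] H by blast
    with j(1) H show False by simp
  qed
  with m show "w \<in> matchings n (n - 2 * k) \<and> right_free w" by (auto simp: right_free_def)
next
  assume *: "w \<in> matchings n (n - 2 * k) \<and> right_free w"
  then have m: "w \<in> matchings n (n - 2 * k)" by simp
  have "\<exists>j\<in>{- int n..-1}. {j, i} \<in> w" if i: "i \<in> {1..int (n - 2 * k)}" for i
  proof -
    have "i \<in> dots n (n - 2 * k)" using i by (simp add: dots_iff)
    then obtain j where j: "{i, j} \<in> w" "j \<noteq> i" "j \<in> dots n (n - 2 * k)" using matchings_obtain[OF m] by metis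
    have "{j, i} \<in> w" using j(1) by (simp add: insert_commute)
    have "\<not> 0 < j"
    proof
      assume "0 < j"
      have "0 < i" using i by simp
      have free: "\<not> (0 < x \<and> x < y)" if "{x, y} \<in> w" for x y using * that unfolding right_free_def by blast
      have "\<not> i < j" "\<not> j < i"
        using free[OF j(1)] free[OF \<open>{j, i} \<in> w\<close>] \<open>0 < i\<close> \<open>0 < j\<close> by auto
      then show False using j(2) by simp
    qed
    with j have "j \<in> {- int n..-1}" by (auto simp: dots_iff)
    with \<open>{j, i} \<in> w\<close> show ?thesis by blast
  qed
  with m show "w \<in> simple_basis n k" by (simp add: simple_basis_def)
qed

lemma right_block_exists:
  assumes p: "p \<in> matchings a b" and ab: "a < b \<or> (a = b \<and> p \<noteq> id_diagram a)"
  obtains x y where "{x, y} \<in> p" "x < y" "0 < x"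
proof -
  have m: "mirror p \<in> matchings b a" by (rule mirror_matching[OF p])
  have "a < b \<or> b = a \<and> mirror p \<noteq> id_diagram b" using ab by (metis mirror_id mirror_mirror)
  then obtain x y where xy: "{x, y} \<in> mirror p" "x < y" "y < 0" using left_block_exists[OF m] by blast
  then have "{- y, - x} \<in> p" by (simp add: insert_commute)
  then show ?thesis using that[of "- y" "- x"] xy by simp
qed

text \<open>\<open>eta m k\<close> has \<open>k\<close> small cups at the top left, above \<open>m\<close> through strands.\<close>

definition eta :: "nat \<Rightarrow> nat \<Rightarrow> diagram" where
  "eta m k = (ins 1 ^^ k) (id_diagram m)"

lemma ins1_matching: "e \<in> matchings m c \<Longrightarrow> (ins 1 ^^ k) e \<in> matchings (m + 2 * k) c"
proof (induction k)
  case (Suc k)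
  then show ?case using ins_matching[of "(ins 1 ^^ k) e" "m + 2 * k" c 1] by (simp add: add.commute add.left_commute)
qed simp

lemma eta_matching: "eta m k \<in> matchings (m + 2 * k) m"
  unfolding eta_def by (rule ins1_matching[OF id_matching])

lemma ins1_through: "{x, y} \<in> e \<Longrightarrow> x < 0 \<Longrightarrow> 0 < y \<Longrightarrow> {x - 2 * int k, y} \<in> (ins 1 ^^ k) e"
proof (induction k)
  case (Suc k)
  have "{sh 1 (x - 2 * int k), sh 1 y} \<in> (ins 1 ^^ Suc k) e"
    using ins_sh[OF Suc.IH[OF Suc.prems], of 1] by simp
  moreover have "sh 1 (x - 2 * int k) = x - 2 * int (Suc k)" using Suc.prems by (simp add: sh_def)
  moreover have "sh 1 y = y" using Suc.prems by simp
  ultimately show ?case by (simp only:)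
qed simp

lemma ins1_left: "{x, y} \<in> e \<Longrightarrow> x < 0 \<Longrightarrow> y < 0 \<Longrightarrow> {x - 2 * int k, y - 2 * int k} \<in> (ins 1 ^^ k) e"
proof (induction k)
  case (Suc k)
  have "{sh 1 (x - 2 * int k), sh 1 (y - 2 * int k)} \<in> (ins 1 ^^ Suc k) e"
    using ins_sh[OF Suc.IH[OF Suc.prems], of 1] by simp
  moreover have "sh 1 (x - 2 * int k) = x - 2 * int (Suc k)" "sh 1 (y - 2 * int k) = y - 2 * int (Suc k)"
    using Suc.prems by (simp_all add: sh_def)
  ultimately show ?case by (simp only:)
qed simp

lemma ins1_right: "{x, y} \<in> e \<Longrightarrow> 0 < x \<Longrightarrow> 0 < y \<Longrightarrow> {x, y} \<in> (ins 1 ^^ k) e"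
proof (induction k)
  case (Suc k)
  have "{sh 1 x, sh 1 y} \<in> (ins 1 ^^ Suc k) e"
    using ins_sh[OF Suc.IH[OF Suc.prems], of 1] by simp
  then show ?case using Suc.prems by simp
qed simp

context tl_alg
begin

abbreviation E where "E m k \<equiv> dg (eta m k)"
abbreviation E' where "E' m k \<equiv> dg (mirror (eta m k))"

lemma E_H: "E m k \<in> H (m + 2 * k) m" and E'_H: "E' m k \<in> H m (m + 2 * k)"
  using eta_matching mirror_matching[OF eta_matching] by simp_all

lemma E_Suc: "E m (Suc k) = dg (cup (m + 2 * k) 1) \<star> E m k"
  using concat_cup[OF eta_matching, of 1 m k] by (simp add: mult_dg eta_def)

lemma E'_Suc: "E' m (Suc k) = E' m k \<star> dg (cap (m + 2 * k) 1)"
  using concat_cup[OF eta_matching, of 1 m k]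
    mirror_concat_matching[OF cup_matching[of 1 "m + 2 * k"] eta_matching[of m k]]
  by (simp add: mult_dg eta_def cap_def)

lemma E_mult:
  assumes e: "e \<in> matchings m c" shows "E m k \<star> dg e = dg ((ins 1 ^^ k) e)"
proof (induction k)
  case 0
  then show ?case using one_mult[of "dg e" m c] e by (simp add: eta_def)
next
  case (Suc k)
  have "E m (Suc k) \<star> dg e = dg (cup (m + 2 * k) 1) \<star> (E m k \<star> dg e)"
    unfolding E_Suc using cup_matching[of 1 "m + 2 * k"] e
    by (intro mult_assoc[OF _ E_H]) auto
  also have "\<dots> = dg (ins 1 ((ins 1 ^^ k) e))"
    unfolding Suc using concat_cup[OF ins1_matching[OF e], of 1 k] by (simp add: mult_dg)
  finally show ?case by simp
qed

lemma E'_E: "E' m k \<star> E m k = sc (\<delta> ^ k) (one m)"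
proof (induction k)
  case 0
  then show ?case using one_mult[OF one_H, of m] by (simp add: eta_def)
next
  case (Suc k)
  let ?c = "dg (cap (m + 2 * k) 1)"
  have c: "?c \<in> H (m + 2 * k) (m + 2 * k + 2)" using cap_matching[of 1 "m + 2 * k"] by simp
  have E: "E m (Suc k) \<in> H (m + 2 * k + 2) m" using E_H[of m "Suc k"] by (simp add: add.commute add.left_commute)
  have "E' m (Suc k) \<star> E m (Suc k) = E' m k \<star> (?c \<star> E m (Suc k))"
    unfolding E'_Suc by (rule mult_assoc[OF E'_H c E])
  also have "?c \<star> E m (Suc k) = sc \<delta> (E m k)"
    using concat_cap_ins[OF eta_matching, of 1 m k] by (simp add: mult_dg eta_def)
  finally show ?case using Suc by (simp add: right.scale)
qed

text \<open>For \<open>b < c\<close> there are too few left dots in \<open>g\<close>, so each of its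
  diagrams has a right block, and that block survives.\<close>

lemma mult_in_right_block:
  assumes f: "f \<in> H a b" and g: "g \<in> H b c" and bc: "b < c"
  shows "f \<star> g \<in> supp_on {w \<in> matchings a c. \<not> right_free w}"
proof -
  let ?S = "supp_on {w \<in> matchings a c. \<not> right_free w}"
  have "dg p \<star> dg r \<in> ?S" if p: "p \<in> matchings a b" and r: "r \<in> matchings b c" for p r
  proof -
    obtain x y where xy: "{x, y} \<in> r" "x < y" "0 < x" using right_block_exists[OF r] bc by blast
    then have "{x, y} \<in> diagram_concat p r" using concat_right_block[OF p r] by simp
    then have "\<not> right_free (diagram_concat p r)" using xy by (auto simp: right_free_def)
    then show ?thesis unfolding mult_dg
      using concat_matching[OF p r] by (intro pm.subspace_scale[OF subspace_supp_on]) simp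
  qed
  then have "dg p \<star> g \<in> ?S" if "p \<in> matchings a b" for p
    by (rule linear_in_subspace[OF linear_mult_right subspace_supp_on g[unfolded H_def]]) (rule that)
  then show ?thesis
    by (rule linear_in_subspace[OF linear_mult_left subspace_supp_on f[unfolded H_def]])
qed

end

text \<open>A space closed under products and independent of numbers of dots, so that
  \<open>fin_assoc\<close> works as a rewrite rule without bookkeeping of sources and
  targets.\<close>

definition finitary :: "tl set" where
  "finitary = supp_on {p. finite (\<Union> p)}"

lemma finite_concat: "finite (\<Union> p) \<Longrightarrow> finite (\<Union> q) \<Longrightarrow> finite (\<Union> (diagram_concat p q))"
proof -
  assume "finite (\<Union> p)" "finite (\<Union> q)"
  moreover have "\<Union> (glued p q) = left_dot ` \<Union> p \<union> right_dot ` \<Union> q" unfolding glued_def by blast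
  ultimately have "finite (\<Union> (glued p q))" by simp
  moreover have "inj outer_dot" by (rule injI) (auto simp: outer_dot_def split: if_splits)
  ultimately have "finite (outer_dot -` \<Union> (glued p q))" by (rule finite_vimageI)
  moreover have "\<Union> (diagram_concat p q) \<subseteq> outer_dot -` \<Union> (glued p q)"
    using Union_comps[of "glued p q"] unfolding diagram_concat_def components_eq by blast
  ultimately show ?thesis by (rule finite_subset[rotated])
qed

lemma H_finitary: "f \<in> H a b \<Longrightarrow> f \<in> finitary"
  using finite_matching unfolding H_def finitary_def supp_on_def by blast

context tl_alg
begin

lemma finitary_mult [simp]:
  assumes f: "f \<in> finitary" and g: "g \<in> finitary" shows "f \<star> g \<in> finitary"
proof -
  have S: "pm.subspace finitary" unfolding finitary_def by (rule subspace_supp_on)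
  have "dg p \<star> dg r \<in> finitary" if "finite (\<Union> p)" "finite (\<Union> r)" for p r
    unfolding mult_dg using finite_concat[OF that] by (intro pm.subspace_scale[OF S]) (simp add: finitary_def)
  then have "dg p \<star> g \<in> finitary" if "finite (\<Union> p)" for p
    using that by (intro linear_in_subspace[OF linear_mult_right S g[unfolded finitary_def]]) auto
  then show ?thesis
    by (intro linear_in_subspace[OF linear_mult_left S f[unfolded finitary_def]]) auto
qed

lemma fin_assoc:
  assumes f: "f \<in> finitary" and g: "g \<in> finitary" and h: "h \<in> finitary"
  shows "f \<star> g \<star> h = f \<star> (g \<star> h)"
proof -
  have 1: "dg p \<star> dg q \<star> dg r = dg p \<star> (dg q \<star> dg r)"
    if "finite (\<Union> p)" "finite (\<Union> q)" "finite (\<Union> r)" for p q r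
  proof -
    have "\<delta> ^ loops p q * \<delta> ^ loops (diagram_concat p q) r
        = \<delta> ^ loops q r * \<delta> ^ loops p (diagram_concat q r)"
      using loops_assoc[OF that] by (simp flip: power_add)
    then show ?thesis by (simp add: mult_dg left.scale right.scale concat_assoc)
  qed
  have lin3: "Vector_Spaces.linear sc sc (\<lambda>f. f \<star> g \<star> h)" for g h
    by unfold_locales (auto simp: left.add left.scale)
  have lin3': "Vector_Spaces.linear sc sc (\<lambda>g. f \<star> g \<star> h)" "Vector_Spaces.linear sc sc (\<lambda>g. f \<star> (g \<star> h))" for f h
    by (unfold_locales; auto simp: left.add left.scale right.add right.scale)+
  have lin3'': "Vector_Spaces.linear sc sc (\<lambda>h. f \<star> (g \<star> h))" for f g
    by unfold_locales (auto simp: right.add right.scale)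
  have 2: "dg p \<star> dg q \<star> h = dg p \<star> (dg q \<star> h)" if "finite (\<Union> p)" "finite (\<Union> q)" for p q
    by (rule linear_eq_on_supp[OF linear_mult_right lin3'' h[unfolded finitary_def]]) (use 1[OF that] in simp)
  have 3: "dg p \<star> g \<star> h = dg p \<star> (g \<star> h)" if "finite (\<Union> p)" for p
    by (rule linear_eq_on_supp[OF lin3' g[unfolded finitary_def]]) (use 2[OF that] in simp)
  show ?thesis
    by (rule linear_eq_on_supp[OF lin3 linear_mult_left f[unfolded finitary_def]]) (use 3 in simp)
qed

lemma E_fin [simp]: "E m k \<in> finitary" "E' m k \<in> finitary" "one m \<in> finitary"
  using H_finitary[OF E_H] H_finitary[OF E'_H] H_finitary[OF one_H] by auto

lemma dg_fin: "d \<in> matchings a b \<Longrightarrow> dg d \<in> finitary"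
  using H_finitary by simp

end

context tl_generic
begin

lemma JW_fin [simp]: "JW m \<in> finitary"
  using H_finitary[OF JW_H] .

lemma JW_mult_less:
  assumes x: "x \<in> H a b" and "b < a" shows "JW a \<star> x = 0"
proof -
  have "JW a \<star> dg d \<in> {0}" if d: "d \<in> matchings a b" for d
  proof -
    obtain y z where "{y, z} \<in> d" "y < z" "z < 0" using left_block_exists[OF d] assms(2) by blast
    then show ?thesis using JW_left_block[OF d] by simp
  qed
  from linear_in_subspace[OF linear_mult_right _ x[unfolded H_def] this] show ?thesis
    by (simp add: pm.subspace_single_0)
qed

lemma mult_JW_zero:
  assumes x: "x \<in> supp_on {w \<in> matchings a b. \<not> right_free w}" shows "x \<star> JW b = 0"
proof -
  have "dg d \<star> JW b \<in> {0}" if d: "d \<in> {w \<in> matchings a b. \<not> right_free w}" for d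
    using JW_right_block[of d a b] d by (auto simp: right_free_def)
  from linear_in_subspace[OF linear_mult_left _ x this] show ?thesis
    by (simp add: pm.subspace_single_0)
qed

lemma mult_JW_less:
  assumes x: "x \<in> H a b" and "a < b" shows "x \<star> JW b = 0"
proof (rule mult_JW_zero)
  have "one a \<star> x \<in> supp_on {w \<in> matchings a b. \<not> right_free w}"
    by (rule mult_in_right_block[OF one_H x assms(2)])
  then show "x \<in> supp_on {w \<in> matchings a b. \<not> right_free w}" by (simp add: one_mult[OF x])
qed

lemma H_decompose:
  assumes "x \<in> H n n"
  obtains y where "y \<in> supp_on (matchings n n - {id_diagram n})"
    "x = sc (Poly_Mapping.lookup x (id_diagram n)) (one n) + y"
proof
  show "x - sc (Poly_Mapping.lookup x (id_diagram n)) (one n) \<in> supp_on (matchings n n - {id_diagram n})"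
    using assms by (auto simp: H_def supp_on_iff lookup_minus dg_def lookup_single when_def)
qed simp

text \<open>Any diagram other than the identity has a left block and is killed by the projector, so
  only the coefficient of the identity survives.\<close>

lemma JW_mult_same:
  assumes x: "x \<in> H a a" shows "JW a \<star> x = sc (Poly_Mapping.lookup x (id_diagram a)) (JW a)"
proof -
  obtain y where y: "y \<in> supp_on (matchings a a - {id_diagram a})"
    "x = sc (Poly_Mapping.lookup x (id_diagram a)) (one a) + y" using H_decompose[OF x] .
  have "JW a \<star> dg d \<in> {0}" if d: "d \<in> matchings a a - {id_diagram a}" for d
  proof -
    have d': "d \<in> matchings a a" using d by simp
    obtain y z where "{y, z} \<in> d" "y < z" "z < 0" using left_block_exists[OF d'] d by blast
    then show ?thesis using JW_left_block[OF d'] by simp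
  qed
  from linear_in_subspace[OF linear_mult_right _ y(1) this] have "JW a \<star> y = 0"
    by (simp add: pm.subspace_single_0)
  then show ?thesis by (subst y(2)) (simp add: right.add right.scale mult_one[OF JW_H])
qed

section \<open>The unit as a combination of products through projectors\<close>

text \<open>For fixed \<open>k\<close> these products belong to the simple module indexed by (n - k,
  k). That all of them together span the unit is the form in which semisimplicity is used.\<close>

definition ideal_gens :: "nat \<Rightarrow> tl set" where
  "ideal_gens n = {dg \<alpha> \<star> JW (n - 2 * k) \<star> dg \<beta> | \<alpha> \<beta> k. 2 * k \<le> n \<and>
     \<alpha> \<in> matchings n (n - 2 * k) \<and> \<beta> \<in> matchings (n - 2 * k) n}"

text \<open>Induction on the number \<open>n - 2 * k\<close> of strands through which the product
  factors. \<open>JW m\<close> is the identity plus diagrams with a left cup, so inserting it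
  changes the product only by terms that factor through fewer strands.\<close>

lemma mult_in_span_gens:
  assumes "2 * k \<le> n" and \<alpha>: "\<alpha> \<in> matchings n (n - 2 * k)" and \<beta>: "\<beta> \<in> matchings (n - 2 * k) n"
  shows "dg \<alpha> \<star> dg \<beta> \<in> pm.span (ideal_gens n)"
  using assms
proof (induction "n - 2 * k" arbitrary: k \<alpha> \<beta> rule: less_induct)
  case less
  let ?S = "pm.span (ideal_gens n)"
  define m where "m = n - 2 * k"
  have a: "\<alpha> \<in> matchings n m" and b: "\<beta> \<in> matchings m n" using less.prems by (auto simp: m_def)
  obtain y where y: "y \<in> supp_on (matchings m m - {id_diagram m})" "JW m = one m + y"
    using H_decompose[OF JW_H[of m]] JW_coeff[of m] by auto
  have "Vector_Spaces.linear sc sc (\<lambda>y. dg \<alpha> \<star> y \<star> dg \<beta>)"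
    by unfold_locales (auto simp: left.add left.scale right.add right.scale)
  then have "dg \<alpha> \<star> y \<star> dg \<beta> \<in> ?S"
  proof (rule linear_in_subspace[OF _ pm.subspace_span y(1)])
    fix d assume d: "d \<in> matchings m m - {id_diagram m}"
    then have d': "d \<in> matchings m m" by simp
    obtain x z where xz: "{x, z} \<in> d" "x < z" "z < 0" using left_block_exists[OF d'] d by blast
    obtain i where i: "1 \<le> i" "{- i - 1, - i} \<in> d" using left_cup[OF d' xz] by metis
    obtain l e where e: "m = l + 2" "i \<le> int l + 1" "e \<in> matchings l m" "d = ins i e"
      using strip_left_cup[OF d' i(2,1)] .
    have l: "l = n - 2 * Suc k" "2 * Suc k \<le> n" using e(1) m_def less.prems(1) by auto
    have c: "cup l i \<in> matchings m l" using cup_matching[OF i(1) e(2)] e(1) by simp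
    have "dg d = dg (cup l i) \<star> dg e" using concat_cup[OF e(3) i(1) e(2)] e(4) by (simp add: mult_dg)
    then have "dg \<alpha> \<star> dg d \<star> dg \<beta> = dg \<alpha> \<star> dg (cup l i) \<star> (dg e \<star> dg \<beta>)"
      using mult_assoc[of "dg \<alpha>" n m "dg (cup l i)" l "dg e" m]
        mult_assoc[of "dg \<alpha> \<star> dg (cup l i)" n l "dg e" m "dg \<beta>" n]
        mult_closed[of "dg \<alpha>" n m "dg (cup l i)" l] a b c e(3) by simp
    also have "\<dots> = sc (\<delta> ^ loops \<alpha> (cup l i) * \<delta> ^ loops e \<beta>)
        (dg (diagram_concat \<alpha> (cup l i)) \<star> dg (diagram_concat e \<beta>))"
      by (simp only: mult_dg[of \<alpha>] mult_dg[of e] left.scale right.scale pm.scale_scale mult.commute)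
    also have "\<dots> \<in> ?S"
    proof (rule pm.span_scale, rule less.hyps[of "Suc k"])
      show "n - 2 * Suc k < n - 2 * k" "2 * Suc k \<le> n" using l by auto
      show "diagram_concat \<alpha> (cup l i) \<in> matchings n (n - 2 * Suc k)"
        using concat_matching[OF a c] l by simp
      show "diagram_concat e \<beta> \<in> matchings (n - 2 * Suc k) n"
        using concat_matching[OF e(3) b] l by simp
    qed
    finally show "dg \<alpha> \<star> dg d \<star> dg \<beta> \<in> ?S" .
  qed
  moreover have "dg \<alpha> \<star> JW m \<star> dg \<beta> \<in> ?S"
    using less.prems by (intro pm.span_base) (auto simp: ideal_gens_def m_def)
  moreover have "dg \<alpha> \<star> dg \<beta> = dg \<alpha> \<star> JW m \<star> dg \<beta> - dg \<alpha> \<star> y \<star> dg \<beta>"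
    unfolding y(2) using mult_one[of "dg \<alpha>" n m] a by (simp add: right.add left.add)
  ultimately show ?case by (simp add: pm.span_diff)
qed

lemma one_in_span_gens: "one n \<in> pm.span (ideal_gens n)"
  using mult_in_span_gens[of 0 n "id_diagram n" "id_diagram n"] one_mult[OF one_H, of n] by simp

text \<open>The bilinear form on the simple module is nondegenerate.\<close>

lemma simple_radical:
  assumes kn: "2 * k \<le> n" and s: "s \<in> supp_on (simple_basis n k)"
    and zero: "\<And>\<beta>. \<beta> \<in> matchings (n - 2 * k) n \<Longrightarrow>
      Poly_Mapping.lookup (dg \<beta> \<star> s) (id_diagram (n - 2 * k)) = 0"
  shows "s = 0"
proof -
  define m where "m = n - 2 * k"
  let ?N = "supp_on {w \<in> matchings n m. \<not> right_free w}"
  have sH: "s \<in> H n m" using s by (auto simp: H_def supp_on_def simple_basis_iff m_def)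
  \<comment> \<open>Through fewer than \<open>m\<close> strands the product acquires a right block;
    through more it is killed by the projector; through exactly \<open>m\<close> strands the form
    appears, which vanishes by assumption. For \<open>x\<close> the unit, \<open>s\<close> has right
    blocks only, while its diagrams have none.\<close>
  have "x \<star> s \<in> ?N" if x: "x \<in> pm.span (ideal_gens n)" for x
  proof -
    have lin: "Vector_Spaces.linear sc sc (\<lambda>x. x \<star> s)" by (rule linear_mult_left)
    have gens: "x \<star> s \<in> ?N" if "x \<in> ideal_gens n" for x
    proof -
      obtain \<alpha> \<beta> l where g: "x = dg \<alpha> \<star> JW (n - 2 * l) \<star> dg \<beta>" "2 * l \<le> n"
        "\<alpha> \<in> matchings n (n - 2 * l)" "\<beta> \<in> matchings (n - 2 * l) n" using \<open>x \<in> ideal_gens n\<close>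
        by (auto simp: ideal_gens_def)
      define m' where "m' = n - 2 * l"
      have a: "dg \<alpha> \<in> H n m'" and b: "dg \<beta> \<in> H m' n" using g by (auto simp: m'_def)
      have bs: "dg \<beta> \<star> s \<in> H m' m" by (rule mult_closed[OF b sH])
      have aJ: "dg \<alpha> \<star> JW m' \<in> H n m'" by (rule mult_closed[OF a JW_H])
      have eq: "x \<star> s = dg \<alpha> \<star> JW m' \<star> (dg \<beta> \<star> s)"
        unfolding g(1) m'_def[symmetric] by (rule mult_assoc[OF aJ b sH])
      have eq': "x \<star> s = dg \<alpha> \<star> (JW m' \<star> (dg \<beta> \<star> s))"
        unfolding eq by (rule mult_assoc[OF a JW_H bs])
      consider "m' < m" | "m' = m" | "m < m'" by linarith
      then show ?thesis
      proof cases
        case 1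
        then show ?thesis unfolding eq by (rule mult_in_right_block[OF aJ bs])
      next
        case 2
        have "JW m \<star> (dg \<beta> \<star> s) = 0"
          using JW_mult_same[of "dg \<beta> \<star> s" m] bs zero[of \<beta>] g(4) 2 by (simp add: m_def m'_def)
        then show ?thesis unfolding eq' 2 using pm.subspace_0[OF subspace_supp_on] by (simp add: right.zero)
      next
        case 3
        then have "JW m' \<star> (dg \<beta> \<star> s) = 0" by (rule JW_mult_less[OF bs])
        then show ?thesis unfolding eq' using pm.subspace_0[OF subspace_supp_on] by (simp add: right.zero)
      qed
    qed
    show ?thesis
      using x
    proof (induction rule: pm.span_induct_alt)
      case base
      then show ?case using pm.subspace_0[OF subspace_supp_on] by (simp add: left.zero)
    next
      case (step c x y)
      then show ?case
        using pm.subspace_add[OF subspace_supp_on pm.subspace_scale[OF subspace_supp_on gens[OF step(1)]] step(2)]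
        by (simp add: left.add left.scale)
    qed
  qed
  from this[OF one_in_span_gens] have "s \<in> ?N" by (simp add: one_mult[OF sH])
  then have "Poly_Mapping.lookup s p = 0" for p
    using s unfolding supp_on_iff by (cases "right_free p") (auto simp: simple_basis_iff)
  then show ?thesis by (intro poly_mapping_eqI) simp
qed

end

section \<open>Decomposition of modules over the Temperley--Lieb algebra\<close>

lemma subspace_linear_image:
  assumes "Vector_Spaces.linear sc sc L" "pm.subspace S" shows "pm.subspace (L ` S)"
proof -
  interpret L: Vector_Spaces.linear sc sc L by fact
  show ?thesis by (rule L.subspace_image[OF assms(2)])
qed

context tl_generic
begin

text \<open>A primitive idempotent: it has rank one on the simple module with \<open>m\<close> through strands and vanishes
  on the others.\<close>

definition idem :: "nat \<Rightarrow> nat \<Rightarrow> tl" where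
  "idem m k = sc (1 / \<delta> ^ k) (E m k \<star> JW m \<star> E' m k)"

lemma idem_H: "idem m k \<in> H (m + 2 * k) (m + 2 * k)"
  unfolding idem_def by (rule H_sc[OF mult_closed[OF mult_closed[OF E_H JW_H] E'_H]])

lemma idem_fin [simp]: "idem m k \<in> finitary"
  using H_finitary[OF idem_H] .

lemma E'_E_mult: "x \<in> finitary \<Longrightarrow> x \<in> H m b \<Longrightarrow> E' m k \<star> (E m k \<star> x) = sc (\<delta> ^ k) x"
  using fin_assoc[of "E' m k" "E m k" x] by (simp add: E'_E left.scale one_mult)

lemma E'_idem: "E' m k \<star> idem m k = JW m \<star> E' m k"
proof -
  have "JW m \<star> E' m k \<in> H m (m + 2 * k)" by (rule mult_closed[OF JW_H E'_H])
  then have "E' m k \<star> (E m k \<star> (JW m \<star> E' m k)) = sc (\<delta> ^ k) (JW m \<star> E' m k)"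
    by (intro E'_E_mult) auto
  then show ?thesis using delta_nz by (simp add: idem_def right.scale fin_assoc)
qed

lemma idem_idem: "idem m k \<star> idem m k = idem m k"
proof -
  have "idem m k \<star> idem m k = sc (1 / \<delta> ^ k) (E m k \<star> (JW m \<star> (E' m k \<star> idem m k)))"
    by (subst (1) idem_def) (simp add: left.scale fin_assoc)
  also have "JW m \<star> (E' m k \<star> idem m k) = JW m \<star> E' m k"
    unfolding E'_idem using JW_idem[of m] by (simp flip: fin_assoc)
  finally show ?thesis by (simp add: idem_def fin_assoc)
qed

text \<open>Schur orthogonality for the idempotents: projectors on different numbers of strands
  annihilate everything between them, and between equal ones only the coefficient of the identity in
  \<open>\<beta> \<star> w\<close> is left, which is the value of the bilinear form.\<close>

lemma sandwich:
  assumes n: "n = m + 2 * k" and b: "\<beta> \<in> H m' n" and w: "w \<in> H n m"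
  shows "E m' k' \<star> JW m' \<star> \<beta> \<star> (w \<star> E' m k) \<star> idem m k =
    (if m' = m then sc (Poly_Mapping.lookup (\<beta> \<star> w) (id_diagram m)) (E m k' \<star> JW m \<star> E' m k) else 0)"
proof -
  have [simp]: "\<beta> \<in> finitary" "w \<in> finitary" using H_finitary b w by auto
  have bw: "\<beta> \<star> w \<in> H m' m" by (rule mult_closed[OF b w])
  have "E m' k' \<star> JW m' \<star> \<beta> \<star> (w \<star> E' m k) \<star> idem m k
      = E m' k' \<star> (JW m' \<star> (\<beta> \<star> w) \<star> JW m \<star> E' m k)"
    by (simp add: fin_assoc E'_idem)
  moreover have "JW m' \<star> (\<beta> \<star> w) \<star> JW m =
    (if m' = m then sc (Poly_Mapping.lookup (\<beta> \<star> w) (id_diagram m)) (JW m) else 0)"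
  proof -
    consider "m' < m" | "m' = m" | "m < m'" by linarith
    then show ?thesis
    proof cases
      case 1
      then show ?thesis
        using mult_JW_less[OF bw] fin_assoc[of "JW m'" "\<beta> \<star> w" "JW m"] by (simp add: right.zero)
    next
      case 2
      then show ?thesis using JW_mult_same[of "\<beta> \<star> w" m] bw JW_idem[of m] by (simp add: left.scale)
    next
      case 3
      then show ?thesis using JW_mult_less[OF bw] by (simp add: left.zero)
    qed
  qed
  ultimately show ?thesis by (simp add: left.scale right.scale left.zero right.zero fin_assoc)
qed

text \<open>Separates the rule that concatenations outside the basis are set to zero from the
  multiplication itself.\<close>

definition proj_simple :: "nat \<Rightarrow> nat \<Rightarrow> tl \<Rightarrow> tl" where
  "proj_simple n k = lin (\<lambda>p. if p \<in> simple_basis n k then dg p else 0)"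

lemma simple_action_eq: "simple_action \<delta> n k f g = proj_simple n k (f \<star> g)"
proof -
  have 1: "(if diagram_concat p w \<in> simple_basis n k
      then Poly_Mapping.single (diagram_concat p w)
       (Poly_Mapping.lookup f p * Poly_Mapping.lookup g w * \<delta> ^ loops p w) else 0) =
    sc (Poly_Mapping.lookup f p) (sc (Poly_Mapping.lookup g w) (proj_simple n k (sc (\<delta> ^ loops p w) (dg (diagram_concat p w)))))" for p w
    by (simp add: proj_simple_def lin_sc) (simp add: dg_def mult.assoc)
  show ?thesis
    unfolding simple_action_def 1 mult_lin unfolding proj_simple_def lin_def[of _ f] lin_def[of _ g]
    by (simp add: lin_sc lin_sum pm.scale_sum_right)
qed

lemma proj_simple_supp: "proj_simple n k y \<in> supp_on (simple_basis n k)"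
  unfolding proj_simple_def
  by (rule lin_in_subspace[OF subspace_supp_on, of _ UNIV])
     (auto simp: supp_on_def[of UNIV] pm.subspace_0[OF subspace_supp_on])

lemma proj_simple_diff:
  assumes "y \<in> H n (n - 2 * k)"
  shows "y - proj_simple n k y \<in> supp_on {w \<in> matchings n (n - 2 * k). \<not> right_free w}"
proof -
  let ?S = "supp_on {w \<in> matchings n (n - 2 * k). \<not> right_free w}"
  have "Vector_Spaces.linear sc sc (\<lambda>y. y - proj_simple n k y)"
    unfolding proj_simple_def by unfold_locales (auto simp: lin_add lin_sc pm.scale_right_diff_distrib)
  then show ?thesis
  proof (rule linear_in_subspace[OF _ subspace_supp_on assms[unfolded H_def]])
    fix p assume "p \<in> matchings n (n - 2 * k)"
    then show "dg p - proj_simple n k (dg p) \<in> ?S"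
      by (auto simp: proj_simple_def simple_basis_iff pm.subspace_0[OF subspace_supp_on])
  qed
qed

end

text \<open>A finite-dimensional TL_n-module carried by a subspace \<open>T\<close> of a space of
  finitely supported functions. The maps \<open>act x\<close> are linear on the whole space, so that
  library facts apply, while the module laws are asked for on \<open>T\<close> only.\<close>

locale tl_mod = tl_generic \<delta> for \<delta> +
  fixes n :: nat and T :: "('g \<Rightarrow>\<^sub>0 complex) set"
    and act :: "tl \<Rightarrow> ('g \<Rightarrow>\<^sub>0 complex) \<Rightarrow> ('g \<Rightarrow>\<^sub>0 complex)"
  assumes T: "pm.subspace T"
    and act_lin: "Vector_Spaces.linear sc sc (act x)"
    and act_lin_left: "Vector_Spaces.linear sc sc (\<lambda>x. act x t)"
    and act_T: "x \<in> H n n \<Longrightarrow> t \<in> T \<Longrightarrow> act x t \<in> T"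
    and act_mult: "x \<in> H n n \<Longrightarrow> y \<in> H n n \<Longrightarrow> t \<in> T \<Longrightarrow> act (x \<star> y) t = act x (act y t)"
    and act_one: "t \<in> T \<Longrightarrow> act (one n) t = t"
    and finite_dim: "\<exists>G. finite G \<and> T \<subseteq> pm.span G"
begin

sublocale actr: Vector_Spaces.linear sc sc "act x" for x by (rule act_lin)
sublocale actl: Vector_Spaces.linear sc sc "\<lambda>x. act x t" for t by (rule act_lin_left)

text \<open>The multiplicity space of the simple module with \<open>m\<close> through strands.\<close>

definition X :: "nat \<Rightarrow> nat \<Rightarrow> ('g \<Rightarrow>\<^sub>0 complex) set" where
  "X m k = act (idem m k) ` T"

lemma X_subspace: "pm.subspace (X m k)"
  unfolding X_def by (rule subspace_linear_image[OF act_lin T])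

context
  fixes m k assumes n: "n = m + 2 * k"
begin

lemma idem_Hn: "idem m k \<in> H n n" using idem_H n by simp

lemma E_Hn: "E m k \<in> H n m" "E' m k \<in> H m n" using E_H E'_H n by simp_all

lemma X_T: "x \<in> X m k \<Longrightarrow> x \<in> T"
  unfolding X_def using act_T[OF idem_Hn] by blast

lemma X_idem: "x \<in> X m k \<Longrightarrow> act (idem m k) x = x"
  unfolding X_def using act_mult[OF idem_Hn idem_Hn] by (auto simp: idem_idem)

lemma act_sandwich:
  assumes b: "\<beta> \<in> H m' n" and n': "n = m' + 2 * k'" and w: "w \<in> H n m" and x: "x \<in> X m k"
  shows "act (E m' k' \<star> JW m' \<star> \<beta>) (act (w \<star> E' m k) x) =
    (if m' = m then sc (Poly_Mapping.lookup (\<beta> \<star> w) (id_diagram m) * \<delta> ^ k) x else 0)"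
proof -
  have H1: "E m' k' \<star> JW m' \<star> \<beta> \<in> H n n"
    using mult_closed[OF mult_closed[OF E_H JW_H] b, of k'] n' by simp
  have H2: "w \<star> E' m k \<in> H n n" by (rule mult_closed[OF w E_Hn(2)])
  have "act (E m' k' \<star> JW m' \<star> \<beta>) (act (w \<star> E' m k) x) =
      act (E m' k' \<star> JW m' \<star> \<beta> \<star> (w \<star> E' m k) \<star> idem m k) x"
    using act_mult[OF mult_closed[OF H1 H2] idem_Hn X_T[OF x]] act_mult[OF H1 H2 X_T[OF x]] X_idem[OF x] by simp
  also have "\<dots> = (if m' = m then sc (Poly_Mapping.lookup (\<beta> \<star> w) (id_diagram m) * \<delta> ^ k) x else 0)"
  proof (cases "m' = m")
    case True
    then have "k' = k" using n n' by simp
    have "E m k \<star> JW m \<star> E' m k = sc (\<delta> ^ k) (idem m k)" using delta_nz by (simp add: idem_def)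
    then show ?thesis using sandwich[OF n b w, of k'] True \<open>k' = k\<close> X_idem[OF x] by (simp add: actl.scale)
  qed (use sandwich[OF n b w, of k'] in \<open>simp add: actl.zero\<close>)
  finally show ?thesis .
qed

text \<open>Justifies the truncation in the simple module: a right block of \<open>y\<close> is
  carried by \<open>E'\<close> to the projector inside the idempotent, which kills it.\<close>

lemma act_nonsimple:
  assumes y: "y \<in> supp_on {w \<in> matchings n m. \<not> right_free w}" and x: "x \<in> X m k"
  shows "act (y \<star> E' m k) x = 0"
proof -
  have yH: "y \<in> H n m" using y by (auto simp: H_def supp_on_def)
  have [simp]: "y \<in> finitary" using H_finitary[OF yH] .
  have "act (y \<star> E' m k) x = act (y \<star> E' m k \<star> idem m k) x"
    using act_mult[OF mult_closed[OF yH E_Hn(2)] idem_Hn X_T[OF x]] X_idem[OF x] by simp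
  also have "y \<star> E' m k \<star> idem m k = y \<star> JW m \<star> E' m k" by (simp add: fin_assoc E'_idem)
  also have "\<dots> = 0" using mult_JW_zero[OF y] by (simp add: left.zero)
  finally show ?thesis by (simp add: actl.zero)
qed

text \<open>Routes \<open>\<alpha> \<star> JW m \<star> \<beta>\<close> through the multiplicity
  space. Between \<open>E'\<close> and \<open>E\<close> exactly \<open>k\<close> loops close, and
  \<open>1 / \<delta> ^ k\<close> compensates for them.\<close>

lemma act_through:
  assumes a: "\<alpha> \<in> H n m" and b: "\<beta> \<in> H m n" and t: "t \<in> T"
  shows "act (\<alpha> \<star> JW m \<star> \<beta>) t =
    sc (1 / \<delta> ^ k) (act (\<alpha> \<star> E' m k) (act (idem m k) (act (E m k \<star> \<beta>) t)))"
proof -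
  have [simp]: "\<alpha> \<in> finitary" "\<beta> \<in> finitary" using H_finitary a b by auto
  have H1: "\<alpha> \<star> E' m k \<in> H n n" "E m k \<star> \<beta> \<in> H n n" using mult_closed a b E_Hn by auto
  have "\<alpha> \<star> E' m k \<star> idem m k \<star> (E m k \<star> \<beta>) = \<alpha> \<star> (JW m \<star> (E' m k \<star> (E m k \<star> \<beta>)))"
    using fin_assoc[of \<alpha> "E' m k" "idem m k"] by (simp add: E'_idem fin_assoc)
  also have "\<dots> = sc (\<delta> ^ k) (\<alpha> \<star> JW m \<star> \<beta>)"
    using E'_E_mult[OF _ b, of k] by (simp add: right.scale fin_assoc)
  finally have "act (\<alpha> \<star> E' m k \<star> idem m k \<star> (E m k \<star> \<beta>)) t = sc (\<delta> ^ k) (act (\<alpha> \<star> JW m \<star> \<beta>) t)"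
    by (simp add: actl.scale)
  moreover have "act (\<alpha> \<star> E' m k \<star> idem m k \<star> (E m k \<star> \<beta>)) t =
      act (\<alpha> \<star> E' m k) (act (idem m k) (act (E m k \<star> \<beta>) t))"
    using act_mult[OF mult_closed[OF H1(1) idem_Hn] H1(2) t] act_mult[OF H1(1) idem_Hn act_T[OF H1(2) t]] by simp
  ultimately show ?thesis using delta_nz by simp
qed

lemma finite_independent_X: "B \<subseteq> X m k \<Longrightarrow> pm.independent B \<Longrightarrow> finite B"
  using finite_dim X_T pm.independent_span_bound by (metis subset_iff)

end

definition basis_X :: "nat \<Rightarrow> ('g \<Rightarrow>\<^sub>0 complex) set" where
  "basis_X k = (SOME B. B \<subseteq> X (n - 2 * k) k \<and> pm.independent B \<and> X (n - 2 * k) k \<subseteq> pm.span B)"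

lemma basis_X:
  assumes "2 * k \<le> n"
  shows "basis_X k \<subseteq> X (n - 2 * k) k" "pm.independent (basis_X k)" "X (n - 2 * k) k = pm.span (basis_X k)"
    "finite (basis_X k)" "card (basis_X k) = pm.dim (X (n - 2 * k) k)"
proof -
  obtain B where "B \<subseteq> X (n - 2 * k) k" "pm.independent B" "X (n - 2 * k) k \<subseteq> pm.span B"
    using pm.maximal_independent_subset by metis
  then have "\<exists>B. B \<subseteq> X (n - 2 * k) k \<and> pm.independent B \<and> X (n - 2 * k) k \<subseteq> pm.span B" by blast
  from someI_ex[OF this] have B: "basis_X k \<subseteq> X (n - 2 * k) k" "pm.independent (basis_X k)"
      "X (n - 2 * k) k \<subseteq> pm.span (basis_X k)"
    unfolding basis_X_def by auto
  then show "basis_X k \<subseteq> X (n - 2 * k) k" "pm.independent (basis_X k)" by auto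
  show "X (n - 2 * k) k = pm.span (basis_X k)"
    using B(3) pm.span_minimal[OF B(1) X_subspace] by blast
  show "finite (basis_X k)" using finite_independent_X[of "n - 2 * k" k, OF _ B(1,2)] assms by simp
  show "card (basis_X k) = pm.dim (X (n - 2 * k) k)"
    using pm.basis_card_eq_dim[OF B(1,3,2)] .
qed

definition mult_X :: "nat \<Rightarrow> nat" where
  "mult_X k = pm.dim (X (n - 2 * k) k)"

definition xs :: "nat \<Rightarrow> nat \<Rightarrow> ('g \<Rightarrow>\<^sub>0 complex)" where
  "xs k = (SOME f. bij_betw f {..<mult_X k} (basis_X k))"

lemma xs_bij: "2 * k \<le> n \<Longrightarrow> bij_betw (xs k) {..<mult_X k} (basis_X k)"
proof -
  assume k: "2 * k \<le> n"
  have "\<exists>f. bij_betw f {..<mult_X k} (basis_X k)"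
    using basis_X(4,5)[OF k] unfolding mult_X_def by (intro finite_same_card_bij) auto
  then show ?thesis unfolding xs_def by (rule someI_ex)
qed

lemma xs_X: "2 * k \<le> n \<Longrightarrow> j < mult_X k \<Longrightarrow> xs k j \<in> X (n - 2 * k) k"
  using xs_bij[of k] basis_X(1)[of k] by (auto simp: bij_betw_def)

lemma xs_independent:
  assumes k: "2 * k \<le> n" and zero: "(\<Sum>j<mult_X k. sc (c j) (xs k j)) = 0" and j: "j < mult_X k"
  shows "c j = 0"
proof -
  let ?g = "\<lambda>b. c (the_inv_into {..<mult_X k} (xs k) b)"
  have inj: "inj_on (xs k) {..<mult_X k}" using xs_bij[OF k] by (rule bij_betw_imp_inj_on)
  have "(\<Sum>b\<in>basis_X k. sc (?g b) b) = (\<Sum>j<mult_X k. sc (?g (xs k j)) (xs k j))"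
    using sum.reindex_bij_betw[OF xs_bij[OF k], of "\<lambda>b. sc (?g b) b"] by simp
  also have "\<dots> = 0"
    unfolding zero[symmetric] by (intro sum.cong) (auto simp: the_inv_into_f_f[OF inj])
  finally have "?g b = 0" if "b \<in> basis_X k" for b
    using pm.independentD[OF basis_X(2)[OF k] basis_X(4)[OF k] subset_refl _ that, of ?g] by simp
  moreover have "xs k j \<in> basis_X k" using xs_bij[OF k] j by (auto simp: bij_betw_def)
  ultimately have "?g (xs k j) = 0" by blast
  then show ?thesis using the_inv_into_f_f[OF inj] j by simp
qed

lemma xs_span:
  assumes k: "2 * k \<le> n" and x: "x \<in> X (n - 2 * k) k"
  obtains c where "x = (\<Sum>j<mult_X k. sc (c j) (xs k j))"
proof -
  have "x \<in> pm.span (basis_X k)" using basis_X(3)[OF k] x by simp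
  then obtain g where "x = (\<Sum>b\<in>basis_X k. sc (g b) b)"
    using pm.span_finite[OF basis_X(4)[OF k]] by auto
  also have "\<dots> = (\<Sum>j<mult_X k. sc (g (xs k j)) (xs k j))"
    using sum.reindex_bij_betw[OF xs_bij[OF k], of "\<lambda>b. sc (g b) b"] by simp
  finally show ?thesis by (rule that)
qed

section \<open>The isomorphism from a direct sum of simple modules\<close>

definition idx :: "(nat \<times> nat) set" where
  "idx = {(k, j). 2 * k \<le> n \<and> j < mult_X k}"

lemma finite_idx: "finite idx"
proof -
  have "idx = (SIGMA k:{k. 2 * k \<le> n}. {..<mult_X k})" by (auto simp: idx_def)
  moreover have "finite {k. 2 * k \<le> n}" by (rule finite_subset[of _ "{..n}"]) auto
  ultimately show ?thesis by simp
qed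

definition simples :: "(nat \<times> nat \<Rightarrow> tl) set" where
  "simples = (\<Pi>\<^sub>E (k, j)\<in>idx. supp_on (simple_basis n k))"

text \<open>Evaluation of half diagrams on a basis of the multiplicity spaces. The factor
  \<open>E'\<close> completes a half diagram with \<open>n - 2 * k\<close> right dots to an element
  of TL_n.\<close>

definition theta :: "(nat \<times> nat \<Rightarrow> tl) \<Rightarrow> ('g \<Rightarrow>\<^sub>0 complex)" where
  "theta s = (\<Sum>(k, j)\<in>idx. act (s (k, j) \<star> E' (n - 2 * k) k) (xs k j))"

lemma theta_add: "theta (\<lambda>i\<in>idx. s i + s' i) = theta s + theta s'"
  unfolding theta_def sum.distrib[symmetric]
  by (intro sum.cong) (auto simp: left.add actl.add)

lemma theta_scale: "theta (\<lambda>i\<in>idx. sc c (s i)) = sc c (theta s)"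
  unfolding theta_def pm.scale_sum_right
  by (intro sum.cong) (auto simp: left.scale actl.scale)

lemma idx_facts:
  assumes "(k, j) \<in> idx"
  shows "2 * k \<le> n" "j < mult_X k" "n = (n - 2 * k) + 2 * k" "xs k j \<in> X (n - 2 * k) k" "xs k j \<in> T"
proof -
  show k: "2 * k \<le> n" "j < mult_X k" using assms by (auto simp: idx_def)
  then show n: "n = (n - 2 * k) + 2 * k" by simp
  show x: "xs k j \<in> X (n - 2 * k) k" by (rule xs_X[OF k])
  show "xs k j \<in> T" by (rule X_T[OF n x])
qed

lemma simple_H: "s \<in> supp_on (simple_basis n k) \<Longrightarrow> s \<in> H n (n - 2 * k)"
  by (auto simp: supp_on_def H_def simple_basis_iff)

lemma simplesI:
  "(\<And>k j. (k, j) \<in> idx \<Longrightarrow> s (k, j) \<in> supp_on (simple_basis n k)) \<Longrightarrow> (\<lambda>i\<in>idx. s i) \<in> simples"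
  by (auto simp: simples_def PiE_iff)

lemma simplesD: "s \<in> simples \<Longrightarrow> (k, j) \<in> idx \<Longrightarrow> s (k, j) \<in> supp_on (simple_basis n k)"
  by (auto simp: simples_def PiE_iff)

lemma simples_add: "s \<in> simples \<Longrightarrow> s' \<in> simples \<Longrightarrow> (\<lambda>i\<in>idx. s i + s' i) \<in> simples"
  by (rule simplesI) (rule pm.subspace_add[OF subspace_supp_on simplesD simplesD])

lemma simples_scale: "s \<in> simples \<Longrightarrow> (\<lambda>i\<in>idx. sc c (s i)) \<in> simples"
  by (rule simplesI) (rule pm.subspace_scale[OF subspace_supp_on simplesD])

lemma simples_H: "s \<in> simples \<Longrightarrow> (k, j) \<in> idx \<Longrightarrow> s (k, j) \<in> H n (n - 2 * k)"
  by (rule simple_H) (auto simp: simples_def PiE_iff)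

lemma theta_T: "s \<in> simples \<Longrightarrow> theta s \<in> T"
  unfolding theta_def
  by (rule pm.subspace_sum[OF T])
     (auto intro!: act_T mult_closed[OF simples_H] idx_facts(5) E_Hn(2)[OF idx_facts(3)])

text \<open>The product of \<open>a\<close> with \<open>s (k, j)\<close> and the module action
  differ by diagrams with a right block, on which \<open>act_nonsimple\<close> applies.\<close>

lemma theta_equivariant:
  assumes a: "a \<in> H n n" and s: "s \<in> simples"
  shows "theta (\<lambda>(k, j)\<in>idx. simple_action \<delta> n k a (s (k, j))) = act a (theta s)"
proof -
  have "act (simple_action \<delta> n k a (s (k, j)) \<star> E' (n - 2 * k) k) (xs k j) =
      act a (act (s (k, j) \<star> E' (n - 2 * k) k) (xs k j))" if i: "(k, j) \<in> idx" for k j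
  proof -
    note f = idx_facts[OF i] and sH = simples_H[OF s i]
    have [simp]: "a \<in> finitary" "s (k, j) \<in> finitary" using H_finitary a sH by auto
    have as: "a \<star> s (k, j) \<in> H n (n - 2 * k)" by (rule mult_closed[OF a sH])
    have "act ((a \<star> s (k, j) - simple_action \<delta> n k a (s (k, j))) \<star> E' (n - 2 * k) k) (xs k j) = 0"
      unfolding simple_action_eq by (rule act_nonsimple[OF f(3) proj_simple_diff[OF as] f(4)])
    then have "act (simple_action \<delta> n k a (s (k, j)) \<star> E' (n - 2 * k) k) (xs k j) =
        act (a \<star> s (k, j) \<star> E' (n - 2 * k) k) (xs k j)"
      by (simp add: left.diff actl.diff)
    also have "\<dots> = act a (act (s (k, j) \<star> E' (n - 2 * k) k) (xs k j))"
      using act_mult[OF a mult_closed[OF sH E_Hn(2)[OF f(3)]] f(5)] by (simp add: fin_assoc)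
    finally show ?thesis .
  qed
  then show ?thesis unfolding theta_def actr.sum by (intro sum.cong) auto
qed

text \<open>Acting by \<open>E \<star> JW \<star> \<beta>\<close> with \<open>n - 2 * l\<close>
  strands removes all summands with \<open>k \<noteq> l\<close> and leaves a combination of the
  independent vectors \<open>xs l j\<close>, with the values of the form as coefficients. As
  \<open>\<beta>\<close> varies, nondegeneracy applies.\<close>

lemma theta_inj:
  assumes s: "s \<in> simples" and zero: "theta s = 0" and i: "(l, i) \<in> idx"
  shows "s (l, i) = 0"
proof (rule simple_radical)
  note fl = idx_facts[OF i]
  let ?m = "n - 2 * l"
  show "2 * l \<le> n" by (rule fl(1))
  show "s (l, i) \<in> supp_on (simple_basis n l)" using s i by (auto simp: simples_def PiE_iff)
  fix \<beta> assume "\<beta> \<in> matchings (n - 2 * l) n"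
  then have b: "dg \<beta> \<in> H ?m n" by simp
  let ?c = "\<lambda>j. Poly_Mapping.lookup (dg \<beta> \<star> s (l, j)) (id_diagram ?m) * \<delta> ^ l"
  let ?g = "\<lambda>(k, j). act (E ?m l \<star> JW ?m \<star> dg \<beta>) (act (s (k, j) \<star> E' (n - 2 * k) k) (xs k j))"
  have g: "?g (k, j) = (if k = l then sc (?c j) (xs k j) else 0)" if H: "(k, j) \<in> idx" for k j
  proof -
    note f = idx_facts[OF H]
    have "n - 2 * l = n - 2 * k \<longleftrightarrow> k = l" using f(1) fl(1) by linarith
    then show ?thesis using act_sandwich[OF f(3) b fl(3) simples_H[OF s H] f(4)] by auto
  qed
  have "0 = act (E ?m l \<star> JW ?m \<star> dg \<beta>) (theta s)" by (simp add: zero actr.zero)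
  also have "\<dots> = (\<Sum>x\<in>idx. ?g x)" unfolding theta_def actr.sum by (intro sum.cong) auto
  also have "\<dots> = (\<Sum>x\<in>Pair l ` {..<mult_X l}. ?g x)"
  proof (rule sum.mono_neutral_right[OF finite_idx])
    show "Pair l ` {..<mult_X l} \<subseteq> idx" using fl(1) by (auto simp: idx_def)
    show "\<forall>x\<in>idx - Pair l ` {..<mult_X l}. ?g x = 0"
    proof
      fix x assume x: "x \<in> idx - Pair l ` {..<mult_X l}"
      obtain k j where kj: "x = (k, j)" by force
      with x have "(k, j) \<in> idx" "k \<noteq> l" by (auto simp: idx_def)
      then show "?g x = 0" unfolding kj using g by simp
    qed
  qed
  also have "\<dots> = (\<Sum>j<mult_X l. ?g (l, j))" by (subst sum.reindex) (auto simp: inj_on_def)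
  also have "\<dots> = (\<Sum>j<mult_X l. sc (?c j) (xs l j))"
    using g fl(1) by (intro sum.cong) (auto simp: idx_def)
  finally have "?c i = 0" using xs_independent[OF fl(1), of ?c i] fl(2) by simp
  then show "Poly_Mapping.lookup (dg \<beta> \<star> s (l, i)) (id_diagram ?m) = 0" using delta_nz by simp
qed

lemma theta_single:
  assumes k: "2 * k \<le> n" and x: "x \<in> X (n - 2 * k) k" and w: "w \<in> supp_on (simple_basis n k)"
  shows "act (w \<star> E' (n - 2 * k) k) x \<in> theta ` simples"
proof -
  obtain c where c: "x = (\<Sum>j<mult_X k. sc (c j) (xs k j))" using xs_span[OF k x] .
  define s where "s = (\<lambda>i\<in>idx. if fst i = k then sc (c (snd i)) w else 0)"
  have "s \<in> simples"
    using w pm.subspace_scale[OF subspace_supp_on w] pm.subspace_0[OF subspace_supp_on]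
    by (auto simp: simples_def s_def PiE_iff)
  moreover have "theta s = act (w \<star> E' (n - 2 * k) k) x"
  proof -
    let ?g = "\<lambda>(k', j). act (s (k', j) \<star> E' (n - 2 * k') k') (xs k' j)"
    have "theta s = (\<Sum>x\<in>Pair k ` {..<mult_X k}. ?g x)"
      unfolding theta_def
    proof (rule sum.mono_neutral_right[OF finite_idx])
      show "Pair k ` {..<mult_X k} \<subseteq> idx" using k by (auto simp: idx_def)
      show "\<forall>x\<in>idx - Pair k ` {..<mult_X k}. ?g x = 0"
        by (auto simp: idx_def s_def left.zero actl.zero)
    qed
    also have "\<dots> = (\<Sum>j<mult_X k. ?g (k, j))" by (subst sum.reindex) (auto simp: inj_on_def)
    also have "\<dots> = (\<Sum>j<mult_X k. sc (c j) (act (w \<star> E' (n - 2 * k) k) (xs k j)))"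
      using k by (intro sum.cong) (auto simp: s_def idx_def left.scale actl.scale)
    finally show ?thesis unfolding c by (simp add: actr.sum actr.scale)
  qed
  ultimately show ?thesis by (metis imageI)
qed

lemma theta_image_subspace: "pm.subspace (theta ` simples)"
proof (rule pm.subspaceI)
  have 0: "(\<lambda>i\<in>idx. 0) \<in> simples" by (rule simplesI) (rule pm.subspace_0[OF subspace_supp_on])
  have z: "0 = theta (\<lambda>i\<in>idx. 0)"
    unfolding theta_def by (rule sum.neutral[symmetric]) (auto simp: left.zero actl.zero)
  show "0 \<in> theta ` simples" by (rule image_eqI[where f = theta, OF z 0])
  fix x y assume "x \<in> theta ` simples" "y \<in> theta ` simples"
  then obtain s s' where s: "s \<in> simples" "x = theta s" "s' \<in> simples" "y = theta s'" by blast
  show "x + y \<in> theta ` simples"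
    by (rule image_eqI[where f = theta, OF _ simples_add[OF s(1,3)]]) (simp only: theta_add s(2,4))
next
  fix c x assume "x \<in> theta ` simples"
  then obtain s where s: "s \<in> simples" "x = theta s" by blast
  show "sc c x \<in> theta ` simples"
    by (rule image_eqI[where f = theta, OF _ simples_scale[OF s(1)]]) (simp only: theta_scale s(2))
qed

text \<open>The unit is a combination of \<open>ideal_gens\<close>, and each of these maps
  \<open>t\<close> into the image by \<open>act_through\<close>, or to zero if its half diagram has
  a right block.\<close>

lemma theta_surj: "theta ` simples = T"
proof
  show "theta ` simples \<subseteq> T" using theta_T by blast
  show "T \<subseteq> theta ` simples"
  proof
    fix t assume t: "t \<in> T"
    have gens: "act x t \<in> theta ` simples" if x: "x \<in> ideal_gens n" for x
    proof -
      obtain \<alpha> \<beta> k where g: "x = dg \<alpha> \<star> JW (n - 2 * k) \<star> dg \<beta>" "2 * k \<le> n"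
        "\<alpha> \<in> matchings n (n - 2 * k)" "\<beta> \<in> matchings (n - 2 * k) n" using x
        by (auto simp: ideal_gens_def)
      let ?m = "n - 2 * k"
      have n: "n = ?m + 2 * k" using g(2) by simp
      have a: "dg \<alpha> \<in> H n ?m" and b: "dg \<beta> \<in> H ?m n" using g by auto
      show ?thesis
      proof (cases "right_free \<alpha>")
        case True
        let ?x = "act (idem ?m k) (act (E ?m k \<star> dg \<beta>) t)"
        have "?x \<in> X ?m k"
          unfolding X_def using act_T[OF mult_closed[OF E_Hn(1)[OF n] b] t] by blast
        then have "act (dg \<alpha> \<star> E' ?m k) ?x \<in> theta ` simples"
          using True g by (intro theta_single) (auto simp: simple_basis_iff)
        then show ?thesis unfolding g(1) act_through[OF n a b t]
          by (rule pm.subspace_scale[OF theta_image_subspace])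
      next
        case False
        then have "dg \<alpha> \<star> JW ?m = 0" using g by (intro mult_JW_zero[of _ n]) auto
        then show ?thesis unfolding g(1)
          using pm.subspace_0[OF theta_image_subspace] by (simp add: left.zero actl.zero)
      qed
    qed
    have "act x t \<in> theta ` simples" if x: "x \<in> pm.span (ideal_gens n)" for x
      using x
    proof (induction rule: pm.span_induct_alt)
      case base
      then show ?case using pm.subspace_0[OF theta_image_subspace] by (simp add: actl.zero)
    next
      case (step c x y)
      then show ?case
        using pm.subspace_add[OF theta_image_subspace
          pm.subspace_scale[OF theta_image_subspace gens[OF step(1)]] step(2)]
        by (simp add: actl.add actl.scale)
    qed
    from this[OF one_in_span_gens] show "t \<in> theta ` simples" by (simp add: act_one[OF t])
  qed
qed

lemma theta_bij: "bij_betw theta simples T"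
  unfolding bij_betw_def
proof
  show "theta ` simples = T" by (rule theta_surj)
  show "inj_on theta simples"
  proof (rule inj_onI)
    fix s s' assume s: "s \<in> simples" and s': "s' \<in> simples" and eq: "theta s = theta s'"
    let ?d = "\<lambda>i\<in>idx. s i + (\<lambda>i\<in>idx. sc (- 1) (s' i)) i"
    have d: "?d \<in> simples" by (rule simples_add[OF s simples_scale[OF s']])
    have "theta ?d = 0" unfolding theta_add theta_scale using eq by (simp add: pm.scale_minus_left)
    then have "?d (k, j) = 0" if "(k, j) \<in> idx" for k j using theta_inj[OF d _ that] by blast
    then have "s (k, j) = s' (k, j)" if "(k, j) \<in> idx" for k j
    proof -
      have "s (k, j) + sc (- 1) (s' (k, j)) = 0" using \<open>(k, j) \<in> idx \<Longrightarrow> ?d (k, j) = 0\<close> that by simp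
      then show ?thesis by (simp add: pm.scale_minus_left)
    qed
    then have "s i = s' i" if "i \<in> idx" for i using that by (cases i) auto
    moreover have "s \<in> extensional idx" "s' \<in> extensional idx" using s s' by (auto simp: simples_def PiE_iff)
    ultimately show "s = s'" by (intro extensionalityI)
  qed
qed

end

section \<open>Stability\<close>

text \<open>Adds a through strand at the bottom, as the left embedding by one strand does; the
  numbers of dots may differ because half diagrams are extended as well.\<close>

definition ext :: "nat \<Rightarrow> nat \<Rightarrow> diagram \<Rightarrow> diagram" where
  "ext a b d = insert {- int a - 1, int b + 1} d"

lemma dots_Suc: "dots (Suc a) (Suc b) = insert (- int a - 1) (insert (int b + 1) (dots a b))"
  by (auto simp: dots_iff)

lemma ext_matching: "d \<in> matchings a b \<Longrightarrow> ext a b d \<in> matchings (Suc a) (Suc b)"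
  unfolding matchings_iff dots_Suc ext_def
proof (rule ncm_insert)
  assume d: "ncm (dots a b) d"
  show "- int a - 1 < v \<and> v < int b + 1" if "{u, v} \<in> d" for u v
    using ncm_mem[OF d that] by (auto simp: dots_iff)
qed (auto simp: dots_iff)

lemma ext_remove:
  assumes d: "d \<in> matchings (Suc a) (Suc b)" and B: "{- int a - 1, int b + 1} \<in> d"
  obtains e where "e \<in> matchings a b" "d = ext a b e"
proof
  let ?B = "{- int a - 1, int b + 1}"
  have "dots (Suc a) (Suc b) - ?B = dots a b" unfolding dots_Suc by (auto simp: dots_iff)
  then show "d - {?B} \<in> matchings a b"
    using ncm_remove[of "dots (Suc a) (Suc b)" d ?B] d B by (simp add: matchings_iff)
  show "d = ext a b (d - {?B})" unfolding ext_def by (rule insert_Diff[OF B, symmetric])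
qed

lemma ins1_ext: "(ins 1 ^^ k) (ext a b e) = ext (a + 2 * k) b ((ins 1 ^^ k) e)"
proof (induction k)
  case (Suc k)
  have "ins 1 (ext c b p) = ext (c + 2) b (ins 1 p)" for c p
  proof -
    have "sh 1 (- int c - 1) = - int (c + 2) - 1" "sh 1 (int b + 1) = int b + 1" by (auto simp: sh_def)
    then have "sh 1 ` {- int c - 1, int b + 1} = {- int (c + 2) - 1, int b + 1}" by simp
    then show ?thesis unfolding ins_def ext_def image_insert by (simp only: insert_commute)
  qed
  then show ?case using Suc by (simp add: add.commute add.left_commute)
qed simp

section \<open>Counting arguments for planar diagrams\<close>

text \<open>Each right dot beyond \<open>p\<close> has its partner among the \<open>m\<close> left
  dots and the first \<open>p\<close> right dots, and partners of different dots differ.\<close>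

lemma no_right_block_card:
  assumes e: "e \<in> matchings m n" and no: "\<And>x y. {x, y} \<in> e \<Longrightarrow> int p < x \<Longrightarrow> x < y \<Longrightarrow> False"
  shows "n \<le> m + 2 * p"
proof -
  have "\<exists>y. {x, y} \<in> e \<and> y \<in> dots m p" if x: "x \<in> {int p + 1..int n}" for x
  proof -
    have "x \<in> dots m n" using x by (auto simp: dots_iff)
    then obtain y where y: "{x, y} \<in> e" "y \<noteq> x" "y \<in> dots m n" using matchings_obtain[OF e] by metis
    have "{y, x} \<in> e" using y(1) by (simp add: insert_commute)
    then have "\<not> int p < y" using no[of y x] no[OF y(1)] x y(2) by force
    with y show ?thesis by (auto simp: dots_iff)
  qed
  then obtain f where f: "\<And>x. x \<in> {int p + 1..int n} \<Longrightarrow> {x, f x} \<in> e \<and> f x \<in> dots m p" by metis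
  have "inj_on f {int p + 1..int n}"
  proof (rule inj_onI)
    fix x y assume xy: "x \<in> {int p + 1..int n}" "y \<in> {int p + 1..int n}" "f x = f y"
    have "{f x, x} \<in> e" "{f x, y} \<in> e" using f[OF xy(1)] f[OF xy(2)] xy(3) by (simp_all add: insert_commute)
    then show "x = y" by (rule matchings_unique[OF e])
  qed
  then have "card {int p + 1..int n} \<le> card (dots m p)"
    by (rule card_inj_on_le) (use f in auto)
  moreover have "card (dots m p) \<le> m + p"
    unfolding dots_def by (rule order_trans[OF card_Un_le]) simp
  ultimately show ?thesis by simp
qed

text \<open>If the last right dot were joined to a right dot \<open>y\<close>, then
  \<open>y \<le> p\<close>, and by planarity the partners of all \<open>m + 1\<close> left dots
  would lie in \<open>{1..y - 1}\<close>, which is too small. So it is joined to a left dot, and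
  planarity forces the last one.\<close>

lemma bottom_strand:
  assumes e: "e \<in> matchings (Suc m) (Suc n)" and "p \<le> m"
    and left: "\<And>x y. {x, y} \<in> e \<Longrightarrow> x < y \<Longrightarrow> y < 0 \<Longrightarrow> False"
    and no: "\<And>x y. {x, y} \<in> e \<Longrightarrow> int p < x \<Longrightarrow> x < y \<Longrightarrow> False"
  shows "{- int m - 1, int n + 1} \<in> e"
proof -
  note q = e[unfolded matchings_iff]
  let ?N = "int n + 1"
  have "?N \<in> dots (Suc m) (Suc n)" by (simp add: dots_iff)
  then obtain y where y: "{?N, y} \<in> e" "y \<noteq> ?N" "y \<in> dots (Suc m) (Suc n)" using matchings_obtain[OF e] by metis
  have y': "{y, ?N} \<in> e" using y(1) by (simp add: insert_commute)
  have yN: "y < ?N" using y by (auto simp: dots_iff)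
  have partner: "\<exists>r. {x, r} \<in> e \<and> 0 < r \<and> r \<le> ?N" if x: "x \<in> {- int m - 1..-1}" for x
  proof -
    have "x \<in> dots (Suc m) (Suc n)" using x by (auto simp: dots_iff)
    then obtain r where r: "{x, r} \<in> e" "r \<noteq> x" "r \<in> dots (Suc m) (Suc n)" using matchings_obtain[OF e] by metis
    have "{r, x} \<in> e" using r(1) by (simp add: insert_commute)
    then have "\<not> r < 0" using left[of r x] left[OF r(1)] x r(2) by force
    with r show ?thesis by (auto simp: dots_iff)
  qed
  then obtain f where f: "\<And>x. x \<in> {- int m - 1..-1} \<Longrightarrow> {x, f x} \<in> e \<and> 0 < f x \<and> f x \<le> ?N" by metis
  have flip: "{f x, x} \<in> e" if "x \<in> {- int m - 1..-1}" for x using f[OF that] by (simp add: insert_commute)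
  have fN: "x = y" if "x \<in> {- int m - 1..-1}" "f x = ?N" for x
    using matchings_unique[OF e y(1), of x] flip[OF that(1)] that(2) by simp
  show ?thesis
  proof (cases "0 < y")
    case True
    have yp: "y \<le> int p" using no[OF y'] yN by force
    have "f x \<in> {1..y - 1}" if x: "x \<in> {- int m - 1..-1}" for x
    proof -
      have "f x \<noteq> ?N" using fN[OF x] x True by auto
      moreover have "f x \<noteq> y"
      proof
        assume "f x = y"
        then have "{y, x} \<in> e" using flip[OF x] by simp
        then have "x = ?N" using matchings_unique[OF e y'] by blast
        with x show False by simp
      qed
      moreover have "\<not> (y < f x \<and> f x < ?N)" using ncm_nest[OF q y' flip[OF x]] x True by auto
      ultimately show ?thesis using f[OF x] by auto
    qed
    moreover have "inj_on f {- int m - 1..-1}"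
    proof (rule inj_onI)
      fix x z assume xz: "x \<in> {- int m - 1..-1}" "z \<in> {- int m - 1..-1}" "f x = f z"
      have "{f x, x} \<in> e" "{f x, z} \<in> e" using flip[OF xz(1)] flip[OF xz(2)] xz(3) by auto
      then show "x = z" by (rule matchings_unique[OF e])
    qed
    ultimately have "card {- int m - 1..-1} \<le> card {1..y - 1}" by (intro card_inj_on_le) auto
    then show ?thesis using yp assms(2) True by simp
  next
    case False
    then have y0: "- int m - 1 \<le> y" "y < 0" using y(3) by (auto simp: dots_iff)
    have "y = - int m - 1"
    proof (rule ccontr)
      assume "y \<noteq> - int m - 1"
      have x: "- int m - 1 \<in> {- int m - 1..-1}" by simp
      have "f (- int m - 1) \<noteq> ?N" using fN[OF x] \<open>y \<noteq> - int m - 1\<close> by auto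
      then have "y < f (- int m - 1) \<and> f (- int m - 1) < ?N" using f[OF x] y0 by auto
      then have "y < - int m - 1" using ncm_nest[OF q y' flip[OF x]] by blast
      with y0 show False by simp
    qed
    with y' show ?thesis by simp
  qed
qed

text \<open>A basis of \<open>S\<close> maps to a spanning set of the image. If the dimensions
  agree, no vector of this set is redundant, so a basis goes to a basis.\<close>

lemma surj_dim:
  assumes L: "Vector_Spaces.linear sc sc L" and S: "pm.subspace S" and G: "finite G" "S \<subseteq> pm.span G"
  shows "pm.dim (L ` S) \<le> pm.dim S" "pm.dim (L ` S) = pm.dim S \<Longrightarrow> inj_on L S"
proof -
  interpret L: Vector_Spaces.linear sc sc L by fact
  obtain B where B: "B \<subseteq> S" "pm.independent B" "S \<subseteq> pm.span B" "card B = pm.dim S"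
    using pm.basis_exists by blast
  have finB: "finite B" using pm.independent_span_bound[OF G(1) B(2)] B(1) G(2) by blast
  have SB: "S = pm.span B" using B(3) pm.span_minimal[OF B(1) S] by blast
  have LS: "L ` S = pm.span (L ` B)" unfolding SB by (rule L.span_image[symmetric])
  have "pm.dim (L ` S) \<le> card (L ` B)" unfolding LS by (rule pm.dim_le_card) (use finB in auto)
  also have "card (L ` B) \<le> card B" by (rule card_image_le[OF finB])
  finally show "pm.dim (L ` S) \<le> pm.dim S" using B(4) by simp
  assume eq: "pm.dim (L ` S) = pm.dim S"
  with \<open>pm.dim (L ` S) \<le> card (L ` B)\<close> \<open>card (L ` B) \<le> card B\<close> B(4) have card: "card (L ` B) = card B" by simp
  then have inj: "inj_on L B" using eq_card_imp_inj_on[OF finB] by blast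
  have "pm.independent (L ` B)"
    unfolding pm.dependent_def
  proof
    assume "\<exists>a\<in>L ` B. a \<in> pm.span (L ` B - {a})"
    then obtain a where a: "a \<in> L ` B" "a \<in> pm.span (L ` B - {a})" by blast
    then have "pm.span (L ` B) = pm.span (L ` B - {a})"
      using pm.span_redundant[OF a(2)] by (simp add: insert_absorb)
    then have "pm.dim (L ` S) \<le> card (L ` B - {a})"
      unfolding LS using finB by (intro pm.dim_le_card) auto
    also have "\<dots> < card (L ` B)" using a(1) finB by (intro card_Diff1_less) auto
    finally show False using eq card B(4) by simp
  qed
  then show "inj_on L S" unfolding SB by (rule L.inj_on_span_independent_image[OF _ inj])
qed

lemma decreasing_eventually_constant:
  fixes f :: "nat \<Rightarrow> nat"
  assumes "\<And>m. L \<le> m \<Longrightarrow> f (Suc m) \<le> f m"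
  obtains M where "L \<le> M" "\<And>m. M \<le> m \<Longrightarrow> f m = f M"
proof -
  define v where "v = (LEAST v. \<exists>m\<ge>L. f m = v)"
  have "\<exists>m\<ge>L. f m = v" unfolding v_def by (rule LeastI[of _ "f L"]) auto
  then obtain M where M: "L \<le> M" "f M = v" by blast
  have "f m = f M" if "M \<le> m" for m
  proof (rule antisym)
    show "f m \<le> f M" using that
    proof (induction m rule: dec_induct)
      case (step m)
      then show ?case using assms[of m] M(1) by simp
    qed simp
    show "f M \<le> f m" unfolding M(2) v_def using that M(1) by (intro Least_le exI[of _ m]) auto
  qed
  with M(1) show ?thesis using that by blast
qed

context tl_generic
begin

lemma ins1_dg: "e \<in> matchings m c \<Longrightarrow> dg ((ins 1 ^^ k) e) = E m k \<star> dg e"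
  by (rule E_mult[symmetric])

lemma idem_ins1:
  assumes e: "e \<in> matchings m c" shows "idem m k \<star> dg ((ins 1 ^^ k) e) = E m k \<star> JW m \<star> dg e"
proof -
  have [simp]: "dg e \<in> finitary" by (rule dg_fin[OF e])
  have "dg e \<in> H m c" using e by simp
  then have "E' m k \<star> (E m k \<star> dg e) = sc (\<delta> ^ k) (dg e)" by (intro E'_E_mult) auto
  then show ?thesis unfolding ins1_dg[OF e] idem_def
    using delta_nz by (simp add: left.scale right.scale fin_assoc)
qed

lemma idem_dg:
  assumes d: "d \<in> matchings (m + 2 * k) c"
  obtains r where "idem m k \<star> dg d = sc r (E m k \<star> JW m \<star> dg (diagram_concat (mirror (eta m k)) d))"
proof
  have [simp]: "dg d \<in> finitary" by (rule dg_fin[OF d])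
  have "dg (diagram_concat (mirror (eta m k)) d) \<in> finitary"
    by (rule dg_fin[OF concat_matching[OF mirror_matching[OF eta_matching] d]])
  note [simp] = this
  show "idem m k \<star> dg d = sc (1 / \<delta> ^ k * \<delta> ^ loops (mirror (eta m k)) d)
      (E m k \<star> JW m \<star> dg (diagram_concat (mirror (eta m k)) d))"
    by (simp add: idem_def left.scale right.scale fin_assoc mult_dg)
qed

lemma idem_kill_left_block:
  assumes d: "d \<in> matchings (m + 2 * k) c"
    and "{x, y} \<in> diagram_concat (mirror (eta m k)) d" "x < y" "y < 0"
  shows "idem m k \<star> dg d = 0"
proof -
  let ?e = "diagram_concat (mirror (eta m k)) d"
  have e: "?e \<in> matchings m c" by (rule concat_matching[OF mirror_matching[OF eta_matching] d])
  obtain r where "idem m k \<star> dg d = sc r (E m k \<star> JW m \<star> dg ?e)" using idem_dg[OF d] .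
  then show ?thesis using JW_left_block[OF e assms(2-4)] dg_fin[OF e] by (simp add: fin_assoc right.zero)
qed

text \<open>The cups of \<open>eta m k\<close> occupy the top \<open>2 * k\<close> dots. A left
  block of \<open>d\<close> below them passes along the straight strands of the mirrored diagram and
  arrives as a left block at the projector.\<close>

lemma idem_kill:
  assumes d: "d \<in> matchings (m + 2 * k) c" and blk: "{x - 2 * int k, y - 2 * int k} \<in> d" and "x < y" "y < 0"
  shows "idem m k \<star> dg d = 0"
proof (rule idem_kill_left_block[OF d _ assms(3,4)])
  have thr: "{z, - (z - 2 * int k)} \<in> mirror (eta m k)" if z: "z < 0" "- int m \<le> z" for z
  proof -
    have "{z, - z} \<in> id_diagram m" using z by (simp add: id_block)
    then have "{z - 2 * int k, - z} \<in> eta m k" unfolding eta_def using ins1_through z by simp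
    then show ?thesis by (simp add: insert_commute)
  qed
  have "x - 2 * int k \<in> dots (m + 2 * k) c" using matchings_mem[OF d blk] by simp
  then have x: "- int m \<le> x" using assms(3,4) by (auto simp: dots_iff)
  show "{x, y} \<in> diagram_concat (mirror (eta m k)) d"
    by (rule concat_left_through[OF mirror_matching[OF eta_matching] d thr _ _ thr])
       (use x assms(3,4) blk in auto)
qed

end

section \<open>Towers of Temperley--Lieb modules generated in bounded degree\<close>

text \<open>What the stability argument needs of a functor, stated without its Hom spaces:
  \<open>gen i n\<close> is the image in degree \<open>n\<close> of a generator born in degree
  \<open>lvl i\<close>, and \<open>gen_bad\<close> records the trivial module in the definition of
  Hom.\<close>

locale tl_system = tl_generic \<delta> for \<delta> +
  fixes T :: "nat \<Rightarrow> ('g \<Rightarrow>\<^sub>0 complex) set"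
    and act :: "nat \<Rightarrow> tl \<Rightarrow> ('g \<Rightarrow>\<^sub>0 complex) \<Rightarrow> ('g \<Rightarrow>\<^sub>0 complex)"
    and phi :: "nat \<Rightarrow> ('g \<Rightarrow>\<^sub>0 complex) \<Rightarrow> ('g \<Rightarrow>\<^sub>0 complex)"
    and I :: "'i set" and lvl :: "'i \<Rightarrow> nat" and gen :: "'i \<Rightarrow> nat \<Rightarrow> ('g \<Rightarrow>\<^sub>0 complex)" and L :: nat
  assumes sys_T: "pm.subspace (T n)"
    and sys_act_lin: "Vector_Spaces.linear sc sc (act n x)"
    and sys_act_lin_left: "Vector_Spaces.linear sc sc (\<lambda>x. act n x t)"
    and sys_act_T: "x \<in> H n n \<Longrightarrow> t \<in> T n \<Longrightarrow> act n x t \<in> T n"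
    and sys_act_mult: "x \<in> H n n \<Longrightarrow> y \<in> H n n \<Longrightarrow> t \<in> T n \<Longrightarrow> act n (x \<star> y) t = act n x (act n y t)"
    and sys_act_one: "t \<in> T n \<Longrightarrow> act n (one n) t = t"
    and phi_lin: "Vector_Spaces.linear sc sc (phi n)"
    and phi_T: "t \<in> T n \<Longrightarrow> phi n t \<in> T (Suc n)"
    and phi_act: "d \<in> matchings n n \<Longrightarrow> t \<in> T n \<Longrightarrow> phi n (act n (dg d) t) = act (Suc n) (dg (ext n n d)) (phi n t)"
    and finite_I: "finite I"
    and lvl_le: "i \<in> I \<Longrightarrow> lvl i \<le> L"
    and gen_T: "i \<in> I \<Longrightarrow> lvl i \<le> n \<Longrightarrow> gen i n \<in> T n"
    and gen_phi: "i \<in> I \<Longrightarrow> lvl i \<le> n \<Longrightarrow> phi n (gen i n) = gen i (Suc n)"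
    and gen_bad: "i \<in> I \<Longrightarrow> lvl i \<le> n \<Longrightarrow> d \<in> matchings n n \<Longrightarrow> {a, b} \<in> d \<Longrightarrow> int (lvl i) < a \<Longrightarrow> a < b \<Longrightarrow>
      act n (dg d) (gen i n) = 0"
    and gen_span: "T n \<subseteq> pm.span {act n (dg d) (gen i n) | d i. d \<in> matchings n n \<and> i \<in> I \<and> lvl i \<le> n}"
begin

sublocale M: tl_mod \<delta> n "T n" "act n" for n
proof unfold_locales
  show "\<exists>G. finite G \<and> T n \<subseteq> pm.span G"
  proof (intro exI conjI)
    show "finite {act n (dg d) (gen i n) | d i. d \<in> matchings n n \<and> i \<in> I \<and> lvl i \<le> n}"
      by (rule finite_subset[of _ "(\<lambda>(d, i). act n (dg d) (gen i n)) ` (matchings n n \<times> I)"])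
         (auto simp: finite_matchings finite_I)
  qed (rule gen_span)
qed (use sys_T sys_act_lin sys_act_lin_left sys_act_T sys_act_mult sys_act_one in
  \<open>auto simp: Vector_Spaces.linear_def module_hom_def module_hom_axioms_def\<close>)

sublocale phi: Vector_Spaces.linear sc sc "phi n" for n by (rule phi_lin)

lemma X_generated:
  assumes n: "n = m + 2 * k" and S: "pm.subspace S"
    and gens: "\<And>d i. d \<in> matchings n n \<Longrightarrow> i \<in> I \<Longrightarrow> lvl i \<le> n \<Longrightarrow> act n (idem m k \<star> dg d) (gen i n) \<in> S"
  shows "M.X n m k \<subseteq> S"
proof
  fix x assume "x \<in> M.X n m k"
  then obtain t where t: "t \<in> T n" "x = act n (idem m k) t" by (auto simp: M.X_def)
  have "t \<in> pm.span {act n (dg d) (gen i n) | d i. d \<in> matchings n n \<and> i \<in> I \<and> lvl i \<le> n}"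
    using t(1) gen_span by blast
  then have "act n (idem m k) t \<in> S"
  proof (induction rule: pm.span_induct_alt)
    case base
    then show ?case using pm.subspace_0[OF S] by (simp add: M.actr.zero)
  next
    case (step c x y)
    then obtain d i where di: "x = act n (dg d) (gen i n)" "d \<in> matchings n n" "i \<in> I" "lvl i \<le> n" by blast
    have "act n (idem m k) x = act n (idem m k \<star> dg d) (gen i n)"
      unfolding di(1) using sys_act_mult[OF M.idem_Hn[OF n], of "dg d" "gen i n"] di gen_T by simp
    then have "act n (idem m k) x \<in> S" using gens di by simp
    then show ?case
      using pm.subspace_add[OF S pm.subspace_scale[OF S]] step(2) by (simp add: M.actr.add M.actr.scale)
  qed
  with t(2) show "x \<in> S" by simp
qed

text \<open>The caps of the idempotent turn \<open>d\<close> into a half diagram \<open>e\<close>,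
  and its cups are put back on top. If the result is nonzero, \<open>e\<close> has no left block
  because of the projector, and no right block beyond \<open>lvl i\<close> because of
  \<open>gen_bad\<close>.\<close>

lemma gen_reduce:
  assumes n: "n = m + 2 * k" and d: "d \<in> matchings n n" and i: "i \<in> I" "lvl i \<le> n"
    and nz: "act n (idem m k \<star> dg d) (gen i n) \<noteq> 0"
  shows "\<exists>e r. e \<in> matchings m n \<and> (\<forall>x y. {x, y} \<in> e \<longrightarrow> x < y \<longrightarrow> \<not> y < 0) \<and>
    (\<forall>x y. {x, y} \<in> e \<longrightarrow> int (lvl i) < x \<longrightarrow> \<not> x < y) \<and>
    act n (idem m k \<star> dg d) (gen i n) = sc r (act n (idem m k) (act n (dg ((ins 1 ^^ k) e)) (gen i n)))"
proof -
  let ?e = "diagram_concat (mirror (eta m k)) d"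
  have d': "d \<in> matchings (m + 2 * k) n" using d n by simp
  have e: "?e \<in> matchings m n" by (rule concat_matching[OF mirror_matching[OF eta_matching] d'])
  have de: "(ins 1 ^^ k) ?e \<in> matchings n n" using ins1_matching[OF e, of k] n by simp
  obtain r where r: "idem m k \<star> dg d = sc r (E m k \<star> JW m \<star> dg ?e)" using idem_dg[OF d'] .
  have eq: "act n (idem m k \<star> dg d) (gen i n) = sc r (act n (idem m k) (act n (dg ((ins 1 ^^ k) ?e)) (gen i n)))"
    unfolding r idem_ins1[OF e, symmetric] M.actl.scale
    using sys_act_mult[OF M.idem_Hn[OF n], of "dg ((ins 1 ^^ k) ?e)" "gen i n"] de gen_T[OF i] by simp
  have "\<not> y < 0" if "{x, y} \<in> ?e" "x < y" for x y
    using idem_kill_left_block[OF d' that] nz by (auto simp: M.actl.zero)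
  moreover have "\<not> x < y" if "{x, y} \<in> ?e" "int (lvl i) < x" for x y
  proof
    assume "x < y"
    then have "{x, y} \<in> (ins 1 ^^ k) ?e" using ins1_right[OF that(1)] that(2) by simp
    then have "act n (dg ((ins 1 ^^ k) ?e)) (gen i n) = 0" using gen_bad[OF i de] that(2) \<open>x < y\<close> by blast
    then show False using nz eq by (simp add: M.actr.zero)
  qed
  ultimately show ?thesis using e eq by blast
qed

text \<open>A nonzero contribution would yield by \<open>gen_reduce\<close> a half diagram to which
  \<open>no_right_block_card\<close> applies, so that \<open>k \<le> lvl i \<le> L\<close>.\<close>

lemma X_vanish:
  assumes n: "n = m + 2 * k" and "L < k" shows "M.X n m k = {0}"
proof -
  have "M.X n m k \<subseteq> {0}"
  proof (rule X_generated[OF n pm.subspace_single_0])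
    fix d i assume d: "d \<in> matchings n n" and i: "i \<in> I" "lvl i \<le> n"
    show "act n (idem m k \<star> dg d) (gen i n) \<in> {0}"
    proof (rule ccontr)
      assume "act n (idem m k \<star> dg d) (gen i n) \<notin> {0}"
      then have nz: "act n (idem m k \<star> dg d) (gen i n) \<noteq> 0" by simp
      obtain e where e: "e \<in> matchings m n" "\<forall>x y. {x, y} \<in> e \<longrightarrow> int (lvl i) < x \<longrightarrow> \<not> x < y"
        using gen_reduce[OF n d i nz] by metis
      have "n \<le> m + 2 * lvl i" by (rule no_right_block_card[OF e(1)]) (use e(2) in blast)
      then show False using n lvl_le[OF i(1)] assms(2) by simp
    qed
  qed
  then show ?thesis using pm.subspace_0[OF M.X_subspace] by blast
qed

definition up :: "nat \<Rightarrow> nat \<Rightarrow> ('g \<Rightarrow>\<^sub>0 complex) \<Rightarrow> ('g \<Rightarrow>\<^sub>0 complex)" where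
  "up m k x = act (Suc (m + 2 * k)) (idem (Suc m) k) (phi (m + 2 * k) x)"

lemma up_lin: "Vector_Spaces.linear sc sc (up m k)"
  unfolding up_def by unfold_locales (auto simp: phi.add phi.scale M.actr.add M.actr.scale)

lemma up_X: "x \<in> M.X (m + 2 * k) m k \<Longrightarrow> up m k x \<in> M.X (Suc (m + 2 * k)) (Suc m) k"
  unfolding up_def M.X_def[of "Suc (m + 2 * k)"]
  using phi_T[OF M.X_T[OF refl]] by blast

text \<open>\<open>up\<close> absorbs the smaller idempotent. The terms of \<open>JW m\<close> other
  than the identity have a left block; it remains a left block after one more strand is added, and
  is then killed by \<open>idem (Suc m) k\<close>.\<close>

lemma up_idem:
  assumes y: "y \<in> matchings m (m + 2 * k)" and g: "g \<in> T (m + 2 * k)"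
  shows "up m k (act (m + 2 * k) (dg ((ins 1 ^^ k) y)) g) =
    up m k (act (m + 2 * k) (idem m k) (act (m + 2 * k) (dg ((ins 1 ^^ k) y)) g))"
proof -
  interpret up: Vector_Spaces.linear sc sc "up m k" by (rule up_lin)
  define n where "n = m + 2 * k"
  have y: "y \<in> matchings m n" and g: "g \<in> T n" using y g by (auto simp: n_def)
  have [simp]: "dg y \<in> finitary" by (rule dg_fin[OF y])
  have Y: "(ins 1 ^^ k) y \<in> matchings n n" using ins1_matching[OF y, of k] by (simp add: n_def)
  obtain N where N: "N \<in> supp_on (matchings m m - {id_diagram m})" "JW m = one m + N"
    using H_decompose[OF JW_H[of m]] JW_coeff[of m] by auto
  have "N \<in> H m m" using N(1) by (auto simp: H_def supp_on_def)
  then have [simp]: "N \<in> finitary" by (rule H_finitary)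
  have "up m k (act n (E m k \<star> N \<star> dg y) g) \<in> {0}"
  proof (rule linear_in_subspace[OF _ pm.subspace_single_0 N(1), where L = "\<lambda>N. up m k (act n (E m k \<star> N \<star> dg y) g)"])
    show "Vector_Spaces.linear sc sc (\<lambda>N. up m k (act n (E m k \<star> N \<star> dg y) g))"
      by unfold_locales (auto simp: left.add left.scale right.add right.scale M.actl.add M.actl.scale up.add up.scale)
    fix d assume "d \<in> matchings m m - {id_diagram m}"
    then have d: "d \<in> matchings m m" "d \<noteq> id_diagram m" by auto
    have [simp]: "dg d \<in> finitary" by (rule dg_fin[OF d(1)])
    let ?D = "diagram_concat d y" and ?F = "(ins 1 ^^ k) (diagram_concat d y)"
    have D: "?D \<in> matchings m n" by (rule concat_matching[OF d(1) y])
    have F: "?F \<in> matchings n n" using ins1_matching[OF D, of k] by (simp add: n_def)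
    obtain x z where xz: "{x, z} \<in> d" "x < z" "z < 0" using left_block_exists[OF d(1)] d(2) by blast
    then have "{x, z} \<in> ?D" using concat_left_block[OF d(1) y] by simp
    then have "{x - 2 * int k, z - 2 * int k} \<in> ?F" using ins1_left xz by simp
    then have blk: "{x - 2 * int k, z - 2 * int k} \<in> ext n n ?F" by (simp add: ext_def)
    have eF: "ext n n ?F \<in> matchings (Suc m + 2 * k) (Suc n)" using ext_matching[OF F] by (simp add: n_def)
    then have kill: "idem (Suc m) k \<star> dg (ext n n ?F) = 0" by (rule idem_kill[OF _ blk xz(2,3)])
    have "E m k \<star> dg d \<star> dg y = sc (\<delta> ^ loops d y) (dg ?F)"
    proof -
      have "E m k \<star> dg d \<star> dg y = E m k \<star> (dg d \<star> dg y)" by (rule fin_assoc) simp_all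
      then show ?thesis unfolding ins1_dg[OF D] mult_dg[of d y] by (simp only: right.scale)
    qed
    moreover have "up m k (act n (dg ?F) g) = 0"
    proof -
      have "up m k (act n (dg ?F) g) = act (Suc n) (idem (Suc m) k) (act (Suc n) (dg (ext n n ?F)) (phi n g))"
        using phi_act[OF F g] by (simp add: up_def n_def)
      also have "\<dots> = act (Suc n) (idem (Suc m) k \<star> dg (ext n n ?F)) (phi n g)"
        using sys_act_mult[of "idem (Suc m) k" "Suc n" "dg (ext n n ?F)" "phi n g"]
          idem_H[of "Suc m" k] ext_matching[OF F] phi_T[OF g] by (simp add: n_def)
      finally show ?thesis by (simp add: kill M.actl.zero)
    qed
    ultimately show "up m k (act n (E m k \<star> dg d \<star> dg y) g) \<in> {0}"
      by (simp add: M.actl.scale up.scale)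
  qed
  moreover have "act n (idem m k) (act n (dg ((ins 1 ^^ k) y)) g) =
      act n (dg ((ins 1 ^^ k) y)) g + act n (E m k \<star> N \<star> dg y) g"
  proof -
    have "act n (idem m k) (act n (dg ((ins 1 ^^ k) y)) g) = act n (idem m k \<star> dg ((ins 1 ^^ k) y)) g"
      using sys_act_mult[OF M.idem_Hn, of n m k "dg ((ins 1 ^^ k) y)" g] Y g by (simp add: n_def)
    also have "idem m k \<star> dg ((ins 1 ^^ k) y) = E m k \<star> JW m \<star> dg y" by (rule idem_ins1[OF y])
    also have "E m k \<star> JW m = E m k + E m k \<star> N"
      unfolding N(2) using mult_one[OF E_H[of m k]] by (simp add: right.add)
    finally show ?thesis by (simp add: left.add M.actl.add ins1_dg[OF y])
  qed
  ultimately show ?thesis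
    by (simp add: n_def up.add)
qed

text \<open>\<open>gen_reduce\<close> and \<open>bottom_strand\<close> exhibit the nonzero spanning
  vectors of the target as multiples of values of \<open>idem (Suc m) k\<close> on images of
  \<open>phi\<close>. Their preimages need not lie in the smaller multiplicity space;
  \<open>up_idem\<close> moves them there.\<close>

lemma up_surj:
  assumes "L \<le> m" shows "up m k ` M.X (m + 2 * k) m k = M.X (Suc (m + 2 * k)) (Suc m) k"
proof
  define n where "n = m + 2 * k"
  show "up m k ` M.X (m + 2 * k) m k \<subseteq> M.X (Suc (m + 2 * k)) (Suc m) k" using up_X by blast
  have n': "Suc n = Suc m + 2 * k" by (simp add: n_def)
  have S: "pm.subspace (up m k ` M.X n m k)" by (rule subspace_linear_image[OF up_lin M.X_subspace])
  have "M.X (Suc n) (Suc m) k \<subseteq> up m k ` M.X n m k"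
  proof (rule X_generated[OF n' S])
    fix d i assume d: "d \<in> matchings (Suc n) (Suc n)" and i: "i \<in> I" "lvl i \<le> Suc n"
    have li: "lvl i \<le> m" "lvl i \<le> n" using lvl_le[OF i(1)] assms by (auto simp: n_def)
    let ?g = "gen i n"
    have g: "?g \<in> T n" by (rule gen_T[OF i(1) li(2)])
    show "act (Suc n) (idem (Suc m) k \<star> dg d) (gen i (Suc n)) \<in> up m k ` M.X n m k"
    proof (cases "act (Suc n) (idem (Suc m) k \<star> dg d) (gen i (Suc n)) = 0")
      case True
      then show ?thesis using pm.subspace_0[OF S] by simp
    next
      case False
      obtain e r where e: "e \<in> matchings (Suc m) (Suc n)" "\<forall>x y. {x, y} \<in> e \<longrightarrow> x < y \<longrightarrow> \<not> y < 0"
        "\<forall>x y. {x, y} \<in> e \<longrightarrow> int (lvl i) < x \<longrightarrow> \<not> x < y"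
        and eq: "act (Suc n) (idem (Suc m) k \<star> dg d) (gen i (Suc n)) =
          sc r (act (Suc n) (idem (Suc m) k) (act (Suc n) (dg ((ins 1 ^^ k) e)) (gen i (Suc n))))"
        using gen_reduce[OF n' d i False] by metis
      have "{- int m - 1, int n + 1} \<in> e"
        by (rule bottom_strand[OF e(1) li(1)]) (use e(2,3) in blast)+
      then obtain y where y: "y \<in> matchings m n" "e = ext m n y" using ext_remove[OF e(1)] by blast
      have Y: "(ins 1 ^^ k) y \<in> matchings n n" using ins1_matching[OF y(1), of k] by (simp add: n_def)
      have "(ins 1 ^^ k) e = ext n n ((ins 1 ^^ k) y)" unfolding y(2) ins1_ext by (simp add: n_def)
      then have "act (Suc n) (dg ((ins 1 ^^ k) e)) (gen i (Suc n)) = phi n (act n (dg ((ins 1 ^^ k) y)) ?g)"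
        using phi_act[OF Y g] gen_phi[OF i(1) li(2)] by simp
      then have "act (Suc n) (idem (Suc m) k) (act (Suc n) (dg ((ins 1 ^^ k) e)) (gen i (Suc n))) =
          up m k (act n (idem m k) (act n (dg ((ins 1 ^^ k) y)) ?g))"
        using up_idem[of y m k ?g] y(1) g by (simp add: up_def n_def)
      moreover have "act n (idem m k) (act n (dg ((ins 1 ^^ k) y)) ?g) \<in> M.X n m k"
        unfolding M.X_def using sys_act_T[of "dg ((ins 1 ^^ k) y)" n ?g] Y g by simp
      ultimately show ?thesis unfolding eq by (intro pm.subspace_scale[OF S]) (simp only: imageI)
    qed
  qed
  then show "M.X (Suc (m + 2 * k)) (Suc m) k \<subseteq> up m k ` M.X (m + 2 * k) m k" by (simp add: n_def)
qed

definition mult_dim :: "nat \<Rightarrow> nat \<Rightarrow> nat" where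
  "mult_dim k m = pm.dim (M.X (m + 2 * k) m k)"

lemma up_dim:
  assumes "L \<le> m"
  shows "mult_dim k (Suc m) \<le> mult_dim k m"
    "mult_dim k (Suc m) = mult_dim k m \<Longrightarrow> inj_on (up m k) (M.X (m + 2 * k) m k)"
proof -
  obtain G where G: "finite G" "T (m + 2 * k) \<subseteq> pm.span G" using M.finite_dim by blast
  then have "M.X (m + 2 * k) m k \<subseteq> pm.span G" using M.X_T[OF refl] by blast
  note * = surj_dim[OF up_lin M.X_subspace G(1) this]
  show "mult_dim k (Suc m) \<le> mult_dim k m"
    using *(1)[of m k] unfolding up_surj[OF assms] mult_dim_def by simp
  show "mult_dim k (Suc m) = mult_dim k m \<Longrightarrow> inj_on (up m k) (M.X (m + 2 * k) m k)"
    using *(2)[of m k] unfolding up_surj[OF assms] mult_dim_def by simp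
qed

lemma mult_stable: "\<exists>M\<ge>L. \<forall>m\<ge>M. mult_dim k m = mult_dim k M"
  using decreasing_eventually_constant[of L "mult_dim k"] up_dim(1) by metis

text \<open>The kernel of \<open>phi n\<close> is stable under TL_n, so its part in each
  multiplicity space lies in the kernel of \<open>up\<close>, which is zero for large
  \<open>n\<close>. Since the unit is a combination of \<open>ideal_gens\<close>, the whole kernel
  vanishes.\<close>

lemma phi_inj: "\<exists>N. \<forall>n\<ge>N. \<forall>t\<in>T n. phi n t = 0 \<longrightarrow> t = 0"
proof -
  obtain M where M: "\<And>k. L \<le> M k" "\<And>k m. M k \<le> m \<Longrightarrow> mult_dim k m = mult_dim k (M k)"
    using mult_stable by metis
  \<comment> \<open>The sum dominates every \<open>M k\<close> with \<open>k \<le> L\<close>, and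
    adding \<open>2 * L\<close> keeps the number \<open>n - 2 * k\<close> of strands above that
    bound. Larger \<open>k\<close> are covered by \<open>X_vanish\<close>.\<close>
  define N where "N = (\<Sum>k\<le>L. M k) + 2 * L"
  have "t = 0" if nN: "N \<le> n" and t: "t \<in> T n" and zero: "phi n t = 0" for n t
  proof -
    have phi_zero: "phi n (act n x t) = 0" if x: "x \<in> H n n" for x
    proof -
      have "phi n (act n x t) \<in> {0}"
      proof (rule linear_in_subspace[OF _ pm.subspace_single_0 x[unfolded H_def], where L = "\<lambda>x. phi n (act n x t)"])
        show "Vector_Spaces.linear sc sc (\<lambda>x. phi n (act n x t))"
          by unfold_locales (auto simp: M.actl.add M.actl.scale phi.add phi.scale)
        show "phi n (act n (dg d) t) \<in> {0}" if "d \<in> matchings n n" for d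
          using phi_act[OF that t] zero by (simp add: M.actr.zero)
      qed
      then show ?thesis by simp
    qed
    have gens: "act n x t = 0" if x: "x \<in> ideal_gens n" for x
    proof -
      obtain \<alpha> \<beta> k where g: "x = dg \<alpha> \<star> JW (n - 2 * k) \<star> dg \<beta>" "2 * k \<le> n"
        "\<alpha> \<in> matchings n (n - 2 * k)" "\<beta> \<in> matchings (n - 2 * k) n" using x
        by (auto simp: ideal_gens_def)
      define m where "m = n - 2 * k"
      have n: "n = m + 2 * k" using g(2) by (simp add: m_def)
      have a: "dg \<alpha> \<in> H n m" and b: "dg \<beta> \<in> H m n" using g by (auto simp: m_def)
      have Eb: "E m k \<star> dg \<beta> \<in> H n n" by (rule mult_closed[OF M.E_Hn(1)[OF n] b])
      let ?x = "act n (idem m k) (act n (E m k \<star> dg \<beta>) t)"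
      have X: "?x \<in> M.X n m k" unfolding M.X_def using sys_act_T[OF Eb t] by blast
      have "?x = 0"
      proof (cases "k \<le> L")
        case False
        then show ?thesis using X X_vanish[OF n] by simp
      next
        case True
        then have "M k \<le> (\<Sum>k\<le>L. M k)" by (intro member_le_sum) auto
        then have mM: "M k \<le> m" using nN True n by (simp add: N_def)
        then have "mult_dim k (Suc m) = mult_dim k m" using M(2)[of k m] M(2)[of k "Suc m"] by simp
        then have inj: "inj_on (up m k) (M.X n m k)"
          using up_dim(2)[of m k] M(1)[of k] mM n by simp
        have "?x = act n (idem m k \<star> (E m k \<star> dg \<beta>)) t"
          using sys_act_mult[OF M.idem_Hn[OF n] Eb t] by simp
        then have "phi n ?x = 0" using phi_zero mult_closed[OF M.idem_Hn[OF n] Eb] by simp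
        then have "up m k ?x = 0" unfolding up_def n[symmetric] by (simp add: M.actr.zero)
        moreover have "up m k 0 = 0" unfolding up_def by (simp add: M.actr.zero phi.zero)
        ultimately show ?thesis using inj_onD[OF inj _ X pm.subspace_0[OF M.X_subspace]] by simp
      qed
      then show ?thesis
        unfolding g(1) m_def[symmetric] M.act_through[OF n a b t] by (simp add: M.actr.zero)
    qed
    have "act n x t = 0" if x: "x \<in> pm.span (ideal_gens n)" for x
      using x
    proof (induction rule: pm.span_induct_alt)
      case base
      then show ?case by (simp add: M.actl.zero)
    next
      case (step c x y)
      then show ?case using gens[OF step(1)] by (simp add: M.actl.add M.actl.scale)
    qed
    from this[OF one_in_span_gens] show "t = 0" using sys_act_one[OF t] by simp
  qed
  then show ?thesis by blast
qed

end

section \<open>Quotients of free spaces\<close>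

lemma free_space_simps [simp]:
  "carrier (free_space X) = supp_on X" "zero (free_space X) = 0" "add (free_space X) = (+)"
  "module.smult (free_space X) = sc"
  by (auto simp: free_space_def supp_on_def sc_def)

lemma vectorspaceI:
  fixes V :: "(complex, 'v) module"
  assumes "abelian_group V"
    and "\<And>c x. x \<in> carrier V \<Longrightarrow> c \<odot>\<^bsub>V\<^esub> x \<in> carrier V"
    and "\<And>a b x. x \<in> carrier V \<Longrightarrow> (a + b) \<odot>\<^bsub>V\<^esub> x = a \<odot>\<^bsub>V\<^esub> x \<oplus>\<^bsub>V\<^esub> b \<odot>\<^bsub>V\<^esub> x"
    and "\<And>c x y. x \<in> carrier V \<Longrightarrow> y \<in> carrier V \<Longrightarrow> c \<odot>\<^bsub>V\<^esub> (x \<oplus>\<^bsub>V\<^esub> y) = c \<odot>\<^bsub>V\<^esub> x \<oplus>\<^bsub>V\<^esub> c \<odot>\<^bsub>V\<^esub> y"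
    and "\<And>a b x. x \<in> carrier V \<Longrightarrow> (a * b) \<odot>\<^bsub>V\<^esub> x = a \<odot>\<^bsub>V\<^esub> (b \<odot>\<^bsub>V\<^esub> x)"
    and "\<And>x. x \<in> carrier V \<Longrightarrow> 1 \<odot>\<^bsub>V\<^esub> x = x"
  shows "vectorspace class_ring V"
proof (rule vectorspace.intro)
  show "Module.module class_ring V"
    by (rule moduleI) (use assms field.is_ring[OF class_field] in
      \<open>auto simp: class_field[THEN fieldE(1)]\<close>)
  show "field (class_ring :: complex ring)" by (rule class_field)
qed

lemma linear_mapI:
  fixes V :: "(complex, 'v) module" and W :: "(complex, 'w) module"
  assumes "vectorspace class_ring V" "vectorspace class_ring W"
    and "\<And>x. x \<in> carrier V \<Longrightarrow> f x \<in> carrier W"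
    and "\<And>x y. x \<in> carrier V \<Longrightarrow> y \<in> carrier V \<Longrightarrow> f (x \<oplus>\<^bsub>V\<^esub> y) = f x \<oplus>\<^bsub>W\<^esub> f y"
    and "\<And>c x. x \<in> carrier V \<Longrightarrow> f (c \<odot>\<^bsub>V\<^esub> x) = c \<odot>\<^bsub>W\<^esub> f x"
  shows "linear_map class_ring V W f"
proof -
  interpret V: vectorspace class_ring V by fact
  interpret W: vectorspace class_ring W by fact
  have "f \<in> LinearCombinations.module_hom class_ring V W" unfolding LinearCombinations.module_hom_def using assms(3-5) by simp
  then show ?thesis
    by (intro linear_map.intro mod_hom.intro assms(1,2) mod_hom_axioms.intro
        vectorspace.axioms(1)[OF assms(1)] vectorspace.axioms(1)[OF assms(2)])
qed

lemma linear_mapD: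
  fixes V :: "(complex, 'v) module" and W :: "(complex, 'w) module"
  assumes "linear_map class_ring V W f"
  shows "vectorspace class_ring V" "vectorspace class_ring W"
    and "x \<in> carrier V \<Longrightarrow> f x \<in> carrier W"
    and "x \<in> carrier V \<Longrightarrow> y \<in> carrier V \<Longrightarrow> f (x \<oplus>\<^bsub>V\<^esub> y) = f x \<oplus>\<^bsub>W\<^esub> f y"
    and "x \<in> carrier V \<Longrightarrow> f (c \<odot>\<^bsub>V\<^esub> x) = c \<odot>\<^bsub>W\<^esub> f x"
    and "f \<zero>\<^bsub>V\<^esub> = \<zero>\<^bsub>W\<^esub>"
proof -
  show V: "vectorspace class_ring V" and W: "vectorspace class_ring W"
    using assms by (simp_all add: linear_map_def)
  interpret V: vectorspace class_ring V by fact
  interpret W: vectorspace class_ring W by fact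
  have h: "f \<in> LinearCombinations.module_hom class_ring V W"
    using assms by (simp add: linear_map_def mod_hom_def mod_hom_axioms_def)
  show cl: "x \<in> carrier V \<Longrightarrow> f x \<in> carrier W" for x using h unfolding LinearCombinations.module_hom_def by auto
  show "x \<in> carrier V \<Longrightarrow> y \<in> carrier V \<Longrightarrow> f (x \<oplus>\<^bsub>V\<^esub> y) = f x \<oplus>\<^bsub>W\<^esub> f y"
    using h unfolding LinearCombinations.module_hom_def by simp
  show sm: "x \<in> carrier V \<Longrightarrow> f (c \<odot>\<^bsub>V\<^esub> x) = c \<odot>\<^bsub>W\<^esub> f x" for x c
    using h unfolding LinearCombinations.module_hom_def by simp
  have "f (0 \<odot>\<^bsub>V\<^esub> \<zero>\<^bsub>V\<^esub>) = 0 \<odot>\<^bsub>W\<^esub> f \<zero>\<^bsub>V\<^esub>" by (rule sm) simp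
  moreover have "0 \<odot>\<^bsub>V\<^esub> \<zero>\<^bsub>V\<^esub> = \<zero>\<^bsub>V\<^esub>" using V.lmult_0[of "\<zero>\<^bsub>V\<^esub>"] by simp
  moreover have "0 \<odot>\<^bsub>W\<^esub> f \<zero>\<^bsub>V\<^esub> = \<zero>\<^bsub>W\<^esub>" using W.lmult_0[of "f \<zero>\<^bsub>V\<^esub>"] cl by simp
  ultimately show "f \<zero>\<^bsub>V\<^esub> = \<zero>\<^bsub>W\<^esub>" by simp
qed

lemma vectorspace_free: "vectorspace class_ring (free_space X)"
proof (rule vectorspaceI)
  note S = subspace_supp_on[of X]
  show "abelian_group (free_space X)"
  proof (rule abelian_groupI)
    show "\<exists>y\<in>carrier (free_space X). y \<oplus>\<^bsub>free_space X\<^esub> x = \<zero>\<^bsub>free_space X\<^esub>"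
      if "x \<in> carrier (free_space X)" for x
      using that pm.subspace_neg[OF S, of x] by (intro bexI[of _ "- x"]) auto
  qed (auto simp: pm.subspace_add[OF S] pm.subspace_0[OF S] algebra_simps)
qed (auto simp: pm.subspace_scale[OF subspace_supp_on] pm.scale_left_distrib pm.scale_right_distrib)

text \<open>Bridge from the span of the record-based definitions to \<open>pm.span\<close>.\<close>

lemma span_free:
  assumes R: "R \<subseteq> supp_on X"
  shows "LinearCombinations.module.span class_ring (free_space X) R = pm.span R"
proof -
  interpret F: vectorspace class_ring "free_space X" by (rule vectorspace_free)
  have R': "R \<subseteq> carrier (free_space X)" using R by simp
  have sub: "pm.span R \<subseteq> supp_on X" by (rule pm.span_minimal[OF R subspace_supp_on])
  show ?thesis
  proof
    have "LinearCombinations.submodule class_ring (pm.span R) (free_space X)"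
      unfolding LinearCombinations.submodule_def using sub F.module_axioms
      by (auto simp: pm.span_add pm.span_scale pm.span_zero)
    then show "F.span R \<subseteq> pm.span R" by (intro F.span_is_subset) (auto intro: pm.span_base)
    have "LinearCombinations.submodule class_ring (F.span R) (free_space X)"
      by (rule F.span_is_submodule[OF R'])
    then have "pm.subspace (F.span R)"
      unfolding LinearCombinations.submodule_def pm.subspace_def by simp
    then show "pm.span R \<subseteq> F.span R" using F.in_own_span[OF R'] by (intro pm.span_minimal)
  qed
qed

definition coset :: "('x \<Rightarrow>\<^sub>0 complex) set \<Rightarrow> ('x \<Rightarrow>\<^sub>0 complex) \<Rightarrow> ('x \<Rightarrow>\<^sub>0 complex) set" where
  "coset K f = (\<lambda>k. k + f) ` K"

lemma a_r_coset_free: "K +>\<^bsub>free_space X\<^esub> f = coset K f"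
  by (auto simp: a_r_coset_def' coset_def)

context
  fixes K :: "('x \<Rightarrow>\<^sub>0 complex) set" assumes K: "pm.subspace K"
begin

lemma coset_eq_iff: "coset K f = coset K g \<longleftrightarrow> f - g \<in> K"
proof
  assume "coset K f = coset K g"
  moreover have "f \<in> coset K f" unfolding coset_def using pm.subspace_0[OF K] by force
  ultimately obtain k where "k \<in> K" "f = k + g" by (auto simp: coset_def)
  then show "f - g \<in> K" by simp
next
  have le: "coset K f \<subseteq> coset K g" if "f - g \<in> K" for f g
  proof
    fix x assume "x \<in> coset K f"
    then obtain k where k: "k \<in> K" "x = k + f" by (auto simp: coset_def)
    have "k + (f - g) \<in> K" using k that pm.subspace_add[OF K] by blast
    moreover have "x = k + (f - g) + g" using k by simp
    ultimately show "x \<in> coset K g" unfolding coset_def by (rule rev_image_eqI)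
  qed
  assume "f - g \<in> K"
  moreover have "g - f \<in> K" using pm.subspace_neg[OF K \<open>f - g \<in> K\<close>] by simp
  ultimately show "coset K f = coset K g" using le by blast
qed

lemma coset_self: "f \<in> coset K f"
  unfolding coset_def using pm.subspace_0[OF K] by force

lemma quotient_add: "set_add (free_space X) (coset K f) (coset K g) = coset K (f + g)"
proof
  have m: "set_add (free_space X) A B = {a + b | a b. a \<in> A \<and> b \<in> B}" for A B
    by (auto simp: set_add_def' )
  show "set_add (free_space X) (coset K f) (coset K g) \<subseteq> coset K (f + g)"
  proof
    fix x assume "x \<in> set_add (free_space X) (coset K f) (coset K g)"
    then obtain k l where "k \<in> K" "l \<in> K" "x = (k + f) + (l + g)" unfolding m coset_def by auto
    then have "k + l \<in> K" "x = (k + l) + (f + g)" using pm.subspace_add[OF K] by (auto simp: algebra_simps)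
    then show "x \<in> coset K (f + g)" unfolding coset_def by (intro rev_image_eqI)
  qed
  show "coset K (f + g) \<subseteq> set_add (free_space X) (coset K f) (coset K g)"
  proof
    fix x assume "x \<in> coset K (f + g)"
    then obtain k where k: "k \<in> K" "x = k + (f + g)" by (auto simp: coset_def)
    then have "k + f \<in> coset K f" "x = (k + f) + g" by (auto simp: coset_def algebra_simps)
    then show "x \<in> set_add (free_space X) (coset K f) (coset K g)" unfolding m using coset_self[of g] by blast
  qed
qed

lemma quotient_smult:
  "(\<Union>x\<in>coset K f. K +>\<^bsub>free_space X\<^esub> (c \<odot>\<^bsub>free_space X\<^esub> x)) = coset K (sc c f)"
proof -
  have "coset K (sc c x) = coset K (sc c f)" if H: "x \<in> coset K f" for x
  proof -
    obtain k where "k \<in> K" "x = k + f" using H by (auto simp: coset_def)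
    then show ?thesis unfolding coset_eq_iff
      using pm.subspace_scale[OF K] by (simp add: pm.scale_right_distrib)
  qed
  then have "(\<Union>x\<in>coset K f. coset K (sc c x)) = (\<Union>x\<in>coset K f. coset K (sc c f))" by (rule SUP_cong[OF refl])
  also have "\<dots> = coset K (sc c f)" using coset_self by blast
  finally show ?thesis by (simp add: a_r_coset_free)
qed

end

lemma carrier_quotient: "carrier (quotient_space (free_space X) K) = coset K ` supp_on X"
  by (auto simp: quotient_space_def A_RCOSETS_def' a_r_coset_free)

section \<open>Stacking\<close>

lemma partition_on_eq_cover:
  assumes "partition_on S p" "\<And>B. B \<in> r \<Longrightarrow> B \<in> p" "S \<subseteq> \<Union> r" shows "p = r"
proof
  show "p \<subseteq> r"
  proof
    fix B assume B: "B \<in> p"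
    then obtain x where x: "x \<in> B" "x \<in> S"
      using partition_onD3[OF assms(1)] partition_onD1[OF assms(1)] by (metis UnionI all_not_in_conv)
    then obtain C where C: "C \<in> r" "x \<in> C" using assms(3) by blast
    then have "B = C" using partition_on_unique[OF assms(1) B] assms(2) x(1) by blast
    with C show "B \<in> r" by simp
  qed
  show "r \<subseteq> p" using assms(2) by blast
qed

lemma stack_id_Suc: "stack m y (id_diagram (Suc k)) = ext (m + k) (m + k) (stack m y (id_diagram k))"
proof -
  have "{1..int (Suc k)} = insert (int k + 1) {1..int k}" by auto
  then have *: "id_diagram (Suc k) = insert {- (int k + 1), int k + 1} (id_diagram k)"
    by (simp add: id_diagram_def)
  let ?f = "\<lambda>i. if i < 0 then i - int m else i + int m"
  have "?f (- (int k + 1)) = - int (m + k) - 1" "?f (int k + 1) = int (m + k) + 1" by simp_all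
  then have "?f ` {- (int k + 1), int k + 1} = {- int (m + k) - 1, int (m + k) + 1}"
    by (simp only: image_insert image_empty)
  then show ?thesis unfolding stack_def * ext_def image_insert by (simp only: Un_insert_right)
qed

lemma stack_id_0 [simp]: "stack m y (id_diagram 0) = y"
  by (simp add: stack_def id_diagram_def)

lemma stack_id_matching: "y \<in> matchings m m \<Longrightarrow> stack m y (id_diagram k) \<in> matchings (m + k) (m + k)"
proof (induction k)
  case (Suc k)
  then show ?case using ext_matching unfolding stack_id_Suc by simp
qed simp

lemma stack_id_1: "stack m y (id_diagram 1) = ext m m y"
  using stack_id_Suc[of m y 0] by simp

lemma stack_id_block: "m < x \<Longrightarrow> x \<le> m + k \<Longrightarrow> {- int x, int x} \<in> stack m y (id_diagram k)"
proof (induction k)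
  case (Suc k)
  then show ?case unfolding stack_id_Suc by (cases "x = Suc (m + k)") (auto simp: ext_def)
qed simp

lemma stack_id_sub: "B \<in> y \<Longrightarrow> B \<in> stack m y r"
  by (simp add: stack_def)

lemma id_Suc: "id_diagram (Suc n) = ext n n (id_diagram n)"
proof -
  have "{1..int (Suc n)} = insert (int n + 1) {1..int n}" by auto
  then show ?thesis by (simp add: id_diagram_def ext_def)
qed

lemma stack_id_id: "stack m (id_diagram m) (id_diagram k) = id_diagram (m + k)"
proof (induction k)
  case (Suc k)
  show ?case unfolding stack_id_Suc Suc by (simp add: id_Suc)
qed simp

definition tshift :: "nat \<Rightarrow> int \<Rightarrow> int" where
  "tshift m x = (if x < 0 then x - int m else x + int m)"

lemma stack_tshift: "stack m p r = p \<union> (image (tshift m)) ` r"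
  by (simp add: stack_def tshift_def[abs_def])

lemma id_stack_matching:
  assumes r: "r \<in> matchings k k"
  shows "stack m (id_diagram m) r \<in> matchings (m + k) (m + k)"
proof -
  let ?R = "(image (tshift m)) ` r" and ?S = "tshift m ` dots k k"
  have R: "ncm ?S ?R"
    using r by (intro ncm_image) (auto simp: matchings_iff tshift_def dots_iff intro!: strict_mono_onI)
  \<comment> \<open>The straight strands are added from position \<open>m\<close> down to position
    1. All dots present so far have larger absolute value, so none lies between the ends of the new
    strand.\<close>
  have step: "ncm (?S \<union> {x. int (m - j) < \<bar>x\<bar> \<and> \<bar>x\<bar> \<le> int m}) (?R \<union> (\<lambda>i. {- i, i}) ` {int (m - j) + 1..int m})"
    if "j \<le> m" for j
    using that
  proof (induction j)
    case 0
    have "{x. int (m - 0) < \<bar>x\<bar> \<and> \<bar>x\<bar> \<le> int m} = {}" "{int (m - 0) + 1..int m} = {}" by auto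
    then show ?case using R by (simp only: image_empty Un_empty_right)
  next
    case (Suc j)
    let ?i = "int (m - j)"
    have i: "1 \<le> ?i" "int (m - Suc j) = ?i - 1" using Suc.prems by auto
    have S: "?S \<union> {x. int (m - Suc j) < \<bar>x\<bar> \<and> \<bar>x\<bar> \<le> int m} =
        insert (- ?i) (insert ?i (?S \<union> {x. ?i < \<bar>x\<bar> \<and> \<bar>x\<bar> \<le> int m}))" unfolding i(2) using i(1) by auto
    have "{?i - 1 + 1..int m} = insert ?i {?i + 1..int m}" by auto
    then have P: "?R \<union> (\<lambda>i. {- i, i}) ` {int (m - Suc j) + 1..int m} =
        insert {- ?i, ?i} (?R \<union> (\<lambda>i. {- i, i}) ` {?i + 1..int m})" unfolding i(2) by simp
    have out: "int m < \<bar>x\<bar>" if "x \<in> ?S" for x using that by (auto simp: tshift_def dots_iff)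
    have IH: "ncm (?S \<union> {x. ?i < \<bar>x\<bar> \<and> \<bar>x\<bar> \<le> int m}) (?R \<union> (\<lambda>i. {- i, i}) ` {?i + 1..int m})"
      using Suc by simp
    have big: "?i < \<bar>x\<bar>" if "x \<in> ?S \<union> {x. ?i < \<bar>x\<bar> \<and> \<bar>x\<bar> \<le> int m}" for x
      using that out[of x] by auto
    show ?case unfolding S P
    proof (rule ncm_insert[OF IH])
      show "- ?i < ?i" using i by simp
      show "- ?i \<notin> ?S \<union> {x. ?i < \<bar>x\<bar> \<and> \<bar>x\<bar> \<le> int m}" "?i \<notin> ?S \<union> {x. ?i < \<bar>x\<bar> \<and> \<bar>x\<bar> \<le> int m}"
        using big[of "- ?i"] big[of ?i] by auto
      show "- ?i < v \<and> v < ?i" if "{u, v} \<in> ?R \<union> (\<lambda>i. {- i, i}) ` {?i + 1..int m}" "- ?i < u" "u < ?i" for u v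
        using big[of u] ncm_mem[OF IH that(1)] that(2,3) by auto
    qed
  qed
  have S: "?S \<union> {x. 0 < \<bar>x\<bar> \<and> \<bar>x\<bar> \<le> int m} = dots (m + k) (m + k)"
  proof
    show "?S \<union> {x. 0 < \<bar>x\<bar> \<and> \<bar>x\<bar> \<le> int m} \<subseteq> dots (m + k) (m + k)" by (auto simp: tshift_def dots_iff)
    show "dots (m + k) (m + k) \<subseteq> ?S \<union> {x. 0 < \<bar>x\<bar> \<and> \<bar>x\<bar> \<le> int m}"
    proof
      fix x assume x: "x \<in> dots (m + k) (m + k)"
      show "x \<in> ?S \<union> {x. 0 < \<bar>x\<bar> \<and> \<bar>x\<bar> \<le> int m}"
      proof (cases "\<bar>x\<bar> \<le> int m")
        case True
        then show ?thesis using x by (auto simp: dots_iff)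
      next
        case False
        define z where "z = (if x < 0 then x + int m else x - int m)"
        have "x = tshift m z" "z \<in> dots k k" using False x by (auto simp: z_def tshift_def dots_iff)
        then show ?thesis by blast
      qed
    qed
  qed
  have "stack m (id_diagram m) r = ?R \<union> (\<lambda>i. {- i, i}) ` {1..int m}"
    unfolding stack_tshift id_diagram_def by (rule Un_commute)
  then show ?thesis using step[of m] S by (simp add: matchings_iff)
qed

lemma id_stack_block: "{x, y} \<in> r \<Longrightarrow> {tshift m x, tshift m y} \<in> stack m p r"
  unfolding stack_tshift using imageI[of "{x, y}" r "image (tshift m)"] by simp

lemma id_stack_U:
  assumes "1 \<le> j" "j < int k"
  shows "stack m (id_diagram m) (U k j) = U (m + k) (int m + j)"
proof -
  let ?i = "int m + j" and ?n = "m + k"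
  let ?r = "{{- ?i - 1, - ?i}, {?i, ?i + 1}} \<union> (\<lambda>x. {- x, x}) ` ({1..int ?n} - {?i, ?i + 1})"
  have cover: "dots ?n ?n \<subseteq> \<Union> ?r"
  proof
    fix x assume x: "x \<in> dots ?n ?n"
    show "x \<in> \<Union> ?r"
    proof (cases "\<bar>x\<bar> \<in> {?i, ?i + 1}")
      case True
      then have "x \<in> {- ?i - 1, - ?i} \<or> x \<in> {?i, ?i + 1}" by auto
      then show ?thesis by blast
    next
      case False
      then have "\<bar>x\<bar> \<in> {1..int ?n} - {?i, ?i + 1}" using x by (auto simp: dots_iff)
      moreover have "x \<in> {- \<bar>x\<bar>, \<bar>x\<bar>}" by auto
      ultimately show ?thesis by blast
    qed
  qed
  have i: "1 \<le> ?i" "?i < int ?n" using assms by auto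
  have "U ?n ?i = ?r"
  proof (rule partition_on_eq_cover[OF matchings_partition[OF U_eq(3)[OF i]] _ cover])
    fix B assume "B \<in> ?r"
    then consider "B = {- ?i - 1, - ?i}" | "B = {?i, ?i + 1}"
      | x where "x \<in> {1..int ?n} - {?i, ?i + 1}" "B = {- x, x}" by blast
    then show "B \<in> U ?n ?i"
    proof cases
      case 1 then show ?thesis using U_left[of ?i ?n] by simp
    next
      case 2 then show ?thesis using U_right[OF i(1)] by simp
    next
      case 3 then show ?thesis using U_through[OF i, of x] by auto
    qed
  qed
  moreover have "stack m (id_diagram m) (U k j) = ?r"
  proof (rule partition_on_eq_cover[OF matchings_partition[OF id_stack_matching[OF U_eq(3)[OF assms]]] _ cover])
    fix B assume "B \<in> ?r"
    then consider "B = {- ?i - 1, - ?i}" | "B = {?i, ?i + 1}"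
      | x where "x \<in> {1..int ?n} - {?i, ?i + 1}" "B = {- x, x}" by blast
    then show "B \<in> stack m (id_diagram m) (U k j)"
    proof cases
      case 1
      have "tshift m (- j - 1) = - ?i - 1" "tshift m (- j) = - ?i" using assms by (auto simp: tshift_def)
      then show ?thesis using id_stack_block[OF U_left[of j k], of m "id_diagram m"] 1 by simp
    next
      case 2
      have "tshift m j = ?i" "tshift m (j + 1) = ?i + 1" using assms by (auto simp: tshift_def)
      then show ?thesis using id_stack_block[OF U_right[OF assms(1)], of m "id_diagram m"] 2 by simp
    next
      case 3
      show ?thesis
      proof (cases "x \<le> int m")
        case True
        then have "B \<in> id_diagram m" using 3 by (auto simp: id_block)
        then show ?thesis by (rule stack_id_sub)
      next
        case False
        then have "{- (x - int m), x - int m} \<in> U k j" using 3 assms by (intro U_through) auto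
        from id_stack_block[OF this, of m "id_diagram m"] show ?thesis
          using 3 False by (simp add: tshift_def)
      qed
    qed
  qed
  ultimately show ?thesis by simp
qed

section \<open>Tensor relations\<close>

lemma tensor_relationsI:
  assumes "x \<in> carrier X" "y \<in> carrier Y"
  shows "x' \<in> carrier X \<Longrightarrow> Poly_Mapping.single (x \<oplus>\<^bsub>X\<^esub> x', y) 1 - Poly_Mapping.single (x, y) 1
      - Poly_Mapping.single (x', y) 1 \<in> tensor_relations S X ra Y la"
    and "y' \<in> carrier Y \<Longrightarrow> Poly_Mapping.single (x, y \<oplus>\<^bsub>Y\<^esub> y') 1 - Poly_Mapping.single (x, y) 1
      - Poly_Mapping.single (x, y') 1 \<in> tensor_relations S X ra Y la"
    and "Poly_Mapping.single (c \<odot>\<^bsub>X\<^esub> x, y) 1 - Poly_Mapping.single (x, y) c \<in> tensor_relations S X ra Y la"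
    and "Poly_Mapping.single (x, c \<odot>\<^bsub>Y\<^esub> y) 1 - Poly_Mapping.single (x, y) c \<in> tensor_relations S X ra Y la"
    and "s \<in> S \<Longrightarrow> Poly_Mapping.single (ra x s, y) 1 - Poly_Mapping.single (x, la s y) 1
      \<in> tensor_relations S X ra Y la"
  using assms unfolding tensor_relations_def Un_iff mem_Collect_eq by blast+

lemma tensor_relations_cases:
  assumes "r \<in> tensor_relations S X ra Y la"
  obtains x x' y where "x \<in> carrier X" "x' \<in> carrier X" "y \<in> carrier Y"
      "r = Poly_Mapping.single (x \<oplus>\<^bsub>X\<^esub> x', y) 1 - Poly_Mapping.single (x, y) 1 - Poly_Mapping.single (x', y) 1"
  | x y y' where "x \<in> carrier X" "y \<in> carrier Y" "y' \<in> carrier Y"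
      "r = Poly_Mapping.single (x, y \<oplus>\<^bsub>Y\<^esub> y') 1 - Poly_Mapping.single (x, y) 1 - Poly_Mapping.single (x, y') 1"
  | c x y where "x \<in> carrier X" "y \<in> carrier Y"
      "r = Poly_Mapping.single (c \<odot>\<^bsub>X\<^esub> x, y) 1 - Poly_Mapping.single (x, y) c"
  | c x y where "x \<in> carrier X" "y \<in> carrier Y"
      "r = Poly_Mapping.single (x, c \<odot>\<^bsub>Y\<^esub> y) 1 - Poly_Mapping.single (x, y) c"
  | x s y where "x \<in> carrier X" "s \<in> S" "y \<in> carrier Y"
      "r = Poly_Mapping.single (ra x s, y) 1 - Poly_Mapping.single (x, la s y) 1"
  using assms unfolding tensor_relations_def Un_iff mem_Collect_eq
  by (elim disjE exE conjE) (rule that; assumption)+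

lemma tensor_relations_supp:
  assumes "\<And>x y. x \<in> carrier X \<Longrightarrow> y \<in> carrier X \<Longrightarrow> x \<oplus>\<^bsub>X\<^esub> y \<in> carrier X"
    and "\<And>x y. x \<in> carrier Y \<Longrightarrow> y \<in> carrier Y \<Longrightarrow> x \<oplus>\<^bsub>Y\<^esub> y \<in> carrier Y"
    and "\<And>c x. x \<in> carrier X \<Longrightarrow> c \<odot>\<^bsub>X\<^esub> x \<in> carrier X"
    and "\<And>c x. x \<in> carrier Y \<Longrightarrow> c \<odot>\<^bsub>Y\<^esub> x \<in> carrier Y"
    and "\<And>x s. x \<in> carrier X \<Longrightarrow> s \<in> S \<Longrightarrow> ra x s \<in> carrier X"
    and "\<And>s y. s \<in> S \<Longrightarrow> y \<in> carrier Y \<Longrightarrow> la s y \<in> carrier Y"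
  shows "tensor_relations S X ra Y la \<subseteq> supp_on (carrier X \<times> carrier Y)"
proof
  note D = pm.subspace_diff[OF subspace_supp_on]
  have s: "Poly_Mapping.single (x, y) c \<in> supp_on (carrier X \<times> carrier Y)"
    if "x \<in> carrier X" "y \<in> carrier Y" for x y c using that by (auto simp: supp_on_def)
  fix r assume "r \<in> tensor_relations S X ra Y la"
  then show "r \<in> supp_on (carrier X \<times> carrier Y)"
    by (cases rule: tensor_relations_cases) (simp_all add: D s assms)
qed

section \<open>Morphisms of the Temperley--Lieb category\<close>

text \<open>The diagrams that become zero in Hom(m, n). By \<open>hom_of_eqD\<close> and
  \<open>hom_of_eqI\<close>, two elements of TL_n give the same morphism exactly if they differ by a
  combination of these.\<close>

definition bad :: "nat \<Rightarrow> nat \<Rightarrow> diagram set" where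
  "bad m n = {d \<in> matchings n n. \<exists>x y. {x, y} \<in> d \<and> int m < x \<and> x < y}"

lemma TL_simps [simp]:
  "carrier (TL \<delta> n) = H n n" "add (TL \<delta> n) = (+)" "zero (TL \<delta> n) = 0" "module.smult (TL \<delta> n) = sc"
  "monoid.mult (TL \<delta> n) = tl_mult \<delta>" "one (TL \<delta> n) = dg (id_diagram n)"
  by (simp_all add: TL_def free_space_def supp_on_def H_def sc_def[abs_def] dg_def)

lemma scalar_space_simps [simp]:
  "carrier scalar_space = UNIV" "add scalar_space = (+)" "zero scalar_space = 0" "module.smult scalar_space = (*)"
  by (simp_all add: scalar_space_def)

lemma tl_stack_lin: "tl_stack a f g = lin (\<lambda>p. lin (\<lambda>r. dg (stack a p r)) g) f"
  unfolding tl_stack_def lin_def by (simp add: dg_def pm.scale_sum_right)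

lemma left_embedding_lin: "left_embedding \<delta> a b f = lin (\<lambda>p. dg (stack a p (id_diagram b))) f"
  by (simp add: left_embedding_def tl_stack_lin)

lemma right_embedding_lin: "right_embedding \<delta> a b g = lin (\<lambda>r. dg (stack a (id_diagram a) r)) g"
  by (simp add: right_embedding_def tl_stack_lin)

lemma left_embedding_H: "f \<in> H m m \<Longrightarrow> left_embedding \<delta> m k f \<in> H (m + k) (m + k)"
  unfolding left_embedding_lin H_def
  by (rule lin_in_subspace[OF subspace_supp_on]) (auto intro: stack_id_matching)

lemma right_embedding_H: "f \<in> H k k \<Longrightarrow> right_embedding \<delta> m k f \<in> H (m + k) (m + k)"
  unfolding right_embedding_lin H_def
  by (rule lin_in_subspace[OF subspace_supp_on]) (auto intro: id_stack_matching)

lemma left_embedding_one: "left_embedding \<delta> m k (dg (id_diagram m)) = dg (id_diagram (m + k))"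
  by (simp add: left_embedding_lin stack_id_id)

lemma left_embedding_0: "left_embedding \<delta> m 0 f = f"
  by (simp add: left_embedding_lin lin_id)

lemma left_embedding_linear: "Vector_Spaces.linear sc sc (left_embedding \<delta> m k)"
  unfolding left_embedding_lin[abs_def] by (rule linear_lin)

context tl_alg
begin

abbreviation Bad where "Bad m n \<equiv> supp_on (bad m n)"

lemma Bad_H: "x \<in> Bad m n \<Longrightarrow> x \<in> H n n"
  by (auto simp: H_def supp_on_def bad_def)

lemma dg_mult_Bad:
  assumes p: "p \<in> matchings n n" and r: "r \<in> bad m n" shows "dg p \<star> dg r \<in> Bad m n"
proof -
  obtain x y where xy: "r \<in> matchings n n" "{x, y} \<in> r" "int m < x" "x < y" using r by (auto simp: bad_def)
  then have "{x, y} \<in> diagram_concat p r" using concat_right_block[OF p xy(1,2)] by simp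
  then have "diagram_concat p r \<in> bad m n" using xy concat_matching[OF p xy(1)] by (auto simp: bad_def)
  then show ?thesis unfolding mult_dg by (intro pm.subspace_scale[OF subspace_supp_on]) simp
qed

lemma mult_Bad: "x \<in> H n n \<Longrightarrow> y \<in> Bad m n \<Longrightarrow> x \<star> y \<in> Bad m n"
proof -
  assume x: "x \<in> H n n" and y: "y \<in> Bad m n"
  have "dg p \<star> y \<in> Bad m n" if "p \<in> matchings n n" for p
    by (rule linear_in_subspace[OF linear_mult_right subspace_supp_on y]) (rule dg_mult_Bad[OF that])
  then show ?thesis
    by (rule linear_in_subspace[OF linear_mult_left subspace_supp_on x[unfolded H_def]])
qed

text \<open>The identity part of \<open>s\<close> acts by its coefficient, as on the trivial module.
  Every other diagram has a right block, which the embedding moves beyond the first \<open>m\<close>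
  dots.\<close>

lemma right_embedding_action:
  assumes x: "x \<in> H (m + k) (m + k)" and s: "s \<in> H k k"
  shows "x \<star> right_embedding \<delta> m k s - sc (Poly_Mapping.lookup s (id_diagram k)) x \<in> Bad m (m + k)"
proof -
  let ?n = "m + k"
  obtain y where y: "y \<in> supp_on (matchings k k - {id_diagram k})"
    "s = sc (Poly_Mapping.lookup s (id_diagram k)) (one k) + y"
  proof
    show "s - sc (Poly_Mapping.lookup s (id_diagram k)) (one k) \<in> supp_on (matchings k k - {id_diagram k})"
      using s by (auto simp: H_def supp_on_iff lookup_minus dg_def lookup_single when_def)
  qed simp
  have "right_embedding \<delta> m k y \<in> Bad m ?n"
    unfolding right_embedding_lin
  proof (rule lin_in_subspace[OF subspace_supp_on y(1)])
    fix r assume "r \<in> matchings k k - {id_diagram k}"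
    then have r: "r \<in> matchings k k" "r \<noteq> id_diagram k" by auto
    obtain a b where ab: "{a, b} \<in> r" "a < b" "0 < a" using right_block_exists[OF r(1)] r(2) by blast
    then have "{tshift m a, tshift m b} \<in> stack m (id_diagram m) r" by (intro id_stack_block)
    moreover have "int m < tshift m a" "tshift m a < tshift m b" using ab by (auto simp: tshift_def)
    ultimately show "dg (stack m (id_diagram m) r) \<in> Bad m ?n"
      using id_stack_matching[OF r(1)] by (auto simp: bad_def)
  qed
  then have B: "x \<star> right_embedding \<delta> m k y \<in> Bad m ?n" by (rule mult_Bad[OF x])
  have "right_embedding \<delta> m k s = sc (Poly_Mapping.lookup s (id_diagram k)) (one ?n) + right_embedding \<delta> m k y"
    by (subst y(2)) (simp add: right_embedding_lin lin_add lin_sc stack_id_id)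
  then have "x \<star> right_embedding \<delta> m k s - sc (Poly_Mapping.lookup s (id_diagram k)) x = x \<star> right_embedding \<delta> m k y"
    using mult_one[OF x] by (simp add: right.add right.scale)
  with B show ?thesis by simp
qed

text \<open>The stacked factor is straight beyond the first \<open>m\<close> dots, so a right block
  situated there passes through unchanged.\<close>

lemma Bad_mult_left_embedding:
  assumes x: "x \<in> Bad m n" and y: "y \<in> H m m" and "l \<le> m" "n = m + k"
  shows "x \<star> left_embedding \<delta> m k y \<in> Bad l n"
proof -
  have "dg d \<star> dg (stack m e (id_diagram k)) \<in> Bad l n" if d: "d \<in> bad m n" and e: "e \<in> matchings m m" for d e
  proof -
    let ?s = "stack m e (id_diagram k)"
    obtain a b where ab: "d \<in> matchings n n" "{a, b} \<in> d" "int m < a" "a < b" using d by (auto simp: bad_def)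
    have s: "?s \<in> matchings n n" using stack_id_matching[OF e] assms(4) by simp
    have "a \<in> dots n n" "b \<in> dots n n" using matchings_mem[OF ab(1,2)] by auto
    then have "b \<le> int n" using ab by (auto simp: dots_iff)
    then have "{- int (nat a), int (nat a)} \<in> ?s" "{- int (nat b), int (nat b)} \<in> ?s"
      using ab assms(4) by (intro stack_id_block; linarith)+
    then have "{a, b} \<in> diagram_concat d ?s"
      using concat_right_through[OF ab(1) s ab(2)] ab(3,4) by simp
    then have "diagram_concat d ?s \<in> bad l n"
      using concat_matching[OF ab(1) s] ab(3,4) assms(3)
      unfolding bad_def by (intro CollectI conjI exI) (assumption | linarith)+
    then show ?thesis unfolding mult_dg by (intro pm.subspace_scale[OF subspace_supp_on]) simp
  qed
  then have "dg d \<star> left_embedding \<delta> m k y \<in> Bad l n" if "d \<in> bad m n" for d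
    using that
    by (intro linear_in_subspace[OF _ subspace_supp_on y[unfolded H_def], where L = "\<lambda>y. dg d \<star> left_embedding \<delta> m k y"])
       (auto simp: left_embedding_lin Vector_Spaces.linear_iff lin_add lin_sc right.add right.scale pm.vector_space_axioms)
  then show ?thesis
    by (rule linear_in_subspace[OF linear_mult_left subspace_supp_on x])
qed

lemma left_embedding_Bad:
  assumes y: "y \<in> Bad l m" shows "left_embedding \<delta> m k y \<in> Bad l (m + k)"
  unfolding left_embedding_lin
proof (rule lin_in_subspace[OF subspace_supp_on y])
  fix d assume "d \<in> bad l m"
  then obtain a b where "d \<in> matchings m m" "{a, b} \<in> d" "int l < a" "a < b" by (auto simp: bad_def)
  then have "stack m d (id_diagram k) \<in> bad l (m + k)"
    using stack_id_matching[of d m k] stack_id_sub[of "{a, b}" d m "id_diagram k"] by (auto simp: bad_def)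
  then show "dg (stack m d (id_diagram k)) \<in> Bad l (m + k)" by simp
qed

section \<open>Hom spaces as quotients by the bad diagrams\<close>

definition rels :: "nat \<Rightarrow> nat \<Rightarrow> (tl \<times> complex \<Rightarrow>\<^sub>0 complex) set" where
  "rels m n = tensor_relations (carrier (TL \<delta> (n - m))) (TL \<delta> n) (hom_right_action \<delta> m n)
     scalar_space (trivial_action (n - m))"

abbreviation ker where "ker m n \<equiv> pm.span (rels m n)"

abbreviation pr where "pr x \<equiv> Poly_Mapping.single (x, 1) 1 :: tl \<times> complex \<Rightarrow>\<^sub>0 complex"

context
  fixes m n :: nat assumes mn: "m \<le> n"
begin

lemma right_action_H: "x \<in> H n n \<Longrightarrow> s \<in> H (n - m) (n - m) \<Longrightarrow> hom_right_action \<delta> m n x s \<in> H n n"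
  using mult_closed[of x n n "right_embedding \<delta> m (n - m) s" n] right_embedding_H[where m = m and k = "n - m" and f = s] mn
  by (simp add: hom_right_action_def)

lemma single_supp: "x \<in> H n n \<Longrightarrow> Poly_Mapping.single (x, z) c \<in> supp_on (H n n \<times> UNIV)"
  by (auto simp: supp_on_def)

lemma rels_supp: "rels m n \<subseteq> supp_on (H n n \<times> UNIV)"
  using tensor_relations_supp[of "TL \<delta> n" scalar_space "carrier (TL \<delta> (n - m))"
      "hom_right_action \<delta> m n" "trivial_action (n - m)"]
  by (simp add: rels_def right_action_H H_add H_sc)

lemma hom_kernel: "tensor_kernel (carrier (TL \<delta> (n - m))) (TL \<delta> n) (hom_right_action \<delta> m n)
     scalar_space (trivial_action (n - m)) = ker m n"
  unfolding tensor_kernel_def rels_def[symmetric]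
  using span_free[OF rels_supp] by (simp add:)

lemma hom_of_coset: "hom_of \<delta> m n x = coset (ker m n) (pr x)"
  unfolding hom_of_def pure_tensor_def hom_kernel a_r_coset_free ..

lemma hom_space_eq: "hom_space \<delta> m n = quotient_space (free_space (H n n \<times> UNIV)) (ker m n)"
  using mn hom_kernel by (simp add: hom_space_def tensor_space_def)

lemma rel_add1: "x \<in> H n n \<Longrightarrow> y \<in> H n n \<Longrightarrow>
    Poly_Mapping.single (x + y, z) 1 - Poly_Mapping.single (x, z) 1 - Poly_Mapping.single (y, z) 1 \<in> ker m n"
  using tensor_relationsI(1)[of x "TL \<delta> n" z scalar_space y]
  by (intro pm.span_base) (simp add: rels_def)

lemma rel_sc1: "x \<in> H n n \<Longrightarrow> Poly_Mapping.single (sc c x, z) 1 - Poly_Mapping.single (x, z) c \<in> ker m n"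
  using tensor_relationsI(3)[of x "TL \<delta> n" z scalar_space c]
  by (intro pm.span_base) (simp add: rels_def)

lemma rel_sc2: "x \<in> H n n \<Longrightarrow> Poly_Mapping.single (x, c * z) 1 - Poly_Mapping.single (x, z) c \<in> ker m n"
  using tensor_relationsI(4)[of x "TL \<delta> n" z scalar_space c]
  by (intro pm.span_base) (simp add: rels_def)

lemma rel_bal: "x \<in> H n n \<Longrightarrow> s \<in> H (n - m) (n - m) \<Longrightarrow>
    Poly_Mapping.single (hom_right_action \<delta> m n x s, z) 1
      - Poly_Mapping.single (x, trivial_action (n - m) s z) 1 \<in> ker m n"
  using tensor_relationsI(5)[of x "TL \<delta> n" z scalar_space s "H (n - m) (n - m)" "hom_right_action \<delta> m n"
      "trivial_action (n - m)"]
  by (intro pm.span_base) (simp add: rels_def)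

text \<open>Every element of the free space is congruent to a single \<open>x \<otimes> 1\<close>.\<close>

definition ev :: "(tl \<times> complex \<Rightarrow>\<^sub>0 complex) \<Rightarrow> tl" where
  "ev = lin (\<lambda>(x, z). sc z x)"

lemma ev_H: "f \<in> supp_on (H n n \<times> UNIV) \<Longrightarrow> ev f \<in> H n n"
  unfolding ev_def H_def
  by (rule lin_in_subspace[OF subspace_supp_on]) (auto intro: pm.subspace_scale[OF subspace_supp_on])

lemma pr_add: "x \<in> H n n \<Longrightarrow> y \<in> H n n \<Longrightarrow> pr (x + y) - (pr x + pr y) \<in> ker m n"
  using rel_add1[of x y 1] by (simp add: algebra_simps)

lemma pr_sc: "x \<in> H n n \<Longrightarrow> pr (sc c x) - sc c (pr x) \<in> ker m n"
  using rel_sc1[of x c 1] by simp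

lemma pr_0: "pr 0 \<in> ker m n"
  using pr_sc[OF H_0, of 0] by (simp add: pm.scale_zero_left)

lemma pr_ev: "f \<in> supp_on (H n n \<times> UNIV) \<Longrightarrow> f - pr (ev f) \<in> ker m n"
proof -
  assume "f \<in> supp_on (H n n \<times> UNIV)"
  then have "f \<in> pm.span (dg ` (H n n \<times> UNIV))" by (simp only: supp_on_span)
  then have "f \<in> supp_on (H n n \<times> UNIV) \<and> f - pr (ev f) \<in> ker m n"
  proof (induction rule: pm.span_induct_alt)
    case base
    then show ?case using pr_0 pm.subspace_0[OF subspace_supp_on] pm.span_neg by (fastforce simp: ev_def)
  next
    case (step c u f)
    then obtain x z where u: "u = dg (x, z)" "x \<in> H n n" by auto
    have f: "f \<in> supp_on (H n n \<times> UNIV)" "f - pr (ev f) \<in> ker m n" using step by auto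
    have uS: "sc c u \<in> supp_on (H n n \<times> UNIV)" using u by (simp add: dg_def supp_on_def)
    have evu: "ev (sc c u + f) = sc c (sc z x) + ev f" by (simp add: ev_def lin_add lin_sc u)
    have H: "sc c (sc z x) \<in> H n n" "ev f \<in> H n n" "sc z x \<in> H n n" using H_sc u ev_H f by auto
    have 1: "u - sc z (pr x) \<in> ker m n"
      using rel_sc2[OF u(2), of z 1] unfolding u(1) by (simp add: dg_def)
    have 2: "pr (sc c (sc z x)) - sc (c * z) (pr x) \<in> ker m n"
      using pr_sc[OF u(2), of "c * z"] by simp
    have "sc c u + f - pr (ev (sc c u + f)) =
      sc c (u - sc z (pr x)) + (f - pr (ev f)) - (pr (sc c (sc z x)) - sc (c * z) (pr x))
      - (pr (sc c (sc z x) + ev f) - (pr (sc c (sc z x)) + pr (ev f)))"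
      unfolding evu by (simp add: pm.scale_right_diff_distrib)
    also have "\<dots> \<in> ker m n"
      by (intro pm.span_diff pm.span_add pm.span_scale 1 f(2) 2 pr_add H)
    finally show ?case using pm.subspace_add[OF subspace_supp_on uS f(1)] by simp
  qed
  then show ?thesis by simp
qed

lemma hom_space_carrier: "carrier (hom_space \<delta> m n) = hom_of \<delta> m n ` H n n"
proof
  note K = pm.subspace_span[of "rels m n"]
  show "carrier (hom_space \<delta> m n) \<subseteq> hom_of \<delta> m n ` H n n"
  proof
    fix F assume "F \<in> carrier (hom_space \<delta> m n)"
    then have "F \<in> coset (ker m n) ` supp_on (H n n \<times> UNIV)" by (simp only: hom_space_eq carrier_quotient)
    then obtain f where f: "F = coset (ker m n) f" "f \<in> supp_on (H n n \<times> UNIV)" by (rule imageE)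
    then have "F = hom_of \<delta> m n (ev f)" using pr_ev[OF f(2)] by (simp add: hom_of_coset coset_eq_iff[OF K])
    then show "F \<in> hom_of \<delta> m n ` H n n" using ev_H[OF f(2)] by (rule image_eqI)
  qed
  show "hom_of \<delta> m n ` H n n \<subseteq> carrier (hom_space \<delta> m n)"
    unfolding hom_space_eq carrier_quotient hom_of_coset by (intro image_subsetI imageI single_supp)
qed

lemma hom_of_add: "x \<in> H n n \<Longrightarrow> y \<in> H n n \<Longrightarrow>
    hom_of \<delta> m n (x + y) = hom_of \<delta> m n x \<oplus>\<^bsub>hom_space \<delta> m n\<^esub> hom_of \<delta> m n y"
  unfolding hom_space_eq quotient_space_def hom_of_coset ring.simps quotient_add[OF pm.subspace_span]
    coset_eq_iff[OF pm.subspace_span] by (rule pr_add)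

lemma hom_of_sc: "x \<in> H n n \<Longrightarrow>
    hom_of \<delta> m n (sc c x) = c \<odot>\<^bsub>hom_space \<delta> m n\<^esub> hom_of \<delta> m n x"
proof -
  assume x: "x \<in> H n n"
  have "c \<odot>\<^bsub>hom_space \<delta> m n\<^esub> hom_of \<delta> m n x = coset (ker m n) (sc c (pr x))"
    unfolding hom_space_eq quotient_space_def hom_of_coset
    by (simp only: module.simps quotient_smult[OF pm.subspace_span])
  then show ?thesis using pr_sc[OF x] by (simp add: hom_of_coset coset_eq_iff[OF pm.subspace_span])
qed

lemma hom_of_zero: "hom_of \<delta> m n 0 = \<zero>\<^bsub>hom_space \<delta> m n\<^esub>"
proof -
  have "\<zero>\<^bsub>hom_space \<delta> m n\<^esub> = coset (ker m n) 0"
    unfolding hom_space_eq by (simp add: quotient_space_def coset_def)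
  then show ?thesis using pr_0 by (simp add: hom_of_coset coset_eq_iff[OF pm.subspace_span])
qed

text \<open>The bilinearity relations are mapped to 0 by \<open>ev\<close>, and the balancing
  relation to an element of \<open>Bad\<close> by \<open>right_embedding_action\<close>.\<close>

lemma ev_ker: "f \<in> ker m n \<Longrightarrow> ev f \<in> Bad m n"
proof (induction rule: pm.span_induct_alt)
  case base
  then show ?case using pm.subspace_0[OF subspace_supp_on] by (simp add: ev_def)
next
  case (step c r f)
  have "ev r \<in> Bad m n"
  proof -
    have mn': "m + (n - m) = n" using mn by simp
    have ev1: "ev (Poly_Mapping.single (x, z) c) = sc (c * z) x" for x z c by (simp add: ev_def)
    have evd: "ev (f - g) = ev f - ev g" for f g
      unfolding ev_def by (rule module_hom.diff[OF Vector_Spaces.linear.axioms(3)[OF linear_lin]])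
    have bal: "ev (Poly_Mapping.single (hom_right_action \<delta> m n x s, z) 1 - Poly_Mapping.single (x, trivial_action (n - m) s z) 1) \<in> Bad m n"
      if "x \<in> H n n" "s \<in> H (n - m) (n - m)" for x s z
    proof -
      have "x \<star> right_embedding \<delta> m (n - m) s - sc (Poly_Mapping.lookup s (id_diagram (n - m))) x \<in> Bad m n"
        using right_embedding_action[of x m "n - m" s] that unfolding mn' by simp
      from pm.subspace_scale[OF subspace_supp_on this, of z] show ?thesis
        by (simp add: evd ev1 hom_right_action_def trivial_action_def pm.scale_right_diff_distrib mult.commute)
    qed
    have z: "(0 :: tl) \<in> Bad m n" by (rule pm.subspace_0[OF subspace_supp_on])
    note D = evd ev1 z pm.scale_right_distrib pm.scale_left_distrib mult.commute
    from step(1)[unfolded rels_def] show ?thesis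
    proof (cases rule: tensor_relations_cases)
      case (5 x s y)
      then show ?thesis using bal[of x s y] by simp
    qed (simp_all add: D)
  qed
  then show ?case
    using step(2) pm.subspace_add[OF subspace_supp_on pm.subspace_scale[OF subspace_supp_on]]
    by (simp add: ev_def lin_add lin_sc)
qed

lemma hom_of_eqD: "hom_of \<delta> m n x = hom_of \<delta> m n y \<Longrightarrow> x - y \<in> Bad m n"
proof -
  assume "hom_of \<delta> m n x = hom_of \<delta> m n y"
  then have "pr x - pr y \<in> ker m n" by (simp add: hom_of_coset coset_eq_iff[OF pm.subspace_span])
  then have "ev (pr x - pr y) \<in> Bad m n" by (rule ev_ker)
  moreover have "ev (pr x - pr y) = ev (pr x) - ev (pr y)"
    unfolding ev_def by (rule module_hom.diff[OF Vector_Spaces.linear.axioms(3)[OF linear_lin]])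
  ultimately show ?thesis by (simp add: ev_def)
qed

end

end

context tl_generic
begin

text \<open>A bad diagram has a small right cup beyond the first \<open>m\<close> dots, so it is
  \<open>1 / \<delta>\<close> times its product with a generator from the right embedded algebra.
  Balancing moves this generator to the trivial module, where it acts as zero.\<close>

lemma pr_bad:
  assumes mn: "m \<le> n" and d: "d \<in> bad m n" shows "pr (dg d) \<in> ker m n"
proof -
  obtain x y where xy: "d \<in> matchings n n" "{x, y} \<in> d" "int m < x" "x < y" using d by (auto simp: bad_def)
  obtain i where i: "1 \<le> i" "i < int n" "{i, i + 1} \<in> d" "x \<le> i" using right_cup[OF xy(1,2,4)] xy(3) by auto
  define k where "k = n - m"
  define j where "j = i - int m"
  have n: "n = m + k" using mn by (simp add: k_def)
  have j: "1 \<le> j" "j < int k" "int m + j = i" using i xy(3) n by (auto simp: j_def)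
  have s: "dg (U k j) \<in> H k k" using U_eq(3)[OF j(1,2)] by simp
  have dH: "sc (1 / \<delta>) (dg d) \<in> H n n" using xy(1) by (intro H_sc) simp
  have "right_embedding \<delta> m k (dg (U k j)) = u n i"
    using id_stack_U[OF j(1,2), of m] j(3) n by (simp add: right_embedding_lin)
  then have act: "hom_right_action \<delta> m n (sc (1 / \<delta>) (dg d)) (dg (U k j)) = dg d"
    using u_right_cup(1)[OF xy(1) i(3,1)] delta_nz by (simp add: hom_right_action_def k_def left.scale)
  have "U k j \<noteq> id_diagram k"
    using U_left[of j k] id_block[of "- j - 1" "- j" k] j by auto
  then have triv: "trivial_action k (dg (U k j)) 1 = 0"
    by (simp add: trivial_action_def dg_def lookup_single when_def)
  have "pr (dg d) - Poly_Mapping.single (sc (1 / \<delta>) (dg d), 0) 1 \<in> ker m n"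
    using rel_bal[OF mn dH, of "dg (U k j)" 1] s act triv by (simp add: k_def)
  moreover have "Poly_Mapping.single (sc (1 / \<delta>) (dg d), 0) 1 \<in> ker m n"
    using rel_sc2[OF mn dH, of 0 0] by simp
  ultimately have "pr (dg d) - Poly_Mapping.single (sc (1 / \<delta>) (dg d), 0) 1
     + Poly_Mapping.single (sc (1 / \<delta>) (dg d), 0) 1 \<in> ker m n" by (rule pm.span_add)
  then show ?thesis by simp
qed

lemma pr_Bad:
  assumes mn: "m \<le> n" and b: "b \<in> Bad m n" shows "pr b \<in> ker m n"
proof -
  have "b \<in> pm.span (dg ` bad m n)" using b by (simp only: supp_on_span)
  then have "b \<in> H n n \<and> pr b \<in> ker m n"
  proof (induction rule: pm.span_induct_alt)
    case base
    then show ?case using pr_0[OF mn] H_0 by simp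
  next
    case (step c x y)
    then obtain d where d: "x = dg d" "d \<in> bad m n" by blast
    then have x: "x \<in> H n n" by (simp add: bad_def)
    have H: "sc c x \<in> H n n" "y \<in> H n n" using H_sc x step by auto
    have "pr (sc c x + y) = (pr (sc c x + y) - (pr (sc c x) + pr y)) + (pr (sc c x) - sc c (pr x)) + sc c (pr x) + pr y"
      by simp
    also have "\<dots> \<in> ker m n"
      using pr_bad[OF mn d(2)] step(2) unfolding d(1)[symmetric]
      by (intro pm.span_add pm.span_scale pr_add[OF mn H] pr_sc[OF mn x]) auto
    finally show ?case using H_add[OF H] by simp
  qed
  then show ?thesis by simp
qed

lemma hom_of_eqI:
  assumes mn: "m \<le> n" and x: "x \<in> H n n" and y: "y \<in> H n n" and b: "x - y \<in> Bad m n"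
  shows "hom_of \<delta> m n x = hom_of \<delta> m n y"
proof -
  have "pr x - pr y = (pr ((x - y) + y) - (pr (x - y) + pr y)) + pr (x - y)" by simp
  also have "\<dots> \<in> ker m n"
    by (intro pm.span_add pr_add[OF mn] H_diff x y pr_Bad[OF mn b])
  finally show ?thesis using mn by (simp add: hom_of_coset coset_eq_iff[OF pm.subspace_span])
qed

text \<open>\<open>hom_comp\<close> is a definite description over all representatives, so the value
  must not depend on them: changing \<open>x\<close> by \<open>Bad m n\<close> and \<open>y\<close>
  by \<open>Bad l m\<close> changes the product by \<open>Bad l n\<close>.\<close>

lemma hom_comp_eval:
  assumes lm: "l \<le> m" and mn: "m \<le> n" and x: "x \<in> H n n" and y: "y \<in> H m m"
  shows "hom_comp \<delta> l m n (hom_of \<delta> m n x) (hom_of \<delta> l m y) =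
    hom_of \<delta> l n (x \<star> left_embedding \<delta> m (n - m) y)"
proof -
  let ?e = "left_embedding \<delta> m (n - m)"
  have n: "m + (n - m) = n" using mn by simp
  have eH: "?e y \<in> H n n" if "y \<in> H m m" for y using left_embedding_H[OF that, of \<delta> "n - m"] unfolding n .
  interpret e: Vector_Spaces.linear sc sc ?e by (rule left_embedding_linear)
  have uniq: "hom_of \<delta> l n (x' \<star> ?e y') = hom_of \<delta> l n (x \<star> ?e y)"
    if H: "x' \<in> H n n" "y' \<in> H m m" "hom_of \<delta> m n x = hom_of \<delta> m n x'" "hom_of \<delta> l m y = hom_of \<delta> l m y'" for x' y'
  proof (rule hom_of_eqI)
    show "l \<le> n" using lm mn by simp
    show "x' \<star> ?e y' \<in> H n n" "x \<star> ?e y \<in> H n n" by (rule mult_closed[OF H(1) eH[OF H(2)]], rule mult_closed[OF x eH[OF y]])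
    have 1: "x' - x \<in> Bad m n" using hom_of_eqD[OF mn, of x' x] H(3) by simp
    have 2: "y' - y \<in> Bad l m" using hom_of_eqD[OF lm, of y' y] H(4) by simp
    have "x' \<star> ?e y' - x \<star> ?e y = (x' - x) \<star> ?e y' + x \<star> ?e (y' - y)"
      by (simp add: left.diff right.diff e.diff)
    moreover have "(x' - x) \<star> ?e y' \<in> Bad l n"
      by (rule Bad_mult_left_embedding[OF 1 H(2) lm n[symmetric]])
    moreover have "x \<star> ?e (y' - y) \<in> Bad l n"
      using mult_Bad[OF x] left_embedding_Bad[OF 2, of "n - m"] unfolding n by blast
    ultimately show "x' \<star> ?e y' - x \<star> ?e y \<in> Bad l n" by (simp add: pm.subspace_add[OF subspace_supp_on])
  qed
  have "l \<le> m \<and> m \<le> n" using lm mn by simp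
  note P = if_P[OF this]
  show ?thesis unfolding hom_comp_def TL_simps P
  proof (rule the_equality)
    show "\<exists>x'\<in>H n n. \<exists>y'\<in>H m m. hom_of \<delta> m n x = hom_of \<delta> m n x' \<and> hom_of \<delta> l m y = hom_of \<delta> l m y' \<and>
        hom_of \<delta> l n (x \<star> ?e y) = hom_of \<delta> l n (x' \<star> ?e y')"
      by (intro bexI[OF _ x] bexI[OF _ y] conjI refl)
  next
    fix F
    assume "\<exists>x'\<in>H n n. \<exists>y'\<in>H m m. hom_of \<delta> m n x = hom_of \<delta> m n x' \<and> hom_of \<delta> l m y = hom_of \<delta> l m y' \<and>
        F = hom_of \<delta> l n (x' \<star> ?e y')"
    then show "F = hom_of \<delta> l n (x \<star> ?e y)"
    proof (elim bexE conjE)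
      fix x' y'
      assume "x' \<in> H n n" "y' \<in> H m m" "hom_of \<delta> m n x = hom_of \<delta> m n x'" "hom_of \<delta> l m y = hom_of \<delta> l m y'"
        and F: "F = hom_of \<delta> l n (x' \<star> ?e y')"
      from uniq[OF this(1-4)] show ?thesis unfolding F .
    qed
  qed
qed

end

section \<open>Linear maps out of free spaces\<close>

interpretation pp: vector_space_pair sc sc ..

locale cvs = fixes W :: "(complex, 'w) module" assumes vs: "vectorspace class_ring W"
begin

sublocale vectorspace class_ring W by (rule vs)

lemma sm_closed [simp]: "x \<in> carrier W \<Longrightarrow> c \<odot>\<^bsub>W\<^esub> x \<in> carrier W"
  by (rule smult_closed) simp_all

lemma sm_add_left: "x \<in> carrier W \<Longrightarrow> (a + b) \<odot>\<^bsub>W\<^esub> x = a \<odot>\<^bsub>W\<^esub> x \<oplus>\<^bsub>W\<^esub> b \<odot>\<^bsub>W\<^esub> x"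
  using smult_l_distr[of a b x] by simp

lemma sm_add_right: "x \<in> carrier W \<Longrightarrow> y \<in> carrier W \<Longrightarrow> c \<odot>\<^bsub>W\<^esub> (x \<oplus>\<^bsub>W\<^esub> y) = c \<odot>\<^bsub>W\<^esub> x \<oplus>\<^bsub>W\<^esub> c \<odot>\<^bsub>W\<^esub> y"
  by (rule smult_r_distr) simp_all

lemma sm_mult: "x \<in> carrier W \<Longrightarrow> (a * b) \<odot>\<^bsub>W\<^esub> x = a \<odot>\<^bsub>W\<^esub> (b \<odot>\<^bsub>W\<^esub> x)"
  using smult_assoc1[of a b x] by simp

lemma sm_0 [simp]: "x \<in> carrier W \<Longrightarrow> 0 \<odot>\<^bsub>W\<^esub> x = \<zero>\<^bsub>W\<^esub>"
  using lmult_0[of x] by simp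

lemma sm_one [simp]: "x \<in> carrier W \<Longrightarrow> 1 \<odot>\<^bsub>W\<^esub> x = x"
  using smult_one[of x] by simp

definition lc :: "('x \<Rightarrow> 'w) \<Rightarrow> ('x \<Rightarrow>\<^sub>0 complex) \<Rightarrow> 'w" where
  "lc b f = (\<Oplus>\<^bsub>W\<^esub>u\<in>Poly_Mapping.keys f. Poly_Mapping.lookup f u \<odot>\<^bsub>W\<^esub> b u)"

context
  fixes b :: "'x \<Rightarrow> 'w" and X assumes b: "\<And>x. x \<in> X \<Longrightarrow> b x \<in> carrier W"
begin

lemma lc_superset:
  "finite A \<Longrightarrow> A \<subseteq> X \<Longrightarrow> Poly_Mapping.keys f \<subseteq> A \<Longrightarrow>
    lc b f = (\<Oplus>\<^bsub>W\<^esub>u\<in>A. Poly_Mapping.lookup f u \<odot>\<^bsub>W\<^esub> b u)"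
  unfolding lc_def using b
  by (intro add.finprod_mono_neutral_cong_left) (auto simp: in_keys_iff subset_iff)

lemma lc_closed: "f \<in> supp_on X \<Longrightarrow> lc b f \<in> carrier W"
  unfolding lc_def using b by (intro finsum_closed) (auto simp: supp_on_def)

lemma lc_add:
  assumes "f \<in> supp_on X" "g \<in> supp_on X"
  shows "lc b (f + g) = lc b f \<oplus>\<^bsub>W\<^esub> lc b g"
proof -
  let ?A = "Poly_Mapping.keys f \<union> Poly_Mapping.keys g"
  have A: "finite ?A" "?A \<subseteq> X" "Poly_Mapping.keys (f + g) \<subseteq> ?A"
    using assms by (auto simp: supp_on_def keys_add)
  have A': "Poly_Mapping.keys f \<subseteq> ?A" "Poly_Mapping.keys g \<subseteq> ?A" by auto
  have bA: "b u \<in> carrier W" if "u \<in> ?A" for u using that A(2) b by auto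
  have "lc b (f + g) = (\<Oplus>\<^bsub>W\<^esub>u\<in>?A. Poly_Mapping.lookup f u \<odot>\<^bsub>W\<^esub> b u \<oplus>\<^bsub>W\<^esub> Poly_Mapping.lookup g u \<odot>\<^bsub>W\<^esub> b u)"
    unfolding lc_superset[OF A] using bA by (intro finsum_cong') (auto simp: lookup_add sm_add_left)
  also have "\<dots> = lc b f \<oplus>\<^bsub>W\<^esub> lc b g"
    unfolding lc_superset[OF A(1,2) A'(1)] lc_superset[OF A(1,2) A'(2)]
    using bA by (intro finsum_addf) auto
  finally show ?thesis .
qed

lemma lc_sc:
  assumes "f \<in> supp_on X"
  shows "lc b (sc c f) = c \<odot>\<^bsub>W\<^esub> lc b f"
proof -
  let ?A = "Poly_Mapping.keys f"
  have A: "finite ?A" "?A \<subseteq> X" "Poly_Mapping.keys (sc c f) \<subseteq> ?A"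
    using assms by (auto simp: supp_on_def keys_sc)
  have bA: "b u \<in> carrier W" if "u \<in> ?A" for u using that A(2) b by auto
  have "lc b (sc c f) = (\<Oplus>\<^bsub>W\<^esub>u\<in>?A. c \<odot>\<^bsub>W\<^esub> (Poly_Mapping.lookup f u \<odot>\<^bsub>W\<^esub> b u))"
    unfolding lc_superset[OF A] using bA by (intro finsum_cong') (auto simp: sm_mult)
  also have "\<dots> = c \<odot>\<^bsub>W\<^esub> lc b f"
    unfolding lc_def using bA by (intro finsum_smult_ldistr[symmetric]) auto
  finally show ?thesis .
qed

lemma lc_single: "x \<in> X \<Longrightarrow> lc b (Poly_Mapping.single x c) = c \<odot>\<^bsub>W\<^esub> b x"
  by (subst lc_superset[of "{x}"]) (simp_all add: b)

lemma lc_dg: "x \<in> X \<Longrightarrow> lc b (dg x) = b x"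
  by (simp add: dg_def lc_single b)

lemma lc_diff_0:
  assumes "f \<in> supp_on X" "g \<in> supp_on X" and eq: "lc b f = lc b g"
  shows "lc b (f - g) = \<zero>\<^bsub>W\<^esub>"
proof -
  have "f - g = f + sc (- 1) g" by simp
  moreover have g: "sc (- 1) g \<in> supp_on X" by (rule pm.subspace_scale[OF subspace_supp_on assms(2)])
  ultimately have "lc b (f - g) = lc b f \<oplus>\<^bsub>W\<^esub> (- 1) \<odot>\<^bsub>W\<^esub> lc b f"
    by (simp only: lc_add[OF assms(1) g] lc_sc[OF assms(2)] eq)
  also have "\<dots> = (1 + - 1) \<odot>\<^bsub>W\<^esub> lc b f"
    using lc_closed[OF assms(1)] by (subst sm_add_left) simp_all
  finally show ?thesis using lc_closed[OF assms(1)] by simp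
qed

end

text \<open>A coordinate section \<open>s\<close> of the surjection \<open>lc b\<close>, linear because it factors through a projection \<open>\<rho>\<close>
  along the kernel.\<close>

lemma section_exists:
  fixes b :: "'x \<Rightarrow> 'w"
  assumes b: "\<And>x. b x \<in> carrier W" and surj: "carrier W \<subseteq> range (lc b)"
  obtains s \<rho> where "Vector_Spaces.linear sc sc \<rho>" "\<And>f. s (lc b f) = \<rho> f"
    "\<And>w. w \<in> carrier W \<Longrightarrow> lc b (s w) = w"
proof -
  have U: "f \<in> supp_on UNIV" for f :: "'x \<Rightarrow>\<^sub>0 complex" by (simp add: supp_on_def)
  note lcU = lc_add[of UNIV b, OF b U U] lc_sc[of UNIV b, OF b U] lc_closed[of UNIV b, OF b U]
  define K where "K = {f. lc b f = \<zero>\<^bsub>W\<^esub>}"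
  have K: "pm.subspace K"
    unfolding K_def by (rule pm.subspaceI) (simp_all add: lcU, simp add: lc_def)
  obtain B where B: "B \<subseteq> K" "pm.independent B" "K \<subseteq> pm.span B" using pm.basis_exists[of K] by metis
  let ?B = "pm.extend_basis B"
  obtain \<rho> where rho: "Vector_Spaces.linear sc sc \<rho>" "\<And>x. x \<in> ?B \<Longrightarrow> \<rho> x = (if x \<in> B then 0 else x)"
    using pp.linear_independent_extend[OF pm.independent_extend_basis[OF B(2)], of "\<lambda>x. if x \<in> B then 0 else x"]
    by (elim exE conjE) simp
  interpret r: Vector_Spaces.linear sc sc \<rho> by (rule rho(1))
  have rB: "\<rho> x = 0" if "x \<in> B" for x
    using rho(2)[of x] that pm.extend_basis_superset[OF B(2)] by auto
  have rK: "\<rho> f = 0" if "f \<in> K" for f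
    by (rule r.eq_0_on_span[of B]) (use rB that B(3) in auto)
  have Kr: "f - \<rho> f \<in> K" for f
  proof -
    have "f \<in> pm.span ?B" by (simp add: pm.span_extend_basis[OF B(2)])
    then show ?thesis
    proof (induction rule: pm.span_induct_alt)
      case base
      show ?case using pm.subspace_0[OF K] by (simp add: r.zero)
    next
      case (step c x y)
      have "x - \<rho> x \<in> K"
        using rho(2)[OF step(1)] B(1) pm.subspace_0[OF K] by auto
      then have mem: "sc c (x - \<rho> x) + (y - \<rho> y) \<in> K"
        by (intro pm.subspace_add[OF K] pm.subspace_scale[OF K] step(2))
      have "sc c x + y - \<rho> (sc c x + y) = sc c (x - \<rho> x) + (y - \<rho> y)"
        by (simp add: r.add r.scale pm.scale_right_diff_distrib)
      from this mem show ?case by (rule ssubst)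
    qed
  qed
  \<comment> \<open>Any preimage serves, since two preimages differ by an element of
    \<open>K\<close> and \<open>\<rho>\<close> kills \<open>K\<close>.\<close>
  define s where "s = (\<lambda>w. \<rho> (SOME f. lc b f = w))"
  show ?thesis
  proof
    show "Vector_Spaces.linear sc sc \<rho>" by (rule rho(1))
    show srho: "s (lc b f) = \<rho> f" for f
    proof -
      define g where "g = (SOME g. lc b g = lc b f)"
      have "lc b g = lc b f" unfolding g_def by (rule someI) (rule refl)
      then have "g - f \<in> K" unfolding K_def using lc_diff_0[of UNIV b g f] b U by auto
      then have "\<rho> g - \<rho> f = 0" using rK r.diff by metis
      then show ?thesis by (simp add: s_def g_def)
    qed
    show "lc b (s w) = w" if W: "w \<in> carrier W" for w
    proof -
      obtain f where f: "w = lc b f" using subsetD[OF surj W] by (rule imageE)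
      have "f = \<rho> f + (f - \<rho> f)" by simp
      then have "lc b f = lc b (\<rho> f) \<oplus>\<^bsub>W\<^esub> lc b (f - \<rho> f)" using lcU(1) by metis
      then have "lc b f = lc b (\<rho> f)" using Kr[of f] lcU(3)[of "\<rho> f"] by (simp add: K_def)
      then show ?thesis unfolding f srho by simp
    qed
  qed
qed

end

lemma vectorspace_dsum:
  assumes V: "\<And>i. i \<in> I \<Longrightarrow> vectorspace class_ring (V i)"
  shows "vectorspace class_ring (dsum I V :: (complex, 'i \<Rightarrow> 'v) module)"
proof -
  have c: "cvs (V i)" if "i \<in> I" for i using V[OF that] by (rule cvs.intro)
  have ag: "abelian_group (V i)" if "i \<in> I" for i
  proof -
    interpret cvs "V i" by (rule c[OF that])
    show ?thesis by unfold_locales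
  qed
  note am = abelian_group.axioms(1)[OF ag]
  show ?thesis
  proof (rule vectorspaceI)
    show "abelian_group (dsum I V)"
    proof (rule abelian_groupI)
      fix x assume x: "x \<in> carrier (dsum I V)"
      show "\<exists>y\<in>carrier (dsum I V). y \<oplus>\<^bsub>dsum I V\<^esub> x = \<zero>\<^bsub>dsum I V\<^esub>"
        using x ag
        by (intro bexI[of _ "\<lambda>i\<in>I. \<ominus>\<^bsub>V i\<^esub> x i"])
           (auto simp: dsum_def abelian_group.l_neg abelian_group.a_inv_closed PiE_iff intro!: restrict_ext)
      show "x \<oplus>\<^bsub>dsum I V\<^esub> y = y \<oplus>\<^bsub>dsum I V\<^esub> x" if "y \<in> carrier (dsum I V)" for y
        using x that by (auto simp: dsum_def PiE_iff abelian_monoid.a_comm[OF am] intro!: restrict_ext)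
      show "\<zero>\<^bsub>dsum I V\<^esub> \<oplus>\<^bsub>dsum I V\<^esub> x = x"
        using x by (auto simp: dsum_def PiE_iff abelian_monoid.l_zero[OF am] intro!: extensionalityI[of _ I])
    qed (auto simp: dsum_def PiE_iff abelian_monoid.a_closed[OF am] abelian_monoid.zero_closed[OF am]
        abelian_monoid.a_assoc[OF am] intro!: restrict_ext)
  qed (auto simp: dsum_def PiE_iff cvs.sm_closed[OF c] cvs.sm_add_left[OF c] cvs.sm_mult[OF c]
      cvs.sm_one[OF c] cvs.sm_add_right[OF c] abelian_monoid.a_closed[OF am]
      intro!: restrict_ext extensionalityI[of _ I])
qed

section \<open>Maps out of tensor products\<close>

text \<open>The hypotheses under which \<open>tensor_lift\<close> is well defined: the linear
  extension of \<open>b\<close> vanishes on the relations and is thus constant on cosets.\<close>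

locale balanced = cvs W for W :: "(complex, 'w) module" +
  fixes S :: "'s set" and X :: "(complex, 'a) module" and ra :: "'a \<Rightarrow> 's \<Rightarrow> 'a"
    and Y :: "(complex, 'b) module" and la :: "'s \<Rightarrow> 'b \<Rightarrow> 'b" and b :: "'a \<Rightarrow> 'b \<Rightarrow> 'w"
  assumes X: "\<And>x y. x \<in> carrier X \<Longrightarrow> y \<in> carrier X \<Longrightarrow> x \<oplus>\<^bsub>X\<^esub> y \<in> carrier X"
      "\<And>c x. x \<in> carrier X \<Longrightarrow> c \<odot>\<^bsub>X\<^esub> x \<in> carrier X"
      "\<And>x s. x \<in> carrier X \<Longrightarrow> s \<in> S \<Longrightarrow> ra x s \<in> carrier X"
    and Y: "\<And>x y. x \<in> carrier Y \<Longrightarrow> y \<in> carrier Y \<Longrightarrow> x \<oplus>\<^bsub>Y\<^esub> y \<in> carrier Y"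
      "\<And>c x. x \<in> carrier Y \<Longrightarrow> c \<odot>\<^bsub>Y\<^esub> x \<in> carrier Y"
      "\<And>s y. s \<in> S \<Longrightarrow> y \<in> carrier Y \<Longrightarrow> la s y \<in> carrier Y"
    and b_closed: "\<And>x y. x \<in> carrier X \<Longrightarrow> y \<in> carrier Y \<Longrightarrow> b x y \<in> carrier W"
    and b_add: "\<And>x x' y. x \<in> carrier X \<Longrightarrow> x' \<in> carrier X \<Longrightarrow> y \<in> carrier Y \<Longrightarrow> b (x \<oplus>\<^bsub>X\<^esub> x') y = b x y \<oplus>\<^bsub>W\<^esub> b x' y"
      "\<And>x y y'. x \<in> carrier X \<Longrightarrow> y \<in> carrier Y \<Longrightarrow> y' \<in> carrier Y \<Longrightarrow> b x (y \<oplus>\<^bsub>Y\<^esub> y') = b x y \<oplus>\<^bsub>W\<^esub> b x y'"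
    and b_smult: "\<And>c x y. x \<in> carrier X \<Longrightarrow> y \<in> carrier Y \<Longrightarrow> b (c \<odot>\<^bsub>X\<^esub> x) y = c \<odot>\<^bsub>W\<^esub> b x y"
      "\<And>c x y. x \<in> carrier X \<Longrightarrow> y \<in> carrier Y \<Longrightarrow> b x (c \<odot>\<^bsub>Y\<^esub> y) = c \<odot>\<^bsub>W\<^esub> b x y"
    and b_balanced: "\<And>x s y. x \<in> carrier X \<Longrightarrow> s \<in> S \<Longrightarrow> y \<in> carrier Y \<Longrightarrow> b (ra x s) y = b x (la s y)"
begin

abbreviation XY where "XY \<equiv> carrier X \<times> carrier Y"
abbreviation R where "R \<equiv> tensor_relations S X ra Y la"
abbreviation lift where "lift \<equiv> lc (\<lambda>u. b (fst u) (snd u))"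

lemma bXY: "u \<in> XY \<Longrightarrow> b (fst u) (snd u) \<in> carrier W"
  by (auto simp: b_closed)

lemma lift_closed: "f \<in> supp_on XY \<Longrightarrow> lift f \<in> carrier W"
  by (rule lc_closed[where X = XY and b = "\<lambda>u. b (fst u) (snd u)"]) (rule bXY)

lemma lift_add: "f \<in> supp_on XY \<Longrightarrow> g \<in> supp_on XY \<Longrightarrow> lift (f + g) = lift f \<oplus>\<^bsub>W\<^esub> lift g"
  by (rule lc_add[where X = XY and b = "\<lambda>u. b (fst u) (snd u)"]) (rule bXY)

lemma lift_sc: "f \<in> supp_on XY \<Longrightarrow> lift (sc c f) = c \<odot>\<^bsub>W\<^esub> lift f"
  by (rule lc_sc[where X = XY and b = "\<lambda>u. b (fst u) (snd u)"]) (rule bXY)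

lemma lift_diff_0: "f \<in> supp_on XY \<Longrightarrow> g \<in> supp_on XY \<Longrightarrow> lift f = lift g \<Longrightarrow> lift (f - g) = \<zero>\<^bsub>W\<^esub>"
  by (rule lc_diff_0[where X = XY and b = "\<lambda>u. b (fst u) (snd u)"]) (rule bXY)

lemma lift_single: "x \<in> carrier X \<Longrightarrow> y \<in> carrier Y \<Longrightarrow> lift (Poly_Mapping.single (x, y) c) = c \<odot>\<^bsub>W\<^esub> b x y"
  using lc_single[of XY "\<lambda>u. b (fst u) (snd u)" "(x, y)" c] bXY by simp

lemma R_supp: "R \<subseteq> supp_on XY"
  by (rule tensor_relations_supp) (simp_all add: X Y)

lemma lift_R: "r \<in> R \<Longrightarrow> lift r = \<zero>\<^bsub>W\<^esub>"
proof -
  assume r: "r \<in> R"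
  have s: "Poly_Mapping.single (x, y) c \<in> supp_on XY" "lift (Poly_Mapping.single (x, y) c) = c \<odot>\<^bsub>W\<^esub> b x y"
    if "x \<in> carrier X" "y \<in> carrier Y" for x y c
    using that lift_single by (auto simp: supp_on_def)
  have sum: "lift (Poly_Mapping.single (x, y) 1 + Poly_Mapping.single (x', y') 1) = b x y \<oplus>\<^bsub>W\<^esub> b x' y'"
    if "x \<in> carrier X" "y \<in> carrier Y" "x' \<in> carrier X" "y' \<in> carrier Y" for x y x' y'
    using lift_add[OF s(1)[OF that(1,2), of 1] s(1)[OF that(3,4), of 1]] s(2)[OF that(1,2), of 1]
      s(2)[OF that(3,4), of 1] that by (simp add: b_closed)
  have diff: "lift (f - g) = \<zero>\<^bsub>W\<^esub>" if "f \<in> supp_on XY" "g \<in> supp_on XY" "lift f = lift g" for f g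
    by (rule lift_diff_0[OF that])
  note A = pm.subspace_add[OF subspace_supp_on] and N = s b_closed X Y b_add b_smult b_balanced
  from r show ?thesis
  proof (cases rule: tensor_relations_cases)
    case (1 x x' y)
    have "lift (Poly_Mapping.single (x \<oplus>\<^bsub>X\<^esub> x', y) 1 - (Poly_Mapping.single (x, y) 1 + Poly_Mapping.single (x', y) 1)) = \<zero>\<^bsub>W\<^esub>"
      by (rule diff) (simp_all add: 1 N A sum)
    then show ?thesis by (simp add: 1 diff_diff_eq)
  next
    case (2 x y y')
    have "lift (Poly_Mapping.single (x, y \<oplus>\<^bsub>Y\<^esub> y') 1 - (Poly_Mapping.single (x, y) 1 + Poly_Mapping.single (x, y') 1)) = \<zero>\<^bsub>W\<^esub>"
      by (rule diff) (simp_all add: 2 N A sum)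
    then show ?thesis by (simp add: 2 diff_diff_eq)
  next
    case (3 c x y)
    show ?thesis unfolding 3(3) by (rule diff) (simp_all add: 3 N)
  next
    case (4 c x y)
    show ?thesis unfolding 4(3) by (rule diff) (simp_all add: 4 N)
  next
    case (5 x s y)
    show ?thesis unfolding 5(4) by (rule diff) (simp_all add: 5 N)
  qed
qed

lemma lift_kernel: "r \<in> pm.span R \<Longrightarrow> r \<in> supp_on XY \<and> lift r = \<zero>\<^bsub>W\<^esub>"
proof (induction rule: pm.span_induct_alt)
  case base
  show ?case using pm.subspace_0[OF subspace_supp_on] by (simp add: lc_def)
next
  case (step c x y)
  have x: "x \<in> supp_on XY" "sc c x \<in> supp_on XY"
    using R_supp step(1) pm.subspace_scale[OF subspace_supp_on] by auto
  have "lift (sc c x + y) = c \<odot>\<^bsub>W\<^esub> lift x \<oplus>\<^bsub>W\<^esub> lift y"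
    using step(2) x lift_add[OF x(2)] lift_sc[OF x(1)] by simp
  then show ?case using step(2) lift_R[OF step(1)] pm.subspace_add[OF subspace_supp_on x(2)] by simp
qed

lemma tensor_lift_coset:
  assumes f: "f \<in> supp_on XY"
  shows "tensor_lift W b (coset (pm.span R) f) = lift f"
proof -
  have "lift (k + f) = lift f" if k: "k \<in> pm.span R" for k
    using lift_kernel[OF k] lift_add[OF _ f, of k] lift_closed[OF f] by simp
  moreover have "0 \<in> pm.span R" by (rule pm.span_zero)
  ultimately have "lift ` coset (pm.span R) f = {lift f}"
    unfolding coset_def by (auto simp: image_iff intro!: bexI[of _ 0])
  then show ?thesis unfolding tensor_lift_def lc_def by simp
qed

lemma tensor_lift_image:
  "tensor_lift W b ` carrier (tensor_space S X ra Y la) = lift ` supp_on XY"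
proof -
  have "carrier (tensor_space S X ra Y la) = coset (pm.span R) ` supp_on XY"
    unfolding tensor_space_def tensor_kernel_def span_free[OF R_supp] by (rule carrier_quotient)
  then show ?thesis by (simp add: image_image tensor_lift_coset)
qed

end

section \<open>Modules over the Temperley--Lieb category\<close>

locale tl_functor = tl_generic \<delta> for \<delta> +
  fixes V :: "'v tlc_functor"
  assumes tlc: "tlc_module \<delta> V"
begin

abbreviation C where "C n \<equiv> carrier (ob V n)"
abbreviation A where "A n x \<equiv> tl_action \<delta> V n x"
abbreviation stab where "stab n \<equiv> stab_map \<delta> V n"

definition mo :: "nat \<Rightarrow> nat \<Rightarrow> tl \<Rightarrow> 'v \<Rightarrow> 'v" where
  "mo m n x v = mor V m n (hom_of \<delta> m n x) v"

lemma A_mo: "A n x v = mo n n x v"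
  by (simp add: tl_action_def mo_def)

lemma stab_mo: "stab n v = mo n (Suc n) (one (Suc n)) v"
  by (simp add: stab_map_def mo_def)

sublocale ob: cvs "ob V n" for n
  using tlc by (intro cvs.intro) (simp add: tlc_module_def)

lemma mor_lin: "F \<in> carrier (hom_space \<delta> m n) \<Longrightarrow> linear_map class_ring (ob V m) (ob V n) (mor V m n F)"
  using tlc by (simp add: tlc_module_def)

lemma mor_lin_left: "v \<in> C m \<Longrightarrow> linear_map class_ring (hom_space \<delta> m n) (ob V n) (\<lambda>F. mor V m n F v)"
  using tlc by (simp add: tlc_module_def)

lemma vs_hom: "vectorspace class_ring (hom_space \<delta> m n)"
  using linear_mapD(1)[OF mor_lin_left[OF ob.zero_closed]] .

lemma hom_of_carrier: "m \<le> n \<Longrightarrow> x \<in> H n n \<Longrightarrow> hom_of \<delta> m n x \<in> carrier (hom_space \<delta> m n)"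
  unfolding hom_space_carrier by (rule imageI)

context
  fixes m n :: nat assumes mn: "m \<le> n"
begin

lemma mo_closed: "x \<in> H n n \<Longrightarrow> v \<in> C m \<Longrightarrow> mo m n x v \<in> C n"
  unfolding mo_def by (rule linear_mapD(3)[OF mor_lin[OF hom_of_carrier[OF mn]]])

lemma mo_add: "x \<in> H n n \<Longrightarrow> v \<in> C m \<Longrightarrow> w \<in> C m \<Longrightarrow>
    mo m n x (v \<oplus>\<^bsub>ob V m\<^esub> w) = mo m n x v \<oplus>\<^bsub>ob V n\<^esub> mo m n x w"
  unfolding mo_def by (rule linear_mapD(4)[OF mor_lin[OF hom_of_carrier[OF mn]]])

lemma mo_smult: "x \<in> H n n \<Longrightarrow> v \<in> C m \<Longrightarrow> mo m n x (c \<odot>\<^bsub>ob V m\<^esub> v) = c \<odot>\<^bsub>ob V n\<^esub> mo m n x v"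
  unfolding mo_def by (rule linear_mapD(5)[OF mor_lin[OF hom_of_carrier[OF mn]]])

lemma mo_add_left: "x \<in> H n n \<Longrightarrow> y \<in> H n n \<Longrightarrow> v \<in> C m \<Longrightarrow>
    mo m n (x + y) v = mo m n x v \<oplus>\<^bsub>ob V n\<^esub> mo m n y v"
  unfolding mo_def hom_of_add[OF mn]
  by (rule linear_mapD(4)[OF mor_lin_left]) (simp_all add: hom_of_carrier mn)

lemma mo_sc_left: "x \<in> H n n \<Longrightarrow> v \<in> C m \<Longrightarrow> mo m n (sc c x) v = c \<odot>\<^bsub>ob V n\<^esub> mo m n x v"
  unfolding mo_def hom_of_sc[OF mn]
  by (rule linear_mapD(5)[OF mor_lin_left]) (simp_all add: hom_of_carrier mn)

lemma mo_Bad: "x \<in> Bad m n \<Longrightarrow> v \<in> C m \<Longrightarrow> mo m n x v = \<zero>\<^bsub>ob V n\<^esub>"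
proof -
  assume x: "x \<in> Bad m n" and v: "v \<in> C m"
  have "hom_of \<delta> m n x = \<zero>\<^bsub>hom_space \<delta> m n\<^esub>"
    unfolding hom_of_zero[OF mn, symmetric] by (rule hom_of_eqI[OF mn Bad_H[OF x] H_0]) (simp add: x)
  then show ?thesis unfolding mo_def using linear_mapD(6)[OF mor_lin_left[OF v, of n]] by simp
qed

lemma mo_0: "v \<in> C m \<Longrightarrow> mo m n 0 v = \<zero>\<^bsub>ob V n\<^esub>"
  by (rule mo_Bad) (rule pm.subspace_0[OF subspace_supp_on])

end

lemma mo_one: "v \<in> C n \<Longrightarrow> mo n n (one n) v = v"
  using tlc by (simp add: tlc_module_def mo_def)

lemma mo_mo:
  assumes "l \<le> m" "m \<le> n" "x \<in> H n n" "y \<in> H m m" "v \<in> C l"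
  shows "mo m n x (mo l m y v) = mo l n (x \<star> left_embedding \<delta> m (n - m) y) v"
proof -
  have F: "hom_of \<delta> m n x \<in> carrier (hom_space \<delta> m n)" "hom_of \<delta> l m y \<in> carrier (hom_space \<delta> l m)"
    using assms by (simp_all add: hom_of_carrier)
  have "\<forall>F\<in>carrier (hom_space \<delta> m n). \<forall>G\<in>carrier (hom_space \<delta> l m). \<forall>v\<in>carrier (ob V l).
      mor V l n (hom_comp \<delta> l m n F G) v = mor V m n F (mor V l m G v)"
    using tlc by (simp add: tlc_module_def)
  from this[rule_format, OF F assms(5)] show ?thesis
    unfolding mo_def hom_comp_eval[OF assms(1-4)] by simp
qed

lemma one_H: "one n \<in> H n n"
  by (simp add: id_matching)

lemma A_mult: "x \<in> H n n \<Longrightarrow> y \<in> H n n \<Longrightarrow> v \<in> C n \<Longrightarrow> A n (x \<star> y) v = A n x (A n y v)"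
  unfolding A_mo by (simp add: mo_mo left_embedding_0)

definition up :: "nat \<Rightarrow> nat \<Rightarrow> 'v \<Rightarrow> 'v" where
  "up m n v = mo m n (one n) v"

lemma up_closed: "m \<le> n \<Longrightarrow> v \<in> C m \<Longrightarrow> up m n v \<in> C n"
  unfolding up_def by (intro mo_closed one_H)

lemma mo_up: "m \<le> n \<Longrightarrow> x \<in> H n n \<Longrightarrow> v \<in> C m \<Longrightarrow> mo m n x v = A n x (up m n v)"
  unfolding up_def A_mo using mo_mo[of m n n x "one n" v] one_H mult_one[of x n n]
  by (simp add: left_embedding_0)

lemma stab_closed: "v \<in> C n \<Longrightarrow> stab n v \<in> C (Suc n)"
  unfolding stab_mo by (intro mo_closed one_H) simp_all

lemma stab_up: "m \<le> n \<Longrightarrow> v \<in> C m \<Longrightarrow> stab n (up m n v) = up m (Suc n) v"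
  unfolding up_def stab_mo using mo_mo[of m n "Suc n" "one (Suc n)" "one n" v] one_H[of n] one_H[of "Suc n"]
    left_embedding_one[of \<delta> n 1] mult_one[OF one_H[of "Suc n"]]
  by simp

lemma stab_A: "x \<in> H n n \<Longrightarrow> v \<in> C n \<Longrightarrow> stab n (A n x v) = A (Suc n) (left_embedding \<delta> n 1 x) (stab n v)"
proof -
  assume x: "x \<in> H n n" and v: "v \<in> C n"
  have e: "left_embedding \<delta> n 1 x \<in> H (Suc n) (Suc n)" using left_embedding_H[OF x, of \<delta> 1] by simp
  have "stab n (A n x v) = mo n (Suc n) (left_embedding \<delta> n 1 x) v"
    unfolding A_mo stab_mo using mo_mo[of n n "Suc n" "one (Suc n)" x v] x v one_H one_mult[OF e] by simp
  also have "\<dots> = A (Suc n) (left_embedding \<delta> n 1 x) (up n (Suc n) v)"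
    by (rule mo_up[OF _ e v]) simp
  finally show ?thesis by (simp add: up_def stab_mo)
qed

lemma stab_A_dg: "d \<in> matchings n n \<Longrightarrow> v \<in> C n \<Longrightarrow> stab n (A n (dg d) v) = A (Suc n) (dg (ext n n d)) (stab n v)"
  using stab_A[of "dg d" n v] stack_id_1 by (simp add: left_embedding_lin)

lemma A_up_bad:
  assumes "m \<le> n" "v \<in> C m" "d \<in> matchings n n" "{a, b} \<in> d" "int m < a" "a < b"
  shows "A n (dg d) (up m n v) = \<zero>\<^bsub>ob V n\<^esub>"
proof -
  have d: "d \<in> bad m n" using assms(3-6) unfolding bad_def by (intro CollectI conjI exI)
  have "A n (dg d) (up m n v) = mo m n (dg d) v" using mo_up[OF assms(1) _ assms(2), of "dg d"] assms(3) by simp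
  also have "\<dots> = \<zero>\<^bsub>ob V n\<^esub>" using d by (intro mo_Bad assms(1,2)) simp
  finally show ?thesis .
qed

lemma A_closed: "x \<in> H n n \<Longrightarrow> v \<in> C n \<Longrightarrow> A n x v \<in> C n"
  unfolding A_mo by (rule mo_closed) simp

lemma A_add: "x \<in> H n n \<Longrightarrow> v \<in> C n \<Longrightarrow> w \<in> C n \<Longrightarrow>
    A n x (v \<oplus>\<^bsub>ob V n\<^esub> w) = A n x v \<oplus>\<^bsub>ob V n\<^esub> A n x w"
  unfolding A_mo by (rule mo_add[OF order_refl])

lemma A_smult: "x \<in> H n n \<Longrightarrow> v \<in> C n \<Longrightarrow> A n x (c \<odot>\<^bsub>ob V n\<^esub> v) = c \<odot>\<^bsub>ob V n\<^esub> A n x v"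
  unfolding A_mo by (rule mo_smult[OF order_refl])

lemma stab_add: "v \<in> C n \<Longrightarrow> w \<in> C n \<Longrightarrow> stab n (v \<oplus>\<^bsub>ob V n\<^esub> w) = stab n v \<oplus>\<^bsub>ob V (Suc n)\<^esub> stab n w"
  unfolding stab_mo by (rule mo_add) (simp_all add: one_H)

lemma stab_smult: "v \<in> C n \<Longrightarrow> stab n (c \<odot>\<^bsub>ob V n\<^esub> v) = c \<odot>\<^bsub>ob V (Suc n)\<^esub> stab n v"
  unfolding stab_mo by (rule mo_smult) (simp_all add: one_H)

lemma A_in:
  assumes x: "x \<in> H n n" and v: "v \<in> C n" and S: "\<zero>\<^bsub>ob V n\<^esub> \<in> S"
    "\<And>v w. v \<in> S \<Longrightarrow> w \<in> S \<Longrightarrow> v \<oplus>\<^bsub>ob V n\<^esub> w \<in> S" "\<And>c v. v \<in> S \<Longrightarrow> c \<odot>\<^bsub>ob V n\<^esub> v \<in> S"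
    "\<And>d. d \<in> matchings n n \<Longrightarrow> A n (dg d) v \<in> S"
  shows "A n x v \<in> S"
proof -
  have "x \<in> pm.span (dg ` matchings n n)" using x by (simp only: H_def supp_on_span)
  then have "x \<in> H n n \<and> A n x v \<in> S"
  proof (induction rule: pm.span_induct_alt)
    case base
    show ?case using S(1) H_0 v by (simp add: A_mo mo_0)
  next
    case (step c x y)
    from step(1) obtain d where d: "x = dg d" "d \<in> matchings n n" by (rule imageE)
    then have xH: "x \<in> H n n" by simp
    note xc = H_sc[OF xH, of c]
    have yH: "y \<in> H n n" and yS: "A n y v \<in> S" using step(2) by simp_all
    have "A n (sc c x + y) v = c \<odot>\<^bsub>ob V n\<^esub> A n x v \<oplus>\<^bsub>ob V n\<^esub> A n y v"
      unfolding A_mo using mo_add_left[OF order_refl xc yH v] mo_sc_left[OF order_refl xH v, of c] by simp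
    then show ?case using S(2-4) d yS H_add[OF xc yH] by simp
  qed
  then show ?thesis ..
qed

end

section \<open>Finitely generated modules\<close>

text \<open>Generation is put as a closure principle, ready to be applied to any set
  \<open>S\<close>. Scalar multiples are covered by letting \<open>x\<close> range over all of
  \<open>H n n\<close>.\<close>

locale tl_fg = tl_functor \<delta> V for \<delta> and V :: "'v tlc_functor" +
  fixes ps :: "nat list" and v :: "nat \<Rightarrow> 'v"
  assumes v_closed: "i < length ps \<Longrightarrow> v i \<in> C (ps ! i)"
    and generated: "\<And>n w S. w \<in> C n \<Longrightarrow> \<zero>\<^bsub>ob V n\<^esub> \<in> S \<Longrightarrow>
      (\<And>v w. v \<in> S \<Longrightarrow> w \<in> S \<Longrightarrow> v \<oplus>\<^bsub>ob V n\<^esub> w \<in> S) \<Longrightarrow>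
      (\<And>i x. i < length ps \<Longrightarrow> ps ! i \<le> n \<Longrightarrow> x \<in> H n n \<Longrightarrow> A n x (up (ps ! i) n (v i)) \<in> S) \<Longrightarrow> w \<in> S"
begin

abbreviation G where "G i n \<equiv> up (ps ! i) n (v i)"

lemma G_closed: "i < length ps \<Longrightarrow> ps ! i \<le> n \<Longrightarrow> G i n \<in> C n"
  by (rule up_closed[OF _ v_closed])

definition L :: nat where "L = Max (insert 0 (set ps))"

lemma L: "i < length ps \<Longrightarrow> ps ! i \<le> L"
  unfolding L_def by (rule Max_ge) auto

text \<open>A spanning family of V_n. The value zero at meaningless indices makes it total, as
  \<open>section_exists\<close> asks for a family on the whole type.\<close>

definition b :: "nat \<Rightarrow> nat \<times> diagram \<Rightarrow> 'v" where
  "b n = (\<lambda>(i, d). if i < length ps \<and> ps ! i \<le> n \<and> d \<in> matchings n n then A n (dg d) (G i n) else \<zero>\<^bsub>ob V n\<^esub>)"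

lemma b_closed: "b n e \<in> C n"
  using A_closed[OF _ G_closed] by (cases e) (auto simp: b_def)

abbreviation P where "P n \<equiv> ob.lc n (b n)"

lemma supp_UNIV: "f \<in> supp_on UNIV"
  by (simp add: supp_on_def)

lemma P_closed: "P n f \<in> C n" by (rule ob.lc_closed[OF b_closed supp_UNIV])
lemma P_add: "P n (f + g) = P n f \<oplus>\<^bsub>ob V n\<^esub> P n g" by (rule ob.lc_add[OF b_closed supp_UNIV supp_UNIV])
lemma P_sc: "P n (sc c f) = c \<odot>\<^bsub>ob V n\<^esub> P n f" by (rule ob.lc_sc[OF b_closed supp_UNIV])
lemma P_dg: "P n (dg e) = b n e" by (rule ob.lc_dg[OF b_closed UNIV_I])

lemma P_surj: "C n \<subseteq> range (P n)"
proof
  fix w assume w: "w \<in> C n"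
  have P0: "\<zero>\<^bsub>ob V n\<^esub> \<in> range (P n)" by (rule range_eqI[of _ _ 0]) (simp add: ob.lc_def)
  have Padd: "x \<oplus>\<^bsub>ob V n\<^esub> y \<in> range (P n)" if xy: "x \<in> range (P n)" "y \<in> range (P n)" for x y
  proof -
    from xy(1) obtain f where "x = P n f" by (rule rangeE)
    moreover from xy(2) obtain g where "y = P n g" by (rule rangeE)
    ultimately show ?thesis using P_add by (intro range_eqI[of _ _ "f + g"]) simp
  qed
  have Psc: "c \<odot>\<^bsub>ob V n\<^esub> x \<in> range (P n)" if x: "x \<in> range (P n)" for x c
  proof -
    from x obtain f where "x = P n f" by (rule rangeE)
    then show ?thesis using P_sc by (intro range_eqI[of _ _ "sc c f"]) simp
  qed
  show "w \<in> range (P n)"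
  proof (rule generated[OF w P0 Padd])
    fix i and x :: tl assume i: "i < length ps" "ps ! i \<le> n" and x: "x \<in> H n n"
    show "A n x (G i n) \<in> range (P n)"
    proof (rule A_in[OF x G_closed[OF i] P0 Padd Psc])
      fix d assume "d \<in> matchings n n"
      then have "A n (dg d) (G i n) = P n (dg (i, d))" unfolding P_dg using i by (simp add: b_def)
      then show "A n (dg d) (G i n) \<in> range (P n)" by (rule range_eqI)
    qed
  qed
qed

text \<open>From the largest generator degree on, each generator in degree \<open>n + 1\<close> is
  the stabilisation of its image in degree \<open>n\<close>, so \<open>x\<close> times it is the
  image of a pure tensor.\<close>

lemma induced_surj:
  assumes n: "L \<le> n"
  shows "induced_map \<delta> V n ` carrier (induced_space \<delta> V n) = C (n + 1)"
proof -
  let ?N = "Suc n"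
  have e: "left_embedding \<delta> n 1 s \<in> H ?N ?N" if "s \<in> H n n" for s
    using left_embedding_H[OF that, of \<delta> 1] by simp
  interpret T: balanced "ob V (n + 1)" "carrier (TL \<delta> n)" "TL \<delta> (n + 1)"
    "\<lambda>x s. x \<otimes>\<^bsub>TL \<delta> (n + 1)\<^esub> left_embedding \<delta> n 1 s" "ob V n" "tl_action \<delta> V n"
    "\<lambda>x v. tl_action \<delta> V (n + 1) x (stab_map \<delta> V n v)"
  proof unfold_locales
    fix x s y assume *: "x \<in> carrier (TL \<delta> (n + 1))" "s \<in> carrier (TL \<delta> n)" "y \<in> C n"
    then show "tl_action \<delta> V (n + 1) (x \<otimes>\<^bsub>TL \<delta> (n + 1)\<^esub> left_embedding \<delta> n 1 s) (stab_map \<delta> V n y) =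
       tl_action \<delta> V (n + 1) x (stab_map \<delta> V n (tl_action \<delta> V n s y))"
      using A_mult[OF _ e stab_closed, of x s y] stab_A[of s n y] by simp
  next
    fix x y z assume "x \<in> carrier (TL \<delta> (n + 1))" "y \<in> C n" "z \<in> C n"
    then show "tl_action \<delta> V (n + 1) x (stab_map \<delta> V n (y \<oplus>\<^bsub>ob V n\<^esub> z)) =
      tl_action \<delta> V (n + 1) x (stab_map \<delta> V n y) \<oplus>\<^bsub>ob V (n + 1)\<^esub> tl_action \<delta> V (n + 1) x (stab_map \<delta> V n z)"
      using mo_add[of n ?N "one ?N" y z] one_H[of ?N] stab_closed mo_add[of ?N ?N x "stab n y" "stab n z"]
      by (simp add: A_mo stab_mo)
  next
    fix c x y assume "x \<in> carrier (TL \<delta> (n + 1))" "y \<in> C n"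
    then show "tl_action \<delta> V (n + 1) x (stab_map \<delta> V n (c \<odot>\<^bsub>ob V n\<^esub> y)) =
      c \<odot>\<^bsub>ob V (n + 1)\<^esub> tl_action \<delta> V (n + 1) x (stab_map \<delta> V n y)"
      using mo_smult[of n ?N "one ?N" y c] one_H[of ?N] stab_closed mo_smult[of ?N ?N x "stab n y" c]
      by (simp add: A_mo stab_mo)
  next
    show "tl_action \<delta> V n s y \<in> C n" if "s \<in> carrier (TL \<delta> n)" "y \<in> C n" for s y
      using A_closed that by simp
  qed (use stab_closed e in \<open>auto simp: A_mo mo_add_left mo_sc_left mo_closed H_add H_sc mult_closed\<close>)
  have "T.lift ` supp_on T.XY = C (n + 1)"
  proof
    show "T.lift ` supp_on T.XY \<subseteq> C (n + 1)" using T.lift_closed by (rule image_subsetI)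
    show "C (n + 1) \<subseteq> T.lift ` supp_on T.XY"
    proof
      fix w assume w: "w \<in> C (n + 1)"
      show "w \<in> T.lift ` supp_on T.XY"
      proof (rule generated[OF w])
        show "\<zero>\<^bsub>ob V (n + 1)\<^esub> \<in> T.lift ` supp_on T.XY"
          by (rule image_eqI[of _ _ 0]) (simp_all add: ob.lc_def pm.subspace_0[OF subspace_supp_on])
        show "x \<oplus>\<^bsub>ob V (n + 1)\<^esub> y \<in> T.lift ` supp_on T.XY"
          if xy: "x \<in> T.lift ` supp_on T.XY" "y \<in> T.lift ` supp_on T.XY" for x y
        proof -
          from xy(1) obtain f where f: "x = T.lift f" "f \<in> supp_on T.XY" by (rule imageE)
          from xy(2) obtain g where g: "y = T.lift g" "g \<in> supp_on T.XY" by (rule imageE)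
          from T.lift_add[OF f(2) g(2), symmetric] pm.subspace_add[OF subspace_supp_on f(2) g(2)]
          show ?thesis unfolding f g by (rule image_eqI)
        qed
        fix i and x :: tl assume i: "i < length ps" and "ps ! i \<le> n + 1" and x: "x \<in> H (n + 1) (n + 1)"
        have le: "ps ! i \<le> n" using L[OF i] n by simp
        have "A (n + 1) x (G i (n + 1)) = T.lift (dg (x, G i n))"
          using x G_closed[OF i le] stab_up[OF le v_closed[OF i]] T.lift_single[of x "G i n" 1] T.bXY[of "(x, G i n)"]
          by (simp add: dg_def T.b_closed)
        moreover have "dg (x, G i n) \<in> supp_on T.XY" using x G_closed[OF i le] by simp
        ultimately show "A (n + 1) x (G i (n + 1)) \<in> T.lift ` supp_on T.XY" by (rule image_eqI)
      qed
    qed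
  qed
  then show ?thesis unfolding induced_map_def induced_space_def T.tensor_lift_image .
qed

text \<open>To apply the analysis of systems, each \<open>V\<^sub>n\<close> is identified with a subspace \<open>T n\<close> of the free space
  on the pairs \<open>(i, d)\<close> standing for the elements \<open>d \<cdot> G i n\<close>.\<close>

definition s :: "nat \<Rightarrow> 'v \<Rightarrow> (nat \<times> diagram \<Rightarrow>\<^sub>0 complex)" where
  "s n = (SOME s. Vector_Spaces.linear sc sc (\<lambda>f. s (P n f)) \<and> (\<forall>w\<in>C n. P n (s w) = w))"

lemma s: "Vector_Spaces.linear sc sc (\<lambda>f. s n (P n f))" "w \<in> C n \<Longrightarrow> P n (s n w) = w"
proof -
  have "\<exists>s. Vector_Spaces.linear sc sc (\<lambda>f. s (P n f)) \<and> (\<forall>w\<in>C n. P n (s w) = w)"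
  proof (rule ob.section_exists[of "b n" n, OF b_closed P_surj])
    fix s \<rho> assume *: "Vector_Spaces.linear sc sc \<rho>" "\<And>f. s (P n f) = \<rho> f" "\<And>w. w \<in> C n \<Longrightarrow> P n (s w) = w"
    have "(\<lambda>f. s (P n f)) = \<rho>" using *(2) by (rule ext)
    then show ?thesis using *(1,3) by (intro exI[of _ s]) simp
  qed
  from someI_ex[OF this] show "Vector_Spaces.linear sc sc (\<lambda>f. s n (P n f))" "w \<in> C n \<Longrightarrow> P n (s n w) = w"
    unfolding s_def by simp_all
qed

sublocale sP: Vector_Spaces.linear sc sc "\<lambda>f. s n (P n f)" for n
  by (rule s(1))

lemma s_add: "w \<in> C n \<Longrightarrow> x \<in> C n \<Longrightarrow> s n (w \<oplus>\<^bsub>ob V n\<^esub> x) = s n w + s n x"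
  using sP.add[of n "s n w" "s n x"] by (simp add: P_add s(2))

lemma s_smult: "w \<in> C n \<Longrightarrow> s n (c \<odot>\<^bsub>ob V n\<^esub> w) = sc c (s n w)"
  using sP.scale[of n c "s n w"] by (simp add: P_sc s(2))

lemma s_zero: "s n \<zero>\<^bsub>ob V n\<^esub> = 0"
  using s_smult[OF ob.zero_closed, of n 0] by (simp add: pm.scale_zero_left)

definition T :: "nat \<Rightarrow> (nat \<times> diagram \<Rightarrow>\<^sub>0 complex) set" where
  "T n = s n ` C n"

lemma s_T: "w \<in> C n \<Longrightarrow> s n w \<in> T n"
  by (simp add: T_def)

lemma sP_T: "t \<in> T n \<Longrightarrow> s n (P n t) = t"
  by (auto simp: T_def s(2))

text \<open>Linear extension with value zero off \<open>matchings n n\<close> makes this linear in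
  \<open>x\<close> without restriction, as \<open>tl_system\<close> demands; on \<open>H n n\<close>
  it is the transported action by \<open>act_eq\<close>.\<close>

definition act :: "nat \<Rightarrow> tl \<Rightarrow> (nat \<times> diagram \<Rightarrow>\<^sub>0 complex) \<Rightarrow> (nat \<times> diagram \<Rightarrow>\<^sub>0 complex)" where
  "act n x t = lin (\<lambda>d. if d \<in> matchings n n then s n (A n (dg d) (P n t)) else 0) x"

definition phi :: "nat \<Rightarrow> (nat \<times> diagram \<Rightarrow>\<^sub>0 complex) \<Rightarrow> (nat \<times> diagram \<Rightarrow>\<^sub>0 complex)" where
  "phi n t = s (Suc n) (stab n (P n t))"

lemma act_eq:
  assumes x: "x \<in> H n n" shows "act n x t = s n (A n x (P n t))"
proof -
  have "x \<in> pm.span (dg ` matchings n n)" using x by (simp only: H_def supp_on_span)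
  then have "x \<in> H n n \<and> act n x t = s n (A n x (P n t))"
  proof (induction rule: pm.span_induct_alt)
    case base
    show ?case using H_0 P_closed by (simp add: act_def A_mo mo_0 s_zero)
  next
    case (step c x y)
    from step(1) obtain d where d: "x = dg d" "d \<in> matchings n n" by (rule imageE)
    then have xH: "x \<in> H n n" by simp
    note xc = H_sc[OF xH, of c]
    have yH: "y \<in> H n n" and yS: "act n y t = s n (A n y (P n t))" using step(2) by simp_all
    have "A n (sc c x + y) (P n t) = c \<odot>\<^bsub>ob V n\<^esub> A n x (P n t) \<oplus>\<^bsub>ob V n\<^esub> A n y (P n t)"
      unfolding A_mo using mo_add_left[OF order_refl xc yH P_closed] mo_sc_left[OF order_refl xH P_closed, of c] by simp
    then have "s n (A n (sc c x + y) (P n t)) = sc c (s n (A n x (P n t))) + s n (A n y (P n t))"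
      by (simp add: s_add s_smult A_closed xH yH P_closed)
    moreover have "act n (sc c x + y) t = sc c (s n (A n x (P n t))) + act n y t"
      using d by (simp add: act_def lin_add lin_sc)
    ultimately show ?case using yS H_add[OF xc yH] by simp
  qed
  then show ?thesis ..
qed

lemma act_s: "x \<in> H n n \<Longrightarrow> w \<in> C n \<Longrightarrow> act n x (s n w) = s n (A n x w)"
  by (simp add: act_eq s(2))

lemma phi_s: "w \<in> C n \<Longrightarrow> phi n (s n w) = s (Suc n) (stab n w)"
  by (simp add: phi_def s(2))

sublocale S: tl_system \<delta> T act phi "{..<length ps}" "\<lambda>i. ps ! i" "\<lambda>i n. s n (G i n)" L
proof unfold_locales
  fix n
  show "pm.subspace (T n)"
    unfolding T_def
  proof (rule pm.subspaceI)
    show "0 \<in> s n ` C n" using imageI[OF ob.zero_closed[of n], of "s n"] by (simp only: s_zero)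
    show "f + g \<in> s n ` C n" if fg: "f \<in> s n ` C n" "g \<in> s n ` C n" for f g
    proof -
      from fg(1) obtain v where v: "f = s n v" "v \<in> C n" by (rule imageE)
      from fg(2) obtain w where w: "g = s n w" "w \<in> C n" by (rule imageE)
      from s_add[OF v(2) w(2), symmetric] ob.a_closed[OF v(2) w(2)]
      show ?thesis unfolding v w by (rule image_eqI)
    qed
    show "sc c f \<in> s n ` C n" if f: "f \<in> s n ` C n" for c f
    proof -
      from f obtain v where v: "f = s n v" "v \<in> C n" by (rule imageE)
      from s_smult[OF v(2), symmetric] ob.sm_closed[OF v(2)]
      show ?thesis unfolding v by (rule image_eqI)
    qed
  qed
  have dgs: "s n (A n (dg d) (P n (f + g))) = s n (A n (dg d) (P n f)) + s n (A n (dg d) (P n g))"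
    "s n (A n (dg d) (P n (sc c f))) = sc c (s n (A n (dg d) (P n f)))" if "d \<in> matchings n n" for d f g c
    using that by (simp_all add: P_add P_sc P_closed A_add A_smult A_closed s_add s_smult)
  show "act n x (f + g) = act n x f + act n x g" for x f g
    unfolding act_def lin_plus_fun[symmetric] by (rule arg_cong[of _ _ "\<lambda>F. lin F x"]) (auto simp: dgs)
  show "act n x (sc c f) = sc c (act n x f)" for x c f
    unfolding act_def lin_sc_fun[symmetric] by (rule arg_cong[of _ _ "\<lambda>F. lin F x"]) (auto simp: dgs)
  show "act n (x + y) t = act n x t + act n y t" "act n (sc c x) t = sc c (act n x t)" for x y t c
    by (simp_all add: act_def lin_add lin_sc)
  show "act n x t \<in> T n" if "x \<in> H n n" for x t
    unfolding act_eq[OF that] by (intro s_T A_closed that P_closed)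
  show "act n (x \<star> y) t = act n x (act n y t)" if "x \<in> H n n" "y \<in> H n n" for x y t
    unfolding act_eq[OF mult_closed[OF that]] act_eq[OF that(2)] act_s[OF that(1) A_closed[OF that(2) P_closed]]
    by (simp add: A_mult that P_closed)
  show "act n (one n) t = t" if "t \<in> T n" for t
    unfolding act_eq[OF one_H] using mo_one[OF P_closed] sP_T[OF that] by (simp add: A_mo)
  show "phi n (f + g) = phi n f + phi n g" "phi n (sc c f) = sc c (phi n f)" for f g c
    by (simp_all add: phi_def P_add P_sc P_closed stab_add stab_smult stab_closed s_add s_smult)
  show "phi n t \<in> T (Suc n)" for t
    unfolding phi_def by (intro s_T stab_closed P_closed)
  show "phi n (act n (dg d) t) = act (Suc n) (dg (ext n n d)) (phi n t)" if d: "d \<in> matchings n n" for d t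
  proof -
    have dH: "dg d \<in> H n n" using d by simp
    have eH: "dg (ext n n d) \<in> H (Suc n) (Suc n)" using ext_matching[OF d] by simp
    have "phi n (act n (dg d) t) = s (Suc n) (stab n (A n (dg d) (P n t)))"
      unfolding act_eq[OF dH] by (rule phi_s[OF A_closed[OF dH P_closed]])
    also have "\<dots> = s (Suc n) (A (Suc n) (dg (ext n n d)) (stab n (P n t)))"
      by (simp only: stab_A_dg[OF d P_closed])
    also have "\<dots> = act (Suc n) (dg (ext n n d)) (phi n t)"
      unfolding phi_def by (rule act_s[OF eH stab_closed[OF P_closed], symmetric])
    finally show ?thesis .
  qed
  show "finite {..<length ps}" by simp
  fix i assume "i \<in> {..<length ps}"
  then have i: "i < length ps" by simp
  show "ps ! i \<le> L" by (rule L[OF i])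
  assume le: "ps ! i \<le> n"
  show "s n (G i n) \<in> T n" by (rule s_T[OF G_closed[OF i le]])
  show "phi n (s n (G i n)) = s (Suc n) (G i (Suc n))"
    unfolding phi_s[OF G_closed[OF i le]] stab_up[OF le v_closed[OF i]] ..
  show "act n (dg d) (s n (G i n)) = 0"
    if "d \<in> matchings n n" "{x, y} \<in> d" "int (ps ! i) < x" "x < y" for d x y
    using act_s[OF _ G_closed[OF i le], of "dg d"] A_up_bad[OF le v_closed[OF i] that] that(1) by (simp add: s_zero)
next
  fix n
  show "T n \<subseteq> pm.span {act n (dg d) (s n (G i n)) |d i. d \<in> matchings n n \<and> i \<in> {..<length ps} \<and> ps ! i \<le> n}"
    (is "_ \<subseteq> pm.span ?G")
  proof
    fix t assume "t \<in> T n"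
    then have "t = s n (P n t)" by (rule sP_T[symmetric])
    also have "\<dots> \<in> pm.span ?G"
    proof (rule linear_in_subspace[OF s(1) pm.subspace_span supp_UNIV])
      fix e :: "nat \<times> diagram"
      obtain i d where e: "e = (i, d)" by (rule prod.exhaust)
      show "s n (P n (dg e)) \<in> pm.span ?G"
      proof (cases "i < length ps \<and> ps ! i \<le> n \<and> d \<in> matchings n n")
        case True
        then have "s n (P n (dg e)) = act n (dg d) (s n (G i n))"
          unfolding P_dg e using act_s[OF _ G_closed[of i n], of "dg d"] by (simp add: b_def)
        also have "\<dots> \<in> pm.span ?G" using True by (intro pm.span_base) auto
        finally show ?thesis .
      next
        case False
        then show ?thesis unfolding P_dg e by (auto simp: b_def s_zero pm.span_zero)
      qed
    qed
    finally show "t \<in> pm.span ?G" .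
  qed
qed

lemma stab_inj: "\<exists>N. \<forall>n\<ge>N. inj_on (stab n) (C n)"
proof -
  obtain N where N: "\<And>n t. n \<ge> N \<Longrightarrow> t \<in> T n \<Longrightarrow> phi n t = 0 \<Longrightarrow> t = 0"
    using S.phi_inj by metis
  have "inj_on (stab n) (C n)" if n: "n \<ge> N" for n
  proof (rule inj_onI)
    fix v w assume vw: "v \<in> C n" "w \<in> C n" "stab n v = stab n w"
    have "phi n (s n v - s n w) = 0" using vw by (simp add: S.phi.diff phi_s)
    then have "s n v - s n w = 0"
      using N[OF n pm.subspace_diff[OF S.sys_T s_T[OF vw(1)] s_T[OF vw(2)]]] by simp
    then have "P n (s n v) = P n (s n w)" by simp
    then show "v = w" using vw by (simp add: s(2))
  qed
  then show ?thesis by blast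
qed

text \<open>The isomorphism is the inverse of \<open>theta\<close> after the coordinates
  \<open>s n\<close>. Its linearity and equivariance are those of \<open>theta\<close>, transferred
  by injectivity through \<open>uniq\<close>.\<close>

lemma multiplicities: "has_multiplicities \<delta> V n (S.M.mult_X n)"
proof -
  let ?I = "S.M.idx n" and ?S = "dsum (S.M.idx n) (\<lambda>(k, j). simple_space n k)" and ?th = "S.M.theta n"
  let ?X = "S.M.simples n"
  have S: "carrier ?S = ?X"
    unfolding dsum_def S.M.simples_def simple_space_def
    by (simp add: case_prod_unfold)
  have bs: "bij_betw (s n) (C n) (T n)"
    unfolding T_def by (intro inj_on_imp_bij_betw inj_on_inverseI[of _ "P n"] s(2))
  note bth = S.M.theta_bij[of n]
  define \<psi> where "\<psi> = inv_into ?X ?th \<circ> s n"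
  have bpsi: "bij_betw \<psi> (C n) ?X"
    unfolding \<psi>_def by (rule bij_betw_trans[OF bs bij_betw_inv_into[OF bth]])
  have th: "?th (\<psi> v) = s n v" if "v \<in> C n" for v
    unfolding \<psi>_def using bij_betw_inv_into_right[OF bth s_T[OF that]] by simp
  have X: "\<psi> v \<in> ?X" if "v \<in> C n" for v by (rule bij_betw_apply[OF bpsi that])
  have uniq: "\<psi> v = y" if "v \<in> C n" "y \<in> ?X" "?th y = s n v" for v y
    using inj_onD[OF bij_betw_imp_inj_on[OF bth] _ X[OF that(1)] that(2)] th[OF that(1)] that(3) by simp
  have lin: "linear_map class_ring (ob V n) ?S \<psi>"
  proof (rule linear_mapI)
    show "vectorspace class_ring (ob V n)" by (rule ob.vs)
    show "vectorspace class_ring ?S"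
      by (rule vectorspace_dsum) (auto simp: simple_space_def vectorspace_free)
    show "\<psi> v \<in> carrier ?S" if "v \<in> C n" for v unfolding S by (rule X[OF that])
    show "\<psi> (v \<oplus>\<^bsub>ob V n\<^esub> w) = \<psi> v \<oplus>\<^bsub>?S\<^esub> \<psi> w" if vw: "v \<in> C n" "w \<in> C n" for v w
    proof -
      have "\<psi> v \<oplus>\<^bsub>?S\<^esub> \<psi> w = (\<lambda>i\<in>?I. \<psi> v i + \<psi> w i)"
        by (simp add: dsum_def simple_space_def case_prod_unfold)
      moreover have "\<psi> (v \<oplus>\<^bsub>ob V n\<^esub> w) = (\<lambda>i\<in>?I. \<psi> v i + \<psi> w i)"
        by (rule uniq) (simp_all add: vw S.M.simples_add X S.M.theta_add th s_add)
      ultimately show ?thesis by simp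
    qed
    show "\<psi> (c \<odot>\<^bsub>ob V n\<^esub> v) = c \<odot>\<^bsub>?S\<^esub> \<psi> v" if v: "v \<in> C n" for c v
    proof -
      have "c \<odot>\<^bsub>?S\<^esub> \<psi> v = (\<lambda>i\<in>?I. sc c (\<psi> v i))"
        by (simp add: dsum_def simple_space_def case_prod_unfold)
      moreover have "\<psi> (c \<odot>\<^bsub>ob V n\<^esub> v) = (\<lambda>i\<in>?I. sc c (\<psi> v i))"
        by (rule uniq) (simp_all add: v S.M.simples_scale X S.M.theta_scale th s_smult)
      ultimately show ?thesis by simp
    qed
  qed
  have equi: "\<psi> (A n a v) = (\<lambda>(k, j)\<in>?I. simple_action \<delta> n k a (\<psi> v (k, j)))" if a: "a \<in> H n n" and v: "v \<in> C n" for a v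
  proof (rule uniq)
    show "A n a v \<in> C n" by (rule A_closed[OF a v])
    show "(\<lambda>(k, j)\<in>?I. simple_action \<delta> n k a (\<psi> v (k, j))) \<in> ?X"
      using S.M.simplesI[of n "\<lambda>(k, j). simple_action \<delta> n k a (\<psi> v (k, j))"]
      by (simp add: simple_action_eq proj_simple_supp)
    show "?th (\<lambda>(k, j)\<in>?I. simple_action \<delta> n k a (\<psi> v (k, j))) = s n (A n a v)"
      using S.M.theta_equivariant[OF a X[OF v]] th[OF v] act_s[OF a v] by simp
  qed
  have I: "{(k, j). 2 * k \<le> n \<and> j < S.M.mult_X n k} = ?I" by (simp add: S.M.idx_def)
  show ?thesis
    unfolding has_multiplicities_def Let_def I
    using lin bpsi equi by (intro exI[of _ \<psi>]) (simp add: S)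
qed

theorem stable: "representation_stable \<delta> V"
  unfolding representation_stable_def
proof (intro conjI)
  show "\<exists>N. \<forall>n\<ge>N. inj_on (stab n) (C n)" by (rule stab_inj)
  show "\<exists>N. \<forall>n\<ge>N. induced_map \<delta> V n ` carrier (induced_space \<delta> V n) = C (n + 1)"
    using induced_surj by blast
  show "\<exists>c. (\<forall>n. has_multiplicities \<delta> V n (c n)) \<and> (\<forall>k. \<exists>N. \<forall>n\<ge>N. c n k = c N k)"
  proof (intro exI[of _ "S.M.mult_X"] conjI allI)
    show "has_multiplicities \<delta> V n (S.M.mult_X n)" for n by (rule multiplicities)
    fix k
    obtain M where "M \<ge> L \<and> (\<forall>m\<ge>M. S.mult_dim k m = S.mult_dim k M)" using S.mult_stable[of k] ..
    then have M: "S.mult_dim k m = S.mult_dim k M" if "m \<ge> M" for m using that by blast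
    have eq: "S.M.mult_X n k = S.mult_dim k (n - 2 * k)" if "n \<ge> 2 * k" for n
      using that by (simp add: S.M.mult_X_def S.mult_dim_def)
    \<comment> \<open>\<open>M\<close> bounds the number \<open>n - 2 * k\<close> of through
      strands; the shift by \<open>2 * k\<close> converts it to a bound for
      \<open>n\<close>.\<close>
    have "S.M.mult_X n k = S.M.mult_X (M + 2 * k) k" if "n \<ge> M + 2 * k" for n
      using eq[of n] eq[of "M + 2 * k"] M[of "n - 2 * k"] that by simp
    then show "\<exists>N. \<forall>n\<ge>N. S.M.mult_X n k = S.M.mult_X N k" by blast
  qed
qed

end

section \<open>Finitely presented modules are finitely generated\<close>

context tl_functor
begin

text \<open>Yoneda: a map out of M(p) is determined by the image of the identity of p. The images of
  these identities under \<open>\<beta>\<close> are the generators, and surjectivity of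
  \<open>\<beta>\<close> is generation.\<close>

lemma fg_exists:
  assumes "finitely_presented \<delta> V"
  shows "\<exists>ps v. tl_fg \<delta> V ps v"
proof -
  obtain ps \<beta> where hom: "tlc_hom \<delta> (principal_sum \<delta> ps) V \<beta>"
    and surj: "\<forall>n. \<beta> n ` carrier (ob (principal_sum \<delta> ps) n) = C n"
    using assms unfolding finitely_presented_def by (elim exE conjE) (rule that; assumption)
  let ?I = "{..<length ps}" and ?S = "principal_sum \<delta> ps"
  let ?H = "\<lambda>i n. hom_space \<delta> (ps ! i) n"
  have ob: "ob ?S n = dsum ?I (\<lambda>i. ?H i n)" for n
    by (simp add: principal_sum_def tlc_dsum_def principal_def)
  have mor: "mor ?S m n F f = (\<lambda>i\<in>?I. hom_comp \<delta> (ps ! i) m n F (f i))" for m n F f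
    by (simp add: principal_sum_def tlc_dsum_def principal_def)
  have cS: "carrier (ob ?S n) = (\<Pi>\<^sub>E i\<in>?I. carrier (?H i n))" for n by (simp add: ob dsum_def)
  have aS: "f \<oplus>\<^bsub>ob ?S n\<^esub> g = (\<lambda>i\<in>?I. f i \<oplus>\<^bsub>?H i n\<^esub> g i)" for f g n by (simp add: ob dsum_def)
  have zS: "\<zero>\<^bsub>ob ?S n\<^esub> = (\<lambda>i\<in>?I. \<zero>\<^bsub>?H i n\<^esub>)" for n by (simp add: ob dsum_def)
  note lb = conjunct1[OF hom[unfolded tlc_hom_def], rule_format]
  note nat = conjunct2[OF hom[unfolded tlc_hom_def], rule_format]
  interpret h: cvs "hom_space \<delta> m n" for m n by (rule cvs.intro[OF vs_hom])
  define \<iota> where "\<iota> i n F = (\<lambda>k\<in>?I. if k = i then F else \<zero>\<^bsub>?H k n\<^esub>)" for i n F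
  have iS: "\<iota> i n F \<in> carrier (ob ?S n)" if "F \<in> carrier (?H i n)" for i n F
    unfolding cS \<iota>_def by (rule restrict_PiE_iff[THEN iffD2]) (use that in auto)
  define v where "v i = \<beta> (ps ! i) (\<iota> i (ps ! i) (hom_of \<delta> (ps ! i) (ps ! i) (one (ps ! i))))" for i
  have vC: "v i \<in> C (ps ! i)" for i
    unfolding v_def by (rule linear_mapD(3)[OF lb iS[OF hom_of_carrier[OF order_refl one_H]]])
  \<comment> \<open>Needed for the summands other than \<open>i\<close>, in which the inclusion
    \<open>\<iota>\<close> has the entry zero; for \<open>l > m\<close> the zero is that of the
    default branch of \<open>hom_comp\<close>.\<close>
  have comp: "hom_comp \<delta> l m n F \<zero>\<^bsub>hom_space \<delta> l m\<^esub> = \<zero>\<^bsub>hom_space \<delta> l n\<^esub>"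
    if "m \<le> n" "F = hom_of \<delta> m n x" "x \<in> H n n" for l m n F x
  proof (cases "l \<le> m")
    case True
    have "left_embedding \<delta> m (n - m) 0 = 0" by (simp add: left_embedding_lin)
    then show ?thesis
      using hom_comp_eval[OF True that(1,3) H_0] hom_of_zero[OF True] hom_of_zero[OF order_trans[OF True that(1)]] that(2)
      by (simp add: right.zero)
  next
    case False
    then show ?thesis by (simp add: hom_comp_def)
  qed
  have gen: "\<beta> n (\<iota> i n F) = A n x (up (ps ! i) n (v i))"
    if i: "i < length ps" and le: "ps ! i \<le> n" and F: "F = hom_of \<delta> (ps ! i) n x" "x \<in> H n n" for i n F x
  proof -
    let ?p = "ps ! i"
    let ?o = "hom_of \<delta> ?p ?p (one ?p)"
    have "hom_comp \<delta> ?p ?p n F ?o = F"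
      unfolding F(1) hom_comp_eval[OF order_refl le F(2) one_H] left_embedding_one
      using mult_one[OF F(2)] le by simp
    then have "mor ?S ?p n F (\<iota> i ?p ?o) = \<iota> i n F"
      unfolding mor \<iota>_def using comp[OF le F] by (intro restrict_ext) simp
    then have "\<beta> n (\<iota> i n F) = mor V ?p n F (v i)"
      using nat[OF hom_of_carrier[OF le F(2), folded F(1)] iS[OF hom_of_carrier[OF order_refl one_H]]] by (simp add: v_def)
    then show ?thesis unfolding mo_up[OF le F(2) vC, symmetric] mo_def F(1) .
  qed
  have "tl_fg \<delta> V ps v"
  proof unfold_locales
    show "v i \<in> C (ps ! i)" for i by (rule vC)
    fix n w S
    assume w: "w \<in> C n" and S: "\<zero>\<^bsub>ob V n\<^esub> \<in> S" "\<And>v w. v \<in> S \<Longrightarrow> w \<in> S \<Longrightarrow> v \<oplus>\<^bsub>ob V n\<^esub> w \<in> S"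
      "\<And>i x. i < length ps \<Longrightarrow> ps ! i \<le> n \<Longrightarrow> x \<in> H n n \<Longrightarrow> A n x (up (ps ! i) n (v i)) \<in> S"
    have z: "\<beta> n \<zero>\<^bsub>ob ?S n\<^esub> \<in> S" unfolding linear_mapD(6)[OF lb] by (rule S(1))
    have one: "\<beta> n (\<iota> i n F) \<in> S" if i: "i < length ps" and F: "F \<in> carrier (?H i n)" for i F
    proof (cases "ps ! i \<le> n")
      case True
      from F[unfolded hom_space_carrier[OF True]] obtain x where "F = hom_of \<delta> (ps ! i) n x" "x \<in> H n n" by (rule imageE)
      from gen[OF i True this] S(3)[OF i True this(2)] show ?thesis by simp
    next
      case False
      then have "F = \<zero>\<^bsub>?H i n\<^esub>" using F by (simp add: hom_space_def zero_space_def)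
      then have "\<iota> i n F = \<zero>\<^bsub>ob ?S n\<^esub>" unfolding zS \<iota>_def by (intro restrict_ext) simp
      then show ?thesis using z by simp
    qed
    \<comment> \<open>Induction on the number \<open>m\<close> of leading summands in which
      \<open>g\<close> may be nonzero; one component at a time is split off through
      \<open>\<iota>\<close>.\<close>
    have "\<beta> n g \<in> S" if "g \<in> carrier (ob ?S n)" "\<forall>k<length ps. m \<le> k \<longrightarrow> g k = \<zero>\<^bsub>?H k n\<^esub>" for g m
      using that
    proof (induction m arbitrary: g)
      case 0
      then have "g = \<zero>\<^bsub>ob ?S n\<^esub>" unfolding zS cS by (intro extensionalityI[of _ ?I]) (auto simp: PiE_iff)
      then show ?case using z by simp
    next
      case (Suc m)
      show ?case
      proof (cases "m < length ps")
        case True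
        let ?g = "\<lambda>k\<in>?I. if k = m then \<zero>\<^bsub>?H k n\<^esub> else g k"
        have gk: "g k \<in> carrier (?H k n)" if "k < length ps" for k using Suc.prems(1) that by (auto simp: cS)
        have g: "?g \<in> carrier (ob ?S n)"
          unfolding cS by (rule restrict_PiE_iff[THEN iffD2]) (auto simp: gk)
        have "g = ?g \<oplus>\<^bsub>ob ?S n\<^esub> \<iota> m n (g m)"
          using Suc.prems(1) unfolding aS \<iota>_def by (intro extensionalityI[of _ ?I]) (auto simp: cS PiE_iff)
        then have "\<beta> n g = \<beta> n ?g \<oplus>\<^bsub>ob V n\<^esub> \<beta> n (\<iota> m n (g m))"
          using linear_mapD(4)[OF lb g iS[OF gk[OF True]]] by simp
        moreover have "\<beta> n ?g \<in> S" by (rule Suc.IH[OF g]) (use Suc.prems(2) in auto)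
        ultimately show ?thesis using S(2) one[OF True gk[OF True]] by simp
      next
        case False
        then show ?thesis using Suc.IH[OF Suc.prems(1)] by simp
      qed
    qed
    note all = this
    from w[folded surj[rule_format]] obtain g where g: "w = \<beta> n g" "g \<in> carrier (ob ?S n)" by (rule imageE)
    show "w \<in> S" unfolding g(1) by (rule all[OF g(2), of "length ps"]) simp
  qed
  then show ?thesis by blast
qed

end

section \<open>Quantum integers\<close>

text \<open>The right hand side is [m + 2]/[m + 1] for the quantum integers in \<open>t\<close>,
  with negative powers of \<open>t\<close> cleared.\<close>

lemma jw_den_eq:
  fixes t :: complex
  assumes t: "t \<noteq> 0" and q: "\<forall>k::nat. k > 0 \<longrightarrow> (t\<^sup>2) ^ k \<noteq> 1"
  shows "jw_den (t + 1 / t) m = ((t\<^sup>2) ^ (m + 2) - 1) / (t * ((t\<^sup>2) ^ (m + 1) - 1))"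
proof (induction m)
  case 0
  have "t\<^sup>2 \<noteq> 1" using q[rule_format, of 1] by simp
  then show ?case using t by (simp add: field_simps power2_eq_square)
next
  case (Suc m)
  define Q where "Q = (t\<^sup>2) ^ (m + 1)"
  have Q: "Q \<noteq> 1" "t\<^sup>2 * Q \<noteq> 1" using q[rule_format, of "m + 1"] q[rule_format, of "m + 2"] by (simp_all add: Q_def)
  have e: "(t\<^sup>2) ^ (m + 2) = t\<^sup>2 * Q" "(t\<^sup>2) ^ (Suc m + 1) = t\<^sup>2 * Q" "(t\<^sup>2) ^ (Suc m + 2) = t\<^sup>2 * (t\<^sup>2 * Q)"
    by (simp_all add: Q_def)
  have "jw_den (t + 1 / t) (Suc m) = t + 1 / t - t * (Q - 1) / (t\<^sup>2 * Q - 1)"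
    unfolding jw_den.simps Suc.IH e(1) Q_def[symmetric] by simp
  also have "\<dots> = (t\<^sup>2 * (t\<^sup>2 * Q) - 1) / (t * (t\<^sup>2 * Q - 1))"
    using t Q by (simp add: divide_simps) (simp add: algebra_simps power2_eq_square power4_eq_xxxx)
  finally show ?case unfolding e .
qed

lemma jw_den_nonzero:
  fixes \<delta> q :: complex
  assumes q: "q \<noteq> 0" "\<forall>k::nat. k > 0 \<longrightarrow> q ^ k \<noteq> 1" and d: "\<delta>\<^sup>2 = 2 + q + inverse q"
  shows "jw_den \<delta> m \<noteq> 0"
proof -
  obtain t where t: "t\<^sup>2 = q" "\<delta> = t + 1 / t"
  proof -
    let ?r = "csqrt q"
    have r: "?r\<^sup>2 = q" by simp
    then have r0: "?r \<noteq> 0" using q(1) by auto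
    have "(?r + 1 / ?r)\<^sup>2 = ?r\<^sup>2 + 2 + inverse (?r\<^sup>2)"
      using r0 by (simp add: power2_sum power_divide inverse_eq_divide)
    then have "\<delta>\<^sup>2 = (?r + 1 / ?r)\<^sup>2" unfolding r d by simp
    then consider "\<delta> = ?r + 1 / ?r" | "\<delta> = - (?r + 1 / ?r)" unfolding power2_eq_iff by blast
    then show ?thesis
    proof cases
      case 1
      then show ?thesis using that[of ?r] by simp
    next
      \<comment> \<open>Both square roots of \<open>q\<close> are admissible, so the sign of
        \<open>\<delta>\<close> is absorbed into \<open>t\<close>.\<close>
      case 2
      then show ?thesis using that[of "- ?r"] by simp
    qed
  qed
  have "t \<noteq> 0" using t(1) q(1) by auto
  then show ?thesis
    using jw_den_eq[of t m] q(2)[rule_format, of "m + 1"] q(2)[rule_format, of "m + 2"] q(2) t by simp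
qed

theorem theoremA:
  fixes \<delta> q :: complex and V :: "'v tlc_functor"
  assumes "q \<noteq> 0"
    and "\<forall>k::nat. k > 0 \<longrightarrow> q ^ k \<noteq> 1"
    and "\<delta>\<^sup>2 = 2 + q + inverse q"
    and "tlc_module \<delta> V"
    and "finitely_presented \<delta> V"
  shows "representation_stable \<delta> V"
proof -
  interpret tl_functor \<delta> V
    by unfold_locales (rule jw_den_nonzero[OF assms(1-3)], rule assms(4))
  obtain ps v where "tl_fg \<delta> V ps v" using fg_exists[OF assms(5)] by blast
  then interpret tl_fg \<delta> V ps v .
  show ?thesis by (rule stable)
qed

end
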